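(* Let $T$ be a regular theory under $\mathrm{coe}_1+\sigma+\mathrm{Path}+\mathrm{wUA}+\Sigma$, and let $f:X\to Y$ be a morphism of models of $T$. Then $f$ is a weak equivalence if and only if the functor $Ho(f):Ho(X)\to Ho(Y)$ is an equivalence of categories.
   Context: **Partial Horn theories.** A theory consists of a set of sorts, function symbols $\sigma:s_1\times\dots\times s_k\to s$, predicate symbols $R:s_1\times\dots\times s_k$, and axioms, which are sequents $\varphi\vdash_V\psi$ between Horn formulas (finite conjunctions of atomic formulas $t_1=t_2$, $R(t_1,\dots,t_k)$) in a finite set $V$ of sorted variables. Function symbols denote partial functions; $t\downarrow$ means $t=t$ ("$t$ is defined"). A model $M$ is a family of sets $M_s$ with partial functions and relations satisfying the axioms. A morphism $h:M\to N$ is a family of total functions such that if $M(\sigma)(\bar a)$ is defined then $N(\sigma)(h(\bar a))$ is defined and equals $h(M(\sigma)(\bar a))$, and $\bar a\in M(R)$ implies $h(\bar a)\in N(R)$. $T\text{-}\mathbf{Mod}$ is the category of models of $T$. **Dependent type theories.** The sorts are $(ctx,n)$ and $(tm,n)$, $n\ge 0$, and $(ty,n):=(ctx,n+1)$ (contexts of length $n$; terms in contexts of length $n$; a type over a context of length $n$ is identified with the extended context). The theory of substitutions has symbols $\mathbf 1:(ctx,0)$, $ft:(ty,n)\to(ctx,n)$, $ty:(tm,n)\to(ty,n)$, $v_i:(ctx,n)\to(tm,n)$ for $0\le i<n$ (de Bruijn variables), and $subst:(ctx,n)\times(p,k)\times(tm,n)^k\to(p,n)$ for $p\in\{ty,tm\}$,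 with axioms saying that its models are exactly contextual categories: $M_{(ctx,n)}$ is the set of objects of level $n$, $M_{(tm,n)}$ the set of sections of canonical projections $A\to ft(A)$ with $A$ of level $n+1$ and $ty(a)=A$ for such a section $a$, and $subst$ is substitution (canonical pullback) along the context morphism $(a_1,\dots,a_k)$. For $t$ of sort $(p,n)$, $ctx(t)$ of sort $(ctx,n)$ is its context; for $t$ of sort $(p,n+m)$, $ctx^m(t)$ of sort $(ctx,n)$ is the initial segment of length $n$ of its context. If $a:\Gamma\to\Delta$ is a context morphism and $ctx^m(t)=\Delta$, then $a^*(t)$ denotes the substitution of $a$ in $t$ (leaving the last $m$ variables untouched), so $ctx^m(a^*(t))=\Gamma$. **Regular theories.** A theory $T$ extending the theory of substitutions by new function and predicate symbols and axioms is regular if each symbol $\sigma:(p_1,n_1)\times\dots\times(p_k,n_k)\to(p,n)$ comes with versions $\sigma_m:(ctx,m)\times(p_1,n_1+m)\times\dots\times(p_k,n_k+m)\to(p,n+m)$, $m\ge0$, definable in $T$, with $\sigma_0=\sigma$ and $(\sigma_m)_l=\sigma_{m+l}$ (similarly for predicates; for the symbols of the theory of substitutions these are the evident ones), such that: $\sigma_m(\Gamma,b_1,\dots,b_k)$ is defined only if all $ctx^{n_i}(b_i)=\Gamma$, and then its value $c$ has $ctx^n(c)=\Gamma$; every axiom of $T$ remains a theorem of $T$ if all symbols are replaced by their versions over an arbitrary base context $\Gamma$ of length $m$ and variables range over elements with base context $\Gamma$ (stability); and for every context morphism $a:\Gamma\to\Delta$ ($\Gamma$ of length $l$, $\Delta$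 of length $m$), if $\sigma_m(\Delta,b_1,\dots,b_k)$ is defined then $\sigma_l(\Gamma,a^*(b_1),\dots,a^*(b_k))$ is defined and equals $a^*(\sigma_m(\Delta,b_1,\dots,b_k))$ (and predicates are likewise preserved by $a^*$). A system of inference rules in an arbitrary context $\Gamma$, as below, presents the regular theory whose symbols exist in every context, are defined when the premises of the formation rule hold, satisfy the listed equations $\equiv$, and commute with substitution. "$T$ under $T_0$" means $T$ is equipped with a morphism $T_0\to T$ (an interpretation that is the identity on the symbols of the theory of substitutions and is compatible with the versions $\sigma_m$ of the symbols over base contexts); so every model of $T$ carries the operations of $T_0$. $T_1+T_2$ is the union of theories. **The theory $\mathrm{coe}_1+\sigma+\mathrm{Path}+\mathrm{wUA}+\Sigma$.** - $I$: $\Gamma\vdash I\ type$, $\Gamma\vdash left:I$, $\Gamma\vdash right:I$. - $\mathrm{coe}_1$: from $\Gamma,x:I\vdash D\ type$, $\Gamma\vdash d:D[x:=left]$, $\Gamma\vdash i:I$ infer $\Gamma\vdash coe_1(\lambda x.D,d,i):D[x:=i]$; and $coe_1(\lambda x.D,d,left)\equiv d$. - $\sigma$: if $\Gamma\vdash a:A$ then $coe_1(\lambda x.A,a,right)\equiv a$ (with $A$ not depending on $x$). - Put $coe_0(\lambda x.D,d):=coe_1(\lambda x.D,d,right)$. - $\mathrm{Path}$: from $\Gamma,x:I\vdash A\ type$, $\Gamma\vdash a:A[x:=left]$, $\Gamma\vdash a':A[x:=right]$ infer $\Gamma\vdash Path(\lambda x.A,a,a')\ type$; from $\Gamma,x:I\vdash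 a:A$ infer $path(\lambda x.a):Path(\lambda x.A,a[x:=left],a[x:=right])$; from $\Gamma\vdash p:Path(\lambda x.A,a,a')$ and $\Gamma\vdash i:I$ infer $at(p,i):A[x:=i]$ (with $A,a,a'$ suppressed arguments); equations $at(path(\lambda x.a),i)\equiv a[x:=i]$, $path(\lambda y.at(p,y))\equiv p$, $at(p,left)\equiv a$, $at(p,right)\equiv a'$. - For $a,a':A$ put $a\rightsquigarrow a':=Path(\lambda x.A,a,a')$ and $refl(a):=path(\lambda x.a)$. - $\mathrm{wUA}$: given the data $S$: $\Gamma\vdash A\ type$, $\Gamma\vdash B\ type$, $\Gamma,x:A\vdash f:B$, $\Gamma,y:B\vdash g:A$, $\Gamma,x:A\vdash p:g[y:=f]\rightsquigarrow x$, $\Gamma,y:B\vdash q:f[x:=g]\rightsquigarrow y$, and $\Gamma\vdash j:I$, there is a type $\Gamma\vdash iso(A,B,\lambda x.f,\lambda y.g,\lambda x.p,\lambda y.q,j)$, with $iso(\dots,left)\equiv A$, $iso(\dots,right)\equiv B$ and $coe_0(\lambda j.iso(\dots,j),a)\equiv f[x:=a]$ for $\Gamma\vdash a:A$. - $\Sigma$ (with eta): from $\Gamma,A\vdash B\ type$ infer $\Gamma\vdash\Sigma(A,B)\ type$; from also $\Gamma\vdash a:A$, $\Gamma\vdash b:B[a]$ infer $pair(a,b):\Sigma(A,B)$; from $\Gamma\vdash p:\Sigma(A,B)$ infer $\pi_1(p):A$ and $\pi_2(p):B[\pi_1(p)]$; equations $\pi_1(pair(a,b))\equiv a$, $\pi_2(pair(a,b))\equiv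 b$, $pair(\pi_1(p),\pi_2(p))\equiv p$. **Weak equivalences.** A morphism $f:X\to Y$ of models is a weak equivalence if for every $n\ge0$ both of the following hold. (tm,$n$) For every type $\Gamma\vdash A$ in $X_{(ty,n)}$ and every $a\in Y_{(tm,n)}$ with $f(\Gamma)\vdash a:f(A)$ there are $a'\in X_{(tm,n)}$ with $\Gamma\vdash a':A$ and a term $f(\Gamma),z:I\vdash h:f(A)$ in $Y$ (with $f(A)$ not depending on $z$) such that $h[z:=left]=f(a')$ and $h[z:=right]=a$. (ty,$n$) For every $\Gamma\in X_{(ctx,n)}$ and every type $f(\Gamma)\vdash B$ in $Y_{(ty,n)}$ there are a type $\Gamma\vdash A$ in $X_{(ty,n)}$ and terms in $Y$: $f(\Gamma),x:f(A)\vdash b:B$; $f(\Gamma),y:B\vdash a_1:f(A)$; $f(\Gamma),x:f(A)\vdash p:a_1[y:=b]\rightsquigarrow x$; $f(\Gamma),y:B\vdash a_2:f(A)$; $f(\Gamma),y:B\vdash q:b[x:=a_2]\rightsquigarrow y$. (These are the weak equivalences of the model structure on $T\text{-}\mathbf{Mod}$ whose generating cofibrations are the maps from the free model on a type $\Gamma\vdash A$ to the free model on a term $\Gamma\vdash a:A$, and from the free model on a context $\Gamma$ to the free model on a type $\Gamma\vdash A$.) **Homotopy category.** For a model $X$ of $T$, two terms $a,a'\in X_{(tm,n)}$ are equivalent if $ty(a)=ty(a')$ and there is a term $p$ with $ctx(a)\vdash p:a\rightsquigarrow a'$. The objects of $Ho(X)$ are the closed types, i.e. elements of $X_{(ty,0)}$.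 Morphisms $A\to B$ are equivalence classes of terms $b\in X_{(tm,1)}$ with $x:A\vdash b:B$ (with $B$ weakened). Identities are given by the variable, composition by substitution. For $f:X\to Y$, $Ho(f)(A)=f(A)$ and $Ho(f)(b)=f(b)$. *)

theory Defs
  imports Main
begin

section \<open>Partial Horn theories\<close>

text \<open>A finite set of sorted variables is a list of sorts \<open>V\<close>; the variable \<open>Tvar i\<close> has sort
  \<open>V ! i\<close>. A Horn formula is a list of atoms, read conjunctively.\<close>

datatype 'f trm = Tvar nat | Fn 'f "'f trm list"

datatype ('f, 'r) atom = Eq "'f trm" "'f trm" | Rl 'r "'f trm list"

type_synonym ('f, 'r) formula = "('f, 'r) atom list"

type_synonym ('s, 'f, 'r) sequent = "'s list \<times> ('f, 'r) formula \<times> ('f, 'r) formula"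

record ('s, 'f, 'r) horn =
  funs :: "'f set"
  fdom :: "'f \<Rightarrow> 's list"
  fcod :: "'f \<Rightarrow> 's"
  rels :: "'r set"
  rdom :: "'r \<Rightarrow> 's list"
  axs  :: "('s, 'f, 'r) sequent set"

abbreviation dfd :: "'f trm \<Rightarrow> ('f, 'r) atom" where
  "dfd t \<equiv> Eq t t"

inductive has_sort :: "('s, 'f, 'r) horn \<Rightarrow> 's list \<Rightarrow> 'f trm \<Rightarrow> 's \<Rightarrow> bool"
  for T V where
  "i < length V \<Longrightarrow> has_sort T V (Tvar i) (V ! i)"
| "f \<in> funs T \<Longrightarrow> list_all2 (has_sort T V) ts (fdom T f) \<Longrightarrow> has_sort T V (Fn f ts) (fcod T f)"

fun wf_atom :: "('s, 'f, 'r) horn \<Rightarrow> 's list \<Rightarrow> ('f, 'r) atom \<Rightarrow> bool" where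
  "wf_atom T V (Eq t u) \<longleftrightarrow> (\<exists>s. has_sort T V t s \<and> has_sort T V u s)"
| "wf_atom T V (Rl r ts) \<longleftrightarrow> r \<in> rels T \<and> list_all2 (has_sort T V) ts (rdom T r)"

definition wf_theory :: "('s, 'f, 'r) horn \<Rightarrow> bool" where
  "wf_theory T \<longleftrightarrow>
     (\<forall>(V, \<phi>, \<psi>) \<in> axs T. \<forall>\<alpha> \<in> set \<phi> \<union> set \<psi>. wf_atom T V \<alpha>)"

primrec tsub :: "'f trm list \<Rightarrow> 'f trm \<Rightarrow> 'f trm" where
  "tsub us (Tvar i) = us ! i"
| "tsub us (Fn f ts) = Fn f (map (tsub us) ts)"

primrec asub :: "'f trm list \<Rightarrow> ('f, 'r) atom \<Rightarrow> ('f, 'r) atom" where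
  "asub us (Eq t u) = Eq (tsub us t) (tsub us u)"
| "asub us (Rl r ts) = Rl r (map (tsub us) ts)"

text \<open>Provability in partial Horn logic: an equation asserts that both sides are defined,
  function and predicate symbols are strict, and only defined terms may be substituted for the
  variables of an axiom.\<close>

inductive entails :: "('s, 'f, 'r) horn \<Rightarrow> 's list \<Rightarrow> ('f, 'r) formula \<Rightarrow> ('f, 'r) atom \<Rightarrow> bool"
  for T V \<Phi> where
  hyp: "\<alpha> \<in> set \<Phi> \<Longrightarrow> entails T V \<Phi> \<alpha>"
| var: "i < length V \<Longrightarrow> entails T V \<Phi> (dfd (Tvar i))"
| sym: "entails T V \<Phi> (Eq t u) \<Longrightarrow> entails T V \<Phi> (Eq u t)"
| trans: "entails T V \<Phi> (Eq t u) \<Longrightarrow> entails T V \<Phi> (Eq u w) \<Longrightarrow> entails T V \<Phi> (Eq t w)"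
| fcong: "entails T V \<Phi> (dfd (Fn f ts)) \<Longrightarrow> list_all2 (\<lambda>t u. entails T V \<Phi> (Eq t u)) ts us
    \<Longrightarrow> entails T V \<Phi> (Eq (Fn f ts) (Fn f us))"
| rcong: "entails T V \<Phi> (Rl r ts) \<Longrightarrow> list_all2 (\<lambda>t u. entails T V \<Phi> (Eq t u)) ts us
    \<Longrightarrow> entails T V \<Phi> (Rl r us)"
| fstrict: "entails T V \<Phi> (dfd (Fn f ts)) \<Longrightarrow> t \<in> set ts \<Longrightarrow> entails T V \<Phi> (dfd t)"
| rstrict: "entails T V \<Phi> (Rl r ts) \<Longrightarrow> t \<in> set ts \<Longrightarrow> entails T V \<Phi> (dfd t)"
| ax: "(W, \<phi>, \<psi>) \<in> axs T \<Longrightarrow> list_all2 (has_sort T V) us W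
    \<Longrightarrow> (\<And>u. u \<in> set us \<Longrightarrow> entails T V \<Phi> (dfd u))
    \<Longrightarrow> (\<And>\<alpha>. \<alpha> \<in> set \<phi> \<Longrightarrow> entails T V \<Phi> (asub us \<alpha>))
    \<Longrightarrow> \<beta> \<in> set \<psi> \<Longrightarrow> entails T V \<Phi> (asub us \<beta>)"

definition is_thm :: "('s, 'f, 'r) horn \<Rightarrow> ('s, 'f, 'r) sequent \<Rightarrow> bool" where
  "is_thm T = (\<lambda>(V, \<phi>, \<psi>). \<forall>\<beta> \<in> set \<psi>. entails T V \<phi> \<beta>)"


subsection \<open>Models\<close>

record ('s, 'f, 'r, 'x) struct =
  car :: "'s \<Rightarrow> 'x set"
  fn  :: "'f \<Rightarrow> 'x list \<Rightarrow> 'x option"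
  rl  :: "'r \<Rightarrow> 'x list \<Rightarrow> bool"

abbreviation env :: "('s, 'f, 'r, 'x) struct \<Rightarrow> 'x list \<Rightarrow> 's list \<Rightarrow> bool" where
  "env M xs V \<equiv> list_all2 (\<lambda>x s. x \<in> car M s) xs V"

primrec ev :: "('s, 'f, 'r, 'x) struct \<Rightarrow> 'x list \<Rightarrow> 'f trm \<Rightarrow> 'x option" where
  "ev M xs (Tvar i) = (if i < length xs then Some (xs ! i) else None)"
| "ev M xs (Fn f ts) = Option.bind (those (map (ev M xs) ts)) (fn M f)"

fun holds1 :: "('s, 'f, 'r, 'x) struct \<Rightarrow> 'x list \<Rightarrow> ('f, 'r) atom \<Rightarrow> bool" where
  "holds1 M xs (Eq t u) \<longleftrightarrow> ev M xs t \<noteq> None \<and> ev M xs t = ev M xs u"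
| "holds1 M xs (Rl r ts) \<longleftrightarrow> (\<exists>ys. those (map (ev M xs) ts) = Some ys \<and> rl M r ys)"

definition holds :: "('s, 'f, 'r, 'x) struct \<Rightarrow> 'x list \<Rightarrow> ('f, 'r) formula \<Rightarrow> bool" where
  "holds M xs \<phi> \<longleftrightarrow> (\<forall>\<alpha> \<in> set \<phi>. holds1 M xs \<alpha>)"

definition is_struct :: "('s, 'f, 'r) horn \<Rightarrow> ('s, 'f, 'r, 'x) struct \<Rightarrow> bool" where
  "is_struct T M \<longleftrightarrow>
     (\<forall>f \<in> funs T. \<forall>xs y. fn M f xs = Some y \<longrightarrow> env M xs (fdom T f) \<and> y \<in> car M (fcod T f)) \<and>
     (\<forall>r \<in> rels T. \<forall>xs. rl M r xs \<longrightarrow> env M xs (rdom T r))"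

definition is_model :: "('s, 'f, 'r) horn \<Rightarrow> ('s, 'f, 'r, 'x) struct \<Rightarrow> bool" where
  "is_model T M \<longleftrightarrow> is_struct T M \<and>
     (\<forall>(V, \<phi>, \<psi>) \<in> axs T. \<forall>xs. env M xs V \<longrightarrow> holds M xs \<phi> \<longrightarrow> holds M xs \<psi>)"

definition is_morphism ::
  "('s, 'f, 'r) horn \<Rightarrow> ('s, 'f, 'r, 'x) struct \<Rightarrow> ('s, 'f, 'r, 'y) struct \<Rightarrow> ('s \<Rightarrow> 'x \<Rightarrow> 'y) \<Rightarrow> bool"
where
  "is_morphism T M N h \<longleftrightarrow>
     (\<forall>s. \<forall>x \<in> car M s. h s x \<in> car N s) \<and>
     (\<forall>f \<in> funs T. \<forall>xs y. fn M f xs = Some y \<longrightarrow>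
        fn N f (map2 h (fdom T f) xs) = Some (h (fcod T f) y)) \<and>
     (\<forall>r \<in> rels T. \<forall>xs. rl M r xs \<longrightarrow> rl N r (map2 h (rdom T r) xs))"


subsection \<open>Definable operations and interpretations\<close>

text \<open>The restricted term \<open>(t, \<phi>)\<close> denotes the partial operation whose value is \<open>t\<close> and which is
  defined when \<open>t\<close> is defined and \<open>\<phi>\<close> holds.\<close>

type_synonym ('f, 'r) rterm = "'f trm \<times> ('f, 'r) formula"

definition rdfd :: "('f, 'r) rterm \<Rightarrow> ('f, 'r) formula" where
  "rdfd r = dfd (fst r) # snd r"

definition fapp :: "('f, 'r) formula \<Rightarrow> 'f trm list \<Rightarrow> ('f, 'r) formula" where
  "fapp \<phi> us = map (asub us) \<phi> @ map dfd us"

definition rapp :: "('f, 'r) rterm \<Rightarrow> 'f trm list \<Rightarrow> ('f, 'r) rterm" where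
  "rapp r us = (tsub us (fst r), fapp (snd r) us)"

definition wf_rterm :: "('s, 'f, 'r) horn \<Rightarrow> 's list \<Rightarrow> ('f, 'r) rterm \<Rightarrow> 's \<Rightarrow> bool" where
  "wf_rterm T V r s \<longleftrightarrow> has_sort T V (fst r) s \<and> (\<forall>\<alpha> \<in> set (snd r). wf_atom T V \<alpha>)"

text \<open>Provably, under the hypotheses \<open>H\<close>, one of the two restricted terms is defined iff the other
  is, and then they are equal.\<close>

definition rterm_eq ::
  "('s, 'f, 'r) horn \<Rightarrow> 's list \<Rightarrow> ('f, 'r) formula \<Rightarrow> ('f, 'r) rterm \<Rightarrow> ('f, 'r) rterm \<Rightarrow> bool"
where
  "rterm_eq T V H r r' \<longleftrightarrow>
     is_thm T (V, H @ rdfd r, Eq (fst r) (fst r') # snd r') \<and>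
     is_thm T (V, H @ rdfd r', Eq (fst r) (fst r') # snd r)"

definition formula_eq ::
  "('s, 'f, 'r) horn \<Rightarrow> 's list \<Rightarrow> ('f, 'r) formula \<Rightarrow> ('f, 'r) formula \<Rightarrow> ('f, 'r) formula \<Rightarrow> bool"
where
  "formula_eq T V H \<phi> \<psi> \<longleftrightarrow> is_thm T (V, H @ \<phi>, \<psi>) \<and> is_thm T (V, H @ \<psi>, \<phi>)"

record ('f, 'r, 'g, 'q) interp =
  fint :: "'f \<Rightarrow> ('g, 'q) rterm"
  rint :: "'r \<Rightarrow> ('g, 'q) formula"

text \<open>Replacement of all symbols by their interpretations. The interpretations may have \<open>d\<close> extra
  parameters, which become the first \<open>d\<close> variables of the result: \<open>d = 0\<close> for morphisms of
  theories, \<open>d = 1\<close> for the versions of symbols over a base context.\<close>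

primrec tr :: "nat \<Rightarrow> ('f, 'r, 'g, 'q) interp \<Rightarrow> 'f trm \<Rightarrow> ('g, 'q) rterm" where
  "tr d J (Tvar i) = (Tvar (d + i), [])"
| "tr d J (Fn f ts) =
    (let rs = map (tr d J) ts;
         r = rapp (fint J f) (map Tvar [0..<d] @ map fst rs)
     in (fst r, snd r @ concat (map snd rs)))"

fun tr_atom :: "nat \<Rightarrow> ('f, 'r, 'g, 'q) interp \<Rightarrow> ('f, 'r) atom \<Rightarrow> ('g, 'q) formula" where
  "tr_atom d J (Eq t u) = Eq (fst (tr d J t)) (fst (tr d J u)) # snd (tr d J t) @ snd (tr d J u)"
| "tr_atom d J (Rl r ts) =
    (let rs = map (tr d J) ts
     in fapp (rint J r) (map Tvar [0..<d] @ map fst rs) @ concat (map snd rs))"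

definition tr_formula :: "nat \<Rightarrow> ('f, 'r, 'g, 'q) interp \<Rightarrow> ('f, 'r) formula \<Rightarrow> ('g, 'q) formula" where
  "tr_formula d J \<phi> = concat (map (tr_atom d J) \<phi>)"

definition tr_rterm :: "nat \<Rightarrow> ('f, 'r, 'g, 'q) interp \<Rightarrow> ('f, 'r) rterm \<Rightarrow> ('g, 'q) rterm" where
  "tr_rterm d J r = (fst (tr d J (fst r)), snd (tr d J (fst r)) @ tr_formula d J (snd r))"

definition is_interp ::
  "('s, 'f, 'r) horn \<Rightarrow> ('s, 'g, 'q) horn \<Rightarrow> ('f, 'r, 'g, 'q) interp \<Rightarrow> bool"
where
  "is_interp T T' J \<longleftrightarrow>
     (\<forall>f \<in> funs T. wf_rterm T' (fdom T f) (fint J f) (fcod T f)) \<and>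
     (\<forall>r \<in> rels T. \<forall>\<alpha> \<in> set (rint J r). wf_atom T' (rdom T r) \<alpha>) \<and>
     (\<forall>(V, \<phi>, \<psi>) \<in> axs T. is_thm T' (V, tr_formula 0 J \<phi>, tr_formula 0 J \<psi>))"

text \<open>The \<open>T\<close>-structure underlying a model of a theory in which \<open>T\<close> is interpreted.\<close>

definition reduct ::
  "('s, 'f, 'r) horn \<Rightarrow> ('f, 'r, 'g, 'q) interp \<Rightarrow> ('s, 'g, 'q, 'x) struct \<Rightarrow> ('s, 'f, 'r, 'x) struct"
where
  "reduct T J M =
     \<lparr>car = car M,
      fn = (\<lambda>f xs. if f \<in> funs T \<and> env M xs (fdom T f) \<and> holds M xs (snd (fint J f))
                   then ev M xs (fst (fint J f)) else None),
      rl = (\<lambda>r xs. r \<in> rels T \<and> env M xs (rdom T r) \<and> holds M xs (rint J r))\<rparr>"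


section \<open>The theory of substitutions\<close>

datatype sort = Ctx nat | Tm nat

abbreviation Ty :: "nat \<Rightarrow> sort" where
  "Ty n \<equiv> Ctx (Suc n)"

datatype kind = KTy | KTm

primrec ksort :: "kind \<Rightarrow> nat \<Rightarrow> sort" where
  "ksort KTy n = Ty n"
| "ksort KTm n = Tm n"

text \<open>\<open>VarS n i\<close> is \<open>v\<^sub>i\<close> on contexts of length \<open>n\<close>; \<open>SubS p n k\<close> is
  \<open>subst : (ctx,n) \<times> (p,k) \<times> (tm,n)\<^sup>k \<rightarrow> (p,n)\<close>.\<close>

datatype ssym = EmpS | FtS nat | TyS nat | VarS nat nat | SubS kind nat nat

datatype 'f sym = Bas ssym | New 'f

definition ssyms :: "ssym set" where
  "ssyms = {s. \<forall>n i. s = VarS n i \<longrightarrow> i < n}"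

primrec sdom :: "ssym \<Rightarrow> sort list" where
  "sdom EmpS = []"
| "sdom (FtS n) = [Ty n]"
| "sdom (TyS n) = [Tm n]"
| "sdom (VarS n i) = [Ctx n]"
| "sdom (SubS p n k) = Ctx n # ksort p k # replicate k (Tm n)"

primrec scod :: "ssym \<Rightarrow> sort" where
  "scod EmpS = Ctx 0"
| "scod (FtS n) = Ctx n"
| "scod (TyS n) = Ty n"
| "scod (VarS n i) = Tm n"
| "scod (SubS p n k) = ksort p n"

abbreviation emp :: "'f sym trm" where
  "emp \<equiv> Fn (Bas EmpS) []"

abbreviation ft :: "nat \<Rightarrow> 'f sym trm \<Rightarrow> 'f sym trm" where
  "ft n A \<equiv> Fn (Bas (FtS n)) [A]"

abbreviation ty :: "nat \<Rightarrow> 'f sym trm \<Rightarrow> 'f sym trm" where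
  "ty n a \<equiv> Fn (Bas (TyS n)) [a]"

abbreviation vr :: "nat \<Rightarrow> nat \<Rightarrow> 'f sym trm \<Rightarrow> 'f sym trm" where
  "vr n i \<Gamma> \<equiv> Fn (Bas (VarS n i)) [\<Gamma>]"

abbreviation sb :: "kind \<Rightarrow> nat \<Rightarrow> nat \<Rightarrow> 'f sym trm \<Rightarrow> 'f sym trm \<Rightarrow> 'f sym trm list \<Rightarrow> 'f sym trm" where
  "sb p n k \<Gamma> t as \<equiv> Fn (Bas (SubS p n k)) (\<Gamma> # t # as)"

abbreviation tvars :: "nat \<Rightarrow> nat \<Rightarrow> 'f trm list" where
  "tvars i k \<equiv> map Tvar [i..<i + k]"

primrec kctx :: "kind \<Rightarrow> nat \<Rightarrow> 'f sym trm \<Rightarrow> 'f sym trm" where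
  "kctx KTy n t = ft n t"
| "kctx KTm n t = ft n (ty n t)"

text \<open>\<open>ftn n j\<close> is the \<open>j\<close>-fold iterate of \<open>ft\<close>, from sort \<open>Ctx (n + j)\<close> to sort \<open>Ctx n\<close>.\<close>

primrec ftn :: "nat \<Rightarrow> nat \<Rightarrow> 'f sym trm \<Rightarrow> 'f sym trm" where
  "ftn n 0 A = A"
| "ftn n (Suc j) A = ftn n j (ft (n + j) A)"

text \<open>\<open>vars n j \<Gamma>\<close> is the list \<open>v\<^bsub>n-1\<^esub>(\<Gamma>), \<dots>, v\<^sub>j(\<Gamma>)\<close>, the projection of \<open>\<Gamma>\<close> to its initial segment of
  length \<open>n - j\<close>.\<close>

definition vars :: "nat \<Rightarrow> nat \<Rightarrow> 'f sym trm \<Rightarrow> 'f sym trm list" where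
  "vars n j \<Gamma> = map (\<lambda>i. vr n i \<Gamma>) (rev [j..<n])"

text \<open>\<open>(a\<^sub>1, \<dots>, a\<^sub>k)\<close> is a context morphism from \<open>\<Gamma>\<close> (of length \<open>n\<close>) to \<open>\<Delta>\<close> (of length \<open>k\<close>): the type of
  \<open>a\<^bsub>i+1\<^esub>\<close> is the result of substituting \<open>a\<^sub>1, \<dots>, a\<^sub>i\<close> in the \<open>(i+1)\<close>-st type of \<open>\<Delta>\<close>.\<close>

definition cmor :: "nat \<Rightarrow> nat \<Rightarrow> 'f sym trm \<Rightarrow> 'f sym trm \<Rightarrow> 'f sym trm list \<Rightarrow> ('f sym, 'r) formula" where
  "cmor n k \<Gamma> \<Delta> as =
     map (\<lambda>i. Eq (ty n (as ! i)) (sb KTy n i \<Gamma> (ftn (Suc i) (k - Suc i) \<Delta>) (take i as))) [0..<k]"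

definition subst_axioms :: "(sort, 'f sym, 'r) sequent set" where
  "subst_axioms =
     {([], [], [dfd emp]),
      ([Ctx 0], [], [Eq (Tvar 0) emp])} \<union>
     (\<Union>n. {([Ty n], [], [dfd (ft n (Tvar 0))]),
           ([Tm n], [], [dfd (ty n (Tvar 0))])}) \<union>
     (\<Union>n. \<Union>i \<in> {..<n}.
        let \<Gamma> = Tvar 0
        in {([Ctx n], [],
             [Eq (ty n (vr n i \<Gamma>))
                 (sb KTy n (n - Suc i) \<Gamma> (ftn (n - i) i \<Gamma>) (vars n (Suc i) \<Gamma>))])}) \<union>
     (\<Union>p n k.
        let V = Ctx n # ksort p k # replicate k (Tm n);
            \<Gamma> = Tvar 0; t = Tvar 1; as = tvars 2 k
        in {(V, [dfd (sb p n k \<Gamma> t as)], cmor n k \<Gamma> (kctx p k t) as),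
            (V, cmor n k \<Gamma> (kctx p k t) as, [dfd (sb p n k \<Gamma> t as)])}) \<union>
     (\<Union>n k.
        let \<Gamma> = Tvar 0; t = Tvar 1; as = tvars 2 k
        in {(Ctx n # Ty k # replicate k (Tm n), [dfd (sb KTy n k \<Gamma> t as)],
             [Eq (ft n (sb KTy n k \<Gamma> t as)) \<Gamma>]),
            (Ctx n # Tm k # replicate k (Tm n), [dfd (sb KTm n k \<Gamma> t as)],
             [Eq (ty n (sb KTm n k \<Gamma> t as)) (sb KTy n k \<Gamma> (ty k t) as)])}) \<union>
     (\<Union>n k. \<Union>i \<in> {..<k}.
        let \<Gamma> = Tvar 0; \<Delta> = Tvar 1; as = tvars 2 k
        in {(Ctx n # Ctx k # replicate k (Tm n), cmor n k \<Gamma> \<Delta> as,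
             [Eq (sb KTm n k \<Gamma> (vr k i \<Delta>) as) (as ! (k - Suc i))])}) \<union>
     (\<Union>p n.
        let t = Tvar 0; \<Gamma> = kctx p n t
        in {([ksort p n], [], [Eq (sb p n n \<Gamma> t (vars n 0 \<Gamma>)) t])}) \<union>
     (\<Union>p n m k.
        let \<Gamma> = Tvar 0; \<Delta> = Tvar 1; t = Tvar 2; bs = tvars 3 m; as = tvars (3 + m) k
        in {(Ctx n # Ctx m # ksort p k # replicate m (Tm n) @ replicate k (Tm m),
             cmor n m \<Gamma> \<Delta> bs @ [dfd (sb p m k \<Delta> t as)],
             [Eq (sb p n m \<Gamma> (sb p m k \<Delta> t as) bs)
                 (sb p n k \<Gamma> t (map (\<lambda>a. sb KTm n m \<Gamma> a bs) as))])})"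

definition extends_subst :: "(sort, 'f sym, 'r) horn \<Rightarrow> bool" where
  "extends_subst T \<longleftrightarrow> wf_theory T \<and>
     (\<forall>s. Bas s \<in> funs T \<longleftrightarrow> s \<in> ssyms) \<and>
     (\<forall>s \<in> ssyms. fdom T (Bas s) = sdom s \<and> fcod T (Bas s) = scod s) \<and>
     subst_axioms \<subseteq> axs T"


section \<open>Regular theories\<close>

primrec shift :: "nat \<Rightarrow> sort \<Rightarrow> sort" where
  "shift m (Ctx n) = Ctx (n + m)"
| "shift m (Tm n) = Tm (n + m)"

text \<open>\<open>base m s t\<close> is the base context of length \<open>m\<close> of a term \<open>t\<close> of sort \<open>shift m s\<close>.\<close>

fun base :: "nat \<Rightarrow> sort \<Rightarrow> 'f sym trm \<Rightarrow> 'f sym trm" where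
  "base m (Ctx n) t = ftn m n t"
| "base m (Tm n) t = ftn m (Suc n) (ty (m + n) t)"

text \<open>The variables \<open>Tvar i, Tvar (i + 1), \<dots>\<close> of sorts \<open>map (shift m) ss\<close> have base context \<open>\<Gamma>\<close>.\<close>

definition over :: "nat \<Rightarrow> 'f sym trm \<Rightarrow> nat \<Rightarrow> sort list \<Rightarrow> ('f sym, 'r) formula" where
  "over m \<Gamma> i ss = map (\<lambda>j. Eq (base m (ss ! j) (Tvar (i + j))) \<Gamma>) [0..<length ss]"

text \<open>Pullback along a context morphism \<open>as : \<Gamma> \<rightarrow> \<Delta>\<close>, where \<open>\<Gamma>\<close> has length \<open>l\<close> and \<open>\<Delta>\<close> has length \<open>m\<close>.
  Here \<open>lift l n \<Theta> as\<close> is the extension of \<open>as\<close> to the morphism from the pullback \<open>\<Theta>\<close> of an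
  extension of \<open>\<Delta>\<close> by \<open>n\<close> variables: the terms \<open>as\<close> are weakened to \<open>\<Theta>\<close> and the last \<open>n\<close> variables
  are sent to themselves.\<close>

definition lift :: "nat \<Rightarrow> nat \<Rightarrow> 'f sym trm \<Rightarrow> 'f sym trm list \<Rightarrow> 'f sym trm list" where
  "lift l n \<Theta> as =
     (if n = 0 then as
      else map (\<lambda>a. sb KTm (l + n) l \<Theta> a (vars (l + n) n \<Theta>)) as
           @ map (\<lambda>i. vr (l + n) i \<Theta>) (rev [0..<n]))"

primrec pull_ctx :: "nat \<Rightarrow> nat \<Rightarrow> 'f sym trm \<Rightarrow> 'f sym trm list \<Rightarrow> nat \<Rightarrow> 'f sym trm \<Rightarrow> 'f sym trm" where
  "pull_ctx l m \<Gamma> as 0 t = \<Gamma>"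
| "pull_ctx l m \<Gamma> as (Suc n) t =
     (let \<Theta> = pull_ctx l m \<Gamma> as n (ft (m + n) t)
      in sb KTy (l + n) (m + n) \<Theta> t (lift l n \<Theta> as))"

fun pull :: "nat \<Rightarrow> nat \<Rightarrow> 'f sym trm \<Rightarrow> 'f sym trm list \<Rightarrow> sort \<Rightarrow> 'f sym trm \<Rightarrow> 'f sym trm" where
  "pull l m \<Gamma> as (Ctx n) t = pull_ctx l m \<Gamma> as n t"
| "pull l m \<Gamma> as (Tm n) t =
     (let \<Theta> = pull_ctx l m \<Gamma> as n (ft (m + n) (ty (m + n) t))
      in sb KTm (l + n) (m + n) \<Theta> t (lift l n \<Theta> as))"

text \<open>The versions of the symbols of the theory of substitutions over a base context \<open>\<Gamma>\<close> of length
  \<open>m\<close>, which is the variable \<open>Tvar 0\<close>; the arguments are \<open>Tvar 1, Tvar 2, \<dots>\<close>\<close>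

primrec sver_trm :: "nat \<Rightarrow> ssym \<Rightarrow> 'f sym trm" where
  "sver_trm m EmpS = Tvar 0"
| "sver_trm m (FtS n) = ft (n + m) (Tvar 1)"
| "sver_trm m (TyS n) = ty (n + m) (Tvar 1)"
| "sver_trm m (VarS n i) = vr (n + m) i (Tvar 1)"
| "sver_trm m (SubS p n k) =
     sb p (n + m) (k + m) (Tvar 1) (Tvar 2) (vars (n + m) n (Tvar 1) @ tvars 3 k)"

definition sver :: "nat \<Rightarrow> ssym \<Rightarrow> ('f sym, 'r) rterm" where
  "sver m s = (sver_trm m s, over m (Tvar 0) 1 (sdom s))"

text \<open>Variables of the stability sequents: \<open>\<Gamma>\<close>, \<open>\<Delta>\<close>, a morphism \<open>as : \<Gamma> \<rightarrow> \<Delta>\<close>, and arguments \<open>bs\<close> of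
  sorts \<open>ss\<close> over \<open>\<Delta>\<close>.\<close>

definition stab_vars :: "nat \<Rightarrow> nat \<Rightarrow> sort list \<Rightarrow> sort list" where
  "stab_vars l m ss = Ctx l # Ctx m # replicate m (Tm l) @ map (shift m) ss"

definition stab_mor :: "nat \<Rightarrow> nat \<Rightarrow> ('f sym, 'r) formula" where
  "stab_mor l m = cmor l m (Tvar 0) (Tvar 1) (tvars 2 m)"

definition stab_src :: "nat \<Rightarrow> sort list \<Rightarrow> 'f sym trm list" where
  "stab_src m ss = Tvar 1 # tvars (2 + m) (length ss)"

definition stab_pull :: "nat \<Rightarrow> nat \<Rightarrow> sort \<Rightarrow> 'f sym trm \<Rightarrow> 'f sym trm" where
  "stab_pull l m = pull l m (Tvar 0) (tvars 2 m)"

definition stab_tgt :: "nat \<Rightarrow> nat \<Rightarrow> sort list \<Rightarrow> 'f sym trm list" where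
  "stab_tgt l m ss = Tvar 0 # map2 (stab_pull l m) ss (tvars (2 + m) (length ss))"

text \<open>\<open>ver m\<close> assigns to every symbol its version over a base context of length \<open>m\<close>, with the base
  context as the first argument.\<close>

definition regular ::
  "(sort, 'f sym, 'r) horn \<Rightarrow> (nat \<Rightarrow> ('f sym, 'r, 'f sym, 'r) interp) \<Rightarrow> bool"
where
  "regular T ver \<longleftrightarrow> extends_subst T \<and>
     (\<forall>m. \<forall>s \<in> ssyms. fint (ver m) (Bas s) = sver m s) \<and>
     \<comment> \<open>sorts of the versions\<close>
     (\<forall>m. \<forall>f \<in> funs T.
        wf_rterm T (Ctx m # map (shift m) (fdom T f)) (fint (ver m) f) (shift m (fcod T f))) \<and>
     (\<forall>m. \<forall>r \<in> rels T. \<forall>\<alpha> \<in> set (rint (ver m) r).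
        wf_atom T (Ctx m # map (shift m) (rdom T r)) \<alpha>) \<and>
     \<comment> \<open>\<open>\<sigma>\<^sub>0 = \<sigma>\<close>\<close>
     (\<forall>f \<in> funs T.
        rterm_eq T (Ctx 0 # fdom T f) []
          (fint (ver 0) f) (Fn f (tvars 1 (length (fdom T f))), [])) \<and>
     (\<forall>r \<in> rels T.
        formula_eq T (Ctx 0 # rdom T r) []
          (rint (ver 0) r) [Rl r (tvars 1 (length (rdom T r)))]) \<and>
     \<comment> \<open>\<open>(\<sigma>\<^sub>m)\<^sub>l = \<sigma>\<^bsub>m+l\<^esub>\<close>\<close>
     (\<forall>m l. \<forall>f \<in> funs T.
        let ss = Ctx m # map (shift m) (fdom T f)
        in rterm_eq T (Ctx l # map (shift l) ss) (over l (Tvar 0) 1 ss)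
             (tr_rterm 1 (ver l) (fint (ver m) f))
             (rapp (fint (ver (m + l)) f) (tvars 1 (length ss)))) \<and>
     (\<forall>m l. \<forall>r \<in> rels T.
        let ss = Ctx m # map (shift m) (rdom T r)
        in formula_eq T (Ctx l # map (shift l) ss) (over l (Tvar 0) 1 ss)
             (tr_formula 1 (ver l) (rint (ver m) r))
             (fapp (rint (ver (m + l)) r) (tvars 1 (length ss)))) \<and>
     \<comment> \<open>arguments and values have base context \<open>\<Gamma>\<close>\<close>
     (\<forall>m. \<forall>f \<in> funs T.
        is_thm T (Ctx m # map (shift m) (fdom T f), rdfd (fint (ver m) f),
          Eq (base m (fcod T f) (fst (fint (ver m) f))) (Tvar 0) # over m (Tvar 0) 1 (fdom T f))) \<and>
     (\<forall>m. \<forall>r \<in> rels T.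
        is_thm T (Ctx m # map (shift m) (rdom T r), rint (ver m) r,
          over m (Tvar 0) 1 (rdom T r))) \<and>
     \<comment> \<open>stability of the axioms\<close>
     (\<forall>m. \<forall>(V, \<phi>, \<psi>) \<in> axs T.
        is_thm T (Ctx m # map (shift m) V,
          over m (Tvar 0) 1 V @ tr_formula 1 (ver m) \<phi>, tr_formula 1 (ver m) \<psi>)) \<and>
     \<comment> \<open>stability under substitution\<close>
     (\<forall>l m. \<forall>f \<in> funs T.
        let ss = fdom T f;
            r = rapp (fint (ver m) f) (stab_src m ss);
            r' = rapp (fint (ver l) f) (stab_tgt l m ss)
        in is_thm T (stab_vars l m ss, stab_mor l m @ rdfd r,
             Eq (fst r') (stab_pull l m (fcod T f) (fst r)) # snd r')) \<and>
     (\<forall>l m. \<forall>r \<in> rels T.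
        let ss = rdom T r
        in is_thm T (stab_vars l m ss, stab_mor l m @ fapp (rint (ver m) r) (stab_src m ss),
             fapp (rint (ver l) r) (stab_tgt l m ss)))"


section \<open>The theory \<open>coe\<^sub>1 + \<sigma> + Path + wUA + \<Sigma>\<close>\<close>

datatype con =
    IntvC | LeftC | RightC
  | Coe1C
  | PathC | PLamC | AtC
  | IsoC
  | SigC | PairC | Pr1C | Pr2C

text \<open>Every constructor \<open>c\<close> has an instance \<open>(c, n)\<close> for contexts of length \<open>n\<close>, with the context as
  its first argument. The sorts are given relative to that context: \<open>Ctx 2\<close> is a type depending on
  one extra variable and \<open>Tm 1\<close> is a term depending on one extra variable. All arguments that are
  usually suppressed are explicit.\<close>

type_synonym t0 = "(con \<times> nat) sym"

primrec cdom :: "con \<Rightarrow> sort list" where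
  "cdom IntvC = []"
| "cdom LeftC = []"
| "cdom RightC = []"
| "cdom Coe1C = [Ctx 2, Tm 0, Tm 0]"
| "cdom PathC = [Ctx 2, Tm 0, Tm 0]"
| "cdom PLamC = [Tm 1]"
| "cdom AtC = [Ctx 2, Tm 0, Tm 0, Tm 0, Tm 0]"
| "cdom IsoC = [Ctx 1, Ctx 1, Tm 1, Tm 1, Tm 1, Tm 1, Tm 0]"
| "cdom SigC = [Ctx 1, Ctx 2]"
| "cdom PairC = [Ctx 1, Ctx 2, Tm 0, Tm 0]"
| "cdom Pr1C = [Ctx 1, Ctx 2, Tm 0]"
| "cdom Pr2C = [Ctx 1, Ctx 2, Tm 0]"

definition ccod :: "con \<Rightarrow> sort" where
  "ccod c = (if c \<in> {IntvC, PathC, IsoC, SigC} then Ctx 1 else Tm 0)"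

abbreviation cn :: "con \<Rightarrow> nat \<Rightarrow> t0 trm list \<Rightarrow> t0 trm" where
  "cn c n ts \<equiv> Fn (New (c, n)) ts"

text \<open>Below \<open>n\<close> is the length of \<open>\<Gamma>\<close>. A type \<open>A\<close> over \<open>\<Gamma>\<close> is also the context \<open>\<Gamma>, A\<close>.
  \<open>wk n s B t\<close> weakens \<open>t\<close>, of sort \<open>s\<close> relative to \<open>\<Gamma>\<close>, by the type \<open>B\<close> over \<open>\<Gamma>\<close>;
  \<open>inst n p \<Gamma> t a\<close> is \<open>t[x := a]\<close> for \<open>t\<close> in context \<open>\<Gamma>, x : ty a\<close>;
  \<open>cmp n A g f\<close> is \<open>\<Gamma>, x : A \<turnstile> g[y := f]\<close> for \<open>g\<close> in context \<open>\<Gamma>, y : B\<close>.\<close>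

definition wk :: "nat \<Rightarrow> sort \<Rightarrow> 'f sym trm \<Rightarrow> 'f sym trm \<Rightarrow> 'f sym trm" where
  "wk n s B t = pull (Suc n) n B (vars (Suc n) 1 B) s t"

definition inst :: "nat \<Rightarrow> kind \<Rightarrow> 'f sym trm \<Rightarrow> 'f sym trm \<Rightarrow> 'f sym trm \<Rightarrow> 'f sym trm" where
  "inst n p \<Gamma> t a = sb p n (Suc n) \<Gamma> t (vars n 0 \<Gamma> @ [a])"

definition cmp :: "nat \<Rightarrow> 'f sym trm \<Rightarrow> 'f sym trm \<Rightarrow> 'f sym trm \<Rightarrow> 'f sym trm" where
  "cmp n A g f = sb KTm (Suc n) (Suc n) A g (vars (Suc n) 1 A @ [f])"

definition intv :: "nat \<Rightarrow> t0 trm \<Rightarrow> t0 trm" where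
  "intv n \<Gamma> = cn IntvC n [\<Gamma>]"

definition lft :: "nat \<Rightarrow> t0 trm \<Rightarrow> t0 trm" where
  "lft n \<Gamma> = cn LeftC n [\<Gamma>]"

definition rgt :: "nat \<Rightarrow> t0 trm \<Rightarrow> t0 trm" where
  "rgt n \<Gamma> = cn RightC n [\<Gamma>]"

definition coe0 :: "nat \<Rightarrow> t0 trm \<Rightarrow> t0 trm \<Rightarrow> t0 trm \<Rightarrow> t0 trm" where
  "coe0 n \<Gamma> D d = cn Coe1C n [\<Gamma>, D, d, rgt n \<Gamma>]"

text \<open>The type \<open>a \<leadsto> a'\<close> of paths in a type \<open>A\<close> over \<open>\<Gamma>\<close>.\<close>

definition pth :: "nat \<Rightarrow> t0 trm \<Rightarrow> t0 trm \<Rightarrow> t0 trm \<Rightarrow> t0 trm \<Rightarrow> t0 trm" where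
  "pth n \<Gamma> A a a' = cn PathC n [\<Gamma>, wk n (Ctx 1) (intv n \<Gamma>) A, a, a']"

text \<open>\<open>\<Gamma>, x : A \<turnstile> f : B\<close> with \<open>B\<close> a type over \<open>\<Gamma>\<close>.\<close>

definition is_map :: "nat \<Rightarrow> t0 trm \<Rightarrow> t0 trm \<Rightarrow> t0 trm \<Rightarrow> (t0, 'r) atom" where
  "is_map n A B f = Eq (ty (Suc n) f) (wk n (Ctx 1) A B)"

text \<open>\<open>\<Gamma>, x : A \<turnstile> p : g[y := f] \<leadsto> x\<close>\<close>

definition is_retr :: "nat \<Rightarrow> t0 trm \<Rightarrow> t0 trm \<Rightarrow> t0 trm \<Rightarrow> t0 trm \<Rightarrow> (t0, 'r) atom" where
  "is_retr n A g f p =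
     Eq (ty (Suc n) p) (pth (Suc n) A (wk n (Ctx 1) A A) (cmp n A g f) (vr (Suc n) 0 A))"

text \<open>The premises of the rules; the first argument of each constructor is the context \<open>\<Gamma>\<close>.\<close>

primrec prem :: "con \<Rightarrow> nat \<Rightarrow> t0 trm list \<Rightarrow> (t0, 'r) formula" where
  "prem IntvC n xs = []"
| "prem LeftC n xs = []"
| "prem RightC n xs = []"
| "prem Coe1C n xs = (case xs of [\<Gamma>, D, d, i] \<Rightarrow>
     [Eq (ft (Suc n) D) (intv n \<Gamma>),
      Eq (ty n d) (inst n KTy \<Gamma> D (lft n \<Gamma>)),
      Eq (ty n i) (intv n \<Gamma>)])"
| "prem PathC n xs = (case xs of [\<Gamma>, A, a, a'] \<Rightarrow>
     [Eq (ft (Suc n) A) (intv n \<Gamma>),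
      Eq (ty n a) (inst n KTy \<Gamma> A (lft n \<Gamma>)),
      Eq (ty n a') (inst n KTy \<Gamma> A (rgt n \<Gamma>))])"
| "prem PLamC n xs = (case xs of [\<Gamma>, a] \<Rightarrow>
     [Eq (ft (Suc n) (ty (Suc n) a)) (intv n \<Gamma>)])"
| "prem AtC n xs = (case xs of [\<Gamma>, A, a, a', p, i] \<Rightarrow>
     [Eq (ty n p) (cn PathC n [\<Gamma>, A, a, a']),
      Eq (ty n i) (intv n \<Gamma>)])"
| "prem IsoC n xs = (case xs of [\<Gamma>, A, B, f, g, p, q, j] \<Rightarrow>
     [Eq (ft n A) \<Gamma>, Eq (ft n B) \<Gamma>,
      is_map n A B f, is_map n B A g,
      is_retr n A g f p, is_retr n B f g q,
      Eq (ty n j) (intv n \<Gamma>)])"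
| "prem SigC n xs = (case xs of [\<Gamma>, A, B] \<Rightarrow>
     [Eq (ft n A) \<Gamma>, Eq (ft (Suc n) B) A])"
| "prem PairC n xs = (case xs of [\<Gamma>, A, B, a, b] \<Rightarrow>
     [Eq (ft n A) \<Gamma>, Eq (ft (Suc n) B) A,
      Eq (ty n a) A, Eq (ty n b) (inst n KTy \<Gamma> B a)])"
| "prem Pr1C n xs = (case xs of [\<Gamma>, A, B, p] \<Rightarrow>
     [Eq (ft n A) \<Gamma>, Eq (ft (Suc n) B) A, Eq (ty n p) (cn SigC n [\<Gamma>, A, B])])"
| "prem Pr2C n xs = (case xs of [\<Gamma>, A, B, p] \<Rightarrow>
     [Eq (ft n A) \<Gamma>, Eq (ft (Suc n) B) A, Eq (ty n p) (cn SigC n [\<Gamma>, A, B])])"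

text \<open>The typing of the conclusions: a type former yields a type over \<open>\<Gamma>\<close>, a term former yields a
  term of the type indicated in the rule.\<close>

primrec concl :: "con \<Rightarrow> nat \<Rightarrow> t0 trm list \<Rightarrow> (t0, 'r) atom" where
  "concl IntvC n xs = Eq (ft n (cn IntvC n xs)) (hd xs)"
| "concl LeftC n xs = Eq (ty n (cn LeftC n xs)) (intv n (hd xs))"
| "concl RightC n xs = Eq (ty n (cn RightC n xs)) (intv n (hd xs))"
| "concl Coe1C n xs = (case xs of [\<Gamma>, D, d, i] \<Rightarrow>
     Eq (ty n (cn Coe1C n xs)) (inst n KTy \<Gamma> D i))"
| "concl PathC n xs = Eq (ft n (cn PathC n xs)) (hd xs)"
| "concl PLamC n xs = (case xs of [\<Gamma>, a] \<Rightarrow>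
     Eq (ty n (cn PLamC n xs))
        (cn PathC n [\<Gamma>, ty (Suc n) a, inst n KTm \<Gamma> a (lft n \<Gamma>), inst n KTm \<Gamma> a (rgt n \<Gamma>)]))"
| "concl AtC n xs = (case xs of [\<Gamma>, A, a, a', p, i] \<Rightarrow>
     Eq (ty n (cn AtC n xs)) (inst n KTy \<Gamma> A i))"
| "concl IsoC n xs = Eq (ft n (cn IsoC n xs)) (hd xs)"
| "concl SigC n xs = Eq (ft n (cn SigC n xs)) (hd xs)"
| "concl PairC n xs = (case xs of [\<Gamma>, A, B, a, b] \<Rightarrow>
     Eq (ty n (cn PairC n xs)) (cn SigC n [\<Gamma>, A, B]))"
| "concl Pr1C n xs = (case xs of [\<Gamma>, A, B, p] \<Rightarrow>
     Eq (ty n (cn Pr1C n xs)) A)"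
| "concl Pr2C n xs = (case xs of [\<Gamma>, A, B, p] \<Rightarrow>
     Eq (ty n (cn Pr2C n xs)) (inst n KTy \<Gamma> B (cn Pr1C n [\<Gamma>, A, B, p])))"

text \<open>A constructor is defined exactly when the premises hold, its value is typed by the conclusion, and
  it commutes with the pullback along every context morphism.\<close>

definition rule_axioms :: "con \<Rightarrow> (sort, t0, 'r) sequent set" where
  "rule_axioms c =
     (\<Union>n.
        let V = Ctx n # map (shift n) (cdom c); xs = tvars 0 (length V)
        in {(V, prem c n xs, [dfd (cn c n xs), concl c n xs]),
            (V, [dfd (cn c n xs)], prem c n xs)}) \<union>
     (\<Union>l m.
        let t = cn c m (stab_src m (cdom c))
        in {(stab_vars l m (cdom c), stab_mor l m @ [dfd t],
             [Eq (cn c l (stab_tgt l m (cdom c))) (stab_pull l m (ccod c) t)])})"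

definition coe1_axioms :: "(sort, t0, 'r) sequent set" where
  "coe1_axioms =
     (\<Union>c \<in> {IntvC, LeftC, RightC, Coe1C}. rule_axioms c) \<union>
     (\<Union>n.
        let \<Gamma> = Tvar 0; D = Tvar 1; d = Tvar 2
        in {([Ctx n, Ctx (n + 2), Tm n], prem Coe1C n [\<Gamma>, D, d, lft n \<Gamma>],
             [Eq (cn Coe1C n [\<Gamma>, D, d, lft n \<Gamma>]) d])})"

definition sigma_axioms :: "(sort, t0, 'r) sequent set" where
  "sigma_axioms =
     (\<Union>n.
        let a = Tvar 0; A = ty n a; \<Gamma> = ft n A
        in {([Tm n], [], [Eq (coe0 n \<Gamma> (wk n (Ctx 1) (intv n \<Gamma>) A) a) a])})"

definition path_axioms :: "(sort, t0, 'r) sequent set" where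
  "path_axioms =
     (\<Union>c \<in> {PathC, PLamC, AtC}. rule_axioms c) \<union>
     (\<Union>n.
        let \<Gamma> = Tvar 0; a = Tvar 1; i = Tvar 2
        in {([Ctx n, Tm (n + 1), Tm n], prem PLamC n [\<Gamma>, a] @ [Eq (ty n i) (intv n \<Gamma>)],
             [Eq (cn AtC n [\<Gamma>, ty (Suc n) a, inst n KTm \<Gamma> a (lft n \<Gamma>), inst n KTm \<Gamma> a (rgt n \<Gamma>),
                            cn PLamC n [\<Gamma>, a], i])
                 (inst n KTm \<Gamma> a i)])}) \<union>
     (\<Union>n.
        let \<Gamma> = Tvar 0; A = Tvar 1; a = Tvar 2; a' = Tvar 3; p = Tvar 4;
            I = intv n \<Gamma>
        in {([Ctx n, Ctx (n + 2), Tm n, Tm n, Tm n], [Eq (ty n p) (cn PathC n [\<Gamma>, A, a, a'])],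
             [Eq (cn PLamC n [\<Gamma>, cn AtC (Suc n) [I, wk n (Ctx 2) I A, wk n (Tm 0) I a,
                                wk n (Tm 0) I a', wk n (Tm 0) I p, vr (Suc n) 0 I]])
                 p,
              Eq (cn AtC n [\<Gamma>, A, a, a', p, lft n \<Gamma>]) a,
              Eq (cn AtC n [\<Gamma>, A, a, a', p, rgt n \<Gamma>]) a'])})"

definition wua_axioms :: "(sort, t0, 'r) sequent set" where
  "wua_axioms = rule_axioms IsoC \<union>
     (\<Union>n.
        let \<Gamma> = Tvar 0; A = Tvar 1; B = Tvar 2; f = Tvar 3; g = Tvar 4; p = Tvar 5; q = Tvar 6;
            V = [Ctx n, Ctx (n + 1), Ctx (n + 1), Tm (n + 1), Tm (n + 1), Tm (n + 1), Tm (n + 1)];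
            a = Tvar 7; I = intv n \<Gamma>;
            D = cn IsoC (Suc n) [I, wk n (Ctx 1) I A, wk n (Ctx 1) I B, wk n (Tm 1) I f,
                  wk n (Tm 1) I g, wk n (Tm 1) I p, wk n (Tm 1) I q, vr (Suc n) 0 I]
        in {(V, prem IsoC n [\<Gamma>, A, B, f, g, p, q, lft n \<Gamma>],
             [Eq (cn IsoC n [\<Gamma>, A, B, f, g, p, q, lft n \<Gamma>]) A,
              Eq (cn IsoC n [\<Gamma>, A, B, f, g, p, q, rgt n \<Gamma>]) B]),
            (V @ [Tm n], prem IsoC n [\<Gamma>, A, B, f, g, p, q, lft n \<Gamma>] @ [Eq (ty n a) A],
             [Eq (coe0 n \<Gamma> D a) (inst n KTm \<Gamma> f a)])})"

definition Sigma_axioms :: "(sort, t0, 'r) sequent set" where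
  "Sigma_axioms =
     (\<Union>c \<in> {SigC, PairC, Pr1C, Pr2C}. rule_axioms c) \<union>
     (\<Union>n.
        let \<Gamma> = Tvar 0; A = Tvar 1; B = Tvar 2; a = Tvar 3; b = Tvar 4;
            c = cn PairC n [\<Gamma>, A, B, a, b]
        in {([Ctx n, Ctx (n + 1), Ctx (n + 2), Tm n, Tm n], prem PairC n [\<Gamma>, A, B, a, b],
             [Eq (cn Pr1C n [\<Gamma>, A, B, c]) a, Eq (cn Pr2C n [\<Gamma>, A, B, c]) b])}) \<union>
     (\<Union>n.
        let \<Gamma> = Tvar 0; A = Tvar 1; B = Tvar 2; p = Tvar 3
        in {([Ctx n, Ctx (n + 1), Ctx (n + 2), Tm n], prem Pr1C n [\<Gamma>, A, B, p],
             [Eq (cn PairC n [\<Gamma>, A, B, cn Pr1C n [\<Gamma>, A, B, p], cn Pr2C n [\<Gamma>, A, B, p]]) p])})"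

definition T0 :: "(sort, t0, unit) horn" where
  "T0 =
     \<lparr>funs = Bas ` ssyms \<union> range New,
      fdom = (\<lambda>f. case f of Bas s \<Rightarrow> sdom s | New (c, n) \<Rightarrow> Ctx n # map (shift n) (cdom c)),
      fcod = (\<lambda>f. case f of Bas s \<Rightarrow> scod s | New (c, n) \<Rightarrow> shift n (ccod c)),
      rels = {},
      rdom = (\<lambda>_. []),
      axs = subst_axioms \<union> coe1_axioms \<union> sigma_axioms \<union> path_axioms \<union> wua_axioms \<union> Sigma_axioms\<rparr>"

text \<open>The version over a base context of length \<open>m\<close> of a constructor for contexts of length \<open>n\<close> is the
  constructor for contexts of length \<open>n + m\<close>, restricted to arguments over the base context.\<close>

definition ver0 :: "nat \<Rightarrow> (t0, unit, t0, unit) interp" where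
  "ver0 m =
     \<lparr>fint = (\<lambda>f. case f of
        Bas s \<Rightarrow> sver m s
      | New (c, n) \<Rightarrow> (cn c (n + m) (tvars 1 (Suc (length (cdom c)))),
                      over m (Tvar 0) 1 (fdom T0 (New (c, n))))),
      rint = (\<lambda>_. [])\<rparr>"

text \<open>\<open>T\<close>, regular with versions \<open>ver\<close>, is a theory under \<open>T0\<close> by means of \<open>\<iota>\<close>.\<close>

definition under_T0 ::
  "(sort, 'f sym, 'r) horn \<Rightarrow> (nat \<Rightarrow> ('f sym, 'r, 'f sym, 'r) interp)
    \<Rightarrow> (t0, unit, 'f sym, 'r) interp \<Rightarrow> bool"
where
  "under_T0 T ver \<iota> \<longleftrightarrow> is_interp T0 T \<iota> \<and>
     (\<forall>s \<in> ssyms. fint \<iota> (Bas s) = (Fn (Bas s) (tvars 0 (length (sdom s))), [])) \<and>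
     (\<forall>m. \<forall>f \<in> funs T0.
        rterm_eq T (Ctx m # map (shift m) (fdom T0 f)) (over m (Tvar 0) 1 (fdom T0 f))
          (tr_rterm 0 \<iota> (fint (ver0 m) f))
          (tr_rterm 1 (ver m) (fint \<iota> f)))"


section \<open>Weak equivalences\<close>

type_synonym 'x t0_struct = "(sort, t0, unit, 'x) struct"

definition weak_equiv_tm :: "'x t0_struct \<Rightarrow> 'y t0_struct \<Rightarrow> (sort \<Rightarrow> 'x \<Rightarrow> 'y) \<Rightarrow> nat \<Rightarrow> bool" where
  "weak_equiv_tm X Y f n \<longleftrightarrow>
     (\<forall>A \<in> car X (Ty n). \<forall>a \<in> car Y (Tm n).
        holds Y [f (Ty n) A, a] [Eq (ty n (Tvar 1)) (Tvar 0)] \<longrightarrow>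
        (\<exists>a' \<in> car X (Tm n). \<exists>h \<in> car Y (Tm (Suc n)).
           holds X [A, a'] [Eq (ty n (Tvar 1)) (Tvar 0)] \<and>
           holds Y [f (Ty n) A, f (Tm n) a', a, h]
             (let A = Tvar 0; a' = Tvar 1; a = Tvar 2; h = Tvar 3; \<Gamma> = ft n A
              in [is_map n (intv n \<Gamma>) A h,
                  Eq (inst n KTm \<Gamma> h (lft n \<Gamma>)) a',
                  Eq (inst n KTm \<Gamma> h (rgt n \<Gamma>)) a])))"

definition weak_equiv_ty :: "'x t0_struct \<Rightarrow> 'y t0_struct \<Rightarrow> (sort \<Rightarrow> 'x \<Rightarrow> 'y) \<Rightarrow> nat \<Rightarrow> bool" where
  "weak_equiv_ty X Y f n \<longleftrightarrow>
     (\<forall>\<Gamma> \<in> car X (Ctx n). \<forall>B \<in> car Y (Ty n).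
        holds Y [f (Ctx n) \<Gamma>, B] [Eq (ft n (Tvar 1)) (Tvar 0)] \<longrightarrow>
        (\<exists>A \<in> car X (Ty n). \<exists>b \<in> car Y (Tm (Suc n)).
         \<exists>a\<^sub>1 \<in> car Y (Tm (Suc n)). \<exists>p \<in> car Y (Tm (Suc n)).
         \<exists>a\<^sub>2 \<in> car Y (Tm (Suc n)). \<exists>q \<in> car Y (Tm (Suc n)).
           holds X [\<Gamma>, A] [Eq (ft n (Tvar 1)) (Tvar 0)] \<and>
           holds Y [f (Ty n) A, B, b, a\<^sub>1, p, a\<^sub>2, q]
             (let A = Tvar 0; B = Tvar 1; b = Tvar 2; a\<^sub>1 = Tvar 3; p = Tvar 4; a\<^sub>2 = Tvar 5; q = Tvar 6
              in [is_map n A B b,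
                  is_map n B A a\<^sub>1, is_retr n A a\<^sub>1 b p,
                  is_map n B A a\<^sub>2, is_retr n B b a\<^sub>2 q])))"

definition weak_equivalence :: "'x t0_struct \<Rightarrow> 'y t0_struct \<Rightarrow> (sort \<Rightarrow> 'x \<Rightarrow> 'y) \<Rightarrow> bool" where
  "weak_equivalence X Y f \<longleftrightarrow> (\<forall>n. weak_equiv_tm X Y f n \<and> weak_equiv_ty X Y f n)"


section \<open>Categories\<close>

text \<open>Hom-sets need not be disjoint, so identities, composition and the action of functors on
  morphisms are indexed by objects; \<open>Comp C A B D g f\<close> is the composite of \<open>f : A \<rightarrow> B\<close> and
  \<open>g : B \<rightarrow> D\<close>.\<close>

record ('o, 'm) cat =
  Obj  :: "'o set"
  Hom  :: "'o \<Rightarrow> 'o \<Rightarrow> 'm set"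
  Idn  :: "'o \<Rightarrow> 'm"
  Comp :: "'o \<Rightarrow> 'o \<Rightarrow> 'o \<Rightarrow> 'm \<Rightarrow> 'm \<Rightarrow> 'm"

definition is_cat :: "('o, 'm) cat \<Rightarrow> bool" where
  "is_cat C \<longleftrightarrow>
     (\<forall>A \<in> Obj C. Idn C A \<in> Hom C A A) \<and>
     (\<forall>A \<in> Obj C. \<forall>B \<in> Obj C. \<forall>D \<in> Obj C. \<forall>f \<in> Hom C A B. \<forall>g \<in> Hom C B D.
        Comp C A B D g f \<in> Hom C A D) \<and>
     (\<forall>A \<in> Obj C. \<forall>B \<in> Obj C. \<forall>f \<in> Hom C A B.
        Comp C A B B (Idn C B) f = f \<and> Comp C A A B f (Idn C A) = f) \<and>
     (\<forall>A \<in> Obj C. \<forall>B \<in> Obj C. \<forall>D \<in> Obj C. \<forall>E \<in> Obj C.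
        \<forall>f \<in> Hom C A B. \<forall>g \<in> Hom C B D. \<forall>h \<in> Hom C D E.
          Comp C A D E h (Comp C A B D g f) = Comp C A B E (Comp C B D E h g) f)"

record ('o, 'm, 'p, 'n) func =
  ob :: "'o \<Rightarrow> 'p"
  mp :: "'o \<Rightarrow> 'o \<Rightarrow> 'm \<Rightarrow> 'n"

definition is_functor :: "('o, 'm) cat \<Rightarrow> ('p, 'n) cat \<Rightarrow> ('o, 'm, 'p, 'n) func \<Rightarrow> bool" where
  "is_functor C D F \<longleftrightarrow> is_cat C \<and> is_cat D \<and>
     (\<forall>A \<in> Obj C. ob F A \<in> Obj D \<and> mp F A A (Idn C A) = Idn D (ob F A)) \<and>
     (\<forall>A \<in> Obj C. \<forall>B \<in> Obj C. \<forall>f \<in> Hom C A B. mp F A B f \<in> Hom D (ob F A) (ob F B)) \<and>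
     (\<forall>A \<in> Obj C. \<forall>B \<in> Obj C. \<forall>E \<in> Obj C. \<forall>f \<in> Hom C A B. \<forall>g \<in> Hom C B E.
        mp F A E (Comp C A B E g f) =
          Comp D (ob F A) (ob F B) (ob F E) (mp F B E g) (mp F A B f))"

definition id_func :: "('o, 'm, 'o, 'm) func" where
  "id_func = \<lparr>ob = (\<lambda>A. A), mp = (\<lambda>A B f. f)\<rparr>"

definition comp_func ::
  "('p, 'n, 'q, 'k) func \<Rightarrow> ('o, 'm, 'p, 'n) func \<Rightarrow> ('o, 'm, 'q, 'k) func"
where
  "comp_func G F =
     \<lparr>ob = (\<lambda>A. ob G (ob F A)), mp = (\<lambda>A B f. mp G (ob F A) (ob F B) (mp F A B f))\<rparr>"

definition is_iso :: "('o, 'm) cat \<Rightarrow> 'o \<Rightarrow> 'o \<Rightarrow> 'm \<Rightarrow> bool" where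
  "is_iso C A B f \<longleftrightarrow> f \<in> Hom C A B \<and>
     (\<exists>g \<in> Hom C B A. Comp C A B A g f = Idn C A \<and> Comp C B A B f g = Idn C B)"

definition nat_isomorphic ::
  "('o, 'm) cat \<Rightarrow> ('p, 'n) cat \<Rightarrow> ('o, 'm, 'p, 'n) func \<Rightarrow> ('o, 'm, 'p, 'n) func \<Rightarrow> bool"
where
  "nat_isomorphic C D F G \<longleftrightarrow>
     (\<exists>\<alpha>. (\<forall>A \<in> Obj C. is_iso D (ob F A) (ob G A) (\<alpha> A)) \<and>
          (\<forall>A \<in> Obj C. \<forall>B \<in> Obj C. \<forall>f \<in> Hom C A B.
             Comp D (ob F A) (ob F B) (ob G B) (\<alpha> B) (mp F A B f) =
             Comp D (ob F A) (ob G A) (ob G B) (mp G A B f) (\<alpha> A)))"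

definition is_equivalence :: "('o, 'm) cat \<Rightarrow> ('p, 'n) cat \<Rightarrow> ('o, 'm, 'p, 'n) func \<Rightarrow> bool" where
  "is_equivalence C D F \<longleftrightarrow> is_functor C D F \<and>
     (\<exists>G. is_functor D C G \<and>
          nat_isomorphic C C (comp_func G F) id_func \<and>
          nat_isomorphic D D (comp_func F G) id_func)"


section \<open>Homotopy categories\<close>

definition homotopic :: "'x t0_struct \<Rightarrow> nat \<Rightarrow> ('x \<times> 'x) set" where
  "homotopic M n =
     {(a, a'). a \<in> car M (Tm n) \<and> a' \<in> car M (Tm n) \<and>
        (\<exists>p \<in> car M (Tm n).
           holds M [a, a', p]
             (let a = Tvar 0; a' = Tvar 1; p = Tvar 2
              in [Eq (ty n a) (ty n a'),
                  Eq (ty n p) (pth n (ft n (ty n a)) (ty n a) a a')]))}"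

definition maps :: "'x t0_struct \<Rightarrow> 'x \<Rightarrow> 'x \<Rightarrow> 'x set" where
  "maps M A B = {b \<in> car M (Tm 1). holds M [A, B, b] [is_map 0 (Tvar 0) (Tvar 1) (Tvar 2)]}"

definition Ho :: "'x t0_struct \<Rightarrow> ('x, 'x set) cat" where
  "Ho M =
     \<lparr>Obj = car M (Ty 0),
      Hom = (\<lambda>A B. maps M A B // homotopic M 1),
      Idn = (\<lambda>A. homotopic M 1 `` {v. ev M [A] (vr 1 0 (Tvar 0)) = Some v}),
      Comp = (\<lambda>A B C \<gamma> \<beta>. homotopic M 1 ``
        {d. \<exists>c \<in> \<gamma>. \<exists>b \<in> \<beta>. ev M [A, c, b] (cmp 0 (Tvar 0) (Tvar 1) (Tvar 2)) = Some d})\<rparr>"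

definition Ho_map :: "'y t0_struct \<Rightarrow> (sort \<Rightarrow> 'x \<Rightarrow> 'y) \<Rightarrow> ('x, 'x set, 'y, 'y set) func" where
  "Ho_map Y f = \<lparr>ob = f (Ty 0), mp = (\<lambda>A B \<beta>. homotopic Y 1 `` (f (Tm 1) ` \<beta>))\<rparr>"

end

theory Submission
  imports Defs
begin

text \<open>The contexts of a model form a category with display maps, in which extension by \<open>x : I\<close> is a cylinder.
  There \<open>coe\<^sub>1\<close> lifts the inclusion of the left end of a cylinder against display maps, \<open>Path\<close> represents
  homotopies, and \<open>\<Sigma>\<close> makes every nonempty context isomorphic to a closed type, while the empty context is
  homotopy equivalent to \<open>I\<close>. Hence a morphism that is full, faithful and essentially surjective up to
  homotopy on closed types is so on all contexts.

  Over a context \<open>\<Gamma>\<close> one argues with total spaces. A term of type \<open>A\<close> is a section of a display map; a lift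
  of it up to homotopy can be made a strict section, and sections that are homotopic as maps into the total
  space are homotopic over \<open>\<Gamma>\<close>. Every context over \<open>\<Gamma>\<close> can be replaced by a type over \<open>\<Gamma>\<close> (a mapping path
  space), and a homotopy equivalence of total spaces over \<open>\<Gamma>\<close> is a fibrewise one. This gives the conditions
  (tm,\<open>n\<close>) and (ty,\<open>n\<close>). Conversely, (tm,1) for weakened types is fullness, (tm,1) for path types is
  faithfulness, and (ty,0) is essential surjectivity.\<close>


section \<open>Display maps and cylinders\<close>

text \<open>What makes the argument delicate is how little is primitive. Transport starts at the
  left end only; there is no composition of paths, no connection on the interval, and not even
  symmetry of homotopy is given. One mechanism yields all of them: a cube with two opposite faces
  prescribed is a cube of one dimension less in the \<open>Path\<close> type of these faces, so
  transport fills open squares and open cubes. This forces path types of types that depend on the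
  interval variable. A second obstacle is that a homotopy of maps into a total space may move the
  base point. Two relations are therefore kept apart, \<open>hm\<close> for homotopies of arrows and
  \<open>fh\<close> for homotopies over a fixed map to the base, and \<open>fh_lift\<close>, which
  compares lifts of one homotopy, mediates between them. What a model must supply is condensed into
  \<open>path_cat\<close>, and what a morphism must supply into \<open>path_functor\<close>. Strict
  stability of the constructors under substitution turns the rules, each stated over one context,
  into universal properties with respect to all arrows.\<close>

locale disp_cat =
  fixes obj :: "'o \<Rightarrow> bool" and len :: "'o \<Rightarrow> nat"
    and arr :: "'m \<Rightarrow> bool" and dom cod :: "'m \<Rightarrow> 'o"
    and idn :: "'o \<Rightarrow> 'm" and comp :: "'m \<Rightarrow> 'm \<Rightarrow> 'm" (infixr "\<odot>" 70)
    and base :: "'o \<Rightarrow> 'o" and dp :: "'o \<Rightarrow> 'm"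
    and pb :: "'o \<Rightarrow> 'm \<Rightarrow> 'o" and pq :: "'o \<Rightarrow> 'm \<Rightarrow> 'm"
    and one :: 'o and I :: 'o and lp rp :: 'm
  assumes dom_obj [simp]: "arr f \<Longrightarrow> obj (dom f)"
    and cod_obj [simp]: "arr f \<Longrightarrow> obj (cod f)"
    and idn [simp]: "obj a \<Longrightarrow> arr (idn a)" "dom (idn a) = a" "cod (idn a) = a"
    and comp [simp]: "arr f \<Longrightarrow> arr g \<Longrightarrow> cod f = dom g \<Longrightarrow> arr (g \<odot> f)"
      "dom (g \<odot> f) = dom f" "cod (g \<odot> f) = cod g"
    and idn_left [simp]: "arr f \<Longrightarrow> cod f = b \<Longrightarrow> idn b \<odot> f = f"
    and idn_right [simp]: "arr f \<Longrightarrow> dom f = a \<Longrightarrow> f \<odot> idn a = f"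
    and assoc [simp]: "arr f \<Longrightarrow> arr g \<Longrightarrow> arr h \<Longrightarrow> cod f = dom g \<Longrightarrow> cod g = dom h
      \<Longrightarrow> (h \<odot> g) \<odot> f = h \<odot> (g \<odot> f)"
    and base_obj [simp]: "obj a \<Longrightarrow> len a \<noteq> 0 \<Longrightarrow> obj (base a)"
    and base_len: "obj a \<Longrightarrow> len a \<noteq> 0 \<Longrightarrow> len (base a) < len a"
    and dp [simp]: "obj a \<Longrightarrow> len a \<noteq> 0 \<Longrightarrow> arr (dp a)"
      "obj a \<Longrightarrow> len a \<noteq> 0 \<Longrightarrow> dom (dp a) = a" "obj a \<Longrightarrow> len a \<noteq> 0 \<Longrightarrow> cod (dp a) = base a"
    and pb [simp]: "obj a \<Longrightarrow> len a \<noteq> 0 \<Longrightarrow> arr s \<Longrightarrow> cod s = base a \<Longrightarrow> obj (pb a s)"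
      "obj a \<Longrightarrow> len a \<noteq> 0 \<Longrightarrow> arr s \<Longrightarrow> cod s = base a \<Longrightarrow> len (pb a s) \<noteq> 0"
      "obj a \<Longrightarrow> len a \<noteq> 0 \<Longrightarrow> arr s \<Longrightarrow> cod s = base a \<Longrightarrow> base (pb a s) = dom s"
    and pq [simp]: "obj a \<Longrightarrow> len a \<noteq> 0 \<Longrightarrow> arr s \<Longrightarrow> cod s = base a \<Longrightarrow> arr (pq a s)"
      "obj a \<Longrightarrow> len a \<noteq> 0 \<Longrightarrow> arr s \<Longrightarrow> cod s = base a \<Longrightarrow> dom (pq a s) = pb a s"
      "obj a \<Longrightarrow> len a \<noteq> 0 \<Longrightarrow> arr s \<Longrightarrow> cod s = base a \<Longrightarrow> cod (pq a s) = a"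
    and pb_sq: "obj a \<Longrightarrow> len a \<noteq> 0 \<Longrightarrow> arr s \<Longrightarrow> cod s = base a
      \<Longrightarrow> dp a \<odot> pq a s = s \<odot> dp (pb a s)"
    and pb_univ: "obj a \<Longrightarrow> len a \<noteq> 0 \<Longrightarrow> arr s \<Longrightarrow> cod s = base a \<Longrightarrow> arr x \<Longrightarrow> arr k
      \<Longrightarrow> dom k = dom x \<Longrightarrow> cod x = dom s \<Longrightarrow> cod k = a \<Longrightarrow> dp a \<odot> k = s \<odot> x
      \<Longrightarrow> \<exists>!m. arr m \<and> dom m = dom x \<and> cod m = pb a s \<and> dp (pb a s) \<odot> m = x \<and> pq a s \<odot> m = k"
    and one [simp]: "obj one" "len one = 0"
    and one_len: "obj a \<Longrightarrow> len a = 0 \<Longrightarrow> a = one"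
    and one_term: "obj a \<Longrightarrow> \<exists>!f. arr f \<and> dom f = a \<and> cod f = one"
    and I [simp]: "obj I" "len I \<noteq> 0" "base I = one"
    and lp [simp]: "arr lp" "dom lp = one" "cod lp = I"
    and rp [simp]: "arr rp" "dom rp = one" "cod rp = I"
begin

abbreviation hom :: "'m \<Rightarrow> 'o \<Rightarrow> 'o \<Rightarrow> bool" where
  "hom f a b \<equiv> arr f \<and> dom f = a \<and> cod f = b"

abbreviation isty :: "'o \<Rightarrow> bool" where
  "isty a \<equiv> obj a \<and> len a \<noteq> 0"

definition bang :: "'o \<Rightarrow> 'm" where
  "bang a = (THE f. hom f a one)"

lemma bang [simp]: "obj a \<Longrightarrow> arr (bang a)" "obj a \<Longrightarrow> dom (bang a) = a" "obj a \<Longrightarrow> cod (bang a) = one"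
  using theI'[OF one_term[of a]] by (simp_all add: bang_def)

lemma bang_unique: "arr f \<Longrightarrow> cod f = one \<Longrightarrow> f = bang (dom f)"
  using one_term[of "dom f"] bang[of "dom f"] dom_obj[of f] by blast

lemma bang_comp [simp]: "arr f \<Longrightarrow> cod f = a \<Longrightarrow> bang a \<odot> f = bang (dom f)"
  using bang_unique[of "bang a \<odot> f"] by auto

lemma to_one: "hom f a one \<Longrightarrow> hom g a one \<Longrightarrow> f = g"
  using bang_unique by metis

lemma dp_closed [simp]: "isty a \<Longrightarrow> base a = one \<Longrightarrow> dp a = bang a"
  using bang_unique[of "dp a"] by simp

lemma bang_one [simp]: "bang one = idn one"
  using bang_unique[of "idn one"] by simp

text \<open>Composites are normalised to the right by \<open>assoc\<close>, which hides
  \<open>g \<odot> f\<close> inside \<open>g \<odot> (f \<odot> h)\<close>. Equations meant for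
  rewriting are therefore supplied in this form as well.\<close>

lemma comp_reassoc:
  "g \<odot> f = k \<Longrightarrow> arr f \<Longrightarrow> arr g \<Longrightarrow> cod f = dom g \<Longrightarrow> arr h \<Longrightarrow> cod h = dom f
    \<Longrightarrow> g \<odot> (f \<odot> h) = k \<odot> h"
  using assoc[of h f g] by auto

text \<open>The arrow into a pullback that a cone induces. Pullbacks are handled by their universal
  property, through this arrow and \<open>pb_ext\<close>; strict functoriality of \<open>pb\<close>
  in \<open>s\<close> is a feature of models, not of the locale.\<close>

definition pbm :: "'o \<Rightarrow> 'm \<Rightarrow> 'm \<Rightarrow> 'm \<Rightarrow> 'm" where
  "pbm a s x k = (THE m. hom m (dom x) (pb a s) \<and> dp (pb a s) \<odot> m = x \<and> pq a s \<odot> m = k)"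

lemma pbm:
  assumes "isty a" "arr s" "cod s = base a" "arr x" "arr k" "dom k = dom x" "cod x = dom s" "cod k = a"
    "dp a \<odot> k = s \<odot> x"
  shows "arr (pbm a s x k)" "dom (pbm a s x k) = dom x" "cod (pbm a s x k) = pb a s"
    "dp (pb a s) \<odot> pbm a s x k = x" "pq a s \<odot> pbm a s x k = k"
  using theI'[OF pb_univ[of a s x k]] assms by (simp_all add: pbm_def)

lemma pb_ext:
  assumes "isty a" "arr s" "cod s = base a" "hom f z (pb a s)" "hom g z (pb a s)"
    "dp (pb a s) \<odot> f = dp (pb a s) \<odot> g" "pq a s \<odot> f = pq a s \<odot> g"
  shows "f = g"
proof -
  let ?x = "dp (pb a s) \<odot> f" and ?k = "pq a s \<odot> f"
  have "dp a \<odot> ?k = s \<odot> ?x"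
    using assms pb_sq[of a s] assoc[of f "pq a s" "dp a"] assoc[of f "dp (pb a s)" s] by simp
  then have "\<exists>!m. arr m \<and> dom m = dom ?x \<and> cod m = pb a s \<and> dp (pb a s) \<odot> m = ?x \<and> pq a s \<odot> m = ?k"
    using assms by (intro pb_univ) auto
  then show ?thesis
    using assms by auto
qed

text \<open>The product with the interval, as the pullback of \<open>I\<close> along the map to the
  terminal context; it stands for the context \<open>a, x : I\<close>. Its two projections are
  \<open>pr\<close> and \<open>pI\<close>, and \<open>px\<close> is the pairing.\<close>

definition cyl :: "'o \<Rightarrow> 'o" where "cyl a = pb I (bang a)"

definition pI :: "'o \<Rightarrow> 'm" where "pI a = pq I (bang a)"

abbreviation pr :: "'o \<Rightarrow> 'm" where "pr a \<equiv> dp (cyl a)"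

definition px :: "'m \<Rightarrow> 'm \<Rightarrow> 'm" where "px x k = pbm I (bang (cod x)) x k"

lemma cyl [simp]: "obj a \<Longrightarrow> obj (cyl a)" "obj a \<Longrightarrow> len (cyl a) \<noteq> 0" "obj a \<Longrightarrow> base (cyl a) = a"
  by (simp_all add: cyl_def)

lemma pI [simp]: "obj a \<Longrightarrow> arr (pI a)" "obj a \<Longrightarrow> dom (pI a) = cyl a" "obj a \<Longrightarrow> cod (pI a) = I"
  by (simp_all add: pI_def cyl_def)

lemma px [simp]:
  assumes "arr x" "arr k" "dom k = dom x" "cod k = I"
  shows "arr (px x k)" "dom (px x k) = dom x" "cod (px x k) = cyl (cod x)"
    "cod x = b \<Longrightarrow> pr b \<odot> px x k = x" "cod x = b \<Longrightarrow> pI b \<odot> px x k = k"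
  using pbm[of I "bang (cod x)" x k] assms by (auto simp: px_def cyl_def pI_def)

lemma cyl_ext:
  assumes "hom f z (cyl a)" "hom g z (cyl a)" "obj a" "pr a \<odot> f = pr a \<odot> g" "pI a \<odot> f = pI a \<odot> g"
  shows "f = g"
  using pb_ext[of I "bang a" f z g] assms by (auto simp: cyl_def pI_def)

lemma px_comp [simp]:
  assumes "arr x" "arr k" "dom k = dom x" "cod k = I" "arr f" "cod f = dom x"
  shows "px x k \<odot> f = px (x \<odot> f) (k \<odot> f)"
proof (rule cyl_ext[of _ "dom f" "cod x"])
  show "pr (cod x) \<odot> px x k \<odot> f = pr (cod x) \<odot> px (x \<odot> f) (k \<odot> f)"
    using assms comp_reassoc[OF px(4)[OF assms(1-4) refl], of f] by simp
  show "pI (cod x) \<odot> px x k \<odot> f = pI (cod x) \<odot> px (x \<odot> f) (k \<odot> f)"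
    using assms comp_reassoc[OF px(5)[OF assms(1-4) refl], of f] by simp
qed (use assms in auto)

lemma px_reassoc [simp]:
  assumes "arr x" "arr k" "dom k = dom x" "cod k = I" "arr f" "cod f = dom x"  "cod x = b"
  shows "pr b \<odot> px x k \<odot> f = x \<odot> f" "pI b \<odot> px x k \<odot> f = k \<odot> f"
  using assms by auto

lemma px_id [simp]: "obj a \<Longrightarrow> px (pr a) (pI a) = idn (cyl a)"
  by (rule cyl_ext[of _ "cyl a" a]) auto

definition i0 :: "'o \<Rightarrow> 'm" where "i0 a = px (idn a) (lp \<odot> bang a)"
definition i1 :: "'o \<Rightarrow> 'm" where "i1 a = px (idn a) (rp \<odot> bang a)"
text \<open>The product of \<open>f\<close> with the identity of the interval. On an iterated
  cylinder \<open>i0 (cyl a)\<close> is a face for the outer coordinate and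
  \<open>cyf (i0 a)\<close> a face for the inner one; all boxes below are described in these
  terms.\<close>

definition cyf :: "'m \<Rightarrow> 'm" where "cyf f = px (f \<odot> pr (dom f)) (pI (dom f))"

lemma i0 [simp]: "obj a \<Longrightarrow> arr (i0 a)" "obj a \<Longrightarrow> dom (i0 a) = a" "obj a \<Longrightarrow> cod (i0 a) = cyl a"
  "obj a \<Longrightarrow> pr a \<odot> i0 a = idn a" "obj a \<Longrightarrow> pI a \<odot> i0 a = lp \<odot> bang a"
  by (simp_all add: i0_def)

lemma i1 [simp]: "obj a \<Longrightarrow> arr (i1 a)" "obj a \<Longrightarrow> dom (i1 a) = a" "obj a \<Longrightarrow> cod (i1 a) = cyl a"
  "obj a \<Longrightarrow> pr a \<odot> i1 a = idn a" "obj a \<Longrightarrow> pI a \<odot> i1 a = rp \<odot> bang a"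
  by (simp_all add: i1_def)

lemma cyf [simp]: "arr f \<Longrightarrow> arr (cyf f)" "arr f \<Longrightarrow> dom (cyf f) = cyl (dom f)"
  "arr f \<Longrightarrow> cod (cyf f) = cyl (cod f)"
  "arr f \<Longrightarrow> cod f = b \<Longrightarrow> pr b \<odot> cyf f = f \<odot> pr (dom f)"
  "arr f \<Longrightarrow> cod f = b \<Longrightarrow> pI b \<odot> cyf f = pI (dom f)"
  by (auto simp: cyf_def)

lemma pr_i_comp [simp]:
  "arr f \<Longrightarrow> cod f = a \<Longrightarrow> pr a \<odot> i0 a \<odot> f = f" "arr f \<Longrightarrow> cod f = a \<Longrightarrow> pr a \<odot> i1 a \<odot> f = f"
  "arr f \<Longrightarrow> cod f = a \<Longrightarrow> pI a \<odot> i0 a \<odot> f = lp \<odot> bang (dom f)"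
  "arr f \<Longrightarrow> cod f = a \<Longrightarrow> pI a \<odot> i1 a \<odot> f = rp \<odot> bang (dom f)"
  by (auto simp: comp_reassoc[OF i0(4)] comp_reassoc[OF i1(4)] comp_reassoc[OF i0(5)] comp_reassoc[OF i1(5)])

lemma pr_cyf_comp [simp]:
  "arr f \<Longrightarrow> cod f = b \<Longrightarrow> arr g \<Longrightarrow> cod g = cyl (dom f) \<Longrightarrow> pr b \<odot> cyf f \<odot> g = f \<odot> pr (dom f) \<odot> g"
  "arr f \<Longrightarrow> cod f = b \<Longrightarrow> arr g \<Longrightarrow> cod g = cyl (dom f) \<Longrightarrow> pI b \<odot> cyf f \<odot> g = pI (dom f) \<odot> g"
  by (auto simp: comp_reassoc[OF cyf(4)] comp_reassoc[OF cyf(5)])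

lemma cyf_i [simp]:
  "arr f \<Longrightarrow> dom f = a \<Longrightarrow> cyf f \<odot> i0 a = i0 (cod f) \<odot> f"
  "arr f \<Longrightarrow> dom f = a \<Longrightarrow> cyf f \<odot> i1 a = i1 (cod f) \<odot> f"
  by (rule cyl_ext[of _ a "cod f"]; auto)+

lemma cyf_i_comp [simp]:
  "arr f \<Longrightarrow> dom f = a \<Longrightarrow> arr g \<Longrightarrow> cod g = a \<Longrightarrow> cyf f \<odot> i0 a \<odot> g = i0 (cod f) \<odot> f \<odot> g"
  "arr f \<Longrightarrow> dom f = a \<Longrightarrow> arr g \<Longrightarrow> cod g = a \<Longrightarrow> cyf f \<odot> i1 a \<odot> g = i1 (cod f) \<odot> f \<odot> g"
  by (auto simp: comp_reassoc[OF cyf_i(1)] comp_reassoc[OF cyf_i(2)])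

lemma cyf_comp: "arr f \<Longrightarrow> arr g \<Longrightarrow> cod f = dom g \<Longrightarrow> cyf (g \<odot> f) = cyf g \<odot> cyf f"
  by (rule cyl_ext[of _ "cyl (dom f)" "cod g"]; auto)

lemma cyf_idn [simp]: "obj a \<Longrightarrow> cyf (idn a) = idn (cyl a)"
  by (rule cyl_ext[of _ "cyl a" a]; auto)

lemma cyf_cyf [simp]: "arr f \<Longrightarrow> arr g \<Longrightarrow> cod f = dom g \<Longrightarrow> cyf g \<odot> cyf f = cyf (g \<odot> f)"
  by (simp add: cyf_comp)

end

text \<open>\<open>fill\<close> is \<open>coe\<^sub>1\<close> together with its value at the left
  end. \<open>path\<close> says that \<open>Path\<close> types represent homotopies with given ends,
  \<open>e\<close> being the universal one. \<open>sigma\<close> collapses two successive extensions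
  into one. In \<open>path\<close> the type \<open>c\<close> lives over the cylinder and so may
  depend on the interval variable; the passage to higher dimensions in \<open>fill2\<close> and
  \<open>fill3\<close> rests on this.\<close>

locale path_cat = disp_cat +
  assumes fill: "\<And>d a k. isty d \<Longrightarrow> obj a \<Longrightarrow> base d = cyl a \<Longrightarrow> hom k a d \<Longrightarrow> dp d \<odot> k = i0 a
      \<Longrightarrow> \<exists>K. hom K (cyl a) d \<and> dp d \<odot> K = idn (cyl a) \<and> K \<odot> i0 a = k"
    and path: "\<And>c a u v. isty c \<Longrightarrow> obj a \<Longrightarrow> base c = cyl a \<Longrightarrow> hom u a c \<Longrightarrow> hom v a c
      \<Longrightarrow> dp c \<odot> u = i0 a \<Longrightarrow> dp c \<odot> v = i1 a
      \<Longrightarrow> \<exists>p e. isty p \<and> base p = a \<and> hom e (cyl p) c \<and> dp c \<odot> e = cyf (dp p) \<and>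
            e \<odot> i0 p = u \<odot> dp p \<and> e \<odot> i1 p = v \<odot> dp p \<and>
            (\<forall>s h. arr s \<and> cod s = a \<and> hom h (cyl (dom s)) c \<and> dp c \<odot> h = cyf s \<and>
               h \<odot> i0 (dom s) = u \<odot> s \<and> h \<odot> i1 (dom s) = v \<odot> s \<longrightarrow>
               (\<exists>!k. hom k (dom s) p \<and> dp p \<odot> k = s \<and> e \<odot> cyf k = h))"
    and sigma: "\<And>b. isty b \<Longrightarrow> isty (base b)
      \<Longrightarrow> \<exists>s u v. isty s \<and> base s = base (base b) \<and> hom u s b \<and> hom v b s \<and>
            u \<odot> v = idn b \<and> v \<odot> u = idn s \<and> dp (base b) \<odot> dp b \<odot> u = dp s"
begin

text \<open>After pulling \<open>a\<close> back along \<open>h\<close>, a lift of \<open>h\<close>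
  is a section over the cylinder, and \<open>fill\<close> extends it from the left end.\<close>

lemma hlp:
  assumes "isty a" "obj z" "hom h (cyl z) (base a)" "hom k z a" "dp a \<odot> k = h \<odot> i0 z"
  shows "\<exists>K. hom K (cyl z) a \<and> dp a \<odot> K = h \<and> K \<odot> i0 z = k"
proof -
  note p = pbm[of a h "i0 z" k]
  obtain K where K: "hom K (cyl z) (pb a h)" "dp (pb a h) \<odot> K = idn (cyl z)" "K \<odot> i0 z = pbm a h (i0 z) k"
    using fill[of "pb a h" z "pbm a h (i0 z) k"] assms p by auto
  show ?thesis
    by (rule exI[of _ "pq a h \<odot> K"]) (use assms K p in \<open>auto simp: comp_reassoc[OF pb_sq]\<close>)
qed

text \<open>A square with outer ends \<open>t\<close> and \<open>t'\<close> is a section over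
  \<open>cyl a\<close> of the type \<open>p\<close> of paths from \<open>t\<close> to
  \<open>t'\<close>, and the side \<open>g\<close> prescribes this section at the left end. One
  transport in \<open>p\<close> fills the open square; its free side is the right end of the inner
  coordinate.\<close>

lemma fill2:
  assumes c: "isty c" "base c = cyl (cyl a)" "obj a"
    and t: "hom t (cyl a) c" "hom t' (cyl a) c" "dp c \<odot> t = i0 (cyl a)" "dp c \<odot> t' = i1 (cyl a)"
    and g: "hom g (cyl a) c" "dp c \<odot> g = cyf (i0 a)" "g \<odot> i0 a = t \<odot> i0 a" "g \<odot> i1 a = t' \<odot> i0 a"
  shows "\<exists>H. hom H (cyl (cyl a)) c \<and> dp c \<odot> H = idn (cyl (cyl a)) \<and> H \<odot> i0 (cyl a) = t \<and>
    H \<odot> i1 (cyl a) = t' \<and> H \<odot> cyf (i0 a) = g"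
proof -
  obtain p e where p: "isty p" "base p = cyl a" "hom e (cyl p) c" "dp c \<odot> e = cyf (dp p)"
      "e \<odot> i0 p = t \<odot> dp p" "e \<odot> i1 p = t' \<odot> dp p"
    and u: "\<And>s h. arr s \<Longrightarrow> cod s = cyl a \<Longrightarrow> hom h (cyl (dom s)) c \<Longrightarrow> dp c \<odot> h = cyf s \<Longrightarrow>
               h \<odot> i0 (dom s) = t \<odot> s \<Longrightarrow> h \<odot> i1 (dom s) = t' \<odot> s \<Longrightarrow>
               (\<exists>!k. hom k (dom s) p \<and> dp p \<odot> k = s \<and> e \<odot> cyf k = h)"
    using path[of c "cyl a" t t'] c t by auto
  obtain k where k: "hom k a p" "dp p \<odot> k = i0 a" "e \<odot> cyf k = g"
    using u[of "i0 a" g] g c by auto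
  obtain K where K: "hom K (cyl a) p" "dp p \<odot> K = idn (cyl a)" "K \<odot> i0 a = k"
    using fill[of p a k] k p c by auto
  show ?thesis
    by (rule exI[of _ "e \<odot> cyf K"])
      (use c t g p k K in \<open>auto simp: comp_reassoc[OF p(4)] comp_reassoc[OF p(5)] comp_reassoc[OF p(6)]\<close>)
qed

text \<open>The faces \<open>s\<close> and \<open>s'\<close> define a path type, in which
  \<open>t\<close>, \<open>t'\<close> and \<open>g\<close> become the sides of an open square, so
  that \<open>fill2\<close> applies. The free face is the right end of the innermost
  coordinate.\<close>

lemma fill3:
  assumes c: "isty c" "base c = cyl (cyl (cyl a))" "obj a"
    and s: "hom s (cyl (cyl a)) c" "hom s' (cyl (cyl a)) c"
      "dp c \<odot> s = i0 (cyl (cyl a))" "dp c \<odot> s' = i1 (cyl (cyl a))"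
    and t: "hom t (cyl (cyl a)) c" "hom t' (cyl (cyl a)) c"
      "dp c \<odot> t = cyf (i0 (cyl a))" "dp c \<odot> t' = cyf (i1 (cyl a))"
    and g: "hom g (cyl (cyl a)) c" "dp c \<odot> g = cyf (cyf (i0 a))"
    and st: "t \<odot> i0 (cyl a) = s \<odot> i0 (cyl a)" "t \<odot> i1 (cyl a) = s' \<odot> i0 (cyl a)"
      "t' \<odot> i0 (cyl a) = s \<odot> i1 (cyl a)" "t' \<odot> i1 (cyl a) = s' \<odot> i1 (cyl a)"
    and gs: "g \<odot> i0 (cyl a) = s \<odot> cyf (i0 a)" "g \<odot> i1 (cyl a) = s' \<odot> cyf (i0 a)"
    and gt: "g \<odot> cyf (i0 a) = t \<odot> cyf (i0 a)" "g \<odot> cyf (i1 a) = t' \<odot> cyf (i0 a)"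
  shows "\<exists>H. hom H (cyl (cyl (cyl a))) c \<and> dp c \<odot> H = idn (cyl (cyl (cyl a))) \<and>
    H \<odot> i0 (cyl (cyl a)) = s \<and> H \<odot> i1 (cyl (cyl a)) = s' \<and>
    H \<odot> cyf (i0 (cyl a)) = t \<and> H \<odot> cyf (i1 (cyl a)) = t' \<and> H \<odot> cyf (cyf (i0 a)) = g"
proof -
  obtain p e where p: "isty p" "base p = cyl (cyl a)" "hom e (cyl p) c" "dp c \<odot> e = cyf (dp p)"
      "e \<odot> i0 p = s \<odot> dp p" "e \<odot> i1 p = s' \<odot> dp p"
    and u: "\<And>f h. arr f \<Longrightarrow> cod f = cyl (cyl a) \<Longrightarrow> hom h (cyl (dom f)) c \<Longrightarrow> dp c \<odot> h = cyf f \<Longrightarrow>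
               h \<odot> i0 (dom f) = s \<odot> f \<Longrightarrow> h \<odot> i1 (dom f) = s' \<odot> f \<Longrightarrow>
               (\<exists>!k. hom k (dom f) p \<and> dp p \<odot> k = f \<and> e \<odot> cyf k = h)"
    using path[of c "cyl (cyl a)" s s'] c s by auto
  \<comment> \<open>Arrows into \<open>p\<close> are determined by their projections and the
    homotopies they represent. The compatibility of the faces of the cube thus becomes that of the
    sides of the square, in \<open>m0\<close> and \<open>m1\<close>.\<close>
  have un: "k = k'" if "hom k z p" "hom k' z p" "obj z" "dp p \<odot> k = dp p \<odot> k'" "e \<odot> cyf k = e \<odot> cyf k'" for k k' z
  proof -
    have "\<exists>!m. hom m (dom (dp p \<odot> k)) p \<and> dp p \<odot> m = dp p \<odot> k \<and> e \<odot> cyf m = e \<odot> cyf k"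
      by (rule u) (use that p s c in \<open>simp_all add: comp_reassoc[OF p(4)] comp_reassoc[OF p(5)] comp_reassoc[OF p(6)]\<close>)
    then show ?thesis
      using that p by auto
  qed
  obtain k where k: "hom k (cyl a) p" "dp p \<odot> k = i0 (cyl a)" "e \<odot> cyf k = t"
    using u[of "i0 (cyl a)" t] t c st by auto
  obtain k' where k': "hom k' (cyl a) p" "dp p \<odot> k' = i1 (cyl a)" "e \<odot> cyf k' = t'"
    using u[of "i1 (cyl a)" t'] t c st by auto
  obtain m where m: "hom m (cyl a) p" "dp p \<odot> m = cyf (i0 a)" "e \<odot> cyf m = g"
    using u[of "cyf (i0 a)" g] g c gs by auto
  have m0: "m \<odot> i0 a = k \<odot> i0 a"
    by (rule un[of _ a])
      (use c k m p gt in \<open>auto simp: cyf_comp comp_reassoc[OF m(2)] comp_reassoc[OF m(3)]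
        comp_reassoc[OF k(2)] comp_reassoc[OF k(3)] simp del: cyf_cyf\<close>)
  have m1: "m \<odot> i1 a = k' \<odot> i0 a"
    by (rule un[of _ a])
      (use c k' m p gt in \<open>auto simp: cyf_comp comp_reassoc[OF m(2)] comp_reassoc[OF m(3)]
        comp_reassoc[OF k'(2)] comp_reassoc[OF k'(3)] simp del: cyf_cyf\<close>)
  obtain K where K: "hom K (cyl (cyl a)) p" "dp p \<odot> K = idn (cyl (cyl a))"
      "K \<odot> i0 (cyl a) = k" "K \<odot> i1 (cyl a) = k'" "K \<odot> cyf (i0 a) = m"
    using fill2[of p a k k' m] p c k k' m m0 m1 by auto
  show ?thesis
    by (rule exI[of _ "e \<odot> cyf K"])
      (use c s p k k' m K in \<open>auto simp: comp_reassoc[OF p(4)] comp_reassoc[OF p(5)] comp_reassoc[OF p(6)]\<close>)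
qed

end

section \<open>Boxes over an arbitrary base\<close>

context disp_cat
begin

abbreviation cone :: "'o \<Rightarrow> 'm \<Rightarrow> 'm \<Rightarrow> 'm \<Rightarrow> bool" where
  "cone a s x k \<equiv> isty a \<and> arr s \<and> cod s = base a \<and> arr x \<and> arr k \<and> dom k = dom x \<and>
     cod x = dom s \<and> cod k = a \<and> dp a \<odot> k = s \<odot> x"

lemma pbm_cone:
  assumes "cone a s x k"
  shows "hom (pbm a s x k) (dom x) (pb a s)" "dp (pb a s) \<odot> pbm a s x k = x"
    "pq a s \<odot> pbm a s x k = k"
  using pbm[of a s x k] assms by simp_all

text \<open>Faces that agree along an edge still agree there after being turned into arrows into a
  pullback.\<close>

lemma pbm_comp_eq:
  assumes k: "cone a s x k" and m: "cone a s y m"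
    and f: "arr f" "cod f = dom x" "arr g" "cod g = dom y" "dom f = dom g"
    and e: "x \<odot> f = y \<odot> g" "k \<odot> f = m \<odot> g"
  shows "pbm a s x k \<odot> f = pbm a s y m \<odot> g"
proof (rule pb_ext)
  note p = pbm_cone[OF k] and q = pbm_cone[OF m]
  show "dp (pb a s) \<odot> pbm a s x k \<odot> f = dp (pb a s) \<odot> pbm a s y m \<odot> g"
    using p q f e k m by (simp add: comp_reassoc[OF p(2)] comp_reassoc[OF q(2)])
  show "pq a s \<odot> pbm a s x k \<odot> f = pq a s \<odot> pbm a s y m \<odot> g"
    using p q f e k m by (simp add: comp_reassoc[OF p(3)] comp_reassoc[OF q(3)])
qed (use pbm_cone[OF k] pbm_cone[OF m] k m f in simp_all)

abbreviation const :: "'m \<Rightarrow> 'm" where "const f \<equiv> f \<odot> pr (dom f)"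

definition swap :: "'o \<Rightarrow> 'm" where
  "swap z = px (px (pr z \<odot> pr (cyl z)) (pI (cyl z))) (pI z \<odot> pr (cyl z))"

lemma swap [simp]:
  assumes "obj z"
  shows "arr (swap z)" "dom (swap z) = cyl (cyl z)" "cod (swap z) = cyl (cyl z)"
    "swap z \<odot> i0 (cyl z) = cyf (i0 z)" "swap z \<odot> i1 (cyl z) = cyf (i1 z)"
    "swap z \<odot> cyf (i0 z) = i0 (cyl z)" "swap z \<odot> cyf (i1 z) = i1 (cyl z)"
  using assms by (simp_all add: swap_def i0_def i1_def cyf_def)

end

context path_cat
begin

text \<open>The base is constant in the outer coordinate: \<open>t\<close> and \<open>t'\<close> are
  two lifts of \<open>h\<close>, and \<open>g\<close> is a vertical homotopy between their starting
  points. The free side of the square is then a vertical homotopy between their end points. Pulling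
  \<open>a\<close> back along the constant extension of \<open>h\<close> reduces this to
  \<open>fill2\<close>.\<close>

lemma box:
  assumes a: "isty a" "obj z" "hom h (cyl z) (base a)"
    and t: "hom t (cyl z) a" "hom t' (cyl z) a" "dp a \<odot> t = h" "dp a \<odot> t' = h"
    and g: "hom g (cyl z) a" "dp a \<odot> g = const (h \<odot> i0 z)" "g \<odot> i0 z = t \<odot> i0 z" "g \<odot> i1 z = t' \<odot> i0 z"
  shows "\<exists>H. hom H (cyl (cyl z)) a \<and> dp a \<odot> H = const h \<and> H \<odot> i0 (cyl z) = t \<and>
    H \<odot> i1 (cyl z) = t' \<and> H \<odot> cyf (i0 z) = g"
proof -
  define s where "s = const h"
  have s: "arr s" "dom s = cyl (cyl z)" "cod s = base a" "s \<odot> i0 (cyl z) = h" "s \<odot> i1 (cyl z) = h"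
    "s \<odot> cyf (i0 z) = dp a \<odot> g"
    using a g by (simp_all add: s_def)
  have c: "cone a s (i0 (cyl z)) t" "cone a s (i1 (cyl z)) t'" "cone a s (cyf (i0 z)) g"
    using a t g s by auto
  note p = pbm_cone[OF c(1)] pbm_cone[OF c(2)] pbm_cone[OF c(3)]
  have "\<exists>H. hom H (cyl (cyl z)) (pb a s) \<and> dp (pb a s) \<odot> H = idn (cyl (cyl z)) \<and>
    H \<odot> i0 (cyl z) = pbm a s (i0 (cyl z)) t \<and>
    H \<odot> i1 (cyl z) = pbm a s (i1 (cyl z)) t' \<and> H \<odot> cyf (i0 z) = pbm a s (cyf (i0 z)) g"
    apply (rule fill2)
    using a s t p
    apply simp_all
    subgoal by (rule pbm_comp_eq[OF c(3) c(1)]; use g in simp)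
    subgoal by (rule pbm_comp_eq[OF c(3) c(2)]; use g in simp)
    done
  then obtain H where H: "hom H (cyl (cyl z)) (pb a s)" "dp (pb a s) \<odot> H = idn (cyl (cyl z))"
    "H \<odot> i0 (cyl z) = pbm a s (i0 (cyl z)) t"
    "H \<odot> i1 (cyl z) = pbm a s (i1 (cyl z)) t'" "H \<odot> cyf (i0 z) = pbm a s (cyf (i0 z)) g"
    by blast
  have "dp a \<odot> pq a s = s \<odot> dp (pb a s)"
    using a s by (simp add: pb_sq)
  note r = comp_reassoc[OF this]
  show ?thesis
    by (rule exI[of _ "pq a s \<odot> H"]) (use a H p s s_def[symmetric] in \<open>simp add: r\<close>)
qed

text \<open>For a closed type the condition on display maps is void, so five compatible faces are
  enough. The pullback of \<open>a\<close> to the triple cylinder is a type to which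
  \<open>fill3\<close> applies.\<close>

lemma cube:
  assumes a: "isty a" "base a = one" "obj z"
    and s: "hom s (cyl (cyl z)) a" "hom s' (cyl (cyl z)) a"
    and t: "hom t (cyl (cyl z)) a" "hom t' (cyl (cyl z)) a"
    and g: "hom g (cyl (cyl z)) a"
    and st: "t \<odot> i0 (cyl z) = s \<odot> i0 (cyl z)" "t \<odot> i1 (cyl z) = s' \<odot> i0 (cyl z)"
      "t' \<odot> i0 (cyl z) = s \<odot> i1 (cyl z)" "t' \<odot> i1 (cyl z) = s' \<odot> i1 (cyl z)"
    and gs: "g \<odot> i0 (cyl z) = s \<odot> cyf (i0 z)" "g \<odot> i1 (cyl z) = s' \<odot> cyf (i0 z)"
    and gt: "g \<odot> cyf (i0 z) = t \<odot> cyf (i0 z)" "g \<odot> cyf (i1 z) = t' \<odot> cyf (i0 z)"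
  shows "\<exists>H. hom H (cyl (cyl (cyl z))) a \<and>
    H \<odot> i0 (cyl (cyl z)) = s \<and> H \<odot> i1 (cyl (cyl z)) = s' \<and>
    H \<odot> cyf (i0 (cyl z)) = t \<and> H \<odot> cyf (i1 (cyl z)) = t' \<and> H \<odot> cyf (cyf (i0 z)) = g"
proof -
  let ?b = "bang (cyl (cyl (cyl z)))"
  have c: "cone a ?b (i0 (cyl (cyl z))) s" "cone a ?b (i1 (cyl (cyl z))) s'"
    "cone a ?b (cyf (i0 (cyl z))) t" "cone a ?b (cyf (i1 (cyl z))) t'" "cone a ?b (cyf (cyf (i0 z))) g"
    using a s t g by simp_all
  define S where "S = pbm a ?b (i0 (cyl (cyl z))) s"
  define S' where "S' = pbm a ?b (i1 (cyl (cyl z))) s'"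
  define T where "T = pbm a ?b (cyf (i0 (cyl z))) t"
  define T' where "T' = pbm a ?b (cyf (i1 (cyl z))) t'"
  define G where "G = pbm a ?b (cyf (cyf (i0 z))) g"
  note p = pbm_cone[OF c(1), folded S_def] pbm_cone[OF c(2), folded S'_def]
    pbm_cone[OF c(3), folded T_def] pbm_cone[OF c(4), folded T'_def] pbm_cone[OF c(5), folded G_def]
  note eq = pbm_comp_eq[OF c(3) c(1), folded S_def T_def] pbm_comp_eq[OF c(3) c(2), folded S'_def T_def]
    pbm_comp_eq[OF c(4) c(1), folded S_def T'_def] pbm_comp_eq[OF c(4) c(2), folded S'_def T'_def]
    pbm_comp_eq[OF c(5) c(1), folded S_def G_def] pbm_comp_eq[OF c(5) c(2), folded S'_def G_def]
    pbm_comp_eq[OF c(5) c(3), folded T_def G_def] pbm_comp_eq[OF c(5) c(4), folded T'_def G_def]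
  have q: "isty (pb a ?b)" "base (pb a ?b) = cyl (cyl (cyl z))"
    using a by simp_all
  have "\<exists>H. hom H (cyl (cyl (cyl z))) (pb a ?b) \<and> dp (pb a ?b) \<odot> H = idn (cyl (cyl (cyl z))) \<and>
    H \<odot> i0 (cyl (cyl z)) = S \<and> H \<odot> i1 (cyl (cyl z)) = S' \<and>
    H \<odot> cyf (i0 (cyl z)) = T \<and> H \<odot> cyf (i1 (cyl z)) = T' \<and> H \<odot> cyf (cyf (i0 z)) = G"
  proof (rule fill3[OF q a(3)])
    show "T \<odot> i0 (cyl z) = S \<odot> i0 (cyl z)" by (rule eq(1)) (use a(3) st in simp_all)
    show "T \<odot> i1 (cyl z) = S' \<odot> i0 (cyl z)" by (rule eq(2)) (use a(3) st in simp_all)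
    show "T' \<odot> i0 (cyl z) = S \<odot> i1 (cyl z)" by (rule eq(3)) (use a(3) st in simp_all)
    show "T' \<odot> i1 (cyl z) = S' \<odot> i1 (cyl z)" by (rule eq(4)) (use a(3) st in simp_all)
    show "G \<odot> i0 (cyl z) = S \<odot> cyf (i0 z)" by (rule eq(5)) (use a(3) gs in simp_all)
    show "G \<odot> i1 (cyl z) = S' \<odot> cyf (i0 z)" by (rule eq(6)) (use a(3) gs in simp_all)
    show "G \<odot> cyf (i0 z) = T \<odot> cyf (i0 z)" by (rule eq(7)) (use a(3) gt in simp_all)
    show "G \<odot> cyf (i1 z) = T' \<odot> cyf (i0 z)" by (rule eq(8)) (use a(3) gt in simp_all)
  qed (use p a(3) in simp_all)
  then obtain H where H: "hom H (cyl (cyl (cyl z))) (pb a ?b)"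
    "H \<odot> i0 (cyl (cyl z)) = S" "H \<odot> i1 (cyl (cyl z)) = S'"
    "H \<odot> cyf (i0 (cyl z)) = T" "H \<odot> cyf (i1 (cyl z)) = T'" "H \<odot> cyf (cyf (i0 z)) = G"
    by blast
  show ?thesis
    by (rule exI[of _ "pq a ?b \<odot> H"]) (use a H p in simp)
qed

text \<open>The connection \<open>min\<close> on \<open>I\<close>. A first box filling gives a square with the right values on three
  sides; it is used twice, as two faces of an open cube, to correct the fourth one.\<close>

lemma squeeze_I:
  assumes z: "obj z"
  shows "\<exists>q. hom q (cyl (cyl z)) I \<and> q \<odot> i0 (cyl z) = lp \<odot> bang (cyl z) \<and> q \<odot> i1 (cyl z) = pI z \<and>
    q \<odot> cyf (i0 z) = lp \<odot> bang (cyl z) \<and> q \<odot> cyf (i1 z) = pI z"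
proof -
  have "\<exists>H. hom H (cyl (cyl z)) I \<and> dp I \<odot> H = const (bang (cyl z)) \<and> H \<odot> i0 (cyl z) = lp \<odot> bang (cyl z) \<and>
    H \<odot> i1 (cyl z) = pI z \<and> H \<odot> cyf (i0 z) = lp \<odot> bang (cyl z)"
    by (rule box) (use z in simp_all)
  then obtain c where c: "hom c (cyl (cyl z)) I" "c \<odot> i0 (cyl z) = lp \<odot> bang (cyl z)"
    "c \<odot> i1 (cyl z) = pI z" "c \<odot> cyf (i0 z) = lp \<odot> bang (cyl z)"
    by blast
  \<comment> \<open>Nothing is known about \<open>c\<close> at the right end of its inner coordinate
    except the corners. After the swap this uncontrolled side is the edge common to the two faces
    that are copies of \<open>c\<close>, while the known side \<open>pI z\<close> bounds the free
    face of the cube.\<close>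
  let ?l = "lp \<odot> bang (cyl (cyl z))" and ?c = "c \<odot> swap z"
  have "\<exists>H. hom H (cyl (cyl (cyl z))) I \<and>
    H \<odot> i0 (cyl (cyl z)) = ?l \<and> H \<odot> i1 (cyl (cyl z)) = ?c \<and>
    H \<odot> cyf (i0 (cyl z)) = ?l \<and> H \<odot> cyf (i1 (cyl z)) = ?c \<and> H \<odot> cyf (cyf (i0 z)) = ?l"
    by (rule cube) (use z c in simp_all)
  then obtain H where H: "hom H (cyl (cyl (cyl z))) I"
    "H \<odot> i0 (cyl (cyl z)) = ?l" "H \<odot> i1 (cyl (cyl z)) = ?c"
    "H \<odot> cyf (i0 (cyl z)) = ?l" "H \<odot> cyf (i1 (cyl z)) = ?c"
    by blast
  let ?q = "H \<odot> cyf (cyf (i1 z))"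
  have "?q \<odot> i0 (cyl z) = ?l \<odot> cyf (i1 z)" "?q \<odot> i1 (cyl z) = ?c \<odot> cyf (i1 z)"
    unfolding H(2-3)[symmetric] using H(1) z by simp_all
  moreover have "?q \<odot> cyf (i0 z) = ?l \<odot> cyf (i1 z)" "?q \<odot> cyf (i1 z) = ?c \<odot> cyf (i1 z)"
    unfolding H(4-5)[symmetric] using H(1) z by simp_all
  ultimately show ?thesis
    using H(1) z c by (intro exI[of _ ?q]) simp
qed

text \<open>With the identity in the \<open>z\<close>-coordinate, the connection contracts the
  cylinder onto its left end. Its values on the inner ends make a path of paths out of it: the
  constant path at the start is joined to the path itself.\<close>

lemma squeeze:
  assumes z: "obj z"
  shows "\<exists>q. hom q (cyl (cyl z)) (cyl z) \<and> q \<odot> i0 (cyl z) = const (i0 z) \<and> q \<odot> i1 (cyl z) = idn (cyl z) \<and>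
    q \<odot> cyf (i0 z) = const (i0 z) \<and> q \<odot> cyf (i1 z) = idn (cyl z)"
proof -
  obtain q where "hom q (cyl (cyl z)) I" "q \<odot> i0 (cyl z) = lp \<odot> bang (cyl z)" "q \<odot> i1 (cyl z) = pI z"
    "q \<odot> cyf (i0 z) = lp \<odot> bang (cyl z)" "q \<odot> cyf (i1 z) = pI z"
    using squeeze_I[OF z] by blast
  moreover have "i0 z \<odot> pr z = px (pr z) (lp \<odot> bang (cyl z))"
    using z by (simp add: i0_def)
  ultimately show ?thesis
    using z by (intro exI[of _ "px (pr z \<odot> pr (cyl z)) q"]) simp
qed


section \<open>Homotopies\<close>

text \<open>\<open>fh\<close> is fibrewise homotopy, over a fixed map to \<open>base a\<close>;
  \<open>hm\<close> is homotopy of plain arrows. The former is what terms of path types express, the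
  latter is preserved by composition with arrows that do not respect display maps.\<close>

definition fh :: "'a \<Rightarrow> 'b \<Rightarrow> 'b \<Rightarrow> bool" where
  "fh a f g \<longleftrightarrow> hom f (dom f) a \<and> hom g (dom f) a \<and> dp a \<odot> g = dp a \<odot> f \<and>
     (\<exists>H. hom H (cyl (dom f)) a \<and> dp a \<odot> H = const (dp a \<odot> f) \<and> H \<odot> i0 (dom f) = f \<and> H \<odot> i1 (dom f) = g)"

definition hm :: "'b \<Rightarrow> 'b \<Rightarrow> bool" where
  "hm f g \<longleftrightarrow> arr f \<and> arr g \<and> dom g = dom f \<and> cod g = cod f \<and>
     (\<exists>H. hom H (cyl (dom f)) (cod f) \<and> H \<odot> i0 (dom f) = f \<and> H \<odot> i1 (dom f) = g)"

lemma fh_arr: "fh a f g \<Longrightarrow> hom f (dom f) a \<and> hom g (dom f) a \<and> dp a \<odot> g = dp a \<odot> f"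
  by (simp add: fh_def)

lemma hm_arr: "hm f g \<Longrightarrow> hom f (dom f) (cod f) \<and> hom g (dom f) (cod f)"
  by (simp add: hm_def)

lemma fh_refl: "isty a \<Longrightarrow> hom f z a \<Longrightarrow> fh a f f"
  using dom_obj[of f] unfolding fh_def by (intro conjI exI[of _ "const f"]; simp)

lemma hm_refl: "arr f \<Longrightarrow> hm f f"
  unfolding hm_def by (intro conjI exI[of _ "const f"]; simp)

text \<open>The given homotopy between the starting points is the third side of an open box whose
  other two sides are the lifts; the side obtained by filling is the homotopy between the end
  points. Symmetry, transitivity and the comparison of sections are all instances.\<close>

lemma fh_lift:
  assumes a: "isty a" "obj z" and t: "hom t (cyl z) a" "hom t' (cyl z) a" "dp a \<odot> t' = dp a \<odot> t"
    and h: "fh a (t \<odot> i0 z) (t' \<odot> i0 z)"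
  shows "fh a (t \<odot> i1 z) (t' \<odot> i1 z)"
proof -
  obtain g where g: "hom g (cyl z) a" "dp a \<odot> g = const (dp a \<odot> (t \<odot> i0 z))" "g \<odot> i0 z = t \<odot> i0 z"
    "g \<odot> i1 z = t' \<odot> i0 z"
    using h t a unfolding fh_def by auto
  obtain H where H: "hom H (cyl (cyl z)) a" "dp a \<odot> H = const (dp a \<odot> t)"
    "H \<odot> i0 (cyl z) = t" "H \<odot> i1 (cyl z) = t'"
    using box[of a z "dp a \<odot> t" t t' g] a t g by auto
  have d: "dp a \<odot> t' \<odot> i1 z = dp a \<odot> t \<odot> i1 z"
    using comp_reassoc[OF t(3)] a t by simp
  have e: "dp a \<odot> H \<odot> cyf (i1 z) = (dp a \<odot> t \<odot> i1 z) \<odot> pr z"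
    using comp_reassoc[OF H(2)] H(1) t a by simp
  have i: "H \<odot> cyf (i1 z) \<odot> i0 z = t \<odot> i1 z" "H \<odot> cyf (i1 z) \<odot> i1 z = t' \<odot> i1 z"
    using comp_reassoc[OF H(3)] comp_reassoc[OF H(4)] H(1) t a by simp_all
  show ?thesis
    unfolding fh_def by (intro conjI exI[of _ "H \<odot> cyf (i1 z)"]) (use a t H(1) d e i in simp_all)
qed

text \<open>The homotopy from \<open>f\<close> to \<open>g\<close> and the constant homotopy at
  \<open>f\<close> are lifts with a common start, so their ends \<open>g\<close> and
  \<open>f\<close> are homotopic in this order. Transitivity has the same shape, with two homotopies
  that start at the middle map.\<close>

lemma fh_sym:
  assumes a: "isty a" and h: "fh a f g"
  shows "fh a g f"
proof -
  obtain H where H: "hom f (dom f) a" "hom H (cyl (dom f)) a" "dp a \<odot> H = const (dp a \<odot> f)"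
    "H \<odot> i0 (dom f) = f" "H \<odot> i1 (dom f) = g"
    using h unfolding fh_def by blast
  have "fh a (H \<odot> i1 (dom f)) (const f \<odot> i1 (dom f))"
    by (rule fh_lift) (use a H fh_refl[OF a H(1)] in simp_all)
  then show ?thesis using H by simp
qed

lemma fh_trans:
  assumes a: "isty a" and h: "fh a f g" and k: "fh a g k"
  shows "fh a f k"
proof -
  note h' = fh_sym[OF a h]
  obtain H where H: "hom g (dom g) a" "hom H (cyl (dom g)) a" "dp a \<odot> H = const (dp a \<odot> g)"
    "H \<odot> i0 (dom g) = g" "H \<odot> i1 (dom g) = f"
    using h' unfolding fh_def by blast
  obtain K where K: "hom K (cyl (dom g)) a" "dp a \<odot> K = const (dp a \<odot> g)"
    "K \<odot> i0 (dom g) = g" "K \<odot> i1 (dom g) = k"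
    using k unfolding fh_def by blast
  have "fh a (H \<odot> i1 (dom g)) (K \<odot> i1 (dom g))"
    by (rule fh_lift) (use a H K fh_refl[OF a H(1)] in simp_all)
  then show ?thesis using H K by simp
qed

lemma fh_pre:
  assumes h: "fh a f g" and k: "arr k" "cod k = dom f" and a: "isty a"
  shows "fh a (f \<odot> k) (g \<odot> k)"
proof -
  obtain H where H: "hom H (cyl (dom f)) a" "dp a \<odot> H = const (dp a \<odot> f)"
    "H \<odot> i0 (dom f) = f" "H \<odot> i1 (dom f) = g"
    using h unfolding fh_def by blast
  note f = fh_arr[OF h]
  have "dp a \<odot> g \<odot> k = dp a \<odot> f \<odot> k"
    using comp_reassoc[of "dp a" g] f k a by simp
  moreover have "dp a \<odot> H \<odot> cyf k = dp a \<odot> f \<odot> k \<odot> pr (dom k)"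
    using comp_reassoc[OF H(2)] H(1) f k a by simp
  moreover have "H \<odot> i0 (dom f) \<odot> k = f \<odot> k" "H \<odot> i1 (dom f) \<odot> k = g \<odot> k"
    using comp_reassoc[OF H(3)] comp_reassoc[OF H(4)] H(1) f k a by simp_all
  ultimately show ?thesis
    unfolding fh_def by (intro conjI exI[of _ "H \<odot> cyf k"]) (use f k a H(1) in simp_all)
qed

lemma fh_post:
  assumes h: "fh a f g" and k: "hom k a b" "dp b \<odot> k = dp a" and a: "isty a" "isty b" "base b = base a"
  shows "fh b (k \<odot> f) (k \<odot> g)"
proof -
  obtain H where H: "hom H (cyl (dom f)) a" "dp a \<odot> H = const (dp a \<odot> f)"
    "H \<odot> i0 (dom f) = f" "H \<odot> i1 (dom f) = g"
    using h unfolding fh_def by blast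
  note f = fh_arr[OF h]
  show ?thesis
    unfolding fh_def
    by (intro conjI exI[of _ "k \<odot> H"]) (use f k a H in \<open>simp_all add: comp_reassoc[OF k(2)]\<close>)
qed

lemma hm_pre:
  assumes h: "hm f g" and k: "arr k" "cod k = dom f"
  shows "hm (f \<odot> k) (g \<odot> k)"
proof -
  obtain H where H: "hom H (cyl (dom f)) (cod f)"
    "H \<odot> i0 (dom f) = f" "H \<odot> i1 (dom f) = g"
    using h unfolding hm_def by blast
  note f = hm_arr[OF h]
  have "H \<odot> i0 (dom f) \<odot> k = f \<odot> k" "H \<odot> i1 (dom f) \<odot> k = g \<odot> k"
    using comp_reassoc[OF H(2)] comp_reassoc[OF H(3)] H(1) f k by simp_all
  then show ?thesis
    unfolding hm_def by (intro conjI exI[of _ "H \<odot> cyf k"]) (use f k H(1) in simp_all)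
qed

lemma hm_post:
  assumes h: "hm f g" and k: "arr k" "dom k = cod f"
  shows "hm (k \<odot> f) (k \<odot> g)"
proof -
  obtain H where H: "hom H (cyl (dom f)) (cod f)"
    "H \<odot> i0 (dom f) = f" "H \<odot> i1 (dom f) = g"
    using h unfolding hm_def by blast
  note f = hm_arr[OF h]
  show ?thesis
    unfolding hm_def by (intro conjI exI[of _ "k \<odot> H"]) (use f k H in simp_all)
qed

lemma fh_hm: "isty a \<Longrightarrow> fh a f g \<Longrightarrow> hm f g"
  unfolding fh_def hm_def by auto

text \<open>Over the terminal context there is no base point that could move.\<close>

lemma hm_fh:
  assumes "isty a" "base a = one" "hm f g" "cod f = a"
  shows "fh a f g"
proof -
  obtain H where H: "hom H (cyl (dom f)) a" "H \<odot> i0 (dom f) = f" "H \<odot> i1 (dom f) = g"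
    using assms unfolding hm_def by blast
  then show ?thesis
    unfolding fh_def
    by (intro conjI exI[of _ H]) (use assms hm_arr[OF assms(3)] in \<open>simp_all\<close>)
qed

text \<open>By induction on the length, \<open>base a\<close> is isomorphic to a closed type
  \<open>s\<close>. The isomorphism carries \<open>a\<close> to the type \<open>pb a v\<close> over
  \<open>s\<close>, and \<open>sigma\<close> collapses a type over a closed type into a closed
  type.\<close>

lemma closed_iso:
  assumes "isty a"
  shows "\<exists>s u v. isty s \<and> base s = one \<and> hom u a s \<and> hom v s a \<and> v \<odot> u = idn a \<and> u \<odot> v = idn s"
  using assms
proof (induction "len a" arbitrary: a rule: less_induct)
  case less
  note a = less.prems
  show ?case
  proof (cases "len (base a) = 0")
    case True
    then have "base a = one" using a one_len by simp
    then show ?thesis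
      using a by (intro exI[of _ a] exI[of _ "idn a"]) simp
  next
    case False
    then obtain s u v where s: "isty s" "base s = one" "hom u (base a) s" "hom v s (base a)"
      "v \<odot> u = idn (base a)" "u \<odot> v = idn s"
      using less.hyps[of "base a"] a base_len by auto
    let ?b = "pb a v"
    have b: "isty ?b" "base ?b = s" using a s by simp_all
    obtain t x y where t: "isty t" "base t = one" "hom x t ?b" "hom y ?b t" "x \<odot> y = idn ?b" "y \<odot> x = idn t"
      using sigma[of ?b] b s by auto
    have c: "cone a v (u \<odot> dp a) (idn a)"
      using a s by (simp add: comp_reassoc[OF s(5)])
    note p = pbm_cone[OF c]
    let ?m = "pbm a v (u \<odot> dp a) (idn a)"
    have sq: "dp a \<odot> pq a v = v \<odot> dp ?b" using pb_sq[of a v] a s by simp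
    have i: "?m \<odot> pq a v = idn ?b"
      by (rule pb_ext[of a v _ ?b])
        (use a s p in \<open>simp_all add: comp_reassoc[OF p(2)] comp_reassoc[OF p(3)] sq comp_reassoc[OF s(6)]\<close>)
    have "(pq a v \<odot> x) \<odot> y \<odot> ?m = idn a" "(y \<odot> ?m) \<odot> pq a v \<odot> x = idn t"
      using a s b t p i by (simp_all add: comp_reassoc[OF t(5)] comp_reassoc[OF i])
    then show ?thesis
      using a s b t p by (intro exI[of _ t] exI[of _ "y \<odot> ?m"] exI[of _ "pq a v \<odot> x"]) simp
  qed
qed

text \<open>Box filling takes place in a type and gives symmetry for \<open>fh\<close>. Carrying the
  homotopy to a closed type isomorphic to the codomain makes it fibrewise over the terminal context.
  A codomain of length zero is terminal, and then the two arrows are equal.\<close>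

lemma hm_sym: 
  assumes h: "hm f g"
  shows "hm g f"
proof (cases "len (cod f) = 0")
  case True
  then have "g = f"
    using hm_arr[OF h] one_len[of "cod f"] to_one[of g "dom f" f] by simp
  then show ?thesis using h by simp
next
  case False
  note f = hm_arr[OF h]
  obtain s u v where s: "isty s" "base s = one" "hom u (cod f) s" "hom v s (cod f)" "v \<odot> u = idn (cod f)"
    using closed_iso[of "cod f"] False f by auto
  have "hm (u \<odot> f) (u \<odot> g)" using hm_post[OF h] s by simp
  then have "fh s (u \<odot> f) (u \<odot> g)" by (rule hm_fh[OF s(1,2)]) (use s f in simp)
  then have "hm (u \<odot> g) (u \<odot> f)" using fh_hm[OF s(1)] fh_sym[OF s(1)] by blast
  then have "hm (v \<odot> u \<odot> g) (v \<odot> u \<odot> f)" using hm_post[of "u \<odot> g" "u \<odot> f" v] s f by simp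
  then show ?thesis using s f by (simp add: comp_reassoc[OF s(5)])
qed

lemma hm_trans: 
  assumes h: "hm f g" and k: "hm g k"
  shows "hm f k"
proof (cases "len (cod f) = 0")
  case True
  then have "g = f"
    using hm_arr[OF h] one_len[of "cod f"] to_one[of g "dom f" f] by simp
  then show ?thesis using k by simp
next
  case False
  note f = hm_arr[OF h] and g = hm_arr[OF k]
  obtain s u v where s: "isty s" "base s = one" "hom u (cod f) s" "hom v s (cod f)" "v \<odot> u = idn (cod f)"
    using closed_iso[of "cod f"] False f by auto
  have cg: "cod g = cod f" using f by simp
  have "hm (u \<odot> f) (u \<odot> g)" "hm (u \<odot> g) (u \<odot> k)"
    using hm_post[OF h, of u] hm_post[OF k, of u] s cg by simp_all
  then have "fh s (u \<odot> f) (u \<odot> g)" "fh s (u \<odot> g) (u \<odot> k)"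
    using hm_fh[OF s(1,2), of "u \<odot> f" "u \<odot> g"] hm_fh[OF s(1,2), of "u \<odot> g" "u \<odot> k"] s f g cg
    by simp_all
  then have "hm (u \<odot> f) (u \<odot> k)" using fh_hm[OF s(1)] fh_trans[OF s(1)] by blast
  then have "hm (v \<odot> u \<odot> f) (v \<odot> u \<odot> k)" using hm_post[of "u \<odot> f" "u \<odot> k" v] s f by simp
  then show ?thesis using s f g cg by (simp add: comp_reassoc[OF s(5)])
qed

text \<open>The homotopy in the base is lifted with start \<open>s\<close>. The end of the lift lies
  strictly over \<open>g\<close>, and the lift itself connects it with \<open>s\<close>.\<close>

lemma strictify:
  assumes a: "isty a" and s: "hom s z a" and h: "hm (dp a \<odot> s) g"
  shows "\<exists>t. hom t z a \<and> dp a \<odot> t = g \<and> hm s t"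
proof -
  obtain h where h: "hom h (cyl z) (base a)" "h \<odot> i0 z = dp a \<odot> s" "h \<odot> i1 z = g"
    using h a s unfolding hm_def by auto
  have z: "obj z" using s by auto
  obtain K where K: "hom K (cyl z) a" "dp a \<odot> K = h" "K \<odot> i0 z = s"
    using hlp[of a z h s] a s h z by auto
  have "dp a \<odot> K \<odot> i1 z = g" "\<exists>H. hom H (cyl z) a \<and> H \<odot> i0 z = s \<and> H \<odot> i1 z = K \<odot> i1 z"
    using comp_reassoc[OF K(2), of "i1 z"] K h z a by auto
  note d = this
  show ?thesis
    by (rule exI[of _ "K \<odot> i1 z"])
      (use K h z s a d in \<open>simp add: hm_def\<close>)
qed

text \<open>The homotopy \<open>R\<close> moves the base point along the loops
  \<open>dp a \<odot> R\<close>. The section \<open>s\<close> gives a second lift of these loops,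
  which starts at \<open>s\<close> like \<open>R\<close> but also ends at \<open>s\<close>.
  Comparing the ends of the two lifts gives a homotopy that does not move the base point.\<close>

lemma sections_fh:
  assumes a: "isty a" and s: "hom s (base a) a" "dp a \<odot> s = idn (base a)"
    and s': "hom s' (base a) a" "dp a \<odot> s' = idn (base a)" and h: "hm s s'"
  shows "fh a s s'"
proof -
  obtain R where R: "hom R (cyl (base a)) a" "R \<odot> i0 (base a) = s" "R \<odot> i1 (base a) = s'"
    using h s unfolding hm_def by auto
  have "fh a ((s \<odot> dp a \<odot> R) \<odot> i1 (base a)) (R \<odot> i1 (base a))"
    by (rule fh_lift) (use a s R fh_refl[OF a s(1)] in \<open>simp_all add: comp_reassoc[OF s(2)]\<close>)
  then show ?thesis using R a s s' by simp
qed

text \<open>A fibrewise self-map \<open>u\<close> that is homotopic to the identity in the total space need not be so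
  fibrewise: the homotopy moves the base point along a loop. Transport along that loop is a right
  inverse of \<open>u\<close>.\<close>

lemma self_map_right_inverse:
  assumes a: "isty a" and u: "hom u a a" "dp a \<odot> u = dp a" and h: "hm u (idn a)"
  shows "\<exists>r. hom r a a \<and> dp a \<odot> r = dp a \<and> hm r (idn a) \<and> fh a (u \<odot> r) (idn a)"
proof -
  obtain R where R: "hom R (cyl a) a" "R \<odot> i0 a = u" "R \<odot> i1 a = idn a"
    using h u a unfolding hm_def by auto
  obtain e where e: "hom e (cyl a) a" "dp a \<odot> e = dp a \<odot> R" "e \<odot> i0 a = idn a"
    using hlp[of a a "dp a \<odot> R" "idn a"] a u R by auto
  \<comment> \<open>Both \<open>u \<odot> e\<close> and \<open>R\<close> lift
    \<open>dp a \<odot> R\<close>, and both start at \<open>u\<close>. The end of \<open>e\<close>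
    is the transport along the loop, hence the right inverse.\<close>
  have "fh a ((u \<odot> e) \<odot> i1 a) (R \<odot> i1 a)"
    by (rule fh_lift) (use a u R e fh_refl[OF a u(1)] in \<open>simp_all add: comp_reassoc[OF u(2)]\<close>)
  moreover have "hm (e \<odot> i0 a) (e \<odot> i1 a)"
    unfolding hm_def using e a by (intro conjI exI[of _ e]) simp_all
  then have "hm (e \<odot> i1 a) (idn a)" using hm_sym e by simp
  moreover have "dp a \<odot> e \<odot> i1 a = dp a"
    using comp_reassoc[OF e(2)] a e R by simp
  ultimately show ?thesis
    by (intro exI[of _ "e \<odot> i1 a"]) (use a u e R in simp)
qed

text \<open>The arrows \<open>w\<close> and \<open>w'\<close> are made strict over the base as
  \<open>f\<close> and \<open>g\<close>. The composites of \<open>f\<close> and \<open>g\<close> are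
  then homotopic to identities only in the total spaces, and a right inverse of each composite
  corrects this. The left and the right inverse of \<open>f\<close> come out as separate maps, which
  is the form that condition (ty,n) asks for.\<close>

lemma fibrewise_equiv:
  assumes a: "isty a" and b: "isty b" and ab: "base b = base a"
    and w: "hom w a b" and w': "hom w' b a" and h: "hm (w \<odot> w') (idn b)" "hm (w' \<odot> w) (idn a)"
    and d: "hm (dp b \<odot> w) (dp a)"
  shows "\<exists>f g g'. hom f a b \<and> dp b \<odot> f = dp a \<and> hom g b a \<and> dp a \<odot> g = dp b \<and> hom g' b a \<and>
    dp a \<odot> g' = dp b \<and> fh a (g \<odot> f) (idn a) \<and> fh b (f \<odot> g') (idn b)"
proof -
  obtain f where f: "hom f a b" "dp b \<odot> f = dp a" "hm w f"
    using strictify[OF b w d] by blast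
  have "hm (dp b \<odot> w \<odot> w') (dp a \<odot> w')"
    using hm_pre[OF d, of w'] a b ab w w' by simp
  moreover have "hm (dp b \<odot> w \<odot> w') (dp b)"
    using hm_post[OF h(1), of "dp b"] a b ab w w' by simp
  ultimately have "hm (dp a \<odot> w') (dp b)"
    using hm_sym hm_trans by blast
  then obtain g where g: "hom g b a" "dp a \<odot> g = dp b" "hm w' g"
    using strictify[OF a w'] by blast
  have "hm (w' \<odot> w) (g \<odot> f)"
    by (rule hm_trans[OF hm_post[OF f(3)] hm_pre[OF g(3)]]) (use w w' f in simp_all)
  then have gf: "hm (g \<odot> f) (idn a)" using h hm_sym hm_trans by blast
  have "hm (w \<odot> w') (f \<odot> g)"
    by (rule hm_trans[OF hm_post[OF g(3)] hm_pre[OF f(3)]]) (use w w' g in simp_all)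
  then have fg: "hm (f \<odot> g) (idn b)" using h hm_sym hm_trans by blast
  note [simp] = comp_reassoc[OF f(2)] comp_reassoc[OF g(2)]
  obtain r where r: "hom r a a" "dp a \<odot> r = dp a" "hm r (idn a)" "fh a (g \<odot> f \<odot> r) (idn a)"
    using self_map_right_inverse[OF a _ _ gf] a b ab f g by auto
  \<comment> \<open>A right inverse \<open>r\<close> of \<open>g \<odot> f\<close> that has a right
    inverse \<open>r2\<close> of its own is also a left inverse, by the usual cancellation in
    \<open>r \<odot> g \<odot> f \<odot> r \<odot> r2\<close>. Hence \<open>r \<odot> g\<close> is a
    left inverse of \<open>f\<close>. That \<open>r\<close> is again homotopic to the identity in
    the total space is what allows the second application.\<close>
  obtain r2 where r2: "hom r2 a a" "dp a \<odot> r2 = dp a" "fh a (r \<odot> r2) (idn a)"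
    using self_map_right_inverse[OF a r(1,2,3)] by auto
  obtain r' where r': "hom r' b b" "dp b \<odot> r' = dp b" "fh b (f \<odot> g \<odot> r') (idn b)"
    using self_map_right_inverse[OF b _ _ fg] a b ab f g by auto
  have "fh a (r \<odot> g \<odot> f \<odot> r \<odot> r2) (r \<odot> g \<odot> f)"
    using fh_post[OF r2(3), of "r \<odot> g \<odot> f" a] a b ab f g r r2 by (simp add: comp_reassoc[OF r(2)])
  moreover have "fh a (r \<odot> g \<odot> f \<odot> r \<odot> r2) (r \<odot> r2)"
    using fh_post[OF fh_pre[OF r(4), of r2], of r a] a b ab f g r r2 by simp
  ultimately have "fh a (r \<odot> g \<odot> f) (idn a)"
    using fh_sym[OF a] fh_trans[OF a] r2(3) by blast
  then show ?thesis
    using a b ab f g r r'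
    by (intro exI[of _ f] exI[of _ "r \<odot> g"] exI[of _ "g \<odot> r'"]) (simp add: comp_reassoc[OF r(2)])
qed

text \<open>The interval is the cylinder on the terminal context, which \<open>squeeze\<close>
  contracts to its left end; \<open>?m\<close> is the comparison map from \<open>I\<close> to this
  cylinder.\<close>

lemma one_equiv_I:
  "hom lp one I" "hom (bang I) I one" "bang I \<odot> lp = idn one" "hm (lp \<odot> bang I) (idn I)"
proof -
  obtain q where q: "hom q (cyl (cyl one)) (cyl one)" "q \<odot> i0 (cyl one) = const (i0 one)"
      "q \<odot> i1 (cyl one) = idn (cyl one)"
    using squeeze[of one] by auto
  have 1: "hm (i0 one \<odot> pr one) (idn (cyl one))"
    unfolding hm_def using q by (intro conjI exI[of _ q]) simp_all
  let ?m = "px (bang I) (idn I)"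
  have m: "pI one \<odot> i0 one \<odot> pr one \<odot> ?m = lp \<odot> bang I" "pI one \<odot> ?m = idn I"
    by simp_all
  have "hm (pI one \<odot> (i0 one \<odot> pr one) \<odot> ?m) (pI one \<odot> idn (cyl one) \<odot> ?m)"
    by (intro hm_post hm_pre 1) simp_all
  then show "hm (lp \<odot> bang I) (idn I)" by simp
qed simp_all

lemma closed_equiv:
  assumes "obj z"
  shows "\<exists>s u v. isty s \<and> base s = one \<and> hom u z s \<and> hom v s z \<and> hm (v \<odot> u) (idn z) \<and> hm (u \<odot> v) (idn s)"
proof (cases "len z = 0")
  case True
  then have "z = one" using one_len assms by simp
  then show ?thesis using one_equiv_I hm_refl[of "idn one"]
    by (intro exI[of _ I] exI[of _ lp] exI[of _ "bang I"]) simp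
next
  case False
  then obtain s u v where "isty s" "base s = one" "hom u z s" "hom v s z" "v \<odot> u = idn z" "u \<odot> v = idn s"
    using closed_iso[of z] assms by auto
  then show ?thesis
    using hm_refl[of "idn z"] hm_refl[of "idn s"] assms by (intro exI[of _ s] exI[of _ u] exI[of _ v]) simp
qed


text \<open>The type of pairs of a point \<open>t\<close> of \<open>x\<close> and a path from \<open>e t\<close> to the given point of \<open>s\<close>.\<close>

lemma mapping_path_type:
  assumes s: "isty s" "base s = one" and x: "isty x" "base x = one" and e: "hom e x s"
  shows "\<exists>a f g. isty a \<and> base a = s \<and> hom f a x \<and> hom g x a \<and> f \<odot> g = idn x \<and>
    hm (g \<odot> f) (idn a) \<and> dp a \<odot> g = e"
proof -
  \<comment> \<open>The product of \<open>s\<close> and \<open>x\<close>, regarded as a type over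
    \<open>s\<close>: \<open>p1\<close> and \<open>y\<close> are its projections, and
    \<open>mk\<close> is the pairing.\<close>
  define sx where "sx = pb x (bang s)"
  define y where "y = pq x (bang s)"
  define p1 where "p1 = dp sx"
  have sx: "isty sx" "base sx = s" "hom y sx x" "hom p1 sx s"
    using s x by (simp_all add: sx_def y_def p1_def)
  define mk where "mk = (\<lambda>f g. pbm x (bang s) f g)"
  have mk: "hom (mk f g) z sx" "p1 \<odot> mk f g = f" "y \<odot> mk f g = g" if "hom f z s" "hom g z x" for f g z
    using pbm_cone[of x "bang s" f g] that s x by (auto simp: mk_def sx_def y_def p1_def)
  have sx_ext: "f = g" if "hom f z sx" "hom g z sx" "p1 \<odot> f = p1 \<odot> g" "y \<odot> f = y \<odot> g" for f g z
    using pb_ext[of x "bang s" f z g] that s x by (simp add: sx_def y_def p1_def)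
  \<comment> \<open>The type \<open>s\<close>, weakened to the cylinder on \<open>sx\<close>. Its
    sections \<open>u\<close> and \<open>v\<close> over the two ends are the points
    \<open>e t\<close> and \<open>r\<close> at a pair \<open>(r, t)\<close>, so the path type
    \<open>p\<close> below consists of paths from \<open>e t\<close> to \<open>r\<close>.\<close>
  define c where "c = pb s (bang (cyl sx))"
  define q where "q = pq s (bang (cyl sx))"
  have c: "isty c" "base c = cyl sx" "hom q c s"
    using s sx by (simp_all add: c_def q_def)
  define mc where "mc = (\<lambda>f g. pbm s (bang (cyl sx)) f g)"
  have mc: "hom (mc f g) z c" "dp c \<odot> mc f g = f" "q \<odot> mc f g = g" if "hom f z (cyl sx)" "hom g z s" for f g z
    using pbm_cone[of s "bang (cyl sx)" f g] that s sx by (auto simp: mc_def c_def q_def)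
  have c_ext: "f = g" if "hom f z c" "hom g z c" "dp c \<odot> f = dp c \<odot> g" "q \<odot> f = q \<odot> g" for f g z
    using pb_ext[of s "bang (cyl sx)" f z g] that s sx by (simp add: c_def q_def)
  define u where "u = mc (i0 sx) (e \<odot> y)"
  define v where "v = mc (i1 sx) p1"
  have u: "hom u sx c" "dp c \<odot> u = i0 sx" "q \<odot> u = e \<odot> y"
    using mc[of "i0 sx" sx "e \<odot> y"] sx e by (simp_all add: u_def)
  have v: "hom v sx c" "dp c \<odot> v = i1 sx" "q \<odot> v = p1"
    using mc[of "i1 sx" sx p1] sx by (simp_all add: v_def)
  obtain p ev where p: "isty p" "base p = sx" "hom ev (cyl p) c" "dp c \<odot> ev = cyf (dp p)"
      "ev \<odot> i0 p = u \<odot> dp p" "ev \<odot> i1 p = v \<odot> dp p"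
    and univ: "\<And>f h. arr f \<Longrightarrow> cod f = sx \<Longrightarrow> hom h (cyl (dom f)) c \<Longrightarrow> dp c \<odot> h = cyf f \<Longrightarrow>
               h \<odot> i0 (dom f) = u \<odot> f \<Longrightarrow> h \<odot> i1 (dom f) = v \<odot> f \<Longrightarrow>
               (\<exists>!k. hom k (dom f) p \<and> dp p \<odot> k = f \<and> ev \<odot> cyf k = h)"
    using path[of c sx u v] c u v sx by auto
  note [simp] = comp_reassoc[OF u(2)] comp_reassoc[OF u(3)] comp_reassoc[OF v(2)] comp_reassoc[OF v(3)]
    comp_reassoc[OF p(4)] comp_reassoc[OF p(5)] comp_reassoc[OF p(6)]
  \<comment> \<open>Since \<open>c\<close> is a product with \<open>s\<close>, an arrow into
    \<open>p\<close> amounts to an arrow \<open>f\<close> into \<open>sx\<close> and a plain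
    homotopy in \<open>s\<close> between the two images of \<open>f\<close>. \<open>p_ext\<close> is
    the corresponding uniqueness.\<close>
  have p_intro: "\<exists>k. hom k z p \<and> dp p \<odot> k = f \<and> q \<odot> ev \<odot> cyf k = h"
    if f: "hom f z sx" and h: "hom h (cyl z) s" "h \<odot> i0 z = e \<odot> y \<odot> f" "h \<odot> i1 z = p1 \<odot> f" for f h z
  proof -
    have z: "obj z" using f by auto
    note m = mc[of "cyf f" "cyl z" h]
    have "mc (cyf f) h \<odot> i0 z = u \<odot> f" "mc (cyf f) h \<odot> i1 z = v \<odot> f"
      by (rule c_ext[of _ z]; use m f h z u v c sx e in \<open>simp add: comp_reassoc[OF m(2)] comp_reassoc[OF m(3)]\<close>)+
    then have "\<exists>!k. hom k (dom f) p \<and> dp p \<odot> k = f \<and> ev \<odot> cyf k = mc (cyf f) h"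
      by (intro univ) (use m f h z in simp_all)
    then obtain k where "hom k (dom f) p" "dp p \<odot> k = f" "ev \<odot> cyf k = mc (cyf f) h"
      by blast
    then show ?thesis using m f h z by (intro exI[of _ k]) simp
  qed
  have p_ext: "k = k'" if k: "hom k z p" "hom k' z p" and d: "dp p \<odot> k = dp p \<odot> k'"
    and h: "q \<odot> ev \<odot> cyf k = q \<odot> ev \<odot> cyf k'" for k k' z
  proof -
    have z: "obj z" using k by auto
    have dc: "dp c \<odot> ev \<odot> cyf k = dp c \<odot> ev \<odot> cyf k'"
      using c p(1,2,3) k sx d by simp
    have "hom (ev \<odot> cyf k) (cyl z) c" "hom (ev \<odot> cyf k') (cyl z) c"
      using k p(1,3) by simp_all
    then have *: "ev \<odot> cyf k = ev \<odot> cyf k'"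
      by (rule c_ext[OF _ _ dc h])
    have "\<exists>!m. hom m (dom (dp p \<odot> k)) p \<and> dp p \<odot> m = dp p \<odot> k \<and> ev \<odot> cyf m = ev \<odot> cyf k"
      by (rule univ) (use c p(1,2,3) k z u(1) v(1) sx in simp_all)
    moreover have "dom (dp p \<odot> k) = z" using k p(1) by simp
    ultimately show ?thesis using k d * by metis
  qed
  \<comment> \<open>The path type lies over \<open>sx\<close>, which lies over \<open>s\<close>;
    collapsing the two extensions makes it a single type over \<open>s\<close>.\<close>
  obtain a r t where a: "isty a" "base a = s" "hom r a p" "hom t p a" "r \<odot> t = idn p" "t \<odot> r = idn a"
    "p1 \<odot> dp p \<odot> r = dp a"
    using sigma[of p] p sx by (auto simp: p1_def)
  note [simp] = comp_reassoc[OF a(5)] comp_reassoc[OF a(6)]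
  let ?f0 = "y \<odot> dp p"
  note me = mk[of e x "idn x"]
  \<comment> \<open>The map \<open>k\<close> sends a point \<open>t\<close> to the triple of
    \<open>e t\<close>, \<open>t\<close> and the constant path.\<close>
  have "\<exists>k. hom k x p \<and> dp p \<odot> k = mk e (idn x) \<and> q \<odot> ev \<odot> cyf k = e \<odot> pr x"
    by (rule p_intro) (use me x e s in simp_all)
  then obtain k where k: "hom k x p" "dp p \<odot> k = mk e (idn x)" "q \<odot> ev \<odot> cyf k = e \<odot> pr x"
    by blast
  note [simp] = comp_reassoc[OF k(2)] comp_reassoc[OF me(2)] comp_reassoc[OF me(3)]
  define h where "h = q \<odot> ev"
  have h: "hom h (cyl p) s" "h \<odot> i0 p = e \<odot> ?f0" "h \<odot> i1 p = p1 \<odot> dp p"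
    using c p(1,2,3,5,6) sx u(1) v(1) u(3) v(3) e by (simp_all add: h_def)
  obtain sq where sq: "hom sq (cyl (cyl p)) (cyl p)" "sq \<odot> i0 (cyl p) = const (i0 p)"
    "sq \<odot> i1 (cyl p) = idn (cyl p)" "sq \<odot> cyf (i0 p) = const (i0 p)" "sq \<odot> cyf (i1 p) = idn (cyl p)"
    using squeeze[of p] p(1) by blast
  note mg = mk[of h "cyl p" "y \<odot> dp p \<odot> pr p"]
  \<comment> \<open>The contraction of a triple to one with a constant path. At each time the end
    point is the current point \<open>h\<close> of the path, and the new path is the initial piece
    up to it, parametrised by the connection \<open>sq\<close>. At the left end this is the constant
    path at \<open>e t\<close>, at the right end the path itself.\<close>
  have "\<exists>G. hom G (cyl p) p \<and> dp p \<odot> G = mk h (y \<odot> dp p \<odot> pr p) \<and> q \<odot> ev \<odot> cyf G = h \<odot> sq"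
    by (rule p_intro) (use mg h(1) sq p(1,2,3) sx comp_reassoc[OF h(2)] e in simp_all)
  then obtain G where G: "hom G (cyl p) p" "dp p \<odot> G = mk h (y \<odot> dp p \<odot> pr p)" "q \<odot> ev \<odot> cyf G = h \<odot> sq"
    by blast
  have hk: "h \<odot> cyf k = e \<odot> pr x" using k c p(1,2,3) by (simp add: h_def)
  have hG: "h \<odot> cyf G = h \<odot> sq" using G c p(1,2,3) by (simp add: h_def)
  have hp: "q \<odot> ev \<odot> w = h \<odot> w" if "arr w" "cod w = cyl p" for w
    using that c p(1,2,3) by (simp add: h_def)
  have g0: "G \<odot> i0 p = k \<odot> ?f0"
  proof (rule p_ext[of _ p])
    have "dp p \<odot> G \<odot> i0 p = mk h (y \<odot> dp p \<odot> pr p) \<odot> i0 p"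
      using comp_reassoc[OF G(2), of "i0 p"] G(1) p(1,2,3) by simp
    moreover have "mk h (y \<odot> dp p \<odot> pr p) \<odot> i0 p = mk e (idn x) \<odot> ?f0"
      by (rule sx_ext[of _ p])
        (use mg me h p(1,2,3) sx e x s in \<open>simp_all add: comp_reassoc[OF mg(2)] comp_reassoc[OF mg(3)]\<close>)
    ultimately show "dp p \<odot> G \<odot> i0 p = dp p \<odot> k \<odot> ?f0"
      using k(1) p(1,2,3) sx by simp
    have "q \<odot> ev \<odot> cyf (G \<odot> i0 p) = (h \<odot> cyf G) \<odot> cyf (i0 p)"
      using hp G(1) h(1) p(1) by (simp add: cyf_comp del: cyf_cyf)
    also have "\<dots> = (h \<odot> i0 p) \<odot> pr p"
      using hG h(1) sq p(1) by simp
    also have "\<dots> = (h \<odot> cyf k) \<odot> cyf ?f0"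
      unfolding hk h(2) using x e p(1,2,3) sx by simp
    also have "\<dots> = q \<odot> ev \<odot> cyf (k \<odot> ?f0)"
      using hp k(1) h(1) p(1,2,3) sx by (simp add: cyf_comp del: cyf_cyf)
    finally show "q \<odot> ev \<odot> cyf (G \<odot> i0 p) = q \<odot> ev \<odot> cyf (k \<odot> ?f0)" .
  qed (use G(1) k(1) p(1,2,3) sx in simp_all)
  have g1: "G \<odot> i1 p = idn p"
  proof (rule p_ext[of _ p])
    have "dp p \<odot> G \<odot> i1 p = mk h (y \<odot> dp p \<odot> pr p) \<odot> i1 p"
      using comp_reassoc[OF G(2), of "i1 p"] G(1) p(1,2,3) by simp
    moreover have "mk h (y \<odot> dp p \<odot> pr p) \<odot> i1 p = dp p"
      by (rule sx_ext[of _ p])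
        (use mg me h p(1,2,3) sx e x s in \<open>simp_all add: comp_reassoc[OF mg(2)] comp_reassoc[OF mg(3)]\<close>)
    ultimately show "dp p \<odot> G \<odot> i1 p = dp p \<odot> idn p"
      using p(1,2,3) sx by simp
    have "q \<odot> ev \<odot> cyf (G \<odot> i1 p) = (h \<odot> cyf G) \<odot> cyf (i1 p)"
      using hp G(1) h(1) p(1) by (simp add: cyf_comp del: cyf_cyf)
    also have "\<dots> = h"
      using hG h(1) sq p(1) by simp
    finally show "q \<odot> ev \<odot> cyf (G \<odot> i1 p) = q \<odot> ev \<odot> cyf (idn p)"
      using p(1,2,3) by (simp add: h_def)
  qed (use G(1) p(1,2,3) sx in simp_all)
  have "hm (k \<odot> ?f0) (idn p)"
    unfolding hm_def using G(1) g0 g1 k(1) p(1,2,3) sx by (intro conjI exI[of _ G]) simp_all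
  then have "hm (t \<odot> (k \<odot> ?f0) \<odot> r) (t \<odot> idn p \<odot> r)"
    by (intro hm_post hm_pre) (use a k(1) p(1,2,3) sx in simp_all)
  then have "hm ((t \<odot> k) \<odot> ?f0 \<odot> r) (idn a)"
    using a k(1) p(1,2,3) sx by simp
  moreover have "dp a \<odot> t \<odot> k = e"
    unfolding a(7)[symmetric] using a(1-6) k p(1,2,3) sx me e x by simp
  ultimately show ?thesis
    using a(1-6) k p(1,2,3) sx me e x by (intro exI[of _ a] exI[of _ "?f0 \<odot> r"] exI[of _ "t \<odot> k"]) simp
qed

text \<open>The mapping path type is available over a closed type. It is formed for
  \<open>u \<odot> e\<close> over the closed type \<open>s\<close> isomorphic to \<open>z\<close>,
  and pulled back along the isomorphism \<open>u\<close>. Over the terminal context \<open>x\<close>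
  itself is already a type.\<close>

lemma fibrant_replacement:
  assumes z: "obj z" and x: "isty x" "base x = one" and e: "hom e x z"
  shows "\<exists>a f g. isty a \<and> base a = z \<and> hom f a x \<and> hom g x a \<and> hm (f \<odot> g) (idn x) \<and>
    hm (g \<odot> f) (idn a) \<and> dp a \<odot> g = e"
proof (cases "len z = 0")
  case True
  then have "z = one" using z one_len by simp
  then show ?thesis
    using x e hm_refl[of "idn x"] to_one[of e x "bang x"]
    by (intro exI[of _ x] exI[of _ "idn x"]) simp
next
  case False
  then obtain s u v where s: "isty s" "base s = one" "hom u z s" "hom v s z" "v \<odot> u = idn z" "u \<odot> v = idn s"
    using closed_iso[of z] z by auto
  obtain b f g where b: "isty b" "base b = s" "hom f b x" "hom g x b" "f \<odot> g = idn x"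
    "hm (g \<odot> f) (idn b)" "dp b \<odot> g = u \<odot> e"
    using mapping_path_type[OF s(1,2) x, of "u \<odot> e"] s e by auto
  note [simp] = comp_reassoc[OF s(5)] comp_reassoc[OF s(6)] comp_reassoc[OF b(5)]
  have c: "cone b u (v \<odot> dp b) (idn b)" using b s by simp
  note p = pbm_cone[OF c]
  let ?m = "pbm b u (v \<odot> dp b) (idn b)" and ?a = "pb b u"
  note [simp] = comp_reassoc[OF p(2)] comp_reassoc[OF p(3)]
  have sq: "dp b \<odot> pq b u = u \<odot> dp ?a" using pb_sq[of b u] b s by simp
  have i: "?m \<odot> pq b u = idn ?a"
    by (rule pb_ext[of b u _ ?a]) (use b s p z in \<open>simp_all add: sq\<close>)
  have "hm (?m \<odot> (g \<odot> f) \<odot> pq b u) (?m \<odot> idn b \<odot> pq b u)"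
    by (intro hm_post hm_pre b) (use b s p in simp_all)
  then have "hm ((?m \<odot> g) \<odot> f \<odot> pq b u) (idn ?a)"
    using b s p i by simp
  moreover have "hm ((f \<odot> pq b u) \<odot> ?m \<odot> g) (idn x)"
    using b s p hm_refl[of "idn x"] x by simp
  moreover have "dp ?a \<odot> ?m \<odot> g = e"
    using b s p e by simp
  ultimately show ?thesis
    using b s p by (intro exI[of _ ?a] exI[of _ "f \<odot> pq b u"] exI[of _ "?m \<odot> g"]) simp
qed

end

section \<open>Functors on categories of contexts\<close>

text \<open>Cylinders and their ends are preserved strictly, which makes the functor preserve
  homotopies; display maps are preserved so that fibrewise data on the two sides can be
  compared.\<close>

locale path_functor = X: path_cat objX lenX arrX domX codX idX compX baseX dpX pbX pqX oneX IX lpX rpX +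
  Y: path_cat objY lenY arrY domY codY idY compY baseY dpY pbY pqY oneY IY lpY rpY
  for objX lenX arrX domX codX idX and compX (infixr "\<odot>\<^sub>X" 70) and baseX dpX pbX pqX oneX IX lpX rpX
    and objY lenY arrY domY codY idY and compY (infixr "\<odot>\<^sub>Y" 70) and baseY dpY pbY pqY oneY IY lpY rpY +
  fixes fo :: "'a \<Rightarrow> 'c" and fm :: "'b \<Rightarrow> 'd"
  assumes fo [simp]: "objX a \<Longrightarrow> objY (fo a)" "objX a \<Longrightarrow> lenY (fo a) = lenX a"
    "objX a \<Longrightarrow> lenX a \<noteq> 0 \<Longrightarrow> baseY (fo a) = fo (baseX a)" "fo oneX = oneY"
    "objX a \<Longrightarrow> fo (X.cyl a) = Y.cyl (fo a)"
    and fm [simp]: "arrX f \<Longrightarrow> arrY (fm f)" "arrX f \<Longrightarrow> domY (fm f) = fo (domX f)"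
    "arrX f \<Longrightarrow> codY (fm f) = fo (codX f)"
    "arrX f \<Longrightarrow> arrX g \<Longrightarrow> codX f = domX g \<Longrightarrow> fm (g \<odot>\<^sub>X f) = fm g \<odot>\<^sub>Y fm f"
    "objX a \<Longrightarrow> fm (idX a) = idY (fo a)"
    "objX a \<Longrightarrow> lenX a \<noteq> 0 \<Longrightarrow> fm (dpX a) = dpY (fo a)"
    "objX a \<Longrightarrow> fm (X.i0 a) = Y.i0 (fo a)" "objX a \<Longrightarrow> fm (X.i1 a) = Y.i1 (fo a)"
begin

lemma fm_hm: "X.hm f g \<Longrightarrow> Y.hm (fm f) (fm g)"
proof -
  assume h: "X.hm f g"
  then obtain H where H: "X.hom H (X.cyl (domX f)) (codX f)" "H \<odot>\<^sub>X X.i0 (domX f) = f" "H \<odot>\<^sub>X X.i1 (domX f) = g"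
    unfolding X.hm_def by blast
  note f = X.hm_arr[OF h]
  have "fm H \<odot>\<^sub>Y Y.i0 (fo (domX f)) = fm f" "fm H \<odot>\<^sub>Y Y.i1 (fo (domX f)) = fm g"
    using fm(4)[of "X.i0 (domX f)" H] fm(4)[of "X.i1 (domX f)" H] H f by simp_all
  then show ?thesis
    unfolding Y.hm_def by (intro conjI exI[of _ "fm H"]) (use H(1) f in simp_all)
qed

section \<open>From closed types to arbitrary contexts\<close>

context
  assumes full: "\<And>a b f. X.isty a \<Longrightarrow> baseX a = oneX \<Longrightarrow> X.isty b \<Longrightarrow> baseX b = oneX \<Longrightarrow>
      Y.hom f (fo a) (fo b) \<Longrightarrow> \<exists>g. X.hom g a b \<and> Y.hm (fm g) f"
    and faithful: "\<And>a b g g'. X.isty a \<Longrightarrow> baseX a = oneX \<Longrightarrow> X.isty b \<Longrightarrow> baseX b = oneX \<Longrightarrow>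
      X.hom g a b \<Longrightarrow> X.hom g' a b \<Longrightarrow> Y.hm (fm g) (fm g') \<Longrightarrow> X.hm g g'"
    and esurj: "\<And>b. Y.isty b \<Longrightarrow> baseY b = oneY \<Longrightarrow> \<exists>a w w'. X.isty a \<and> baseX a = oneX \<and>
      Y.hom w (fo a) b \<and> Y.hom w' b (fo a) \<and> Y.hm (w \<odot>\<^sub>Y w') (idY b) \<and> Y.hm (w' \<odot>\<^sub>Y w) (idY (fo a))"
begin

text \<open>Conjugation with the homotopy equivalences between contexts and closed types; the
  functor preserves these equivalences.\<close>

lemma full_all:
  assumes a: "objX a" "objX b" and f: "Y.hom f (fo a) (fo b)"
  shows "\<exists>g. X.hom g a b \<and> Y.hm (fm g) f"
proof -
  obtain s u v where s: "X.isty s" "baseX s = oneX" "X.hom u a s" "X.hom v s a"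
    "X.hm (v \<odot>\<^sub>X u) (idX a)"
    using X.closed_equiv[OF a(1)] by blast
  obtain s' u' v' where s': "X.isty s'" "baseX s' = oneX" "X.hom u' b s'" "X.hom v' s' b"
    "X.hm (v' \<odot>\<^sub>X u') (idX b)"
    using X.closed_equiv[OF a(2)] by blast
  obtain g where g: "X.hom g s s'" "Y.hm (fm g) (fm u' \<odot>\<^sub>Y f \<odot>\<^sub>Y fm v)"
    using full[of s s' "fm u' \<odot>\<^sub>Y f \<odot>\<^sub>Y fm v"] s s' f by auto
  have vu: "Y.hm (fm v \<odot>\<^sub>Y fm u) (idY (fo a))" "Y.hm (fm v' \<odot>\<^sub>Y fm u') (idY (fo b))"
    using fm_hm[OF s(5)] fm_hm[OF s'(5)] s s' a by simp_all
  have "Y.hm (fm v' \<odot>\<^sub>Y fm g \<odot>\<^sub>Y fm u) (fm v' \<odot>\<^sub>Y (fm u' \<odot>\<^sub>Y f \<odot>\<^sub>Y fm v) \<odot>\<^sub>Y fm u)"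
    by (intro Y.hm_post Y.hm_pre g) (use s s' g f in simp_all)
  moreover have "Y.hm (((fm v' \<odot>\<^sub>Y fm u') \<odot>\<^sub>Y f) \<odot>\<^sub>Y (fm v \<odot>\<^sub>Y fm u)) (((fm v' \<odot>\<^sub>Y fm u') \<odot>\<^sub>Y f) \<odot>\<^sub>Y idY (fo a))"
    by (intro Y.hm_post vu) (use s s' f in simp_all)
  moreover have "Y.hm ((fm v' \<odot>\<^sub>Y fm u') \<odot>\<^sub>Y f) (idY (fo b) \<odot>\<^sub>Y f)"
    by (intro Y.hm_pre vu) (use s s' f in simp_all)
  ultimately have "Y.hm (fm (v' \<odot>\<^sub>X g \<odot>\<^sub>X u)) f"
    using s s' g f a by simp (blast intro: Y.hm_trans)
  then show ?thesis using s s' g by (intro exI[of _ "v' \<odot>\<^sub>X g \<odot>\<^sub>X u"]) simp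
qed

lemma faithful_all:
  assumes a: "objX a" "objX b" and g: "X.hom g a b" "X.hom g' a b" and h: "Y.hm (fm g) (fm g')"
  shows "X.hm g g'"
proof -
  obtain s u v where s: "X.isty s" "baseX s = oneX" "X.hom u a s" "X.hom v s a"
    "X.hm (v \<odot>\<^sub>X u) (idX a)"
    using X.closed_equiv[OF a(1)] by blast
  obtain s' u' v' where s': "X.isty s'" "baseX s' = oneX" "X.hom u' b s'" "X.hom v' s' b"
    "X.hm (v' \<odot>\<^sub>X u') (idX b)"
    using X.closed_equiv[OF a(2)] by blast
  have "Y.hm (fm u' \<odot>\<^sub>Y fm g \<odot>\<^sub>Y fm v) (fm u' \<odot>\<^sub>Y fm g' \<odot>\<^sub>Y fm v)"
    by (intro Y.hm_post Y.hm_pre h) (use s s' g in simp_all)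
  then have k: "X.hm (u' \<odot>\<^sub>X g \<odot>\<^sub>X v) (u' \<odot>\<^sub>X g' \<odot>\<^sub>X v)"
    by (intro faithful[of s s']) (use s s' g in simp_all)
  have 1: "X.hm (v' \<odot>\<^sub>X (u' \<odot>\<^sub>X g \<odot>\<^sub>X v) \<odot>\<^sub>X u) (v' \<odot>\<^sub>X (u' \<odot>\<^sub>X g' \<odot>\<^sub>X v) \<odot>\<^sub>X u)"
    by (rule X.hm_post[OF X.hm_pre[OF k]]) (use s s' g in simp_all)
  have 2: "X.hm (v' \<odot>\<^sub>X (u' \<odot>\<^sub>X k \<odot>\<^sub>X v) \<odot>\<^sub>X u) k" if k: "X.hom k a b" for k
  proof -
    have "X.hm (((v' \<odot>\<^sub>X u') \<odot>\<^sub>X k) \<odot>\<^sub>X (v \<odot>\<^sub>X u)) (((v' \<odot>\<^sub>X u') \<odot>\<^sub>X k) \<odot>\<^sub>X idX a)"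
      by (intro X.hm_post s) (use s s' k in simp_all)
    moreover have "X.hm ((v' \<odot>\<^sub>X u') \<odot>\<^sub>X k) (idX b \<odot>\<^sub>X k)"
      by (intro X.hm_pre s') (use s s' k in simp_all)
    ultimately show ?thesis
      using s s' k a by simp (erule (1) X.hm_trans)
  qed
  show ?thesis
    using 1 2[OF g(1)] 2[OF g(2)] X.hm_sym X.hm_trans by blast
qed

text \<open>Fullness lifts \<open>s\<close> to an arrow \<open>t\<close> that is a section only up
  to homotopy in \<open>Y\<close>. Faithfulness, applied to endomorphisms of the base, moves this
  homotopy to \<open>X\<close>, where \<open>t\<close> can be made strict. The image of the strict
  section is homotopic to \<open>s\<close> as an arrow, hence fibrewise by
  \<open>sections_fh\<close>.\<close>

theorem lift_section:
  assumes a: "X.isty a" and s: "Y.hom s (fo (baseX a)) (fo a)" "dpY (fo a) \<odot>\<^sub>Y s = idY (fo (baseX a))"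
  shows "\<exists>t. X.hom t (baseX a) a \<and> dpX a \<odot>\<^sub>X t = idX (baseX a) \<and> Y.fh (fo a) (fm t) s"
proof -
  obtain t where t: "X.hom t (baseX a) a" "Y.hm (fm t) s"
    using full_all[of "baseX a" a s] a s by auto
  have "Y.hm (dpY (fo a) \<odot>\<^sub>Y fm t) (dpY (fo a) \<odot>\<^sub>Y s)"
    by (intro Y.hm_post t) (use a t in simp_all)
  then have "X.hm (dpX a \<odot>\<^sub>X t) (idX (baseX a))"
    by (intro faithful_all[of "baseX a" "baseX a"]) (use a t s in simp_all)
  then obtain t' where t': "X.hom t' (baseX a) a" "dpX a \<odot>\<^sub>X t' = idX (baseX a)" "X.hm t t'"
    using X.strictify[OF a t(1)] by blast
  have "Y.hm (fm t') s"
    using fm_hm[OF t'(3)] t(2) Y.hm_sym Y.hm_trans by blast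
  then have "Y.fh (fo a) (fm t') s"
    by (intro Y.sections_fh) (use a t' s fm(4)[of t' "dpX a"] in simp_all)
  then show ?thesis using t' by blast
qed

text \<open>Essential surjectivity gives a closed type \<open>x\<close> whose image is homotopy
  equivalent to the total space \<open>b\<close>. The resulting map from \<open>fo x\<close> to
  \<open>fo z\<close> is lifted by fullness to \<open>e\<close>, and the replacement of
  \<open>e\<close> by a display map is the required type \<open>a\<close> over
  \<open>z\<close>.\<close>

theorem lift_type:
  assumes z: "objX z" and b: "Y.isty b" "baseY b = fo z"
  shows "\<exists>a f g g'. X.isty a \<and> baseX a = z \<and> Y.hom f (fo a) b \<and> dpY b \<odot>\<^sub>Y f = dpY (fo a) \<and>
    Y.hom g b (fo a) \<and> dpY (fo a) \<odot>\<^sub>Y g = dpY b \<and> Y.hom g' b (fo a) \<and> dpY (fo a) \<odot>\<^sub>Y g' = dpY b \<and>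
    Y.fh (fo a) (g \<odot>\<^sub>Y f) (idY (fo a)) \<and> Y.fh b (f \<odot>\<^sub>Y g') (idY b)"
proof -
  obtain s u v where s: "Y.isty s" "baseY s = oneY" "Y.hom u b s" "Y.hom v s b"
    "Y.hm (v \<odot>\<^sub>Y u) (idY b)" "Y.hm (u \<odot>\<^sub>Y v) (idY s)"
    using Y.closed_equiv[of b] b(1) by blast
  obtain x w0 w0' where x: "X.isty x" "baseX x = oneX" "Y.hom w0 (fo x) s" "Y.hom w0' s (fo x)"
    "Y.hm (w0 \<odot>\<^sub>Y w0') (idY s)" "Y.hm (w0' \<odot>\<^sub>Y w0) (idY (fo x))"
    using esurj[OF s(1,2)] by blast
  have comp_inv: "Y.hm ((k \<odot>\<^sub>Y l) \<odot>\<^sub>Y (l' \<odot>\<^sub>Y k')) (idY d)"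
    if "Y.hom k c d" "Y.hom k' d c" "Y.hom l m c" "Y.hom l' c m"
       "Y.hm (k \<odot>\<^sub>Y k') (idY d)" "Y.hm (l \<odot>\<^sub>Y l') (idY c)" for k k' l l' m c d
  proof -
    have "Y.hm (k \<odot>\<^sub>Y (l \<odot>\<^sub>Y l') \<odot>\<^sub>Y k') (k \<odot>\<^sub>Y idY c \<odot>\<^sub>Y k')"
      by (intro Y.hm_post Y.hm_pre that) (use that in simp_all)
    then show ?thesis using that by simp (blast intro: Y.hm_trans)
  qed
  define w where "w = v \<odot>\<^sub>Y w0"
  define w' where "w' = w0' \<odot>\<^sub>Y u"
  have w: "Y.hom w (fo x) b" "Y.hom w' b (fo x)" "Y.hm (w \<odot>\<^sub>Y w') (idY b)" "Y.hm (w' \<odot>\<^sub>Y w) (idY (fo x))"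
    using comp_inv[OF s(4,3) x(3,4) s(5) x(5)] comp_inv[OF x(4,3) s(3,4) x(6) s(6)] s x
    by (simp_all add: w_def w'_def)
  obtain e where e: "X.hom e x z" "Y.hm (fm e) (dpY b \<odot>\<^sub>Y w)"
    using full_all[of x z "dpY b \<odot>\<^sub>Y w"] x z b w by auto
  obtain a f g where a: "X.isty a" "baseX a = z" "X.hom f a x" "X.hom g x a" "X.hm (f \<odot>\<^sub>X g) (idX x)"
    "X.hm (g \<odot>\<^sub>X f) (idX a)" "dpX a \<odot>\<^sub>X g = e"
    using X.fibrant_replacement[OF z x(1,2) e(1)] by blast
  have fg: "Y.hm (fm f \<odot>\<^sub>Y fm g) (idY (fo x))" "Y.hm (fm g \<odot>\<^sub>Y fm f) (idY (fo a))"
    using fm_hm[OF a(5)] fm_hm[OF a(6)] a x by simp_all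
  let ?k = "w \<odot>\<^sub>Y fm f" and ?k' = "fm g \<odot>\<^sub>Y w'"
  have k: "Y.hm (?k \<odot>\<^sub>Y ?k') (idY b)" "Y.hm (?k' \<odot>\<^sub>Y ?k) (idY (fo a))"
    by (rule comp_inv[of _ "fo x"]; use a w fg in simp)+
  \<comment> \<open>The image of \<open>e\<close> links the two display maps: it is homotopic to
    \<open>dpY b\<close> after \<open>w\<close> by the choice of \<open>e\<close>, and equal to
    \<open>dpY (fo a)\<close> after \<open>fm g\<close>.\<close>
  have "Y.hm (fm e \<odot>\<^sub>Y fm f) ((dpY b \<odot>\<^sub>Y w) \<odot>\<^sub>Y fm f)"
    by (intro Y.hm_pre e) (use a e in simp_all)
  moreover have "Y.hm (dpY (fo a) \<odot>\<^sub>Y fm g \<odot>\<^sub>Y fm f) (dpY (fo a) \<odot>\<^sub>Y idY (fo a))"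
    by (intro Y.hm_post fg) (use a in simp_all)
  moreover have "fm e \<odot>\<^sub>Y fm f = dpY (fo a) \<odot>\<^sub>Y fm g \<odot>\<^sub>Y fm f"
    using fm(4)[of g "dpX a"] a by simp
  ultimately have "Y.hm (dpY b \<odot>\<^sub>Y ?k) (dpY (fo a))"
    using a b w by simp (blast intro: Y.hm_trans Y.hm_sym)
  then show ?thesis
    using Y.fibrewise_equiv[of "fo a" b ?k ?k'] a b w k by (intro exI[of _ a]) simp
qed

end

end

section \<open>Soundness and interpretations\<close>

lemma has_sort_Tvar [simp]: "has_sort T V (Tvar i) s \<longleftrightarrow> i < length V \<and> s = V ! i"
  by (auto elim: has_sort.cases intro: has_sort.intros)

lemma has_sort_Fn [simp]:
  "has_sort T V (Fn f ts) s \<longleftrightarrow> f \<in> funs T \<and> s = fcod T f \<and> list_all2 (has_sort T V) ts (fdom T f)"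
  by (auto elim: has_sort.cases intro: has_sort.intros)

lemma those_Some_iff: "those xs = Some ys \<longleftrightarrow> xs = map Some ys"
proof (induction xs arbitrary: ys)
  case (Cons x xs)
  then show ?case by (cases ys) (auto split: option.splits)
qed auto

lemma those_map_Some [simp]: "those (map Some ys) = Some ys"
  by (simp add: those_Some_iff)

lemma those_None_iff: "those xs = None \<longleftrightarrow> None \<in> set xs"
  by (induction xs) (auto split: option.splits)

lemma ev_carrier:
  assumes "is_struct T M" "env M xs V" "has_sort T V t s" "ev M xs t = Some x"
  shows "x \<in> car M s"
proof (cases t)
  case (Tvar i)
  then show ?thesis using assms by (auto simp: list_all2_conv_all_nth split: if_splits)
next
  case (Fn f ts)
  then show ?thesis using assms by (auto simp: is_struct_def bind_eq_Some_conv)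
qed

lemma list_all2_in_setD: "list_all2 P ts W \<Longrightarrow> t \<in> set ts \<Longrightarrow> \<exists>s. P t s"
  by (auto simp: list_all2_conv_all_nth in_set_conv_nth)

text \<open>The sort of \<open>t\<close> bounds its variables by the length of \<open>V\<close>;
  beyond this bound \<open>us ! i\<close> would be an unspecified term.\<close>

lemma ev_tsub:
  assumes us: "map (ev M xs) us = map Some ys"
  shows "has_sort T V t s \<Longrightarrow> length V = length us \<Longrightarrow> ev M xs (tsub us t) = ev M ys t"
proof (induction t arbitrary: s)
  case (Tvar i)
  then have "map (ev M xs) us ! i = map Some ys ! i" "length ys = length us"
    using us map_eq_imp_length_eq[OF us] by simp_all
  then show ?case using Tvar by simp
next
  case (Fn f ts)
  have "ev M xs (tsub us u) = ev M ys u" if "u \<in> set ts" for u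
    using Fn list_all2_in_setD[of "has_sort T V" ts "fdom T f" u] that by auto
  then have "map (ev M xs) (map (tsub us) ts) = map (ev M ys) ts" by simp
  then show ?case by (simp only: tsub.simps ev.simps)
qed

lemma holds1_asub:
  assumes us: "map (ev M xs) us = map Some ys" and a: "wf_atom T V \<alpha>" "length V = length us"
  shows "holds1 M xs (asub us \<alpha>) \<longleftrightarrow> holds1 M ys \<alpha>"
proof (cases \<alpha>)
  case (Eq t u)
  then obtain s where "has_sort T V t s" "has_sort T V u s" using a by auto
  then have "ev M xs (tsub us t) = ev M ys t" "ev M xs (tsub us u) = ev M ys u"
    using ev_tsub[OF us, of T V t s] ev_tsub[OF us, of T V u s] a(2) by simp_all
  then show ?thesis using Eq by simp
next
  case (Rl r ts)
  have "ev M xs (tsub us u) = ev M ys u" if "u \<in> set ts" for u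
    using a Rl list_all2_in_setD[of "has_sort T V" ts "rdom T r" u] that by (auto simp: ev_tsub[OF us])
  then have "map (ev M xs) (map (tsub us) ts) = map (ev M ys) ts" by simp
  then show ?thesis using Rl by (simp only: asub.simps holds1.simps)
qed

lemma env_of_ev:
  assumes "is_struct T M" "env M xs V" "list_all2 (has_sort T V) us W" "map (ev M xs) us = map Some ys"
  shows "env M ys W"
proof -
  have l: "length ys = length us" using map_eq_imp_length_eq[OF assms(4)] by simp
  have "ev M xs (us ! i) = Some (ys ! i)" if "i < length us" for i
    using arg_cong[OF assms(4), of "\<lambda>zs. zs ! i"] that l by simp
  then show ?thesis
    using assms(3) l ev_carrier[OF assms(1,2)] unfolding list_all2_conv_all_nth by metis
qed

lemma map_ev_cong: "list_all2 (\<lambda>t u. ev M xs t \<noteq> None \<and> ev M xs t = ev M xs u) ts us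
    \<Longrightarrow> map (ev M xs) ts = map (ev M xs) us"
  by (induction rule: list_all2_induct) auto

text \<open>The case with content is \<open>ax\<close>. The substituted terms are provably defined
  and have the sorts that the axiom requires, so their values form an environment for it. Since
  axioms are well sorted, evaluation commutes with the substitution.\<close>

theorem soundness:
  assumes T: "wf_theory T" "is_model T M" and xs: "env M xs V" "holds M xs \<Phi>"
  shows "entails T V \<Phi> \<alpha> \<Longrightarrow> holds1 M xs \<alpha>"
proof (induction rule: entails.induct)
  case (hyp \<alpha>)
  then show ?case using xs by (auto simp: holds_def)
next
  case (var i)
  then show ?case using xs by (auto simp: list_all2_lengthD)
next
  case (fcong f ts us)
  then have "map (ev M xs) ts = map (ev M xs) us"
    by (intro map_ev_cong) (auto elim!: list_all2_mono)
  then show ?case using fcong by (metis ev.simps(2) holds1.simps(1))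
next
  case (rcong r ts us)
  then have "map (ev M xs) ts = map (ev M xs) us"
    by (intro map_ev_cong) (auto elim!: list_all2_mono)
  then show ?case using rcong by simp
next
  case (fstrict f ts t)
  then obtain ys where "map (ev M xs) ts = map Some ys"
    by (auto simp: bind_eq_Some_conv those_Some_iff)
  then have "ev M xs t \<in> Some ` set ys"
    using fstrict(2) by (metis image_eqI image_set)
  then show ?case by auto
next
  case (rstrict r ts t)
  then obtain ys where "map (ev M xs) ts = map Some ys"
    by (auto simp: those_Some_iff)
  then have "ev M xs t \<in> Some ` set ys"
    using rstrict(2) by (metis image_eqI image_set)
  then show ?case by auto
next
  case (ax W \<phi> \<psi> us \<beta>)
  then have "\<forall>u\<in>set us. \<exists>y. ev M xs u = Some y" by auto
  then have "map (ev M xs) us = map Some (map (\<lambda>u. the (ev M xs u)) us)" by auto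
  then obtain ys where ys: "map (ev M xs) us = map Some ys" by blast
  have l: "length W = length us" using ax(2) by (simp add: list_all2_lengthD)
  have wf: "\<forall>\<alpha> \<in> set \<phi> \<union> set \<psi>. wf_atom T W \<alpha>" using T ax(1) unfolding wf_theory_def by fastforce
  have eq: "\<forall>\<alpha> \<in> set \<phi> \<union> set \<psi>. holds1 M xs (asub us \<alpha>) \<longleftrightarrow> holds1 M ys \<alpha>"
    using wf holds1_asub[OF ys _ l] by blast
  have "env M ys W" using env_of_ev[OF _ xs(1) ax(2) ys] T by (simp add: is_model_def)
  moreover have "holds M ys \<phi>"
    using ax(7) eq by (auto simp: holds_def)
  ultimately have "holds M ys \<psi>" using T ax(1) unfolding is_model_def by fastforce
  then show ?case using eq ax(5) by (auto simp: holds_def)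
next
  case (sym t u)
  then show ?case by (metis holds1.simps(1))
next
  case (trans t u w)
  then show ?case by (metis holds1.simps(1))
qed

lemma soundness_thm:
  assumes "wf_theory T" "is_model T M" "is_thm T (V, \<phi>, \<psi>)" "env M xs V" "holds M xs \<phi>"
  shows "holds M xs \<psi>"
  using assms soundness[of T M xs V \<phi>] by (auto simp: is_thm_def holds_def)

lemma holds_append [simp]: "holds M xs (\<phi> @ \<psi>) \<longleftrightarrow> holds M xs \<phi> \<and> holds M xs \<psi>"
  by (auto simp: holds_def)

lemma holds_Cons [simp]: "holds M xs (\<alpha> # \<psi>) \<longleftrightarrow> holds1 M xs \<alpha> \<and> holds M xs \<psi>"
  by (auto simp: holds_def)

lemma holds_Nil [simp]: "holds M xs []"
  by (auto simp: holds_def)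

lemma holds_concat: "holds M xs (concat \<phi>s) \<longleftrightarrow> (\<forall>\<phi> \<in> set \<phi>s. holds M xs \<phi>)"
  by (auto simp: holds_def)

lemma holds_fapp:
  assumes us: "map (ev M xs) us = map Some ys" and a: "\<forall>\<alpha> \<in> set \<phi>. wf_atom T V \<alpha>" "length V = length us"
  shows "holds M xs (fapp \<phi> us) \<longleftrightarrow> holds M ys \<phi>"
proof -
  have "ev M xs u \<noteq> None" if "u \<in> set us" for u
  proof -
    have "ev M xs u \<in> Some ` set ys" using us that by (metis image_eqI image_set)
    then show ?thesis by auto
  qed
  moreover have "\<forall>\<alpha> \<in> set \<phi>. holds1 M xs (asub us \<alpha>) \<longleftrightarrow> holds1 M ys \<alpha>"
    using holds1_asub[OF us _ a(2)] a(1) by blast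
  ultimately show ?thesis
    by (auto simp: holds_def fapp_def)
qed

section \<open>Reducts along an interpretation\<close>

context
  fixes T :: "('s, 'f, 'r) horn" and T' :: "('s, 'g, 'q) horn" and J :: "('f, 'r, 'g, 'q) interp"
  assumes J: "is_interp T T' J"
begin

lemma reduct_struct:
  assumes M: "is_struct T' M"
  shows "is_struct T (reduct T J M)"
  using J ev_carrier[OF M] unfolding is_struct_def is_interp_def wf_rterm_def
  by (auto simp: reduct_def split: if_splits)

text \<open>The case distinction common to function and predicate symbols. Definedness of the
  arguments appears as a condition of its own because an interpreting term may ignore an argument in
  which the symbol is nevertheless strict; \<open>fapp\<close> records the same condition in the
  translation.\<close>

lemma args_reduct:
  assumes M: "is_struct T' M" and xs: "env M xs V" and ts: "list_all2 (has_sort T V) ts W"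
    and IH: "\<And>t s. t \<in> set ts \<Longrightarrow> has_sort T V t s \<Longrightarrow> ev (reduct T J M) xs t =
      (if holds M xs (snd (tr 0 J t)) then ev M xs (fst (tr 0 J t)) else None)"
  obtains (defined) ys where "map (ev (reduct T J M) xs) ts = map Some ys" "env M ys W"
      "map (ev M xs) (map (fst \<circ> tr 0 J) ts) = map Some ys"
      "holds M xs (concat (map (snd \<circ> tr 0 J) ts))"
    | (undefined) "None \<in> set (map (ev (reduct T J M) xs) ts)"
      "\<not> (holds M xs (map dfd (map (fst \<circ> tr 0 J) ts)) \<and> holds M xs (concat (map (snd \<circ> tr 0 J) ts)))"
proof (cases "None \<in> set (map (ev (reduct T J M) xs) ts)")
  case True
  then obtain t where t: "t \<in> set ts" "ev (reduct T J M) xs t = None" by auto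
  then obtain s where "has_sort T V t s"
    using list_all2_in_setD[OF ts] by blast
  then have "\<not> holds M xs (snd (tr 0 J t)) \<or> ev M xs (fst (tr 0 J t)) = None"
    using IH[OF t(1)] t(2) by (auto split: if_splits)
  then show ?thesis
    using True t(1) by (intro undefined) (auto simp: holds_def)
next
  case False
  then have "those (map (ev (reduct T J M) xs) ts) \<noteq> None" by (simp only: those_None_iff not_False_eq_True)
  then obtain ys where ys: "map (ev (reduct T J M) xs) ts = map Some ys"
    by (auto simp: those_Some_iff)
  have "env (reduct T J M) ys W"
    by (rule env_of_ev[OF reduct_struct[OF M] _ ts ys]) (use xs in \<open>simp add: reduct_def\<close>)
  then have e: "env M ys W" by (simp add: reduct_def)
  have t: "holds M xs (snd (tr 0 J t)) \<and> ev M xs (fst (tr 0 J t)) = ev (reduct T J M) xs t" if t: "t \<in> set ts" for t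
  proof -
    obtain s where "has_sort T V t s"
      using list_all2_in_setD[OF ts t] by blast
    moreover have "ev (reduct T J M) xs t \<noteq> None" using False t by force
    ultimately show ?thesis using IH[OF t, of s] by (auto split: if_splits)
  qed
  have "map (ev M xs) (map (fst \<circ> tr 0 J) ts) = map (ev (reduct T J M) xs) ts"
    using t by simp
  then show ?thesis
    by (intro defined[of ys]) (use ys e t in \<open>auto simp: holds_concat\<close>)
qed

lemma ev_reduct:
  assumes M: "is_struct T' M" and xs: "env M xs V"
  shows "has_sort T V t s \<Longrightarrow> ev (reduct T J M) xs t =
    (if holds M xs (snd (tr 0 J t)) then ev M xs (fst (tr 0 J t)) else None)"
proof (induction t arbitrary: s)
  case (Fn f ts)
  then have f: "f \<in> funs T" "list_all2 (has_sort T V) ts (fdom T f)" by auto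
  then have wf: "wf_rterm T' (fdom T f) (fint J f) (fcod T f)" using J by (simp add: is_interp_def)
  show ?case
  proof (rule args_reduct[OF M xs f(2)], goal_cases)
    case (1 t s)
    then show ?case by (rule Fn.IH)
  next
    case (2 ys)
    have l: "length (fdom T f) = length (map (fst \<circ> tr 0 J) ts)"
      using f by (simp add: list_all2_lengthD)
    have 1: "holds M xs (fapp (snd (fint J f)) (map (fst \<circ> tr 0 J) ts)) \<longleftrightarrow> holds M ys (snd (fint J f))"
      using holds_fapp[OF 2(3) _ l, of "snd (fint J f)"] wf unfolding wf_rterm_def by blast
    have 3: "ev M xs (tsub (map (fst \<circ> tr 0 J) ts) (fst (fint J f))) = ev M ys (fst (fint J f))"
      using ev_tsub[OF 2(3) _ l] wf unfolding wf_rterm_def by blast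
    have "ev (reduct T J M) xs (Fn f ts) = fn (reduct T J M) f ys"
      using 2 by simp
    also have "\<dots> = (if holds M ys (snd (fint J f)) then ev M ys (fst (fint J f)) else None)"
      using 2 f by (simp add: reduct_def)
    finally show ?case
      using 2(4) 1 3 by (simp add: rapp_def Let_def comp_def)
  next
    case 3
    then have "those (map (ev (reduct T J M) xs) ts) = None" by (simp only: those_None_iff)
    then show ?case
      using 3(2) by (auto simp: rapp_def Let_def comp_def fapp_def)
  qed
qed (use xs in \<open>simp add: list_all2_lengthD\<close>)

lemma holds1_reduct:
  assumes M: "is_struct T' M" and xs: "env M xs V" and a: "wf_atom T V \<alpha>"
  shows "holds1 (reduct T J M) xs \<alpha> \<longleftrightarrow> holds M xs (tr_atom 0 J \<alpha>)"
proof (cases \<alpha>)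
  case (Eq t u)
  then obtain s where "has_sort T V t s" "has_sort T V u s" using a by auto
  then show ?thesis using Eq by (auto simp: ev_reduct[OF M xs] split: if_splits)
next
  case (Rl r ts)
  then have r: "r \<in> rels T" "list_all2 (has_sort T V) ts (rdom T r)" using a by auto
  then have wf: "\<forall>\<alpha> \<in> set (rint J r). wf_atom T' (rdom T r) \<alpha>" using J by (simp add: is_interp_def)
  show ?thesis
  proof (rule args_reduct[OF M xs r(2)], goal_cases)
    case (1 t s)
    then show ?case by (simp add: ev_reduct[OF M xs])
  next
    case (2 ys)
    have l: "length (rdom T r) = length (map (fst \<circ> tr 0 J) ts)"
      using r by (simp add: list_all2_lengthD)
    have "holds1 (reduct T J M) xs \<alpha> \<longleftrightarrow> rl (reduct T J M) r ys"
      using 2 Rl by simp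
    also have "\<dots> \<longleftrightarrow> holds M ys (rint J r)"
      using 2 r by (simp add: reduct_def)
    also have "\<dots> \<longleftrightarrow> holds M xs (fapp (rint J r) (map (fst \<circ> tr 0 J) ts))"
      using holds_fapp[OF 2(3) wf l] by simp
    finally show ?case
      using 2 Rl by (simp add: Let_def comp_def)
  next
    case 3
    then have "those (map (ev (reduct T J M) xs) ts) = None" by (simp only: those_None_iff)
    then show ?case
      using 3(2) Rl by (simp add: Let_def comp_def fapp_def)
  qed
qed

lemma holds_reduct:
  assumes "is_struct T' M" "env M xs V" "\<forall>\<alpha> \<in> set \<phi>. wf_atom T V \<alpha>"
  shows "holds (reduct T J M) xs \<phi> \<longleftrightarrow> holds M xs (tr_formula 0 J \<phi>)"
  using assms holds1_reduct[OF assms(1,2)] by (auto simp: tr_formula_def holds_concat holds_def)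

theorem reduct_model:
  assumes T: "wf_theory T" "wf_theory T'" and M: "is_model T' M"
  shows "is_model T (reduct T J M)"
proof -
  have M': "is_struct T' M" using M by (simp add: is_model_def)
  have "holds (reduct T J M) xs \<psi>"
    if ax: "(V, \<phi>, \<psi>) \<in> axs T" and xs: "env (reduct T J M) xs V" and h: "holds (reduct T J M) xs \<phi>" for V \<phi> \<psi> xs
  proof -
    have e: "env M xs V" using xs by (simp add: reduct_def)
    have wf: "\<forall>\<alpha> \<in> set \<phi>. wf_atom T V \<alpha>" "\<forall>\<alpha> \<in> set \<psi>. wf_atom T V \<alpha>"
      using T ax unfolding wf_theory_def by fastforce+
    have "is_thm T' (V, tr_formula 0 J \<phi>, tr_formula 0 J \<psi>)"
      using J ax unfolding is_interp_def by fastforce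
    then show ?thesis
      using soundness_thm[OF T(2) M _ e] h holds_reduct[OF M' e wf(1)] holds_reduct[OF M' e wf(2)] by blast
  qed
  then show ?thesis
    using reduct_struct[OF M'] by (auto simp: is_model_def)
qed

end

section \<open>Preservation of terms and Horn formulas by morphisms\<close>

lemma map2_Some_ev:
  assumes "list_all2 (has_sort T V) ts W" "map (ev M xs) ts = map Some ys"
    "\<And>t s x. t \<in> set ts \<Longrightarrow> has_sort T V t s \<Longrightarrow> ev M xs t = Some x \<Longrightarrow> ev N zs t = Some (h s x)"
  shows "map (ev N zs) ts = map Some (map2 h W ys)"
proof (rule nth_equalityI)
  have l: "length ys = length ts" "length W = length ts"
    using map_eq_imp_length_eq[OF assms(2)] assms(1) by (simp_all add: list_all2_lengthD)
  then show "length (map (ev N zs) ts) = length (map Some (map2 h W ys))" by simp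
  fix i assume "i < length (map (ev N zs) ts)"
  then have i: "i < length ts" by simp
  then have "ev M xs (ts ! i) = Some (ys ! i)"
    using arg_cong[OF assms(2), of "\<lambda>zs. zs ! i"] l by simp
  then show "map (ev N zs) ts ! i = map Some (map2 h W ys) ! i"
    using assms(1,3) i l by (simp add: list_all2_conv_all_nth)
qed

lemma ev_morphism:
  assumes h: "is_morphism T M N h" and xs: "length xs = length V"
  shows "has_sort T V t s \<Longrightarrow> ev M xs t = Some x \<Longrightarrow> ev N (map2 h V xs) t = Some (h s x)"
proof (induction t arbitrary: s x)
  case (Tvar i)
  then show ?case using xs by (auto split: if_splits)
next
  case (Fn f ts)
  then obtain ys where ys: "map (ev M xs) ts = map Some ys" "fn M f ys = Some x"
    by (auto simp: bind_eq_Some_conv those_Some_iff)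
  have "map (ev N (map2 h V xs)) ts = map Some (map2 h (fdom T f) ys)"
    by (rule map2_Some_ev[OF _ ys(1)]) (use Fn in auto)
  moreover have "fn N f (map2 h (fdom T f) ys) = Some (h s x)"
    using h Fn(2) ys(2) by (simp add: is_morphism_def)
  ultimately show ?case by (simp del: map_map)
qed

lemma holds_morphism:
  assumes h: "is_morphism T M N h" and xs: "length xs = length V" and wf: "\<forall>\<alpha> \<in> set \<phi>. wf_atom T V \<alpha>"
    and hold: "holds M xs \<phi>"
  shows "holds N (map2 h V xs) \<phi>"
  unfolding holds_def
proof
  fix \<alpha> assume a: "\<alpha> \<in> set \<phi>"
  then have m: "holds1 M xs \<alpha>" using hold by (simp add: holds_def)
  show "holds1 N (map2 h V xs) \<alpha>"
  proof (cases \<alpha>)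
    case (Eq t u)
    then obtain s x where "has_sort T V t s" "has_sort T V u s" "ev M xs t = Some x" "ev M xs u = Some x"
      using m wf a by fastforce
    then show ?thesis using Eq ev_morphism[OF h xs] by simp
  next
    case (Rl r ts)
    then obtain ys where ys: "map (ev M xs) ts = map Some ys" "rl M r ys"
      using m by (auto simp: those_Some_iff)
    have r: "r \<in> rels T" "list_all2 (has_sort T V) ts (rdom T r)" using wf a Rl by auto
    have "map (ev N (map2 h V xs)) ts = map Some (map2 h (rdom T r) ys)"
      by (rule map2_Some_ev[OF r(2) ys(1)]) (use ev_morphism[OF h xs] in auto)
    moreover have "rl N r (map2 h (rdom T r) ys)"
      using h r(1) ys(2) by (simp add: is_morphism_def)
    ultimately show ?thesis using Rl by (simp del: map_map)
  qed
qed

lemma env_morphism: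
  assumes h: "is_morphism T M N h" and "env M xs V"
  shows "env N (map2 h V xs) V"
  using assms by (auto simp: list_all2_conv_all_nth is_morphism_def)

text \<open>Symbols are interpreted by terms restricted by Horn formulas. Morphisms preserve defined
  values and the truth of Horn formulas, so definedness in the source carries over to the
  target.\<close>

theorem reduct_morphism:
  assumes J: "is_interp T T' J" and h: "is_morphism T' M N h"
  shows "is_morphism T (reduct T J M) (reduct T J N) h"
  unfolding is_morphism_def
proof (intro conjI ballI allI impI)
  fix f xs y assume f: "f \<in> funs T" and y: "fn (reduct T J M) f xs = Some y"
  have wf: "wf_rterm T' (fdom T f) (fint J f) (fcod T f)" using J f by (simp add: is_interp_def)
  have d: "env M xs (fdom T f)" "holds M xs (snd (fint J f))" "ev M xs (fst (fint J f)) = Some y"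
    using y by (auto simp: reduct_def split: if_splits)
  have l: "length xs = length (fdom T f)" using d by (simp add: list_all2_lengthD)
  show "fn (reduct T J N) f (map2 h (fdom T f) xs) = Some (h (fcod T f) y)"
    using f wf env_morphism[OF h d(1)] holds_morphism[OF h l _ d(2)] ev_morphism[OF h l _ d(3)]
    by (simp add: reduct_def wf_rterm_def)
next
  fix r xs assume r: "r \<in> rels T" and y: "rl (reduct T J M) r xs"
  have wf: "\<forall>\<alpha> \<in> set (rint J r). wf_atom T' (rdom T r) \<alpha>" using J r by (simp add: is_interp_def)
  have d: "env M xs (rdom T r)" "holds M xs (rint J r)"
    using y by (auto simp: reduct_def)
  have l: "length xs = length (rdom T r)" using d by (simp add: list_all2_lengthD)
  show "rl (reduct T J N) r (map2 h (rdom T r) xs)"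
    using r wf env_morphism[OF h d(1)] holds_morphism[OF h l _ d(2)] by (simp add: reduct_def)
qed (use h in \<open>auto simp: is_morphism_def reduct_def\<close>)

section \<open>The sorts of the axioms\<close>

lemma T0_simps [simp]:
  "Bas s \<in> funs T0 \<longleftrightarrow> s \<in> ssyms" "New x \<in> funs T0"
  "fdom T0 (Bas s) = sdom s" "fdom T0 (New (c, n)) = Ctx n # map (shift n) (cdom c)"
  "fcod T0 (Bas s) = scod s" "fcod T0 (New (c, n)) = shift n (ccod c)"
  "rels T0 = {}"
  by (auto simp: T0_def)

lemma ssyms_simps [simp]: "EmpS \<in> ssyms" "FtS n \<in> ssyms" "TyS n \<in> ssyms"
  "VarS n i \<in> ssyms \<longleftrightarrow> i < n" "SubS p n k \<in> ssyms"
  by (auto simp: ssyms_def)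

declare upt_Suc [simp del]

lemma list_all2_replicate2 [simp]: "list_all2 P xs (replicate n y) \<longleftrightarrow> length xs = n \<and> (\<forall>x \<in> set xs. P x y)"
  by (auto simp: list_all2_conv_all_nth all_set_conv_all_nth)

abbreviation hs :: "sort list \<Rightarrow> t0 trm \<Rightarrow> sort \<Rightarrow> bool" where
  "hs V t s \<equiv> has_sort T0 V t s"

lemma hs_ftn [simp]: "hs V A (Ctx (n + j)) \<Longrightarrow> hs V (ftn n j A) (Ctx n)"
  by (induction j arbitrary: A) (auto simp: add.commute)

lemma hs_ftn': "hs V A (Ctx m) \<Longrightarrow> m = n + j \<Longrightarrow> hs V (ftn n j A) (Ctx n)"
  by simp

lemma hs_ftn_Suc [simp]: "i < n \<Longrightarrow> hs V A (Ctx n) \<Longrightarrow> hs V (ftn (n - i) i A) (Ty (n - Suc i))"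
  using hs_ftn'[of V A n "n - i" i] by (simp add: Suc_diff_Suc)

lemma hs_kctx [simp]: "hs V t (ksort p n) \<Longrightarrow> hs V (kctx p n t) (Ctx n)"
  by (cases p) auto

lemma vars_length [simp]: "length (vars n j \<Gamma>) = n - j"
  by (simp add: vars_def)

lemma hs_vars: "hs V \<Gamma> (Ctx n) \<Longrightarrow> a \<in> set (vars n j \<Gamma>) \<Longrightarrow> hs V a (Tm n)"
  by (auto simp: vars_def)

lemma hs_lift:
  assumes "hs V \<Gamma> (Ctx l)" "\<forall>a \<in> set as. hs V a (Tm l)" "hs V \<Theta> (Ctx (l + n))" "a \<in> set (lift l n \<Theta> as)"
  shows "hs V a (Tm (l + n))"
  using assms by (auto simp: lift_def hs_vars split: if_splits)

lemma lift_length [simp]: "length (lift l n \<Theta> as) = length as + n"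
  by (simp add: lift_def)

lemma hs_pull_ctx:
  assumes "hs V \<Gamma> (Ctx l)" "\<forall>a \<in> set as. hs V a (Tm l)" "length as = m"
  shows "hs V t (Ctx (m + n)) \<Longrightarrow> hs V (pull_ctx l m \<Gamma> as n t) (Ctx (l + n))"
proof (induction n arbitrary: t)
  case (Suc n)
  then have "hs V (pull_ctx l m \<Gamma> as n (ft (m + n) t)) (Ctx (l + n))" by simp
  then show ?case using Suc.prems assms hs_lift[OF assms(1,2)] by (auto simp: Let_def)
qed (use assms in simp)

lemma hs_pull:
  assumes "hs V \<Gamma> (Ctx l)" "\<forall>a \<in> set as. hs V a (Tm l)" "length as = m" "hs V t (shift m s)"
  shows "hs V (pull l m \<Gamma> as s t) (shift l s)"
proof (cases s)
  case (Ctx n)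
  then show ?thesis using assms hs_pull_ctx[OF assms(1-3), of t n] by (simp add: add.commute)
next
  case (Tm n)
  then show ?thesis using assms hs_pull_ctx[OF assms(1-3), of "ft (m + n) (ty (m + n) t)" n]
      hs_lift[OF assms(1,2)]
    by (auto simp: Let_def add.commute[of n])
qed

lemma hs_wk [simp]: "hs V B (Ty n) \<Longrightarrow> hs V t (shift n r) \<Longrightarrow> s = shift (Suc n) r \<Longrightarrow> hs V (wk n r B t) s"
  unfolding wk_def by (auto intro!: hs_pull dest: hs_vars)

lemma hs_inst [simp]: "hs V \<Gamma> (Ctx n) \<Longrightarrow> hs V t (ksort p (Suc n)) \<Longrightarrow> hs V a (Tm n) \<Longrightarrow> s = ksort p n
    \<Longrightarrow> hs V (inst n p \<Gamma> t a) s"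
  by (cases p) (auto simp: inst_def simp flip: replicate_Suc dest: hs_vars)

lemma hs_cmp [simp]: "hs V A (Ty n) \<Longrightarrow> hs V g (Tm (Suc n)) \<Longrightarrow> hs V f (Tm (Suc n)) \<Longrightarrow> s = Tm (Suc n)
    \<Longrightarrow> hs V (cmp n A g f) s"
  by (auto simp: cmp_def simp flip: replicate_Suc dest: hs_vars)

lemma shift_Ctx1 [simp]: "shift n (Ctx (Suc 0)) = Ctx (Suc n)" "shift n (Ctx 2) = Ctx (Suc (Suc n))"
  "shift n (Tm (Suc 0)) = Tm (Suc n)"
  by simp_all

lemma ccod_simps [simp]: "ccod IntvC = Ctx 1" "ccod PathC = Ctx 1" "ccod IsoC = Ctx 1" "ccod SigC = Ctx 1"
  "ccod LeftC = Tm 0" "ccod RightC = Tm 0" "ccod Coe1C = Tm 0" "ccod PLamC = Tm 0" "ccod AtC = Tm 0"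
  "ccod PairC = Tm 0" "ccod Pr1C = Tm 0" "ccod Pr2C = Tm 0"
  by (simp_all add: ccod_def)

lemma hs_intv [simp]: "hs V (intv n \<Gamma>) s \<longleftrightarrow> s = Ty n \<and> hs V \<Gamma> (Ctx n)"
  "hs V (lft n \<Gamma>) s \<longleftrightarrow> s = Tm n \<and> hs V \<Gamma> (Ctx n)"
  "hs V (rgt n \<Gamma>) s \<longleftrightarrow> s = Tm n \<and> hs V \<Gamma> (Ctx n)"
  by (auto simp: intv_def lft_def rgt_def)

lemma hs_coe0 [simp]: "hs V (coe0 n \<Gamma> D d) s \<longleftrightarrow> s = Tm n \<and> hs V \<Gamma> (Ctx n) \<and> hs V D (Ctx (Suc (Suc n))) \<and> hs V d (Tm n)"
  by (auto simp: coe0_def numeral_2_eq_2)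

lemma hs_pth [simp]: "hs V \<Gamma> (Ctx n) \<Longrightarrow> hs V A (Ty n) \<Longrightarrow> hs V a (Tm n) \<Longrightarrow> hs V a' (Tm n) \<Longrightarrow> s = Ty n
    \<Longrightarrow> hs V (pth n \<Gamma> A a a') s"
  by (auto simp: pth_def numeral_2_eq_2)

lemma wf_is_map [simp]: "hs V f (Tm (Suc n)) \<Longrightarrow> hs V A (Ty n) \<Longrightarrow> hs V B (Ty n) \<Longrightarrow> wf_atom T0 V (is_map n A B f)"
  by (simp add: is_map_def)

lemma wf_is_retr [simp]:
  "hs V A (Ty n) \<Longrightarrow> hs V g (Tm (Suc n)) \<Longrightarrow> hs V f (Tm (Suc n)) \<Longrightarrow> hs V p (Tm (Suc n))
    \<Longrightarrow> wf_atom T0 V (is_retr n A g f p)"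
  by (simp add: is_retr_def)

lemma wf_cmor:
  assumes "hs V \<Gamma> (Ctx n)" "hs V \<Delta> (Ctx k)" "length as = k" "\<forall>a \<in> set as. hs V a (Tm n)" "\<alpha> \<in> set (cmor n k \<Gamma> \<Delta> as)"
  shows "wf_atom T0 V \<alpha>"
proof -
  obtain i where i: "i < k" "\<alpha> = Eq (ty n (as ! i)) (sb KTy n i \<Gamma> (ftn (Suc i) (k - Suc i) \<Delta>) (take i as))"
    using assms(5) by (auto simp: cmor_def)
  have "hs V (ftn (Suc i) (k - Suc i) \<Delta>) (Ctx (Suc i))"
    by (rule hs_ftn'[OF assms(2)]) (use i in simp)
  then show ?thesis
    using assms i by (auto simp: list_all2_replicate2 dest: in_set_takeD)
qed

text \<open>The axioms of \<open>T0\<close> have to be well sorted because truth in a reduct agrees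
  with truth of the translation for well-sorted formulas, cf. \<open>holds_reduct\<close>.\<close>

definition wf_ax :: "(sort, t0, unit) sequent \<Rightarrow> bool" where
  "wf_ax = (\<lambda>(V, \<phi>, \<psi>). \<forall>\<alpha> \<in> set \<phi> \<union> set \<psi>. wf_atom T0 V \<alpha>)"

lemma wf_prem_concl:
  assumes xs: "list_all2 (hs V) xs (Ctx n # map (shift n) (cdom c))"
  shows "wf_ax (V, prem c n xs, [dfd (cn c n xs), concl c n xs])"
  using xs by (cases c)
    (auto simp: wf_ax_def list_all2_Cons2 numeral_2_eq_2)

lemma list_all2_tvars:
  assumes "length V1 = i"
  shows "list_all2 (hs (V1 @ W @ V2)) (tvars i (length W)) W"
  using assms by (auto simp: list_all2_conv_all_nth nth_append)

lemma stab_env: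
  fixes ss :: "sort list" and l m :: nat
  defines "V \<equiv> stab_vars l m ss"
  shows "hs V (Tvar 0) (Ctx l)" "hs V (Tvar 1) (Ctx m)" "\<forall>a \<in> set (tvars 2 m). hs V a (Tm l)"
    "list_all2 (hs V) (tvars (2 + m) (length ss)) (map (shift m) ss)"
proof -
  show "hs V (Tvar 0) (Ctx l)" "hs V (Tvar 1) (Ctx m)"
    by (simp_all add: V_def stab_vars_def)
  have "list_all2 (hs ([Ctx l, Ctx m] @ replicate m (Tm l) @ map (shift m) ss)) (tvars 2 (length (replicate m (Tm l)))) (replicate m (Tm l))"
    by (rule list_all2_tvars) simp
  then show "\<forall>a \<in> set (tvars 2 m). hs V a (Tm l)"
    by (simp add: V_def stab_vars_def list_all2_replicate2)
  have "list_all2 (hs (([Ctx l, Ctx m] @ replicate m (Tm l)) @ map (shift m) ss @ [])) (tvars (2 + m) (length (map (shift m) ss))) (map (shift m) ss)"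
    by (rule list_all2_tvars) simp
  then show "list_all2 (hs V) (tvars (2 + m) (length ss)) (map (shift m) ss)"
    by (simp add: V_def stab_vars_def)
qed

lemma hs_stab_pull:
  assumes "hs (stab_vars l m ss) t (shift m s)"
  shows "hs (stab_vars l m ss) (stab_pull l m s t) (shift l s)"
  unfolding stab_pull_def by (rule hs_pull) (use stab_env[where l = l and m = m and ss = ss] assms in \<open>simp_all del: has_sort_Tvar\<close>)

lemma hs_stab_src: "list_all2 (hs (stab_vars l m ss)) (stab_src m ss) (Ctx m # map (shift m) ss)"
  using stab_env[where l = l and m = m and ss = ss] by (simp add: stab_src_def)

lemma hs_stab_tgt: "list_all2 (hs (stab_vars l m ss)) (stab_tgt l m ss) (Ctx l # map (shift l) ss)"
proof -
  have "list_all2 (hs (stab_vars l m ss)) (map2 (stab_pull l m) ss ts) (map (shift l) ss)"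
    if "list_all2 (hs (stab_vars l m ss)) ts (map (shift m) ss)" for ts
    using that by (auto simp: list_all2_conv_all_nth intro!: hs_stab_pull)
  then show ?thesis
    using stab_env[where l = l and m = m and ss = ss] by (simp add: stab_tgt_def)
qed

lemma wf_stab_mor: "\<alpha> \<in> set (stab_mor l m) \<Longrightarrow> wf_atom T0 (stab_vars l m ss) \<alpha>"
  unfolding stab_mor_def by (rule wf_cmor) (use stab_env[where l = l and m = m and ss = ss] in \<open>simp_all del: has_sort_Tvar\<close>)

lemma wf_rule:
  assumes "x \<in> rule_axioms c"
  shows "wf_ax x"
proof -
  have 1: "wf_ax (V, prem c n xs, [dfd (cn c n xs), concl c n xs])"
    if "V = Ctx n # map (shift n) (cdom c)" "xs = tvars 0 (length V)" for V n xs
    using wf_prem_concl[of V xs n c] list_all2_tvars[of "[]" 0 V "[]"] that by simp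
  have 2: "wf_ax (stab_vars l m (cdom c), stab_mor l m @ [dfd (cn c m (stab_src m (cdom c)))],
             [Eq (cn c l (stab_tgt l m (cdom c))) (stab_pull l m (ccod c) (cn c m (stab_src m (cdom c))))])" for l m
  proof -
    have "hs (stab_vars l m (cdom c)) (cn c m (stab_src m (cdom c))) (shift m (ccod c))"
      using hs_stab_src by simp
    then show ?thesis
      using wf_stab_mor[of _ l m "cdom c"] hs_stab_pull hs_stab_tgt by (auto simp: wf_ax_def)
  qed
  show ?thesis
    using assms 1 2 unfolding rule_axioms_def Let_def by (auto simp: wf_ax_def)
qed

lemma wf_rule':
  assumes "(V, \<phi>, \<psi>) \<in> rule_axioms c" "\<alpha> \<in> set \<phi> \<or> \<alpha> \<in> set \<psi>"
  shows "wf_atom T0 V \<alpha>"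
  using wf_rule[OF assms(1)] assms(2) by (auto simp: wf_ax_def)

lemma nth_replicate_append: "i < m + k \<Longrightarrow> (replicate m a @ replicate k b) ! i = (if i < m then a else b)"
  by (simp add: nth_append)

lemma wf_subst:
  assumes "x \<in> subst_axioms"
  shows "wf_ax x"
  using assms unfolding subst_axioms_def Let_def
  apply (elim UnE UN_E)
  by (auto simp: wf_ax_def)
    ((erule hs_vars[rotated]; simp; fail) | (simp add: nth_replicate_append less_diff_conv2; fail) |
     (erule wf_cmor[rotated 4]; auto simp: nth_replicate_append less_diff_conv2; fail))+

lemma wf_coe1: "x \<in> coe1_axioms \<Longrightarrow> wf_ax x"
  unfolding coe1_axioms_def
  by (auto simp: wf_ax_def Let_def numeral_2_eq_2 intro: wf_rule')

lemma wf_sigma: "x \<in> sigma_axioms \<Longrightarrow> wf_ax x"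
  unfolding sigma_axioms_def
  by (auto simp: wf_ax_def Let_def numeral_2_eq_2)

lemma wf_path: "x \<in> path_axioms \<Longrightarrow> wf_ax x"
  unfolding path_axioms_def
  by (auto simp: wf_ax_def Let_def numeral_2_eq_2 intro: wf_rule')

lemma wf_Sigma: "x \<in> Sigma_axioms \<Longrightarrow> wf_ax x"
  unfolding Sigma_axioms_def
  by (auto simp: wf_ax_def Let_def numeral_2_eq_2 intro: wf_rule')

lemma wf_wua: "x \<in> wua_axioms \<Longrightarrow> wf_ax x"
  unfolding wua_axioms_def
  by (auto simp: wf_ax_def Let_def numeral_2_eq_2 intro: wf_rule')

theorem wf_T0: "wf_theory T0"
  using wf_subst wf_coe1 wf_sigma wf_path wf_wua wf_Sigma
  unfolding wf_theory_def T0_def wf_ax_def by (simp, blast)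

lemma subst_axiomsI:
  "([], [], [dfd emp]) \<in> subst_axioms"
  "([Ctx 0], [], [Eq (Tvar 0) emp]) \<in> subst_axioms"
  "([Ty n], [], [dfd (ft n (Tvar 0))]) \<in> subst_axioms"
  "([Tm n], [], [dfd (ty n (Tvar 0))]) \<in> subst_axioms"
  "i < n \<Longrightarrow> ([Ctx n], [], [Eq (ty n (vr n i (Tvar 0)))
       (sb KTy n (n - Suc i) (Tvar 0) (ftn (n - i) i (Tvar 0)) (vars n (Suc i) (Tvar 0)))]) \<in> subst_axioms"
  "(Ctx n # ksort p k # replicate k (Tm n), [dfd (sb p n k (Tvar 0) (Tvar 1) (tvars 2 k))],
      cmor n k (Tvar 0) (kctx p k (Tvar 1)) (tvars 2 k)) \<in> subst_axioms"
  "(Ctx n # ksort p k # replicate k (Tm n), cmor n k (Tvar 0) (kctx p k (Tvar 1)) (tvars 2 k),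
      [dfd (sb p n k (Tvar 0) (Tvar 1) (tvars 2 k))]) \<in> subst_axioms"
  "(Ctx n # Ty k # replicate k (Tm n), [dfd (sb KTy n k (Tvar 0) (Tvar 1) (tvars 2 k))],
      [Eq (ft n (sb KTy n k (Tvar 0) (Tvar 1) (tvars 2 k))) (Tvar 0)]) \<in> subst_axioms"
  "(Ctx n # Tm k # replicate k (Tm n), [dfd (sb KTm n k (Tvar 0) (Tvar 1) (tvars 2 k))],
      [Eq (ty n (sb KTm n k (Tvar 0) (Tvar 1) (tvars 2 k)))
         (sb KTy n k (Tvar 0) (ty k (Tvar 1)) (tvars 2 k))]) \<in> subst_axioms"
  "i < k \<Longrightarrow> (Ctx n # Ctx k # replicate k (Tm n), cmor n k (Tvar 0) (Tvar 1) (tvars 2 k),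
      [Eq (sb KTm n k (Tvar 0) (vr k i (Tvar 1)) (tvars 2 k)) (tvars 2 k ! (k - Suc i))]) \<in> subst_axioms"
  "([ksort p n], [], [Eq (sb p n n (kctx p n (Tvar 0)) (Tvar 0) (vars n 0 (kctx p n (Tvar 0)))) (Tvar 0)]) \<in> subst_axioms"
  "(Ctx n # Ctx m # ksort p k # replicate m (Tm n) @ replicate k (Tm m),
      cmor n m (Tvar 0) (Tvar 1) (tvars 3 m) @ [dfd (sb p m k (Tvar 1) (Tvar 2) (tvars (3 + m) k))],
      [Eq (sb p n m (Tvar 0) (sb p m k (Tvar 1) (Tvar 2) (tvars (3 + m) k)) (tvars 3 m))
        (sb p n k (Tvar 0) (Tvar 2) (map (\<lambda>a. sb KTm n m (Tvar 0) a (tvars 3 m)) (tvars (3 + m) k)))]) \<in> subst_axioms"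
  unfolding subst_axioms_def Let_def
  subgoal by simp
  subgoal by simp
  subgoal by (rule UnI1, rule UnI1, rule UnI1, rule UnI1, rule UnI1, rule UnI1, rule UnI2) blast
  subgoal by (rule UnI1, rule UnI1, rule UnI1, rule UnI1, rule UnI1, rule UnI1, rule UnI2) blast
  subgoal by (rule UnI1, rule UnI1, rule UnI1, rule UnI1, rule UnI1, rule UnI2) blast
  subgoal by (rule UnI1, rule UnI1, rule UnI1, rule UnI1, rule UnI2) blast
  subgoal by (rule UnI1, rule UnI1, rule UnI1, rule UnI1, rule UnI2) blast
  subgoal by (rule UnI1, rule UnI1, rule UnI1, rule UnI2) blast
  subgoal by (rule UnI1, rule UnI1, rule UnI1, rule UnI2) blast
  subgoal by (rule UnI1, rule UnI1, rule UnI2) blast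
  subgoal by (rule UnI1, rule UnI2) blast
  subgoal by (rule UnI2) blast
  done

section \<open>The category of contexts of a model\<close>

locale t0_model =
  fixes M :: "(sort, t0, unit, 'x) struct"
  assumes model: "is_model T0 M"
begin

abbreviation K :: "sort \<Rightarrow> 'x set" where "K \<equiv> car M"

text \<open>Total versions of the partial operations. They are unspecified where the operation is
  undefined; a lemma with prefix \<open>fn_\<close> tells under which hypotheses the value is that
  of the structure.\<close>

definition EMP :: 'x where "EMP = the (fn M (Bas EmpS) [])"
definition FT :: "nat \<Rightarrow> 'x \<Rightarrow> 'x" where "FT n A = the (fn M (Bas (FtS n)) [A])"
definition TY :: "nat \<Rightarrow> 'x \<Rightarrow> 'x" where "TY n a = the (fn M (Bas (TyS n)) [a])"
definition VR :: "nat \<Rightarrow> nat \<Rightarrow> 'x \<Rightarrow> 'x" where "VR n i G = the (fn M (Bas (VarS n i)) [G])"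
definition SB :: "kind \<Rightarrow> nat \<Rightarrow> nat \<Rightarrow> 'x \<Rightarrow> 'x \<Rightarrow> 'x list \<Rightarrow> 'x" where
  "SB p n k G t as = the (fn M (Bas (SubS p n k)) (G # t # as))"

primrec KC :: "kind \<Rightarrow> nat \<Rightarrow> 'x \<Rightarrow> 'x" where
  "KC KTy n t = FT n t" | "KC KTm n t = FT n (TY n t)"

primrec FTN :: "nat \<Rightarrow> nat \<Rightarrow> 'x \<Rightarrow> 'x" where
  "FTN n 0 A = A" | "FTN n (Suc j) A = FTN n j (FT (n + j) A)"

definition VARS :: "nat \<Rightarrow> nat \<Rightarrow> 'x \<Rightarrow> 'x list" where
  "VARS n j G = map (\<lambda>i. VR n i G) (rev [j..<n])"

text \<open>The semantic form of \<open>cmor\<close>. The equations are stated with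
  \<open>Some\<close>, since an equation of partial Horn logic also asserts that both sides are
  defined. Sorts are included here because in the axioms they belong to the variable context and not
  to the formula.\<close>

definition mor :: "nat \<Rightarrow> nat \<Rightarrow> 'x \<Rightarrow> 'x \<Rightarrow> 'x list \<Rightarrow> bool" where
  "mor n k G D as \<longleftrightarrow> G \<in> K (Ctx n) \<and> D \<in> K (Ctx k) \<and> length as = k \<and> (\<forall>a \<in> set as. a \<in> K (Tm n)) \<and>
     (\<forall>i < k. fn M (Bas (SubS KTy n i)) (G # FTN (Suc i) (k - Suc i) D # take i as) = Some (TY n (as ! i)))"

lemma struct: "is_struct T0 M"
  using model by (simp add: is_model_def)

lemma axiom:
  assumes "(V, \<phi>, \<psi>) \<in> axs T0" "env M xs V" "holds M xs \<phi>"
  shows "holds M xs \<psi>"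
  using assms model unfolding is_model_def by fastforce

lemma subst_axiom:
  assumes "(V, \<phi>, \<psi>) \<in> subst_axioms" "env M xs V" "holds M xs \<phi>"
  shows "holds M xs \<psi>"
  using axiom[of V \<phi> \<psi> xs] assms by (simp add: T0_def)

lemma fn_carrier:
  assumes "f \<in> funs T0" "fn M f xs = Some y"
  shows "env M xs (fdom T0 f)" "y \<in> K (fcod T0 f)"
  using struct assms unfolding is_struct_def by blast+

lemma fn_EMP [simp]: "fn M (Bas EmpS) [] = Some EMP"
proof -
  have "([], [], [dfd emp]) \<in> subst_axioms" by (rule subst_axiomsI)
  then have "fn M (Bas EmpS) [] \<noteq> None" using subst_axiom[of "[]" "[]" "[dfd emp]" "[]"] by simp
  then show ?thesis by (auto simp: EMP_def)
qed

lemma EMP [simp]: "EMP \<in> K (Ctx 0)"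
  using fn_carrier[OF _ fn_EMP] by simp

lemma EMP_unique: "G \<in> K (Ctx 0) \<Longrightarrow> G = EMP"
proof -
  assume G: "G \<in> K (Ctx 0)"
  have "([Ctx 0], [], [Eq (Tvar 0) emp]) \<in> subst_axioms" by (rule subst_axiomsI)
  then show ?thesis using subst_axiom[of "[Ctx 0]" "[]" "[Eq (Tvar 0) emp]" "[G]"] G by simp
qed

lemma fn_FT [simp]:
  assumes "A \<in> K (Ty n)"
  shows "fn M (Bas (FtS n)) [A] = Some (FT n A)"
proof -
  have "([Ty n], [], [dfd (ft n (Tvar 0))]) \<in> subst_axioms" by (rule subst_axiomsI)
  then show ?thesis using subst_axiom[of "[Ty n]" "[]" _ "[A]"] assms by (fastforce simp: FT_def)
qed

lemma FT [simp]: "A \<in> K (Ty n) \<Longrightarrow> FT n A \<in> K (Ctx n)"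
  using fn_carrier[OF _ fn_FT] by simp

lemma fn_TY [simp]:
  assumes "a \<in> K (Tm n)"
  shows "fn M (Bas (TyS n)) [a] = Some (TY n a)"
proof -
  have "([Tm n], [], [dfd (ty n (Tvar 0))]) \<in> subst_axioms" by (rule subst_axiomsI)
  then show ?thesis using subst_axiom[of "[Tm n]" "[]" _ "[a]"] assms by (fastforce simp: TY_def)
qed

lemma TY [simp]: "a \<in> K (Tm n) \<Longrightarrow> TY n a \<in> K (Ty n)"
  using fn_carrier[OF _ fn_TY] by simp

lemma KC [simp]: "t \<in> K (ksort p n) \<Longrightarrow> KC p n t \<in> K (Ctx n)"
  by (cases p) auto

lemma FTN [simp]: "A \<in> K (Ctx (n + j)) \<Longrightarrow> FTN n j A \<in> K (Ctx n)"
  by (induction j arbitrary: A) auto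

lemma ev_ftn: "ev M xs t = Some A \<Longrightarrow> A \<in> K (Ctx (n + j)) \<Longrightarrow> ev M xs (ftn n j t) = Some (FTN n j A)"
  by (induction j arbitrary: t A) auto

lemma ev_kctx: "ev M xs t = Some a \<Longrightarrow> a \<in> K (ksort p n) \<Longrightarrow> ev M xs (kctx p n t) = Some (KC p n a)"
  by (cases p) auto

lemma map_ev_Tvar [simp]: "j \<le> length xs \<Longrightarrow> map (ev M xs \<circ> Tvar) [i..<j] = map Some (take (j - i) (drop i xs))"
  by (rule nth_equalityI) auto

lemma map_ev_tvars: "i + k \<le> length xs \<Longrightarrow> map (ev M xs) (tvars i k) = map Some (take k (drop i xs))"
  by (rule nth_equalityI) auto

lemma map_nth_eq: "map f xs = map Some ys \<Longrightarrow> i < length xs \<Longrightarrow> f (xs ! i) = Some (ys ! i)"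
  by (metis length_map nth_map)

lemma holds_cmor:
  assumes "ev M xs \<Gamma> = Some G" "ev M xs \<Delta> = Some D" "map (ev M xs) ts = map Some as"
    "G \<in> K (Ctx n)" "D \<in> K (Ctx k)" "length as = k" "\<forall>a \<in> set as. a \<in> K (Tm n)"
  shows "holds M xs (cmor n k \<Gamma> \<Delta> ts) \<longleftrightarrow> mor n k G D as"
proof -
  have "ev M xs (ty n (ts ! i)) = Some (TY n (as ! i)) \<and>
      ev M xs (sb KTy n i \<Gamma> (ftn (Suc i) (k - Suc i) \<Delta>) (take i ts)) =
        fn M (Bas (SubS KTy n i)) (G # FTN (Suc i) (k - Suc i) D # take i as)" if i: "i < k" for i
  proof -
    have "length ts = k" using assms map_eq_imp_length_eq[OF assms(3)] by simp
    then have "ev M xs (ts ! i) = Some (as ! i)" using map_nth_eq[OF assms(3)] i by simp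
    moreover have "as ! i \<in> K (Tm n)" using assms i by simp
    moreover have "map (ev M xs) (take i ts) = map Some (take i as)"
      using assms(3) by (simp flip: take_map)
    moreover have "ev M xs (ftn (Suc i) (k - Suc i) \<Delta>) = Some (FTN (Suc i) (k - Suc i) D)"
      using ev_ftn[OF assms(2), of "Suc i" "k - Suc i"] assms i by simp
    ultimately show ?thesis using assms by simp
  qed
  then show ?thesis
    using assms by (auto simp: holds_def cmor_def mor_def)
qed

lemma env_SubS:
  "env M (G # t # as) (Ctx n # ksort p k # replicate k (Tm n)) \<longleftrightarrow>
    G \<in> K (Ctx n) \<and> t \<in> K (ksort p k) \<and> length as = k \<and> (\<forall>a \<in> set as. a \<in> K (Tm n))"
  by auto

lemma tvars2: "length as = k \<Longrightarrow> map (ev M (G # t # as)) (tvars 2 k) = map Some as"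
  using map_ev_tvars[of 2 k "G # t # as"] by simp

lemma SB_iff:
  assumes e: "G \<in> K (Ctx n)" "t \<in> K (ksort p k)" "length as = k" "\<forall>a \<in> set as. a \<in> K (Tm n)"
  shows "fn M (Bas (SubS p n k)) (G # t # as) \<noteq> None \<longleftrightarrow> mor n k G (KC p k t) as"
proof -
  let ?V = "Ctx n # ksort p k # replicate k (Tm n)"
  let ?t = "sb p n k (Tvar 0) (Tvar 1) (tvars 2 k)" and ?c = "cmor n k (Tvar 0) (kctx p k (Tvar 1)) (tvars 2 k)"
  have "env M (G # t # as) ?V" using e by (simp add: env_SubS)
  then have "holds M (G # t # as) [dfd ?t] \<longleftrightarrow> holds M (G # t # as) ?c"
    using subst_axiom[OF subst_axiomsI(6)] subst_axiom[OF subst_axiomsI(7)] by blast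
  moreover have "ev M (G # t # as) ?t = fn M (Bas (SubS p n k)) (G # t # as)"
    using tvars2[of as k G t] e by simp
  moreover have "holds M (G # t # as) ?c \<longleftrightarrow> mor n k G (KC p k t) as"
    by (rule holds_cmor) (use e in \<open>auto simp: ev_kctx tvars2 simp del: One_nat_def\<close>)
  ultimately show ?thesis by simp
qed

lemma mor_carrier: "mor n k G D as \<Longrightarrow> G \<in> K (Ctx n) \<and> D \<in> K (Ctx k) \<and> length as = k \<and> (\<forall>a \<in> set as. a \<in> K (Tm n))"
  by (simp add: mor_def)

lemma fn_SB [simp]:
  assumes "t \<in> K (ksort p k)" "mor n k G (KC p k t) as"
  shows "fn M (Bas (SubS p n k)) (G # t # as) = Some (SB p n k G t as)"
  using SB_iff[of G n t p k as] assms mor_carrier[OF assms(2)] by (auto simp: SB_def)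

text \<open>Typing information is read off from equations: as soon as a substitution is known to
  have a value, its arguments form a context morphism. The types of variables, composites of
  substitutions and components of arrows are handled in this way.\<close>

lemma fn_SB_defined:
  assumes "fn M (Bas (SubS p n k)) (G # t # as) = Some y"
  shows "t \<in> K (ksort p k) \<and> mor n k G (KC p k t) as \<and> y = SB p n k G t as"
proof -
  have "env M (G # t # as) (Ctx n # ksort p k # replicate k (Tm n))"
    using fn_carrier[OF _ assms] by simp
  then have e: "G \<in> K (Ctx n)" "t \<in> K (ksort p k)" "length as = k" "\<forall>a \<in> set as. a \<in> K (Tm n)"
    unfolding env_SubS by blast+
  have "mor n k G (KC p k t) as"
    unfolding SB_iff[OF e, symmetric] using assms by simp
  then show ?thesis
    using e(2) assms by (simp add: SB_def del: fn_SB)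
qed

lemma SB [simp]:
  assumes "t \<in> K (ksort p k)" "mor n k G (KC p k t) as"
  shows "SB p n k G t as \<in> K (ksort p n)"
  using fn_carrier[OF _ fn_SB[OF assms]] by simp

lemma mor_0 [simp]: "mor n 0 G D as \<longleftrightarrow> G \<in> K (Ctx n) \<and> D \<in> K (Ctx 0) \<and> as = []"
  by (auto simp: mor_def)

text \<open>The recursion along \<open>ft\<close>. In \<open>mor\<close> every initial segment is
  cut out of \<open>D\<close> itself; here the shorter ones are cut out of \<open>FT k D\<close>,
  and the two agree.\<close>

lemma mor_snoc: "mor n (Suc k) G D (as @ [a]) \<longleftrightarrow>
    D \<in> K (Ty k) \<and> mor n k G (FT k D) as \<and> a \<in> K (Tm n) \<and> TY n a = SB KTy n k G D as"
proof -
  have 1: "FTN (Suc i) (k - i) D = FTN (Suc i) (k - Suc i) (FT k D)" if "i < k" for i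
    using Suc_diff_Suc[OF that, symmetric] that by simp
  have 2: "mor n (Suc k) G D (as @ [a]) \<longleftrightarrow>
    D \<in> K (Ty k) \<and> mor n k G (FT k D) as \<and> a \<in> K (Tm n) \<and>
     fn M (Bas (SubS KTy n k)) (G # D # as) = Some (TY n a)"
    unfolding mor_def by (auto simp: less_Suc_eq 1 nth_append)
  show ?thesis
  proof (cases "D \<in> K (Ty k) \<and> mor n k G (FT k D) as")
    case True
    then show ?thesis using 2 fn_SB[of D KTy k n G as] by auto
  qed (use 2 in blast)
qed

lemma FT_SB [simp]:
  assumes "A \<in> K (Ty k)" "mor n k G (FT k A) as"
  shows "FT n (SB KTy n k G A as) = G"
proof -
  let ?V = "Ctx n # Ty k # replicate k (Tm n)" and ?t = "sb KTy n k (Tvar 0) (Tvar 1) (tvars 2 k)"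
  have "(?V, [dfd ?t], [Eq (ft n ?t) (Tvar 0)]) \<in> subst_axioms"
    by (rule subst_axiomsI)
  from subst_axiom[OF this, of "G # A # as"] show ?thesis
    using tvars2[of as k G A] assms mor_carrier[OF assms(2)] SB[of A KTy k n G as] by simp
qed

lemma TY_SB [simp]:
  assumes "a \<in> K (Tm k)" "mor n k G (FT k (TY k a)) as"
  shows "TY n (SB KTm n k G a as) = SB KTy n k G (TY k a) as"
proof -
  let ?V = "Ctx n # Tm k # replicate k (Tm n)" and ?t = "sb KTm n k (Tvar 0) (Tvar 1) (tvars 2 k)"
  have "(?V, [dfd ?t], [Eq (ty n ?t) (sb KTy n k (Tvar 0) (ty k (Tvar 1)) (tvars 2 k))]) \<in> subst_axioms"
    by (rule subst_axiomsI)
  from subst_axiom[OF this, of "G # a # as"] show ?thesis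
    using tvars2[of as k G a] assms mor_carrier[OF assms(2)] SB[of a KTm k n G as] by simp
qed

lemma fn_VR [simp]:
  assumes "G \<in> K (Ctx n)" "i < n"
  shows "fn M (Bas (VarS n i)) [G] = Some (VR n i G)"
proof -
  have "([Ctx n], [], [Eq (ty n (vr n i (Tvar 0)))
                 (sb KTy n (n - Suc i) (Tvar 0) (ftn (n - i) i (Tvar 0)) (vars n (Suc i) (Tvar 0)))]) \<in> subst_axioms"
    by (rule subst_axiomsI) (use assms in simp)
  from subst_axiom[OF this, of "[G]"] show ?thesis
    using assms by (cases "fn M (Bas (VarS n i)) [G]") (auto simp: VR_def)
qed

lemma VR [simp]: "G \<in> K (Ctx n) \<Longrightarrow> i < n \<Longrightarrow> VR n i G \<in> K (Tm n)"
  using fn_carrier[OF _ fn_VR] by simp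

lemma ev_vars: "ev M xs \<Gamma> = Some G \<Longrightarrow> G \<in> K (Ctx n) \<Longrightarrow> map (ev M xs) (vars n j \<Gamma>) = map Some (VARS n j G)"
  by (auto simp: vars_def VARS_def)

lemma TY_VR:
  assumes "G \<in> K (Ctx n)" "i < n"
  shows "mor n (n - Suc i) G (FT (n - Suc i) (FTN (n - i) i G)) (VARS n (Suc i) G)"
    "TY n (VR n i G) = SB KTy n (n - Suc i) G (FTN (n - i) i G) (VARS n (Suc i) G)"
proof -
  have "([Ctx n], [], [Eq (ty n (vr n i (Tvar 0)))
                 (sb KTy n (n - Suc i) (Tvar 0) (ftn (n - i) i (Tvar 0)) (vars n (Suc i) (Tvar 0)))]) \<in> subst_axioms"
    by (rule subst_axiomsI) (use assms in simp)
  from subst_axiom[OF this, of "[G]"]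
  have "fn M (Bas (SubS KTy n (n - Suc i))) (G # FTN (n - i) i G # VARS n (Suc i) G) = Some (TY n (VR n i G))"
    using assms ev_vars[of "[G]" "Tvar 0" G n "Suc i"] ev_ftn[of "[G]" "Tvar 0" G "n - i" i] by simp
  from fn_SB_defined[OF this]
  show "mor n (n - Suc i) G (FT (n - Suc i) (FTN (n - i) i G)) (VARS n (Suc i) G)"
    "TY n (VR n i G) = SB KTy n (n - Suc i) G (FTN (n - i) i G) (VARS n (Suc i) G)"
    by simp_all
qed

text \<open>De Bruijn indices count from the right, so the list begins with the oldest variable, and
  dropping its last entry gives the projection to the base.\<close>

lemma VARS_0: "VARS (Suc n) 0 G = VARS (Suc n) 1 G @ [VR (Suc n) 0 G]"
  by (simp add: VARS_def upt_conv_Cons)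

lemma mor_dp [simp]: "A \<in> K (Ty n) \<Longrightarrow> mor (Suc n) n A (FT n A) (VARS (Suc n) (Suc 0) A)"
  using TY_VR(1)[of A "Suc n" 0] by simp

lemma TY_VR0 [simp]: "A \<in> K (Ty n) \<Longrightarrow> TY (Suc n) (VR (Suc n) 0 A) = SB KTy (Suc n) n A A (VARS (Suc n) (Suc 0) A)"
  using TY_VR(2)[of A "Suc n" 0] by simp

lemma mor_id [simp]: "G \<in> K (Ctx n) \<Longrightarrow> mor n n G G (VARS n 0 G)"
  by (cases n) (auto simp: VARS_0[unfolded One_nat_def] mor_snoc, simp add: VARS_def)

lemma SB_VR [simp]:
  assumes "mor n k G D as" "i < k"
  shows "SB KTm n k G (VR k i D) as = as ! (k - Suc i)"
proof -
  let ?V = "Ctx n # Ctx k # replicate k (Tm n)"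
  have "(?V, cmor n k (Tvar 0) (Tvar 1) (tvars 2 k),
       [Eq (sb KTm n k (Tvar 0) (vr k i (Tvar 1)) (tvars 2 k)) (tvars 2 k ! (k - Suc i))]) \<in> subst_axioms"
    by (rule subst_axiomsI) (use assms in simp)
  from subst_axiom[OF this, of "G # D # as"]
  have "fn M (Bas (SubS KTm n k)) (G # VR k i D # as) = Some (as ! (k - Suc i))"
    using tvars2[of as k G D] assms mor_carrier[OF assms(1)] holds_cmor[of "G # D # as" "Tvar 0" G "Tvar 1" D "tvars 2 k" as n k]
    by auto
  from fn_SB_defined[OF this] show ?thesis by simp
qed

lemma SB_VARS [simp]:
  assumes "mor n k G D as" "j \<le> k"
  shows "map (\<lambda>a. SB KTm n k G a as) (VARS k j D) = take (k - j) as"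
  using assms mor_carrier[OF assms(1)]
  by (intro nth_equalityI) (auto simp: VARS_def rev_nth)

lemma SB_id [simp]:
  assumes "t \<in> K (ksort p n)" "KC p n t = G"
  shows "SB p n n G t (VARS n 0 G) = t"
proof -
  have "([ksort p n], [], [Eq (sb p n n (kctx p n (Tvar 0)) (Tvar 0) (vars n 0 (kctx p n (Tvar 0)))) (Tvar 0)]) \<in> subst_axioms"
    by (rule subst_axiomsI)
  from subst_axiom[OF this, of "[t]"] show ?thesis
    using assms ev_vars[of "[t]" "kctx p n (Tvar 0)" G n 0] ev_kctx[of "[t]" "Tvar 0" t p n] mor_id[of G n] by auto
qed

text \<open>The axiom for iterated substitution asserts that both sides are defined. The second
  conclusion, that composing componentwise gives a context morphism, is read off from the right-hand
  side.\<close>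

lemma SB_comp:
  assumes t: "t \<in> K (ksort p k)" and b: "mor n m G D bs" and a: "mor m k D (KC p k t) as"
  shows "SB p n m G (SB p m k D t as) bs = SB p n k G t (map (\<lambda>a. SB KTm n m G a bs) as)"
    "mor n k G (KC p k t) (map (\<lambda>a. SB KTm n m G a bs) as)"
proof -
  let ?xs = "G # D # t # bs @ as"
  let ?V = "Ctx n # Ctx m # ksort p k # replicate m (Tm n) @ replicate k (Tm m)"
  let ?b = "tvars 3 m" and ?a = "tvars (3 + m) k"
  have ax: "(?V, cmor n m (Tvar 0) (Tvar 1) ?b @ [dfd (sb p m k (Tvar 1) (Tvar 2) ?a)],
             [Eq (sb p n m (Tvar 0) (sb p m k (Tvar 1) (Tvar 2) ?a) ?b)
                 (sb p n k (Tvar 0) (Tvar 2) (map (\<lambda>a. sb KTm n m (Tvar 0) a ?b) ?a))]) \<in> subst_axioms"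
    by (rule subst_axiomsI)
  note ca = mor_carrier[OF a] and cb = mor_carrier[OF b]
  have eb: "map (ev M ?xs) ?b = map Some bs" and ea: "map (ev M ?xs) ?a = map Some as"
    using map_ev_tvars[of 3 m ?xs] map_ev_tvars[of "3 + m" k ?xs] ca cb
    by (simp_all add: numeral_3_eq_3)
  \<comment> \<open>The type of each component is itself the result of a substitution into the
    context \<open>D\<close>, hence the component lies over \<open>D\<close>.\<close>
  have ctx: "FT m (TY m c) = D" if c: "c \<in> set as" for c
  proof -
    obtain i where i: "i < k" "c = as ! i" using c ca unfolding in_set_conv_nth by blast
    then have "fn M (Bas (SubS KTy m i)) (D # FTN (Suc i) (k - Suc i) (KC p k t) # take i as) = Some (TY m c)"
      using a unfolding mor_def by blast
    from fn_SB_defined[OF this] show ?thesis by auto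
  qed
  have em: "map (ev M ?xs) (map (\<lambda>a. sb KTm n m (Tvar 0) a ?b) ?a) = map Some (map (\<lambda>a. SB KTm n m G a bs) as)"
  proof (rule nth_equalityI)
    fix i assume i: "i < length (map (ev M ?xs) (map (\<lambda>a. sb KTm n m (Tvar 0) a ?b) ?a))"
    then have "ev M ?xs (?a ! i) = Some (as ! i)" using map_nth_eq[OF ea, of i] by simp
    moreover have "as ! i \<in> set as" using i ca by simp
    ultimately show "map (ev M ?xs) (map (\<lambda>a. sb KTm n m (Tvar 0) a ?b) ?a) ! i = map Some (map (\<lambda>a. SB KTm n m G a bs) as) ! i"
      using i ca cb b eb ctx[of "as ! i"] by simp
  qed (use ca in simp)
  let ?t = "sb p m k (Tvar 1) (Tvar 2) ?a"
  let ?L = "sb p n m (Tvar 0) ?t ?b" and ?R = "sb p n k (Tvar 0) (Tvar 2) (map (\<lambda>a. sb KTm n m (Tvar 0) a ?b) ?a)"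
  have env: "env M ?xs ?V"
    using ca cb t by (auto simp: list_all2_append)
  have hc: "holds M ?xs (cmor n m (Tvar 0) (Tvar 1) ?b)"
    using holds_cmor[of ?xs "Tvar 0" G "Tvar 1" D ?b bs n m] eb cb b by simp
  have d: "ev M ?xs ?t = Some (SB p m k D t as)"
    using ea t a by simp
  have "holds M ?xs (cmor n m (Tvar 0) (Tvar 1) ?b @ [dfd ?t])"
    using hc d by (simp only: holds_append holds_Cons holds_Nil holds1.simps option.simps simp_thms)
  then have "holds M ?xs [Eq ?L ?R]"
    by (rule subst_axiom[OF ax env])
  then have "ev M ?xs ?L = ev M ?xs ?R"
    by (simp only: holds_Cons holds1.simps)
  moreover have "KC p m (SB p m k D t as) = D"
    using t a by (cases p) auto
  then have "ev M ?xs ?L = Some (SB p n m G (SB p m k D t as) bs)"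
    using eb d t a b by simp
  moreover have "ev M ?xs ?R = fn M (Bas (SubS p n k)) (G # t # map (\<lambda>a. SB KTm n m G a bs) as)"
    using em by (simp del: map_map)
  ultimately have e: "fn M (Bas (SubS p n k)) (G # t # map (\<lambda>a. SB KTm n m G a bs) as) = Some (SB p n m G (SB p m k D t as) bs)"
    by (simp only:)
  from fn_SB_defined[OF e] show "SB p n m G (SB p m k D t as) bs = SB p n k G t (map (\<lambda>a. SB KTm n m G a bs) as)"
    "mor n k G (KC p k t) (map (\<lambda>a. SB KTm n m G a bs) as)"
    by simp_all
qed

end

text \<open>An object is a context with its length; an arrow consists of its domain, its codomain and its list of
  terms. A term is stored with the length of its context, like a context.\<close>

type_synonym 'x ob = "nat \<times> 'x"
type_synonym 'x ar = "'x ob \<times> 'x ob \<times> 'x list"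

context t0_model
begin

abbreviation dm :: "'x ar \<Rightarrow> 'x ob" where "dm f \<equiv> fst f"
abbreviation cd :: "'x ar \<Rightarrow> 'x ob" where "cd f \<equiv> fst (snd f)"
abbreviation ls :: "'x ar \<Rightarrow> 'x list" where "ls f \<equiv> snd (snd f)"

definition ctx :: "'x ob \<Rightarrow> bool" where "ctx G \<longleftrightarrow> snd G \<in> K (Ctx (fst G))"
definition cmo :: "'x ar \<Rightarrow> bool" where
  "cmo f \<longleftrightarrow> mor (fst (dm f)) (fst (cd f)) (snd (dm f)) (snd (cd f)) (ls f)"
definition trm :: "'x ob \<Rightarrow> bool" where "trm a \<longleftrightarrow> snd a \<in> K (Tm (fst a))"
definition tty :: "'x ob \<Rightarrow> 'x ob" where "tty a = (Suc (fst a), TY (fst a) (snd a))"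
text \<open>The subtraction only serves to make the function total: on contexts of length zero the
  second component is unspecified.\<close>

definition bs :: "'x ob \<Rightarrow> 'x ob" where "bs A = (fst A - 1, FT (fst A - 1) (snd A))"
definition cid :: "'x ob \<Rightarrow> 'x ar" where "cid G = (G, G, VARS (fst G) 0 (snd G))"
definition tms :: "'x ob \<Rightarrow> 'x ar \<Rightarrow> 'x ob" where
  "tms a f = (fst (dm f), SB KTm (fst (dm f)) (fst (cd f)) (snd (dm f)) (snd a) (ls f))"
text \<open>Substitution in a type, read as the canonical pullback of the extended context along
  \<open>f\<close>; it will be the \<open>pb\<close> of the locale, with \<open>pq\<close> as the
  upper side of the square.\<close>

definition pb :: "'x ob \<Rightarrow> 'x ar \<Rightarrow> 'x ob" where
  "pb A f = (Suc (fst (dm f)), SB KTy (fst (dm f)) (fst (cd f)) (snd (dm f)) (snd A) (ls f))"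
definition cc :: "'x ar \<Rightarrow> 'x ar \<Rightarrow> 'x ar" where
  "cc g f = (dm f, cd g, map (\<lambda>a. SB KTm (fst (dm f)) (fst (cd f)) (snd (dm f)) a (ls f)) (ls g))"
definition dsp :: "'x ob \<Rightarrow> 'x ar" where "dsp A = (A, bs A, VARS (fst A) 1 (snd A))"
definition v0 :: "'x ob \<Rightarrow> 'x ob" where "v0 A = (fst A, VR (fst A) 0 (snd A))"
definition ex :: "'x ob \<Rightarrow> 'x ar \<Rightarrow> 'x ob \<Rightarrow> 'x ar" where "ex A s a = (dm s, A, ls s @ [snd a])"
definition lst :: "'x ar \<Rightarrow> 'x ob" where "lst k = (fst (dm k), last (ls k))"
definition pq :: "'x ob \<Rightarrow> 'x ar \<Rightarrow> 'x ar" where "pq A f = ex A (cc f (dsp (pb A f))) (v0 (pb A f))"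

abbreviation ltyp :: "'x ob \<Rightarrow> bool" where "ltyp A \<equiv> ctx A \<and> fst A \<noteq> 0"

lemma ltyp_Suc: "ltyp A \<Longrightarrow> \<exists>n x. A = (Suc n, x) \<and> x \<in> K (Ty n)"
  by (cases A; cases "fst A") (auto simp: ctx_def)

lemma cid [simp]: "ctx G \<Longrightarrow> cmo (cid G)" "dm (cid G) = G" "cd (cid G) = G"
  by (auto simp: ctx_def cmo_def cid_def)

lemma cmo_ctx [simp]: "cmo f \<Longrightarrow> ctx (dm f)" "cmo f \<Longrightarrow> ctx (cd f)"
  using mor_carrier by (auto simp: ctx_def cmo_def)

lemma bs [simp]: "ltyp A \<Longrightarrow> ctx (bs A)"
  using ltyp_Suc[of A] by (auto simp: bs_def ctx_def)

lemma dsp [simp]: "ltyp A \<Longrightarrow> cmo (dsp A)" "dm (dsp A) = A" "cd (dsp A) = bs A"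
  using ltyp_Suc[of A] by (auto simp: bs_def cmo_def dsp_def)

lemma tty [simp]: "trm a \<Longrightarrow> ctx (tty a)" "0 < fst (tty a)" "fst (tty a) = Suc (fst a)"
  by (auto simp: trm_def tty_def ctx_def)

lemma fst_bs_tty [simp]: "fst (bs (tty a)) = fst a"
  by (auto simp: tty_def bs_def)

lemma pb [simp]:
  assumes "ltyp A" "cmo f" "cd f = bs A"
  shows "ctx (pb A f)" "bs (pb A f) = dm f"
  using assms ltyp_Suc[of A] SB[of _ KTy] FT_SB by (auto simp: bs_def pb_def ctx_def cmo_def simp del: SB FT_SB)

lemma fst_pb [simp]: "fst (pb A f) = Suc (fst (dm f))"
  by (simp add: pb_def)

lemma tms [simp]:
  assumes "trm a" "cmo f" "cd f = bs (tty a)"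
  shows "trm (tms a f)" "tty (tms a f) = pb (tty a) f"
  using assms SB[of _ KTm] TY_SB by (auto simp: bs_def tty_def pb_def tms_def trm_def cmo_def simp del: SB TY_SB)

lemma fst_tms [simp]: "fst (tms a f) = fst (dm f)"
  by (simp add: tms_def)

lemma v0 [simp]: "ltyp A \<Longrightarrow> trm (v0 A)" "ltyp A \<Longrightarrow> tty (v0 A) = pb A (dsp A)"
  using ltyp_Suc[of A] by (auto simp: v0_def trm_def tty_def pb_def dsp_def bs_def)

text \<open>For a codomain of positive length \<open>SB_comp\<close>, applied to the last type of
  the codomain, yields both the condition on the shorter list and the type that the last term must
  have.\<close>

lemma cc [simp]: "cmo f \<Longrightarrow> cmo g \<Longrightarrow> cd f = dm g \<Longrightarrow> cmo (cc g f)" "dm (cc g f) = dm f" "cd (cc g f) = cd g"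
proof -
  show "cmo (cc g f)" if f: "cmo f" "cmo g" "cd f = dm g"
  proof (cases "fst (cd g)")
    case 0
    then show ?thesis using f mor_carrier[of "fst (dm f)"] by (auto simp: cmo_def cc_def)
  next
    case (Suc k)
    obtain as a where l: "ls g = as @ [a]"
      using mor_carrier f Suc unfolding cmo_def by (metis append_butlast_last_id length_0_conv nat.distinct(1))
    have g: "snd (cd g) \<in> K (Ty k)" "mor (fst (dm g)) k (snd (dm g)) (FT k (snd (cd g))) as"
      "a \<in> K (Tm (fst (dm g)))" "TY (fst (dm g)) a = SB KTy (fst (dm g)) k (snd (dm g)) (snd (cd g)) as"
      using f(2) unfolding cmo_def l Suc mor_snoc by auto
    have c: "FT (fst (dm g)) (TY (fst (dm g)) a) = snd (dm g)"
      using g by simp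
    note h = SB_comp[where p = KTy, simplified, OF g(1) f(1)[unfolded cmo_def f(3)] g(2)]
    show ?thesis
      using g c h f unfolding cmo_def cc_def l by (simp add: Suc mor_snoc SB[of _ KTm, simplified])
  qed
qed (simp_all add: cc_def)

lemma pb_pb [simp]:
  assumes "ltyp A" "cmo f" "cd f = bs A" "cmo g" "cd g = dm f"
  shows "pb (pb A f) g = pb A (cc f g)"
  using ltyp_Suc[of A] assms SB_comp(1)[where p = KTy] by (auto simp: pb_def cc_def bs_def cmo_def)

lemma tms_tms [simp]:
  assumes "trm a" "cmo f" "cd f = bs (tty a)" "cmo g" "cd g = dm f"
  shows "tms (tms a f) g = tms a (cc f g)"
  using assms SB_comp(1)[where p = KTm] by (auto simp: tms_def cc_def bs_def cmo_def trm_def tty_def)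

lemma pb_id [simp]: "ltyp A \<Longrightarrow> bs A = G \<Longrightarrow> pb A (cid G) = A"
  using ltyp_Suc[of A] SB_id[where p = KTy] by (auto simp: pb_def cid_def bs_def)

lemma tms_id [simp]: "trm a \<Longrightarrow> bs (tty a) = G \<Longrightarrow> tms a (cid G) = a"
  using SB_id[where p = KTm] by (auto simp: tms_def cid_def bs_def tty_def trm_def prod_eq_iff)

text \<open>The type of a component results from a substitution along terms over the domain, and
  \<open>ft\<close> of such a type is the domain.\<close>

lemma cmo_trm:
  assumes "cmo f" "a \<in> set (ls f)"
  shows "trm (fst (dm f), a)" "bs (tty (fst (dm f), a)) = dm f"
proof -
  note m = assms(1)[unfolded cmo_def]
  obtain i where i: "i < fst (cd f)" "a = ls f ! i"
    using assms(2) mor_carrier[OF m] unfolding in_set_conv_nth by auto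
  then have "fn M (Bas (SubS KTy (fst (dm f)) i)) (snd (dm f) # FTN (Suc i) (fst (cd f) - Suc i) (snd (cd f)) # take i (ls f)) =
      Some (TY (fst (dm f)) a)"
    using m unfolding mor_def by blast
  from fn_SB_defined[OF this] show "bs (tty (fst (dm f), a)) = dm f"
    by (auto simp: bs_def tty_def)
  show "trm (fst (dm f), a)"
    using mor_carrier[OF m] assms(2) by (auto simp: trm_def)
qed

lemma cc_id [simp]: "cmo f \<Longrightarrow> dm f = G \<Longrightarrow> cc f (cid G) = f"
proof -
  assume f: "cmo f" "dm f = G"
  have "SB KTm (fst G) (fst G) (snd G) a (ls (cid G)) = a" if "a \<in> set (ls f)" for a
    using tms_id[of "(fst G, a)" G] cmo_trm[OF f(1) that] f(2) by (auto simp: tms_def)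
  then show ?thesis
    using f by (auto simp: cc_def prod_eq_iff intro!: map_idI)
qed

lemma id_cc [simp]: "cmo f \<Longrightarrow> cd f = G \<Longrightarrow> cc (cid G) f = f"
  using SB_VARS[of _ _ _ _ _ 0] mor_carrier by (auto simp: cc_def cid_def cmo_def prod_eq_iff)

lemma cc_assoc [simp]:
  assumes "cmo f" "cmo g" "cmo h" "cd f = dm g" "cd g = dm h"
  shows "cc (cc h g) f = cc h (cc g f)"
proof -
  have "SB KTm (fst (dm f)) (fst (cd f)) (snd (dm f)) (SB KTm (fst (dm g)) (fst (cd g)) (snd (dm g)) a (ls g)) (ls f) =
    SB KTm (fst (dm f)) (fst (cd g)) (snd (dm f)) a (ls (cc g f))" if "a \<in> set (ls h)" for a
    using tms_tms[of "(fst (dm h), a)" g f] cmo_trm[OF assms(3) that] assms by (simp add: tms_def cc_def)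
  then show ?thesis
    using assms by (simp add: cc_def prod_eq_iff)
qed

lemma ex:
  assumes "ltyp A" "cmo s" "cd s = bs A" "trm a" "tty a = pb A s"
  shows "cmo (ex A s a)" "cc (dsp A) (ex A s a) = s" "lst (ex A s a) = a"
proof -
  obtain n x where A: "A = (Suc n, x)" "x \<in> K (Ty n)" using ltyp_Suc assms(1) by blast
  have f: "fst a = fst (dm s)" using assms(5) by (auto simp: tty_def pb_def)
  show c: "cmo (ex A s a)"
    using assms A f by (auto simp: ex_def cmo_def mor_snoc trm_def bs_def pb_def tty_def)
  show "cc (dsp A) (ex A s a) = s"
    using SB_VARS[OF c[unfolded cmo_def], of 1] assms A mor_carrier[OF assms(2)[unfolded cmo_def]]
    by (auto simp: cc_def dsp_def ex_def bs_def prod_eq_iff)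
  show "lst (ex A s a) = a" using f by (auto simp: lst_def ex_def prod_eq_iff)
qed

lemma dm_ex [simp]: "dm (ex A s a) = dm s" "cd (ex A s a) = A"
  by (simp_all add: ex_def)

lemma ls_ne: "cmo k \<Longrightarrow> fst (cd k) \<noteq> 0 \<Longrightarrow> ls k \<noteq> []"
  using mor_carrier unfolding cmo_def by fastforce

lemma ltyp_ls: "cmo k \<Longrightarrow> fst (cd k) \<noteq> 0 \<Longrightarrow> ls k = butlast (ls k) @ [last (ls k)]"
  using mor_carrier unfolding cmo_def by (metis append_butlast_last_id length_0_conv)

lemma cc_dsp:
  assumes "cmo k" "ltyp (cd k)"
  shows "cc (dsp (cd k)) k = (dm k, bs (cd k), butlast (ls k))"
proof -
  note m = mor_carrier[OF assms(1)[unfolded cmo_def]]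
  then have "take (fst (cd k) - 1) (ls k) = butlast (ls k)" by (simp add: butlast_conv_take)
  then show ?thesis
    using SB_VARS[OF assms(1)[unfolded cmo_def], of 1] assms by (simp add: cc_def dsp_def)
qed

lemma lst [simp]:
  assumes "cmo k" "ltyp (cd k)" "cd k = A"
  shows "trm (lst k)" "tty (lst k) = pb A (cc (dsp A) k)"
proof -
  obtain n x where A: "cd k = (Suc n, x)" "x \<in> K (Ty n)" using ltyp_Suc assms(2) by blast
  have "mor (fst (dm k)) (Suc n) (snd (dm k)) x (butlast (ls k) @ [last (ls k)])"
    using assms(1,2) A(1) ltyp_ls[of k, symmetric] unfolding cmo_def by simp
  then show "trm (lst k)" "tty (lst k) = pb A (cc (dsp A) k)"
    unfolding mor_snoc using cc_dsp[OF assms(1,2)] A assms(3) by (auto simp: lst_def trm_def tty_def pb_def bs_def)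
qed

lemma fst_lst [simp]: "fst (lst k) = fst (dm k)"
  by (simp add: lst_def)

text \<open>The last term is exactly what composition with the display map forgets. Equalities of
  arrows in a model are proved with this principle, by one equation in the base and one equation of
  terms.\<close>

lemma ex_ext:
  assumes "cmo k" "cmo k'" "cd k = A" "cd k' = A" "dm k = dm k'" "ltyp A"
    "cc (dsp A) k = cc (dsp A) k'" "lst k = lst k'"
  shows "k = k'"
proof -
  have "butlast (ls k) = butlast (ls k')"
    using cc_dsp[OF assms(1)] cc_dsp[OF assms(2)] assms(3,4,6,7) by (metis snd_conv)
  moreover have "last (ls k) = last (ls k')" using assms(8) by (simp add: lst_def)
  ultimately have "ls k = ls k'" using ltyp_ls[OF assms(1)] ltyp_ls[OF assms(2)] assms(3,4,6) by metis
  then show ?thesis using assms by (simp add: prod_eq_iff)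
qed

lemma lst_cc [simp]: "cmo k \<Longrightarrow> fst (cd k) \<noteq> 0 \<Longrightarrow> lst (cc k f) = tms (lst k) f"
  using ls_ne[of k] by (simp add: lst_def tms_def cc_def last_map)

lemma tms_v0 [simp]: "cmo k \<Longrightarrow> cd k = A \<Longrightarrow> fst A \<noteq> 0 \<Longrightarrow> tms (v0 A) k = lst k"
  using mor_carrier[of "fst (dm k)" "fst A" "snd (dm k)" "snd A" "ls k"] SB_VR[of "fst (dm k)" "fst A" "snd (dm k)" "snd A" "ls k" 0] ls_ne[of k]
  by (auto simp: tms_def v0_def lst_def cmo_def last_conv_nth)

lemma ex_lst: "cmo k \<Longrightarrow> ltyp (cd k) \<Longrightarrow> cd k = A \<Longrightarrow> ex A (cc (dsp A) k) (lst k) = k"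
  by (rule ex_ext[of _ _ A]) (auto simp: ex)

lemma pq [simp]:
  assumes "ltyp A" "cmo f" "cd f = bs A"
  shows "cmo (pq A f)" "dm (pq A f) = pb A f" "cd (pq A f) = A" "cc (dsp A) (pq A f) = cc f (dsp (pb A f))"
    "lst (pq A f) = v0 (pb A f)"
  using assms ex[of A "cc f (dsp (pb A f))" "v0 (pb A f)"] by (simp_all add: pq_def)

lemma ctx_0: "ctx G \<Longrightarrow> fst G = 0 \<Longrightarrow> G = (0, EMP)"
  using EMP_unique by (auto simp: ctx_def prod_eq_iff)

lemma cmo_0: "cmo f \<Longrightarrow> cd f = (0, EMP) \<Longrightarrow> f = (dm f, (0, EMP), [])"
  by (auto simp: cmo_def prod_eq_iff)

definition CN :: "con \<Rightarrow> nat \<Rightarrow> 'x list \<Rightarrow> 'x" where "CN c n xs = the (fn M (New (c, n)) xs)"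

lemma rule_axiom:
  assumes "(V, \<phi>, \<psi>) \<in> rule_axioms c" "env M xs V" "holds M xs \<phi>"
  shows "holds M xs \<psi>"
proof -
  have "rule_axioms c \<subseteq> axs T0"
    by (cases c) (auto simp: T0_def coe1_axioms_def path_axioms_def wua_axioms_def Sigma_axioms_def)
  then show ?thesis using axiom[of V \<phi> \<psi> xs] assms by blast
qed

lemma con_intro:
  assumes "V = Ctx n # map (shift n) (cdom c)" "ts = tvars 0 (length V)" "env M xs V" "holds M xs (prem c n ts)"
  shows "holds M xs [dfd (cn c n ts), concl c n ts]"
proof -
  have "(V, prem c n ts, [dfd (cn c n ts), concl c n ts]) \<in> rule_axioms c"
    unfolding rule_axioms_def Let_def assms(1,2) by (rule UnI1) blast
  then show ?thesis using rule_axiom assms by blast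
qed

lemma con_stable:
  assumes "env M xs (stab_vars l m (cdom c))" "holds M xs (stab_mor l m)"
    "ev M xs (cn c m (stab_src m (cdom c))) = Some y"
  shows "ev M xs (cn c l (stab_tgt l m (cdom c))) = ev M xs (stab_pull l m (ccod c) (cn c m (stab_src m (cdom c)))) \<and>
    ev M xs (cn c l (stab_tgt l m (cdom c))) \<noteq> None"
proof -
  let ?t = "cn c m (stab_src m (cdom c))"
  have "(stab_vars l m (cdom c), stab_mor l m @ [dfd ?t],
             [Eq (cn c l (stab_tgt l m (cdom c))) (stab_pull l m (ccod c) ?t)]) \<in> rule_axioms c"
    unfolding rule_axioms_def Let_def by (rule UnI2) blast
  moreover have "holds M xs (stab_mor l m @ [dfd ?t])"
    using assms(2,3) by (simp only: holds_append holds_Cons holds_Nil holds1.simps option.simps simp_thms)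
  ultimately have "holds M xs [Eq (cn c l (stab_tgt l m (cdom c))) (stab_pull l m (ccod c) ?t)]"
    using rule_axiom assms(1) by blast
  then show ?thesis unfolding holds_Cons holds1.simps by blast
qed

lemma ev_cn: "map (ev M xs) ts = map Some ys \<Longrightarrow> ev M xs (Fn f ts) = fn M f ys"
  by simp

lemma upt_simps [simp]: "[0..<Suc n] = 0 # [Suc 0..<Suc n]" "[Suc k..<Suc n] = map Suc [k..<n]"
  by (auto simp: upt_conv_Cons map_Suc_upt)

lemma IntvC:
  assumes "G \<in> K (Ctx n)"
  shows "fn M (New (IntvC, n)) [G] = Some (CN IntvC n [G])" "CN IntvC n [G] \<in> K (Ty n)" "FT n (CN IntvC n [G]) = G"
proof -
  have "holds M [G] [dfd (cn IntvC n [Tvar 0]), concl IntvC n [Tvar 0]]"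
    by (rule con_intro[OF refl]) (use assms in simp_all)
  then show 1: "fn M (New (IntvC, n)) [G] = Some (CN IntvC n [G])"
    by (cases "fn M (New (IntvC, n)) [G]") (auto simp: CN_def)
  then show 2: "CN IntvC n [G] \<in> K (Ty n)" using fn_carrier(2)[OF _ 1] by simp
  show "FT n (CN IntvC n [G]) = G"
    using \<open>holds M [G] _\<close> 1 2 by simp
qed

lemma LeftC:
  assumes "G \<in> K (Ctx n)"
  shows "fn M (New (LeftC, n)) [G] = Some (CN LeftC n [G])" "CN LeftC n [G] \<in> K (Tm n)" "TY n (CN LeftC n [G]) = CN IntvC n [G]"
proof -
  have "holds M [G] [dfd (cn LeftC n [Tvar 0]), concl LeftC n [Tvar 0]]"
    by (rule con_intro[OF refl]) (use assms in simp_all)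
  then show 1: "fn M (New (LeftC, n)) [G] = Some (CN LeftC n [G])"
    by (cases "fn M (New (LeftC, n)) [G]") (auto simp: CN_def)
  then show 2: "CN LeftC n [G] \<in> K (Tm n)" using fn_carrier(2)[OF _ 1] by simp
  show "TY n (CN LeftC n [G]) = CN IntvC n [G]"
    using \<open>holds M [G] _\<close> 1 2 IntvC[OF assms] by (simp add: intv_def)
qed

lemma RightC:
  assumes "G \<in> K (Ctx n)"
  shows "fn M (New (RightC, n)) [G] = Some (CN RightC n [G])" "CN RightC n [G] \<in> K (Tm n)" "TY n (CN RightC n [G]) = CN IntvC n [G]"
proof -
  have "holds M [G] [dfd (cn RightC n [Tvar 0]), concl RightC n [Tvar 0]]"
    by (rule con_intro[OF refl]) (use assms in simp_all)
  then show 1: "fn M (New (RightC, n)) [G] = Some (CN RightC n [G])"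
    by (cases "fn M (New (RightC, n)) [G]") (auto simp: CN_def)
  then show 2: "CN RightC n [G] \<in> K (Tm n)" using fn_carrier(2)[OF _ 1] by simp
  show "TY n (CN RightC n [G]) = CN IntvC n [G]"
    using \<open>holds M [G] _\<close> 1 2 IntvC[OF assms] by (simp add: intv_def)
qed

definition intT :: "'x ob \<Rightarrow> 'x ob" where "intT G = (Suc (fst G), CN IntvC (fst G) [snd G])"
definition leftT :: "'x ob \<Rightarrow> 'x ob" where "leftT G = (fst G, CN LeftC (fst G) [snd G])"
definition rightT :: "'x ob \<Rightarrow> 'x ob" where "rightT G = (fst G, CN RightC (fst G) [snd G])"

lemma intT [simp]: "ctx G \<Longrightarrow> ctx (intT G)" "fst (intT G) = Suc (fst G)" "ctx G \<Longrightarrow> bs (intT G) = G"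
  using IntvC by (auto simp: intT_def ctx_def bs_def prod_eq_iff)

lemma leftT [simp]: "ctx G \<Longrightarrow> trm (leftT G)" "ctx G \<Longrightarrow> tty (leftT G) = intT G"
  using LeftC by (auto simp: leftT_def ctx_def trm_def tty_def intT_def)

lemma rightT [simp]: "ctx G \<Longrightarrow> trm (rightT G)" "ctx G \<Longrightarrow> tty (rightT G) = intT G"
  using RightC by (auto simp: rightT_def ctx_def trm_def tty_def intT_def)

definition one :: "'x ob" where "one = (0, EMP)"

lemma one [simp]: "ctx one" "fst one = 0"
  by (auto simp: one_def ctx_def)

definition sec :: "'x ob \<Rightarrow> 'x ar" where "sec a = ex (tty a) (cid (bs (tty a))) a"

lemma sec [simp]:
  assumes "trm a"
  shows "cmo (sec a)" "dm (sec a) = bs (tty a)" "cd (sec a) = tty a" "cc (dsp (tty a)) (sec a) = cid (bs (tty a))"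
    "lst (sec a) = a"
  using ex[of "tty a" "cid (bs (tty a))" a] assms by (auto simp: sec_def)

text \<open>Opaque names, since the constants of the locale interpretation below contain these terms.\<close>

definition uI :: "'x ob" where "uI = intT one"
definition uL :: "'x ar" where "uL = sec (leftT one)"
definition uR :: "'x ar" where "uR = sec (rightT one)"

lemma uI [simp]: "ctx uI" "fst uI = Suc 0" "bs uI = one"
  by (simp_all add: uI_def)

lemma uL [simp]: "cmo uL" "dm uL = one" "cd uL = uI"
  and uR [simp]: "cmo uR" "dm uR = one" "cd uR = uI"
  using sec[OF leftT(1)[OF one(1)]] sec[OF rightT(1)[OF one(1)]] by (simp_all add: uI_def uL_def uR_def)

text \<open>The mediating arrow of the pullback extends \<open>x\<close> by the last term of
  \<open>k\<close>. It is well typed because substitution is strictly functorial: substituting along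
  the composite of \<open>s\<close> and \<open>x\<close> is substituting along \<open>s\<close> and
  then along \<open>x\<close>.\<close>

sublocale disp_cat ctx fst cmo dm cd cid cc bs dsp pb pq one uI uL uR
proof
  fix a s x k
  assume a: "ctx a" "fst a \<noteq> 0" and s: "cmo s" "cd s = bs a" and xk: "cmo x" "cmo k" "dm k = dm x"
    "cd x = dm s" "cd k = a" and e: "cc (dsp a) k = cc s x"
  have t: "tty (lst k) = pb (pb a s) x" using a s xk e by simp
  note m = ex[of "pb a s" x "lst k"]
  show "\<exists>!m. cmo m \<and> dm m = dm x \<and> cd m = pb a s \<and> cc (dsp (pb a s)) m = x \<and> cc (pq a s) m = k"
  proof (rule ex1I[of _ "ex (pb a s) x (lst k)"])
    have "cc (pq a s) (ex (pb a s) x (lst k)) = k"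
    proof (rule ex_ext[of _ _ a])
      show "cc (dsp a) (cc (pq a s) (ex (pb a s) x (lst k))) = cc (dsp a) k"
        using a s xk e t m cc_assoc[of "ex (pb a s) x (lst k)" "pq a s" "dsp a"]
          cc_assoc[of "ex (pb a s) x (lst k)" "dsp (pb a s)" s] by simp
    qed (use a s xk t m in simp_all)
    then show "cmo (ex (pb a s) x (lst k)) \<and> dm (ex (pb a s) x (lst k)) = dm x \<and> cd (ex (pb a s) x (lst k)) = pb a s \<and>
      cc (dsp (pb a s)) (ex (pb a s) x (lst k)) = x \<and> cc (pq a s) (ex (pb a s) x (lst k)) = k"
      using a s xk t m by simp
  next
    fix m' assume m': "cmo m' \<and> dm m' = dm x \<and> cd m' = pb a s \<and> cc (dsp (pb a s)) m' = x \<and> cc (pq a s) m' = k"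
    have c: "cmo m'" "cd m' = pb a s" using m' by simp_all
    then have "lst (cc (pq a s) m') = lst m'" using a s by simp
    then have "lst m' = lst k" using m' by metis
    moreover have "dm m' = dm x" "cc (dsp (pb a s)) m' = x" using m' by simp_all
    moreover have "cmo (ex (pb a s) x (lst k))" "cc (dsp (pb a s)) (ex (pb a s) x (lst k)) = x"
      "lst (ex (pb a s) x (lst k)) = lst k" using m a s xk t by simp_all
    moreover have "ltyp (pb a s)" using a s by simp
    ultimately show "m' = ex (pb a s) x (lst k)"
      using c ex_ext[of m' "ex (pb a s) x (lst k)" "pb a s"] dm_ex[of "pb a s" x "lst k"] by argo
  qed
next
  fix a assume "ctx a"
  then show "\<exists>!f. cmo f \<and> dm f = a \<and> cd f = one"
    using cmo_0 by (intro ex1I[of _ "(a, one, [])"]) (auto simp: one_def cmo_def ctx_def)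
next
  fix a assume "ctx a" "fst a = 0"
  then show "a = one" by (simp add: ctx_0 one_def)
qed (simp_all add: bs_def[THEN arg_cong, of fst])

end

section \<open>The type and term constructors in a model\<close>

lemma those_snoc_Some [simp]: "those (map Some ys @ [Some b]) = Some (ys @ [b])"
  by (simp add: those_Some_iff)

context t0_model
begin

text \<open>Links the syntax of the rules with the category: instantiating the last variable at
  \<open>b\<close> is substitution along the section \<open>sec b\<close>.\<close>

lemma ev_inst_KTy:
  assumes "ev M xs \<Gamma> = Some (snd G)" "ev M xs t = Some (snd T)" "ev M xs a = Some (snd b)"
    "trm b" "bs (tty b) = G" "ctx T" "fst T \<noteq> 0" "bs T = tty b" "fst G = n"
  shows "ev M xs (inst n KTy \<Gamma> t a) = Some (snd (pb T (sec b)))"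
proof -
  obtain m x where T: "T = (Suc m, x)" using ltyp_Suc assms by blast
  have f: "fst b = n" "m = Suc n" using assms T by (auto simp: bs_def tty_def)
  have c: "cmo (sec b)" "dm (sec b) = G" "cd (sec b) = tty b"
    using sec[OF assms(4)] assms(5) by simp_all
  have l: "ls (sec b) = VARS n 0 (snd G) @ [snd b]"
    using assms by (simp add: sec_def cid_def ex_def)
  have "mor n (Suc n) (snd G) (FT (Suc n) x) (VARS n 0 (snd G) @ [snd b])"
    using c assms(8,9) f l unfolding cmo_def by (simp add: T bs_def tty_def)
  then show ?thesis
    using assms(1-3,6,9) ev_vars[OF assms(1), of n 0] mor_carrier[of n "Suc n" "snd G"] c l f
    by (simp add: inst_def T pb_def ctx_def)
qed

lemma ev_inst_KTm:
  assumes "ev M xs \<Gamma> = Some (snd G)" "ev M xs t = Some (snd T)" "ev M xs a = Some (snd b)"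
    "trm b" "bs (tty b) = G" "trm T" "bs (tty T) = tty b" "fst G = n"
  shows "ev M xs (inst n KTm \<Gamma> t a) = Some (snd (tms T (sec b)))"
proof -
  have f: "fst b = n" "fst T = Suc n" using assms by (auto simp: bs_def tty_def)
  have c: "cmo (sec b)" "dm (sec b) = G" "cd (sec b) = tty b"
    using sec[OF assms(4)] assms(5) by simp_all
  have l: "ls (sec b) = VARS n 0 (snd G) @ [snd b]"
    using assms by (simp add: sec_def cid_def ex_def)
  have "mor n (Suc n) (snd G) (FT (Suc n) (TY (Suc n) (snd T))) (VARS n 0 (snd G) @ [snd b])"
    using c assms(7,8) f l unfolding cmo_def by (simp add: bs_def tty_def)
  then show ?thesis
    using assms(1-3,6,8) ev_vars[OF assms(1), of n 0] mor_carrier[of n "Suc n" "snd G"] c l f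
    by (simp add: inst_def tms_def trm_def)
qed

text \<open>Only the sorts that occur in the signature are evaluated below.\<close>

definition pulls :: "'x ar \<Rightarrow> sort \<Rightarrow> 'x \<Rightarrow> 'x \<Rightarrow> bool" where
  "pulls s srt b b' \<longleftrightarrow> (\<forall>xs \<Gamma> as t. ev M xs \<Gamma> = Some (snd (dm s)) \<longrightarrow> map (ev M xs) as = map Some (ls s) \<longrightarrow>
     ev M xs t = Some b \<longrightarrow> ev M xs (pull (fst (dm s)) (fst (cd s)) \<Gamma> as srt t) = Some b')"

lemma ev_sb:
  assumes "cmo s" "ev M xs \<Gamma> = Some (snd (dm s))" "map (ev M xs) as = map Some (ls s)"
  shows "ltyp A \<Longrightarrow> bs A = cd s \<Longrightarrow> ev M xs t = Some (snd A) \<Longrightarrow>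
      ev M xs (sb KTy (fst (dm s)) (fst (cd s)) \<Gamma> t as) = Some (snd (pb A s))"
    "trm a \<Longrightarrow> bs (tty a) = cd s \<Longrightarrow> ev M xs t = Some (snd a) \<Longrightarrow>
      ev M xs (sb KTm (fst (dm s)) (fst (cd s)) \<Gamma> t as) = Some (snd (tms a s))"
proof -
  assume A: "ltyp A" "bs A = cd s" "ev M xs t = Some (snd A)"
  then have "snd A \<in> K (Ty (fst (cd s)))" "FT (fst (cd s)) (snd A) = snd (cd s)"
    using ltyp_Suc[of A] by (auto simp: bs_def prod_eq_iff)
  with A show "ev M xs (sb KTy (fst (dm s)) (fst (cd s)) \<Gamma> t as) = Some (snd (pb A s))"
    using assms by (simp add: pb_def cmo_def)
next
  assume a: "trm a" "bs (tty a) = cd s" "ev M xs t = Some (snd a)"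
  then have "snd a \<in> K (Tm (fst (cd s)))" "FT (fst (cd s)) (TY (fst (cd s)) (snd a)) = snd (cd s)"
    by (auto simp: bs_def tty_def trm_def prod_eq_iff)
  with a show "ev M xs (sb KTm (fst (dm s)) (fst (cd s)) \<Gamma> t as) = Some (snd (tms a s))"
    using assms by (simp add: tms_def cmo_def)
qed

text \<open>The formula \<open>lift\<close> weakens a morphism and adds the last variable as a new
  component; its value is the canonical arrow \<open>pq B s\<close> over \<open>s\<close>.\<close>

lemma ev_lift:
  assumes "cmo s" "ltyp B" "bs B = cd s" "ev M xs \<Theta> = Some (snd (pb B s))" "map (ev M xs) as = map Some (ls s)"
  shows "map (ev M xs) (lift (fst (dm s)) 1 \<Theta> as) = map Some (ls (pq B s))"
proof -
  let ?l = "fst (dm s)" and ?P = "pb B s"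
  have P: "snd ?P \<in> K (Ty ?l)" "FT ?l (snd ?P) = snd (dm s)"
    using pb[of B s] assms by (auto simp: ctx_def bs_def prod_eq_iff)
  have v: "map (ev M xs) (vars (Suc ?l) (Suc 0) \<Theta>) = map Some (VARS (Suc ?l) (Suc 0) (snd ?P))"
    using ev_vars[OF assms(4)] P by simp
  have e: "ev M xs (sb KTm (Suc ?l) ?l \<Theta> t (vars (Suc ?l) (Suc 0) \<Theta>)) = Some (SB KTm (Suc ?l) ?l (snd ?P) a (VARS (Suc ?l) (Suc 0) (snd ?P)))"
    if t: "ev M xs t = Some a" and a: "a \<in> set (ls s)" for t a
  proof -
    have "a \<in> K (Tm ?l)" "FT ?l (TY ?l a) = snd (dm s)"
      using cmo_trm[OF assms(1) a] by (auto simp: trm_def tty_def bs_def prod_eq_iff)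
    then show ?thesis using t v assms(4) P mor_dp[OF P(1)] by simp
  qed
  have len: "length as = length (ls s)" using map_eq_imp_length_eq[OF assms(5)] by simp
  have "map (ev M xs) (map (\<lambda>a. sb KTm (Suc ?l) ?l \<Theta> a (vars (Suc ?l) (Suc 0) \<Theta>)) as) =
    map Some (map (\<lambda>a. SB KTm (Suc ?l) ?l (snd ?P) a (VARS (Suc ?l) (Suc 0) (snd ?P))) (ls s))"
  proof (rule nth_equalityI)
    fix i assume "i < length (map (ev M xs) (map (\<lambda>a. sb KTm (Suc ?l) ?l \<Theta> a (vars (Suc ?l) (Suc 0) \<Theta>)) as))"
    then have i: "i < length as" by simp
    then show "map (ev M xs) (map (\<lambda>a. sb KTm (Suc ?l) ?l \<Theta> a (vars (Suc ?l) (Suc 0) \<Theta>)) as) ! i =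
      map Some (map (\<lambda>a. SB KTm (Suc ?l) ?l (snd ?P) a (VARS (Suc ?l) (Suc 0) (snd ?P))) (ls s)) ! i"
      using e[OF map_nth_eq[OF assms(5) i]] len by (simp del: ev.simps)
  qed (use len in simp)
  moreover have "ev M xs (vr (Suc ?l) 0 \<Theta>) = Some (VR (Suc ?l) 0 (snd ?P))"
    using assms(4) P by simp
  ultimately show ?thesis
    using P by (simp add: lift_def pq_def ex_def cc_def dsp_def v0_def bs_def del: ev.simps map_map)
qed

lemma pulls_Ctx1:
  assumes "cmo s" "ltyp A" "bs A = cd s"
  shows "pulls s (Ctx (Suc 0)) (snd A) (snd (pb A s))" "pulls s (Ctx 1) (snd A) (snd (pb A s))"
  using ev_sb(1)[OF assms(1)] assms by (simp_all add: pulls_def lift_def del: ev.simps)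

lemma pulls_Tm0:
  assumes "cmo s" "trm a" "bs (tty a) = cd s"
  shows "pulls s (Tm 0) (snd a) (snd (tms a s))"
  using ev_sb(2)[OF assms(1)] assms by (simp add: pulls_def lift_def del: ev.simps)

lemma ev_ft_bs: "ltyp A \<Longrightarrow> ev M xs t = Some (snd A) \<Longrightarrow> n = fst (bs A) \<Longrightarrow> ev M xs (ft n t) = Some (snd (bs A))"
  using ltyp_Suc[of A] by (auto simp: bs_def)

lemma ev_ty_tty: "trm a \<Longrightarrow> ev M xs t = Some (snd a) \<Longrightarrow> n = fst a \<Longrightarrow> ev M xs (ty n t) = Some (snd (tty a))"
  by (auto simp: tty_def trm_def)

lemma fst_bs: "ltyp A \<Longrightarrow> fst A = Suc (fst (bs A))"
  using ltyp_Suc[of A] by (auto simp: bs_def)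

lemma pulls_Ctx2:
  assumes s: "cmo s" and A: "ltyp A" "bs A = B" "ltyp B" "bs B = cd s"
  shows "pulls s (Ctx 2) (snd A) (snd (pb A (pq B s)))"
  unfolding pulls_def
proof (intro allI impI)
  fix xs :: "'x list" and \<Gamma> as t
  assume e: "ev M xs \<Gamma> = Some (snd (dm s))" "map (ev M xs) as = map Some (ls s)" "ev M xs t = Some (snd A)"
  let ?l = "fst (dm s)" and ?m = "fst (cd s)"
  have fB: "fst B = Suc ?m" using fst_bs[of B] A by simp
  have "ev M xs (ft (Suc ?m) t) = Some (snd B)"
    using ev_ft_bs[OF A(1) e(3), of "Suc ?m"] A fB by (simp del: ev.simps)
  then have th: "ev M xs (sb KTy ?l ?m \<Gamma> (ft (Suc ?m) t) as) = Some (snd (pb B s))"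
    by (rule ev_sb(1)[OF s e(1,2) A(3,4)])
  have q: "cmo (pq B s)" "dm (pq B s) = pb B s" "cd (pq B s) = B" using s A by simp_all
  note l = ev_lift[OF s A(3,4) th e(2)]
  have "ev M xs (sb KTy (fst (dm (pq B s))) (fst (cd (pq B s))) (sb KTy ?l ?m \<Gamma> (ft (Suc ?m) t) as) t
      (lift ?l 1 (sb KTy ?l ?m \<Gamma> (ft (Suc ?m) t) as) as)) = Some (snd (pb A (pq B s)))"
    by (rule ev_sb(1)) (use q l th e A in \<open>simp_all del: ev.simps\<close>)
  moreover have "pull ?l ?m \<Gamma> as (Ctx 2) t = sb KTy (fst (dm (pq B s))) (fst (cd (pq B s))) (sb KTy ?l ?m \<Gamma> (ft (Suc ?m) t) as) t
      (lift ?l 1 (sb KTy ?l ?m \<Gamma> (ft (Suc ?m) t) as) as)"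
    using fB q by (simp add: numeral_2_eq_2 Let_def lift_def[of _ 0])
  ultimately show "ev M xs (pull ?l ?m \<Gamma> as (Ctx 2) t) = Some (snd (pb A (pq B s)))"
    by (simp only:)
qed

lemma pulls_Tm1:
  assumes s: "cmo s" and a: "trm a" "bs (tty a) = B" "ltyp B" "bs B = cd s"
  shows "pulls s (Tm (Suc 0)) (snd a) (snd (tms a (pq B s)))"
  unfolding pulls_def
proof (intro allI impI)
  fix xs :: "'x list" and \<Gamma> as t
  assume e: "ev M xs \<Gamma> = Some (snd (dm s))" "map (ev M xs) as = map Some (ls s)" "ev M xs t = Some (snd a)"
  let ?l = "fst (dm s)" and ?m = "fst (cd s)"
  have fB: "fst B = Suc ?m" using fst_bs[of B] a by simp
  then have fa: "fst a = Suc ?m" using fst_bs_tty[of a] a by simp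
  have "ev M xs (ty (Suc ?m) t) = Some (snd (tty a))"
    by (rule ev_ty_tty[OF a(1) e(3)]) (simp add: fa)
  then have "ev M xs (ft (Suc ?m) (ty (Suc ?m) t)) = Some (snd (bs (tty a)))"
    by (rule ev_ft_bs[rotated]) (use a(1) fa in simp_all)
  then have "ev M xs (ft (Suc ?m) (ty (Suc ?m) t)) = Some (snd B)"
    by (simp only: a(2))
  then have th: "ev M xs (sb KTy ?l ?m \<Gamma> (ft (Suc ?m) (ty (Suc ?m) t)) as) = Some (snd (pb B s))"
    by (rule ev_sb(1)[OF s e(1,2) a(3,4)])
  have q: "cmo (pq B s)" "dm (pq B s) = pb B s" "cd (pq B s) = B" using s a by simp_all
  note l = ev_lift[OF s a(3,4) th e(2)]
  have "ev M xs (sb KTm (fst (dm (pq B s))) (fst (cd (pq B s))) (sb KTy ?l ?m \<Gamma> (ft (Suc ?m) (ty (Suc ?m) t)) as) t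
      (lift ?l 1 (sb KTy ?l ?m \<Gamma> (ft (Suc ?m) (ty (Suc ?m) t)) as) as)) = Some (snd (tms a (pq B s)))"
    by (rule ev_sb(2)) (use q l th e a in \<open>simp_all del: ev.simps\<close>)
  moreover have "pull ?l ?m \<Gamma> as (Tm (Suc 0)) t = sb KTm (fst (dm (pq B s))) (fst (cd (pq B s))) (sb KTy ?l ?m \<Gamma> (ft (Suc ?m) (ty (Suc ?m) t)) as) t
      (lift ?l 1 (sb KTy ?l ?m \<Gamma> (ft (Suc ?m) (ty (Suc ?m) t)) as) as)"
    using fB q by (simp add: Let_def lift_def[of _ 0])
  ultimately show "ev M xs (pull ?l ?m \<Gamma> as (Tm (Suc 0)) t) = Some (snd (tms a (pq B s)))"
    by (simp only:)
qed

text \<open>The stability axiom, evaluated once for all constructors. The environment lists both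
  contexts, the terms of \<open>s\<close> and the arguments in the order of
  \<open>stab_vars\<close>; the hypotheses with \<open>pulls\<close> supply the values of the
  syntactic pullbacks.\<close>

lemma con_pull:
  assumes s: "cmo s" and e: "env M ds (map (shift (fst (cd s))) (cdom c))"
    and y: "fn M (New (c, fst (cd s))) (snd (cd s) # ds) = Some y"
    and p: "list_all2 (\<lambda>(r, b) b'. pulls s r b b') (zip (cdom c) ds) ds'" "pulls s (ccod c) y y'"
  shows "fn M (New (c, fst (dm s))) (snd (dm s) # ds') = Some y'"
proof -
  let ?l = "fst (dm s)" and ?m = "fst (cd s)" and ?k = "length (cdom c)"
  let ?xs = "snd (dm s) # snd (cd s) # ls s @ ds"
  note m = mor_carrier[OF s[unfolded cmo_def]]
  have len: "length ds = ?k" "length ds' = ?k" using e p(1) by (auto dest!: list_all2_lengthD)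
  have ea: "map (ev M ?xs) (tvars 2 ?m) = map Some (ls s)" and eb: "map (ev M ?xs) (tvars (2 + ?m) ?k) = map Some ds"
    using map_ev_tvars[of 2 ?m ?xs] map_ev_tvars[of "2 + ?m" ?k ?xs] m len by (simp_all add: numeral_2_eq_2)
  have env: "env M ?xs (stab_vars ?l ?m (cdom c))"
    using m e by (auto simp: stab_vars_def list_all2_append)
  have h: "holds M ?xs (stab_mor ?l ?m)"
    unfolding stab_mor_def using holds_cmor[of ?xs "Tvar 0" "snd (dm s)" "Tvar 1" "snd (cd s)" "tvars 2 ?m" "ls s" ?l ?m]
      ea m s by (simp add: cmo_def)
  have "map (ev M ?xs) (stab_src ?m (cdom c)) = map Some (snd (cd s) # ds)"
    using eb by (simp add: stab_src_def)
  then have t: "ev M ?xs (cn c ?m (stab_src ?m (cdom c))) = Some y"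
    using y by (simp only: ev.simps those_map_Some bind.simps)
  have "ev M ?xs (pull ?l ?m (Tvar 0) (tvars 2 ?m) (cdom c ! i) (tvars (2 + ?m) ?k ! i)) = Some (ds' ! i)" if i: "i < ?k" for i
  proof -
    have "pulls s (cdom c ! i) (ds ! i) (ds' ! i)"
      using p(1) i len by (auto simp: list_all2_conv_all_nth)
    moreover have "ev M ?xs (tvars (2 + ?m) ?k ! i) = Some (ds ! i)"
      using map_nth_eq[OF eb, of i] i by simp
    ultimately show ?thesis using ea unfolding pulls_def by simp
  qed
  then have "map (ev M ?xs) (map2 (stab_pull ?l ?m) (cdom c) (tvars (2 + ?m) ?k)) = map Some ds'"
    using len by (intro nth_equalityI) (simp_all add: stab_pull_def del: ev.simps pull.simps)
  then have "map (ev M ?xs) (stab_tgt ?l ?m (cdom c)) = map Some (snd (dm s) # ds')"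
    by (simp add: stab_tgt_def)
  then have "ev M ?xs (cn c ?l (stab_tgt ?l ?m (cdom c))) = fn M (New (c, ?l)) (snd (dm s) # ds')"
    by (simp only: ev.simps those_map_Some bind.simps)
  moreover have "ev M ?xs (stab_pull ?l ?m (ccod c) (cn c ?m (stab_src ?m (cdom c)))) = Some y'"
    using p(2) ea t unfolding pulls_def stab_pull_def by simp
  ultimately show ?thesis
    using con_stable[OF env h t] by simp
qed


lemma con_value:
  assumes "ts = tvars 0 (Suc (length (cdom c)))" "env M xs (Ctx n # map (shift n) (cdom c))"
    "holds M xs (prem c n ts)"
  shows "fn M (New (c, n)) xs = Some (CN c n xs)" "CN c n xs \<in> K (shift n (ccod c))"
    "ev M xs (cn c n ts) = Some (CN c n xs)" "holds1 M xs (concl c n ts)"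
proof -
  have h: "holds M xs [dfd (cn c n ts), concl c n ts]"
    by (rule con_intro[OF refl]) (use assms in simp_all)
  have "length xs = Suc (length (cdom c))" using list_all2_lengthD[OF assms(2)] by simp
  then have "map (ev M xs) ts = map Some xs"
    using map_ev_tvars[of 0 "Suc (length (cdom c))" xs] assms(1) by simp
  then have e: "ev M xs (cn c n ts) = fn M (New (c, n)) xs" by (rule ev_cn)
  then show 1: "fn M (New (c, n)) xs = Some (CN c n xs)"
    using h unfolding holds_Cons holds1.simps by (auto simp: CN_def)
  then show "ev M xs (cn c n ts) = Some (CN c n xs)" using e by simp
  show "CN c n xs \<in> K (shift n (ccod c))" using fn_carrier(2)[OF _ 1] by simp
  show "holds1 M xs (concl c n ts)" using h by (simp only: holds_Cons)
qed

lemma ev_intv: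
  assumes "ctx G" "ev M xs t = Some (snd G)" "n = fst G"
  shows "ev M xs (intv n t) = Some (snd (intT G))" "ev M xs (lft n t) = Some (snd (leftT G))"
    "ev M xs (rgt n t) = Some (snd (rightT G))"
  using assms IntvC[of "snd G" n] LeftC[of "snd G" n] RightC[of "snd G" n]
  by (simp_all add: ctx_def intv_def lft_def rgt_def intT_def leftT_def rightT_def)

lemma ev_wk:
  assumes "pulls (dsp B) r b b'" "ltyp B" "ev M xs t = Some (snd B)" "ev M xs u = Some b" "fst B = Suc n"
  shows "ev M xs (wk n r t u) = Some b'"
proof -
  have "snd B \<in> K (Ctx (Suc n))" "fst (bs B) = n" using assms by (auto simp: ctx_def bs_def)
  then show ?thesis
    using assms(1,3-5) ev_vars[OF assms(3), of "Suc n" 1] unfolding pulls_def wk_def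
    by (simp add: dsp_def del: ev.simps pull.simps)
qed

lemma carriers: "ctx G \<Longrightarrow> snd G \<in> K (Ctx (fst G))" "trm a \<Longrightarrow> snd a \<in> K (Tm (fst a))"
  by (simp_all add: ctx_def trm_def)

section \<open>Typing rules for the constructors\<close>

definition coeT where "coeT G D d i = (fst G, CN Coe1C (fst G) [snd G, snd D, snd d, snd i])"
definition pathT where "pathT G C a b = (Suc (fst G), CN PathC (fst G) [snd G, snd C, snd a, snd b])"
definition plam where "plam G a = (fst G, CN PLamC (fst G) [snd G, snd a])"
definition atT where "atT G C a b p i = (fst G, CN AtC (fst G) [snd G, snd C, snd a, snd b, snd p, snd i])"
definition sig where "sig G A B = (Suc (fst G), CN SigC (fst G) [snd G, snd A, snd B])"
definition pair where "pair G A B a b = (fst G, CN PairC (fst G) [snd G, snd A, snd B, snd a, snd b])"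
definition pr1 where "pr1 G A B p = (fst G, CN Pr1C (fst G) [snd G, snd A, snd B, snd p])"
definition pr2 where "pr2 G A B p = (fst G, CN Pr2C (fst G) [snd G, snd A, snd B, snd p])"

lemma fst_con [simp]: "fst (coeT G D d i) = fst G" "fst (pathT G C a b) = Suc (fst G)" "fst (plam G a) = fst G"
  "fst (atT G C a b p i) = fst G" "fst (sig G A B) = Suc (fst G)" "fst (pair G A B a b) = fst G"
  "fst (pr1 G A B p) = fst G" "fst (pr2 G A B p) = fst G"
  by (simp_all add: coeT_def pathT_def plam_def atT_def sig_def pair_def pr1_def pr2_def)

lemma fst_of_tty: "tty a = B \<Longrightarrow> bs B = G \<Longrightarrow> fst a = fst G"
  using fst_bs_tty[of a] by simp

lemma fst2_of_bs: "ltyp D \<Longrightarrow> bs D = B \<Longrightarrow> ltyp B \<Longrightarrow> bs B = G \<Longrightarrow> fst D = Suc (Suc (fst G))"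
  using fst_bs[of D] fst_bs[of B] by auto

lemma vars4: "tvars 0 (Suc 0) = [Tvar 0]" "tvars 0 (Suc (Suc 0)) = [Tvar 0, Tvar 1]"
  "tvars 0 (Suc (Suc (Suc 0))) = [Tvar 0, Tvar 1, Tvar 2]"
  "tvars 0 (Suc (Suc (Suc (Suc 0)))) = [Tvar 0, Tvar 1, Tvar 2, Tvar 3]"
  "tvars 0 (Suc (Suc (Suc (Suc (Suc 0))))) = [Tvar 0, Tvar 1, Tvar 2, Tvar 3, Tvar 4]"
  "tvars 0 (Suc (Suc (Suc (Suc (Suc (Suc 0)))))) = [Tvar 0, Tvar 1, Tvar 2, Tvar 3, Tvar 4, Tvar 5]"
  by (simp_all add: eval_nat_numeral)


text \<open>The scheme for all constructors: the terms in the premises are evaluated to objects of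
  the category of contexts, \<open>con_value\<close> provides the value, and the type of the value
  is read off from the evaluated conclusion. As objects are stored with their lengths, equality of
  types also needs equality of the lengths.\<close>

lemma coeT:
  assumes G: "ctx G" and D: "ltyp D" "bs D = intT G" and d: "trm d" "tty d = pb D (sec (leftT G))"
    and i: "trm i" "tty i = intT G"
  shows "fn M (New (Coe1C, fst G)) [snd G, snd D, snd d, snd i] = Some (snd (coeT G D d i))"
    "trm (coeT G D d i)" "tty (coeT G D d i) = pb D (sec i)"
proof -
  let ?n = "fst G" and ?xs = "[snd G, snd D, snd d, snd i]"
  let ?ts = "[Tvar 0, Tvar 1, Tvar 2, Tvar 3] :: t0 trm list"
  have f: "fst D = Suc (Suc ?n)" "fst d = ?n" "fst i = ?n"
    using fst2_of_bs[OF D] fst_of_tty[OF d(2)] fst_of_tty[OF i(2)] G D by simp_all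
  have v: "ev M ?xs (Tvar 0) = Some (snd G)" "ev M ?xs (Tvar 1) = Some (snd D)"
    "ev M ?xs (Tvar 2) = Some (snd d)" "ev M ?xs (Tvar 3) = Some (snd i)" by simp_all
  have e: "ev M ?xs (ft (Suc ?n) (Tvar 1)) = Some (snd (bs D))"
    "ev M ?xs (intv ?n (Tvar 0)) = Some (snd (intT G))"
    "ev M ?xs (ty ?n (Tvar 2)) = Some (snd (tty d))" "ev M ?xs (ty ?n (Tvar 3)) = Some (snd (tty i))"
    "ev M ?xs (inst ?n KTy (Tvar 0) (Tvar 1) (lft ?n (Tvar 0))) = Some (snd (pb D (sec (leftT G))))"
    "ev M ?xs (inst ?n KTy (Tvar 0) (Tvar 1) (Tvar 3)) = Some (snd (pb D (sec i)))"
    using ev_ft_bs[OF D(1) v(2)] ev_intv[OF G v(1)] ev_ty_tty[OF d(1) v(3)] ev_ty_tty[OF i(1) v(4)]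
      ev_inst_KTy[OF v(1,2) ev_intv(2)[OF G v(1) refl]] ev_inst_KTy[OF v(1,2,4) i(1)] G D i f
    by (simp_all del: ev.simps)
  have h: "holds M ?xs (prem Coe1C ?n ?ts)"
    using e D d i by (simp del: ev.simps)
  have env: "env M ?xs (Ctx ?n # map (shift ?n) (cdom Coe1C))"
    using carriers(1)[OF G] carriers(1)[of D] carriers(2)[OF d(1)] carriers(2)[OF i(1)] D f by simp
  note c = con_value[of ?ts Coe1C, OF _ env h]
  have ts: "?ts = tvars 0 (Suc (length (cdom Coe1C)))" by (simp add: vars4)
  show 1: "fn M (New (Coe1C, fst G)) ?xs = Some (snd (coeT G D d i))"
    using c(1)[OF ts] by (simp add: coeT_def)
  show 2: "trm (coeT G D d i)"
    using c(2)[OF ts] by (simp add: coeT_def trm_def)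
  have "ev M ?xs (ty ?n (cn Coe1C ?n ?ts)) = Some (snd (tty (coeT G D d i)))"
    by (rule ev_ty_tty[OF 2]) (use c(3)[OF ts] in \<open>simp_all add: coeT_def del: ev.simps\<close>)
  then have "snd (tty (coeT G D d i)) = snd (pb D (sec i))"
    using c(4)[OF ts] e(6) by (simp del: ev.simps)
  then show "tty (coeT G D d i) = pb D (sec i)"
    using i G by (simp add: prod_eq_iff)
qed


lemma pathT:
  assumes G: "ctx G" and C: "ltyp C" "bs C = intT G" and a: "trm a" "tty a = pb C (sec (leftT G))"
    and b: "trm b" "tty b = pb C (sec (rightT G))"
  shows "fn M (New (PathC, fst G)) [snd G, snd C, snd a, snd b] = Some (snd (pathT G C a b))"
    "ctx (pathT G C a b)" "bs (pathT G C a b) = G"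
proof -
  let ?n = "fst G" and ?xs = "[snd G, snd C, snd a, snd b]"
  let ?ts = "[Tvar 0, Tvar 1, Tvar 2, Tvar 3] :: t0 trm list"
  have f: "fst C = Suc (Suc ?n)" "fst a = ?n" "fst b = ?n"
    using fst2_of_bs[OF C] fst_of_tty[OF a(2)] fst_of_tty[OF b(2)] G C by simp_all
  have v: "ev M ?xs (Tvar 0) = Some (snd G)" "ev M ?xs (Tvar 1) = Some (snd C)"
    "ev M ?xs (Tvar 2) = Some (snd a)" "ev M ?xs (Tvar 3) = Some (snd b)" by simp_all
  have e: "ev M ?xs (ft (Suc ?n) (Tvar 1)) = Some (snd (bs C))"
    "ev M ?xs (intv ?n (Tvar 0)) = Some (snd (intT G))"
    "ev M ?xs (ty ?n (Tvar 2)) = Some (snd (tty a))" "ev M ?xs (ty ?n (Tvar 3)) = Some (snd (tty b))"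
    "ev M ?xs (inst ?n KTy (Tvar 0) (Tvar 1) (lft ?n (Tvar 0))) = Some (snd (pb C (sec (leftT G))))"
    "ev M ?xs (inst ?n KTy (Tvar 0) (Tvar 1) (rgt ?n (Tvar 0))) = Some (snd (pb C (sec (rightT G))))"
    using ev_ft_bs[OF C(1) v(2)] ev_intv[OF G v(1)] ev_ty_tty[OF a(1) v(3)] ev_ty_tty[OF b(1) v(4)]
      ev_inst_KTy[OF v(1,2) ev_intv(2)[OF G v(1) refl]] ev_inst_KTy[OF v(1,2) ev_intv(3)[OF G v(1) refl]] G C f
    by (simp_all del: ev.simps)
  have h: "holds M ?xs (prem PathC ?n ?ts)"
    using e C a b by (simp del: ev.simps)
  have env: "env M ?xs (Ctx ?n # map (shift ?n) (cdom PathC))"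
    using carriers(1)[OF G] carriers(1)[of C] carriers(2)[OF a(1)] carriers(2)[OF b(1)] C f by simp
  note c = con_value[of ?ts PathC, OF _ env h]
  have ts: "?ts = tvars 0 (Suc (length (cdom PathC)))" by (simp add: vars4)
  show 1: "fn M (New (PathC, fst G)) ?xs = Some (snd (pathT G C a b))"
    using c(1)[OF ts] by (simp add: pathT_def)
  show 2: "ctx (pathT G C a b)"
    using c(2)[OF ts] by (simp add: pathT_def ctx_def)
  have "ev M ?xs (ft ?n (cn PathC ?n ?ts)) = Some (snd (bs (pathT G C a b)))"
    by (rule ev_ft_bs) (use 2 c(3)[OF ts] in \<open>simp_all add: pathT_def bs_def del: ev.simps\<close>)
  then have "snd (bs (pathT G C a b)) = snd G"
    using c(4)[OF ts] v(1) by (simp del: ev.simps(2))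
  then show "bs (pathT G C a b) = G"
    by (simp add: prod_eq_iff bs_def)
qed

lemma ev_cn_pathT:
  assumes "ctx G" "ltyp C" "bs C = intT G" "trm a" "tty a = pb C (sec (leftT G))"
    "trm b" "tty b = pb C (sec (rightT G))"
    "ev M xs t = Some (snd G)" "ev M xs u = Some (snd C)" "ev M xs v = Some (snd a)" "ev M xs w = Some (snd b)"
    "n = fst G"
  shows "ev M xs (cn PathC n [t, u, v, w]) = Some (snd (pathT G C a b))"
  using pathT(1)[OF assms(1-7)] assms(8-12) by simp

lemma plam:
  assumes G: "ctx G" and a: "trm a" "bs (tty a) = intT G"
  shows "trm (plam G a)"
    "tty (plam G a) = pathT G (tty a) (tms a (sec (leftT G))) (tms a (sec (rightT G)))"
    "fn M (New (PLamC, fst G)) [snd G, snd a] = Some (snd (plam G a))"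
proof -
  let ?n = "fst G" and ?xs = "[snd G, snd a]"
  let ?ts = "[Tvar 0, Tvar 1] :: t0 trm list"
  have f: "fst a = Suc ?n"
    using fst_bs_tty[of a] a by simp
  have v: "ev M ?xs (Tvar 0) = Some (snd G)" "ev M ?xs (Tvar 1) = Some (snd a)" by simp_all
  have ea: "ev M ?xs (ty (Suc ?n) (Tvar 1)) = Some (snd (tty a))"
    using ev_ty_tty[OF a(1) v(2)] f by (simp del: ev.simps)
  have e1: "ev M ?xs (ft (Suc ?n) (ty (Suc ?n) (Tvar 1))) = Some (snd (bs (tty a)))"
    by (rule ev_ft_bs[OF _ ea]) (use a(1) f in simp_all)
  have e3: "ev M ?xs (inst ?n KTm (Tvar 0) (Tvar 1) (lft ?n (Tvar 0))) = Some (snd (tms a (sec (leftT G))))"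
    by (rule ev_inst_KTm[OF v(1,2) ev_intv(2)[OF G v(1) refl]]) (use G a in simp_all)
  have e4: "ev M ?xs (inst ?n KTm (Tvar 0) (Tvar 1) (rgt ?n (Tvar 0))) = Some (snd (tms a (sec (rightT G))))"
    by (rule ev_inst_KTm[OF v(1,2) ev_intv(3)[OF G v(1) refl]]) (use G a in simp_all)
  note e = e1 ev_intv(1)[OF G v(1) refl] e3 e4
  have h: "holds M ?xs (prem PLamC ?n ?ts)"
    using e a by (simp del: ev.simps)
  have env: "env M ?xs (Ctx ?n # map (shift ?n) (cdom PLamC))"
    using carriers(1)[OF G] carriers(2)[OF a(1)] f by simp
  note c = con_value[of ?ts PLamC, OF _ env h]
  have ts: "?ts = tvars 0 (Suc (length (cdom PLamC)))" by (simp add: vars4)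
  show 1: "fn M (New (PLamC, fst G)) ?xs = Some (snd (plam G a))"
    using c(1)[OF ts] by (simp add: plam_def)
  show 2: "trm (plam G a)"
    using c(2)[OF ts] by (simp add: plam_def trm_def)
  have 3: "ev M ?xs (ty ?n (cn PLamC ?n ?ts)) = Some (snd (tty (plam G a)))"
    by (rule ev_ty_tty[OF 2]) (use c(3)[OF ts] in \<open>simp_all add: plam_def del: ev.simps\<close>)
  have "ev M ?xs (cn PathC ?n [Tvar 0, ty (Suc ?n) (Tvar 1), inst ?n KTm (Tvar 0) (Tvar 1) (lft ?n (Tvar 0)),
      inst ?n KTm (Tvar 0) (Tvar 1) (rgt ?n (Tvar 0))]) =
    Some (snd (pathT G (tty a) (tms a (sec (leftT G))) (tms a (sec (rightT G)))))"
    by (rule ev_cn_pathT) (use G a v ea e in \<open>simp_all del: ev.simps\<close>)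
  then have "snd (tty (plam G a)) = snd (pathT G (tty a) (tms a (sec (leftT G))) (tms a (sec (rightT G))))"
    using c(4)[OF ts] 3 by (simp del: ev.simps)
  then show "tty (plam G a) = pathT G (tty a) (tms a (sec (leftT G))) (tms a (sec (rightT G)))"
    by (simp add: prod_eq_iff)
qed

lemma atT:
  assumes G: "ctx G" and C: "ltyp C" "bs C = intT G" and a: "trm a" "tty a = pb C (sec (leftT G))"
    and b: "trm b" "tty b = pb C (sec (rightT G))" and p: "trm p" "tty p = pathT G C a b"
    and i: "trm i" "tty i = intT G"
  shows "fn M (New (AtC, fst G)) [snd G, snd C, snd a, snd b, snd p, snd i] = Some (snd (atT G C a b p i))"
    "trm (atT G C a b p i)" "tty (atT G C a b p i) = pb C (sec i)"
proof -
  let ?n = "fst G" and ?xs = "[snd G, snd C, snd a, snd b, snd p, snd i]"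
  let ?ts = "[Tvar 0, Tvar 1, Tvar 2, Tvar 3, Tvar 4, Tvar 5] :: t0 trm list"
  have f: "fst C = Suc (Suc ?n)" "fst a = ?n" "fst b = ?n" "fst p = ?n" "fst i = ?n"
    using fst2_of_bs[OF C] fst_of_tty[OF a(2)] fst_of_tty[OF b(2)] fst_of_tty[OF p(2)] fst_of_tty[OF i(2)]
      pathT(3)[OF G C a b] G C by simp_all
  have v: "ev M ?xs (Tvar 0) = Some (snd G)" "ev M ?xs (Tvar 1) = Some (snd C)"
    "ev M ?xs (Tvar 2) = Some (snd a)" "ev M ?xs (Tvar 3) = Some (snd b)"
    "ev M ?xs (Tvar 4) = Some (snd p)" "ev M ?xs (Tvar 5) = Some (snd i)" by simp_all
  have e: "ev M ?xs (intv ?n (Tvar 0)) = Some (snd (intT G))"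
    "ev M ?xs (ty ?n (Tvar 4)) = Some (snd (tty p))" "ev M ?xs (ty ?n (Tvar 5)) = Some (snd (tty i))"
    "ev M ?xs (inst ?n KTy (Tvar 0) (Tvar 1) (Tvar 5)) = Some (snd (pb C (sec i)))"
    "ev M ?xs (cn PathC ?n [Tvar 0, Tvar 1, Tvar 2, Tvar 3]) = Some (snd (pathT G C a b))"
    using ev_intv[OF G v(1)] ev_ty_tty[OF p(1) v(5)] ev_ty_tty[OF i(1) v(6)]
      ev_inst_KTy[OF v(1,2,6) i(1)] ev_cn_pathT[OF G C a b v(1-4) refl] G C i f
    by (simp_all del: ev.simps)
  have h: "holds M ?xs (prem AtC ?n ?ts)"
    using e p i by (simp del: ev.simps)
  have env: "env M ?xs (Ctx ?n # map (shift ?n) (cdom AtC))"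
    using carriers(1)[OF G] carriers(1)[of C] carriers(2)[OF a(1)] carriers(2)[OF b(1)] carriers(2)[OF p(1)]
      carriers(2)[OF i(1)] C f by simp
  note c = con_value[of ?ts AtC, OF _ env h]
  have ts: "?ts = tvars 0 (Suc (length (cdom AtC)))" by (simp add: vars4)
  show 1: "fn M (New (AtC, fst G)) ?xs = Some (snd (atT G C a b p i))"
    using c(1)[OF ts] by (simp add: atT_def)
  show 2: "trm (atT G C a b p i)"
    using c(2)[OF ts] by (simp add: atT_def trm_def)
  have "ev M ?xs (ty ?n (cn AtC ?n ?ts)) = Some (snd (tty (atT G C a b p i)))"
    by (rule ev_ty_tty[OF 2]) (use c(3)[OF ts] in \<open>simp_all add: atT_def del: ev.simps\<close>)
  then have "snd (tty (atT G C a b p i)) = snd (pb C (sec i))"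
    using c(4)[OF ts] e(4) by (simp del: ev.simps)
  then show "tty (atT G C a b p i) = pb C (sec i)"
    using i G by (simp add: prod_eq_iff)
qed

lemma sig:
  assumes G: "ctx G" and A: "ltyp A" "bs A = G" and B: "ltyp B" "bs B = A"
  shows "fn M (New (SigC, fst G)) [snd G, snd A, snd B] = Some (snd (sig G A B))"
    "ctx (sig G A B)" "bs (sig G A B) = G"
proof -
  let ?n = "fst G" and ?xs = "[snd G, snd A, snd B]"
  let ?ts = "[Tvar 0, Tvar 1, Tvar 2] :: t0 trm list"
  have f: "fst B = Suc (Suc ?n)" "fst A = Suc ?n"
    using fst2_of_bs[OF B A] fst_bs[of A] A by simp_all
  have v: "ev M ?xs (Tvar 0) = Some (snd G)" "ev M ?xs (Tvar 1) = Some (snd A)"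
    "ev M ?xs (Tvar 2) = Some (snd B)" by simp_all
  have e: "ev M ?xs (ft ?n (Tvar 1)) = Some (snd (bs A))" "ev M ?xs (ft (Suc ?n) (Tvar 2)) = Some (snd (bs B))"
    using ev_ft_bs[OF A(1) v(2)] ev_ft_bs[OF B(1) v(3)] A B f by (simp_all del: ev.simps)
  have h: "holds M ?xs (prem SigC ?n ?ts)"
    using e v A B by (simp del: ev.simps)
  have env: "env M ?xs (Ctx ?n # map (shift ?n) (cdom SigC))"
    using carriers(1)[OF G] carriers(1)[of A] carriers(1)[of B] A B f by simp
  note c = con_value[of ?ts SigC, OF _ env h]
  have ts: "?ts = tvars 0 (Suc (length (cdom SigC)))" by (simp add: vars4)
  show 1: "fn M (New (SigC, fst G)) ?xs = Some (snd (sig G A B))"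
    using c(1)[OF ts] by (simp add: sig_def)
  show 2: "ctx (sig G A B)"
    using c(2)[OF ts] by (simp add: sig_def ctx_def)
  have "ev M ?xs (ft ?n (cn SigC ?n ?ts)) = Some (snd (bs (sig G A B)))"
    by (rule ev_ft_bs) (use 2 c(3)[OF ts] in \<open>simp_all add: sig_def bs_def del: ev.simps\<close>)
  then have "snd (bs (sig G A B)) = snd G"
    using c(4)[OF ts] v(1) by (simp del: ev.simps(2))
  then show "bs (sig G A B) = G"
    by (simp add: prod_eq_iff bs_def)
qed

lemma ev_cn_sig:
  assumes "ctx G" "ltyp A" "bs A = G" "ltyp B" "bs B = A"
    "ev M xs t = Some (snd G)" "ev M xs u = Some (snd A)" "ev M xs v = Some (snd B)" "n = fst G"
  shows "ev M xs (cn SigC n [t, u, v]) = Some (snd (sig G A B))"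
  using sig(1)[OF assms(1-5)] assms(6-9) by simp

lemma pair:
  assumes G: "ctx G" and A: "ltyp A" "bs A = G" and B: "ltyp B" "bs B = A"
    and a: "trm a" "tty a = A" and b: "trm b" "tty b = pb B (sec a)"
  shows "fn M (New (PairC, fst G)) [snd G, snd A, snd B, snd a, snd b] = Some (snd (pair G A B a b))"
    "trm (pair G A B a b)" "tty (pair G A B a b) = sig G A B" 
proof -
  let ?n = "fst G" and ?xs = "[snd G, snd A, snd B, snd a, snd b]"
  let ?ts = "[Tvar 0, Tvar 1, Tvar 2, Tvar 3, Tvar 4] :: t0 trm list"
  have f: "fst B = Suc (Suc ?n)" "fst A = Suc ?n" "fst a = ?n" "fst b = ?n"
    using fst2_of_bs[OF B A] fst_bs[of A] A fst_of_tty[OF a(2)] fst_of_tty[OF b(2)] a B by simp_all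
  have v: "ev M ?xs (Tvar 0) = Some (snd G)" "ev M ?xs (Tvar 1) = Some (snd A)"
    "ev M ?xs (Tvar 2) = Some (snd B)" "ev M ?xs (Tvar 3) = Some (snd a)" "ev M ?xs (Tvar 4) = Some (snd b)" by simp_all
  have e: "ev M ?xs (ft ?n (Tvar 1)) = Some (snd (bs A))" "ev M ?xs (ft (Suc ?n) (Tvar 2)) = Some (snd (bs B))"
    "ev M ?xs (ty ?n (Tvar 3)) = Some (snd (tty a))" "ev M ?xs (ty ?n (Tvar 4)) = Some (snd (tty b))"
    "ev M ?xs (inst ?n KTy (Tvar 0) (Tvar 2) (Tvar 3)) = Some (snd (pb B (sec a)))"
    "ev M ?xs (cn SigC ?n [Tvar 0, Tvar 1, Tvar 2]) = Some (snd (sig G A B))"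
    using ev_ft_bs[OF A(1) v(2)] ev_ft_bs[OF B(1) v(3)] ev_ty_tty[OF a(1) v(4)] ev_ty_tty[OF b(1) v(5)]
      ev_inst_KTy[OF v(1,3,4) a(1)] ev_cn_sig[OF G A B v(1-3) refl] A B a f by (simp_all del: ev.simps)
  have h: "holds M ?xs (prem PairC ?n ?ts)"
    using e v A B a b by (simp del: ev.simps)
  have env: "env M ?xs (Ctx ?n # map (shift ?n) (cdom PairC))"
    using carriers(1)[OF G] carriers(1)[of A] carriers(1)[of B] carriers(2)[OF a(1)] carriers(2)[OF b(1)] A B f by simp
  note c = con_value[of ?ts PairC, OF _ env h]
  have ts: "?ts = tvars 0 (Suc (length (cdom PairC)))" by (simp add: vars4)
  show 1: "fn M (New (PairC, fst G)) ?xs = Some (snd (pair G A B a b))"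
    using c(1)[OF ts] by (simp add: pair_def)
  show 2: "trm (pair G A B a b)"
    using c(2)[OF ts] by (simp add: pair_def trm_def)
  have "ev M ?xs (ty ?n (cn PairC ?n ?ts)) = Some (snd (tty (pair G A B a b)))"
    by (rule ev_ty_tty[OF 2]) (use c(3)[OF ts] in \<open>simp_all add: pair_def del: ev.simps\<close>)
  then have "snd (tty (pair G A B a b)) = snd (sig G A B)"
    using c(4)[OF ts] e(6) by (simp del: ev.simps)
  then show "tty (pair G A B a b) = sig G A B"
    by (simp add: prod_eq_iff)
qed

context
  fixes G A B p
  assumes G: "ctx G" and A: "ltyp A" "bs A = G" and B: "ltyp B" "bs B = A"
    and p: "trm p" "tty p = sig G A B"
begin

lemma pr_prem:
  defines "xs \<equiv> [snd G, snd A, snd B, snd p]" and "n \<equiv> fst G"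
  shows "ev M xs (Tvar 0) = Some (snd G)" "ev M xs (Tvar 1) = Some (snd A)"
    "ev M xs (Tvar 2) = Some (snd B)" "ev M xs (Tvar 3) = Some (snd p)"
    "holds M xs [Eq (ft n (Tvar 1)) (Tvar 0), Eq (ft (Suc n) (Tvar 2)) (Tvar 1),
        Eq (ty n (Tvar 3)) (cn SigC n [Tvar 0, Tvar 1, Tvar 2])]"
    "env M xs [Ctx n, Ctx (Suc n), Ctx (Suc (Suc n)), Tm n]"
    "ev M xs (cn SigC n [Tvar 0, Tvar 1, Tvar 2]) = Some (snd (sig G A B))"
proof -
  have f: "fst B = Suc (Suc n)" "fst A = Suc n" "fst p = n"
    using fst2_of_bs[OF B A] fst_bs[of A] A fst_of_tty[OF p(2)] sig(3)[OF G A B] by (simp_all add: n_def)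
  show v: "ev M xs (Tvar 0) = Some (snd G)" "ev M xs (Tvar 1) = Some (snd A)"
    "ev M xs (Tvar 2) = Some (snd B)" "ev M xs (Tvar 3) = Some (snd p)" by (simp_all add: xs_def)
  show "ev M xs (cn SigC n [Tvar 0, Tvar 1, Tvar 2]) = Some (snd (sig G A B))"
    by (rule ev_cn_sig[OF G A B v(1-3)]) (simp add: n_def)
  show "env M xs [Ctx n, Ctx (Suc n), Ctx (Suc (Suc n)), Tm n]"
    using carriers(1)[OF G] carriers(1)[of A] carriers(1)[of B] carriers(2)[OF p(1)] A B f by (simp add: xs_def n_def)
  show "holds M xs [Eq (ft n (Tvar 1)) (Tvar 0), Eq (ft (Suc n) (Tvar 2)) (Tvar 1),
        Eq (ty n (Tvar 3)) (cn SigC n [Tvar 0, Tvar 1, Tvar 2])]"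
    using ev_ft_bs[OF A(1) v(2)] ev_ft_bs[OF B(1) v(3)] ev_ty_tty[OF p(1) v(4)] ev_cn_sig[OF G A B v(1-3), of n] v A B p f
    by (simp add: n_def del: ev.simps)
qed

lemma pr1:
  shows "fn M (New (Pr1C, fst G)) [snd G, snd A, snd B, snd p] = Some (snd (pr1 G A B p))"
    "trm (pr1 G A B p)" "tty (pr1 G A B p) = A"
proof -
  let ?n = "fst G" and ?xs = "[snd G, snd A, snd B, snd p]"
  let ?ts = "[Tvar 0, Tvar 1, Tvar 2, Tvar 3] :: t0 trm list"
  note v = pr_prem
  have c: "?ts = tvars 0 (Suc (length (cdom Pr1C)))" "env M ?xs (Ctx ?n # map (shift ?n) (cdom Pr1C))"
    "holds M ?xs (prem Pr1C ?n ?ts)"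
    using v by (simp_all add: vars4 del: ev.simps)
  note c = con_value[OF c]
  show 1: "fn M (New (Pr1C, fst G)) ?xs = Some (snd (pr1 G A B p))"
    using c(1) by (simp add: pr1_def)
  show 2: "trm (pr1 G A B p)"
    using c(2) by (simp add: pr1_def trm_def)
  have "ev M ?xs (ty ?n (cn Pr1C ?n ?ts)) = Some (snd (tty (pr1 G A B p)))"
    by (rule ev_ty_tty[OF 2]) (use c(3) in \<open>simp_all add: pr1_def del: ev.simps\<close>)
  then have "snd (tty (pr1 G A B p)) = snd A"
    using c(4) v(2) by (simp del: ev.simps)
  then show "tty (pr1 G A B p) = A"
    using fst_bs[of A] A by (simp add: prod_eq_iff)
qed

lemma pr2:
  shows "fn M (New (Pr2C, fst G)) [snd G, snd A, snd B, snd p] = Some (snd (pr2 G A B p))"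
    "trm (pr2 G A B p)" "tty (pr2 G A B p) = pb B (sec (pr1 G A B p))"
proof -
  let ?n = "fst G" and ?xs = "[snd G, snd A, snd B, snd p]"
  let ?ts = "[Tvar 0, Tvar 1, Tvar 2, Tvar 3] :: t0 trm list"
  note v = pr_prem
  have c: "?ts = tvars 0 (Suc (length (cdom Pr2C)))" "env M ?xs (Ctx ?n # map (shift ?n) (cdom Pr2C))"
    "holds M ?xs (prem Pr2C ?n ?ts)"
    using v by (simp_all add: vars4 del: ev.simps)
  note c = con_value[OF c]
  show 1: "fn M (New (Pr2C, fst G)) ?xs = Some (snd (pr2 G A B p))"
    using c(1) by (simp add: pr2_def)
  show 2: "trm (pr2 G A B p)"
    using c(2) by (simp add: pr2_def trm_def)
  have "ev M ?xs (cn Pr1C ?n ?ts) = Some (snd (pr1 G A B p))"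
    using pr1(1) v(1-4) by simp
  then have "ev M ?xs (inst ?n KTy (Tvar 0) (Tvar 2) (cn Pr1C ?n ?ts)) = Some (snd (pb B (sec (pr1 G A B p))))"
    by (rule ev_inst_KTy[OF v(1,3)]) (use pr1 A B in simp_all)
  moreover have "ev M ?xs (ty ?n (cn Pr2C ?n ?ts)) = Some (snd (tty (pr2 G A B p)))"
    by (rule ev_ty_tty[OF 2]) (use c(3) in \<open>simp_all add: pr2_def del: ev.simps\<close>)
  ultimately have "snd (tty (pr2 G A B p)) = snd (pb B (sec (pr1 G A B p)))"
    using c(4) by (simp del: ev.simps)
  then show "tty (pr2 G A B p) = pb B (sec (pr1 G A B p))"
    using pr1 A by (simp add: prod_eq_iff)
qed

end

section \<open>Stability of the constructors under substitution\<close>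

lemma con_stable_eq:
  assumes "cmo s" "cd s = G" "dm s = z" "env M ds (map (shift (fst G)) (cdom c))"
    "fn M (New (c, fst G)) (snd G # ds) = Some y"
    "list_all2 (\<lambda>(r, b) b'. pulls s r b b') (zip (cdom c) ds) ds'" "pulls s (ccod c) y y'"
  shows "y' = CN c (fst z) (snd z # ds')"
  using con_pull[of s ds c y ds' y'] assms by (simp add: CN_def)

lemma fn_intT:
  assumes "ctx G"
  shows "fn M (New (IntvC, fst G)) [snd G] = Some (snd (intT G))"
    "fn M (New (LeftC, fst G)) [snd G] = Some (snd (leftT G))"
    "fn M (New (RightC, fst G)) [snd G] = Some (snd (rightT G))"
  using assms IntvC(1) LeftC(1) RightC(1) by (simp_all add: intT_def leftT_def rightT_def ctx_def)

context
  fixes s :: "'x ar" and G z :: "'x ob"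
  assumes s: "cmo s" and G: "cd s = G" and z: "dm s = z"
begin

lemma ctx_cod: "ctx G" using cmo_ctx(2)[OF s] by (simp add: G)

lemma intT_stable: "pb (intT G) s = intT z"
proof -
  have "snd (pb (intT G) s) = CN IntvC (fst z) [snd z]"
    by (rule con_stable_eq[OF s G z _ fn_intT(1)[OF ctx_cod]])
      (use pulls_Ctx1[OF s, of "intT G"] ctx_cod in \<open>simp_all add: G\<close>)
  then show ?thesis by (simp add: intT_def prod_eq_iff z)
qed

lemma leftT_stable: "tms (leftT G) s = leftT z"
proof -
  have "snd (tms (leftT G) s) = CN LeftC (fst z) [snd z]"
    by (rule con_stable_eq[OF s G z _ fn_intT(2)[OF ctx_cod]])
      (use pulls_Tm0[OF s, of "leftT G"] ctx_cod in \<open>simp_all add: G\<close>)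
  then show ?thesis by (simp add: leftT_def prod_eq_iff z)
qed

lemma rightT_stable: "tms (rightT G) s = rightT z"
proof -
  have "snd (tms (rightT G) s) = CN RightC (fst z) [snd z]"
    by (rule con_stable_eq[OF s G z _ fn_intT(3)[OF ctx_cod]])
      (use pulls_Tm0[OF s, of "rightT G"] ctx_cod in \<open>simp_all add: G\<close>)
  then show ?thesis by (simp add: rightT_def prod_eq_iff z)
qed

lemma coeT_stable:
  assumes D: "ltyp D" "bs D = intT G" and d: "trm d" "tty d = pb D (sec (leftT G))"
    and i: "trm i" "tty i = intT G"
  shows "tms (coeT G D d i) s = coeT z (pb D (pq (intT G) s)) (tms d s) (tms i s)"
proof -
  note c = coeT[OF ctx_cod D d i]
  have f: "fst D = Suc (Suc (fst G))" "fst d = fst G" "fst i = fst G"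
    using fst2_of_bs[OF D] fst_of_tty[OF d(2)] fst_of_tty[OF i(2)] ctx_cod D by simp_all
  have "snd (tms (coeT G D d i) s) = CN Coe1C (fst z) (snd z # [snd (pb D (pq (intT G) s)), snd (tms d s), snd (tms i s)])"
    by (rule con_stable_eq[OF s G z _ c(1)])
      (use pulls_Ctx2[OF s D] pulls_Tm0[OF s d(1)] pulls_Tm0[OF s i(1)] pulls_Tm0[OF s c(2)] ctx_cod D d i c(3)
        carriers(1)[of D] carriers(2)[OF d(1)] carriers(2)[OF i(1)] f in \<open>simp_all add: G\<close>)
  then show ?thesis by (simp add: coeT_def prod_eq_iff z)
qed

lemma pathT_stable:
  assumes C: "ltyp C" "bs C = intT G" and a: "trm a" "tty a = pb C (sec (leftT G))"
    and b: "trm b" "tty b = pb C (sec (rightT G))"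
  shows "pb (pathT G C a b) s = pathT z (pb C (pq (intT G) s)) (tms a s) (tms b s)"
proof -
  note c = pathT[OF ctx_cod C a b]
  have f: "fst C = Suc (Suc (fst G))" "fst a = fst G" "fst b = fst G"
    using fst2_of_bs[OF C] fst_of_tty[OF a(2)] fst_of_tty[OF b(2)] ctx_cod C by simp_all
  have "snd (pb (pathT G C a b) s) = CN PathC (fst z) (snd z # [snd (pb C (pq (intT G) s)), snd (tms a s), snd (tms b s)])"
    by (rule con_stable_eq[OF s G z _ c(1)])
      (use pulls_Ctx2[OF s C] pulls_Tm0[OF s a(1)] pulls_Tm0[OF s b(1)] pulls_Ctx1[OF s, of "pathT G C a b"] ctx_cod C a b c(2,3)
        carriers(1)[of C] carriers(2)[OF a(1)] carriers(2)[OF b(1)] f in \<open>simp_all add: G\<close>)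
  then show ?thesis by (simp add: pathT_def prod_eq_iff z)
qed

lemma plam_stable:
  assumes a: "trm a" "bs (tty a) = intT G"
  shows "tms (plam G a) s = plam z (tms a (pq (intT G) s))"
proof -
  note c = plam[OF ctx_cod a]
  have f: "fst a = Suc (fst G)"
    using fst_bs_tty[of a] a by simp
  have C: "ltyp (tty a)" using a by simp
  have "bs (tty (plam G a)) = G"
    unfolding c(2) by (rule pathT(3)[OF ctx_cod C a(2)]) (use a ctx_cod in simp_all)
  then have "snd (tms (plam G a) s) = CN PLamC (fst z) (snd z # [snd (tms a (pq (intT G) s))])"
    by (intro con_stable_eq[OF s G z _ c(3)])
      (use pulls_Tm1[OF s a] pulls_Tm0[OF s c(1)] ctx_cod a carriers(2)[OF a(1)] f in \<open>simp_all add: G\<close>)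
  then show ?thesis by (simp add: plam_def prod_eq_iff z)
qed

lemma atT_stable:
  assumes C: "ltyp C" "bs C = intT G" and a: "trm a" "tty a = pb C (sec (leftT G))"
    and b: "trm b" "tty b = pb C (sec (rightT G))" and p: "trm p" "tty p = pathT G C a b"
    and i: "trm i" "tty i = intT G"
  shows "tms (atT G C a b p i) s = atT z (pb C (pq (intT G) s)) (tms a s) (tms b s) (tms p s) (tms i s)"
proof -
  note c = atT[OF ctx_cod C a b p i]
  have f: "fst C = Suc (Suc (fst G))" "fst a = fst G" "fst b = fst G" "fst p = fst G" "fst i = fst G"
    using fst2_of_bs[OF C] fst_of_tty[OF a(2)] fst_of_tty[OF b(2)] fst_of_tty[OF p(2)] fst_of_tty[OF i(2)]
      pathT(3)[OF ctx_cod C a b] ctx_cod C by simp_all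
  have "snd (tms (atT G C a b p i) s) = CN AtC (fst z)
      (snd z # [snd (pb C (pq (intT G) s)), snd (tms a s), snd (tms b s), snd (tms p s), snd (tms i s)])"
    by (rule con_stable_eq[OF s G z _ c(1)])
      (use pulls_Ctx2[OF s C] pulls_Tm0[OF s a(1)] pulls_Tm0[OF s b(1)] pulls_Tm0[OF s p(1)] pulls_Tm0[OF s i(1)]
        pulls_Tm0[OF s c(2)] ctx_cod C a b p i c(3) pathT(3)[OF ctx_cod C a b]
        carriers(1)[of C] carriers(2)[OF a(1)] carriers(2)[OF b(1)] carriers(2)[OF p(1)] carriers(2)[OF i(1)] f
        in \<open>simp_all add: G\<close>)
  then show ?thesis by (simp add: atT_def prod_eq_iff z)
qed

lemma sig_stable:
  assumes A: "ltyp A" "bs A = G" and B: "ltyp B" "bs B = A"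
  shows "pb (sig G A B) s = sig z (pb A s) (pb B (pq A s))"
proof -
  note c = sig[OF ctx_cod A B]
  have f: "fst B = Suc (Suc (fst G))" "fst A = Suc (fst G)"
    using fst2_of_bs[OF B A] fst_bs[of A] A by simp_all
  have "snd (pb (sig G A B) s) = CN SigC (fst z) (snd z # [snd (pb A s), snd (pb B (pq A s))])"
    by (rule con_stable_eq[OF s G z _ c(1)])
      (use pulls_Ctx1[OF s A(1)] pulls_Ctx2[OF s B A(1)] pulls_Ctx1[OF s, of "sig G A B"] A B c(2,3)
        carriers(1)[of A] carriers(1)[of B] f in \<open>simp_all add: G\<close>)
  then show ?thesis by (simp add: sig_def prod_eq_iff z)
qed

lemma pair_stable:
  assumes A: "ltyp A" "bs A = G" and B: "ltyp B" "bs B = A"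
    and a: "trm a" "tty a = A" and b: "trm b" "tty b = pb B (sec a)"
  shows "tms (pair G A B a b) s = pair z (pb A s) (pb B (pq A s)) (tms a s) (tms b s)"
proof -
  note c = pair[OF ctx_cod A B a b]
  have f: "fst B = Suc (Suc (fst G))" "fst A = Suc (fst G)" "fst a = fst G" "fst b = fst G"
    using fst2_of_bs[OF B A] fst_bs[of A] A fst_of_tty[OF a(2)] fst_of_tty[OF b(2)] a B by simp_all
  have "snd (tms (pair G A B a b) s) = CN PairC (fst z)
      (snd z # [snd (pb A s), snd (pb B (pq A s)), snd (tms a s), snd (tms b s)])"
    by (rule con_stable_eq[OF s G z _ c(1)])
      (use pulls_Ctx1[OF s A(1)] pulls_Ctx2[OF s B A(1)] pulls_Tm0[OF s a(1)] pulls_Tm0[OF s b(1)]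
        pulls_Tm0[OF s c(2)] A B a b c(3) sig(3)[OF ctx_cod A B]
        carriers(1)[of A] carriers(1)[of B] carriers(2)[OF a(1)] carriers(2)[OF b(1)] f in \<open>simp_all add: G\<close>)
  then show ?thesis by (simp add: pair_def prod_eq_iff z)
qed

lemma pr_stable:
  assumes A: "ltyp A" "bs A = G" and B: "ltyp B" "bs B = A" and p: "trm p" "tty p = sig G A B"
  shows "tms (pr1 G A B p) s = pr1 z (pb A s) (pb B (pq A s)) (tms p s)"
    "tms (pr2 G A B p) s = pr2 z (pb A s) (pb B (pq A s)) (tms p s)"
proof -
  note c = pr1[OF ctx_cod A B p] and d = pr2[OF ctx_cod A B p]
  have f: "fst B = Suc (Suc (fst G))" "fst A = Suc (fst G)" "fst p = fst G"
    using fst2_of_bs[OF B A] fst_bs[of A] A fst_of_tty[OF p(2)] sig(3)[OF ctx_cod A B] by simp_all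
  note u = pulls_Ctx1[OF s A(1)] pulls_Ctx2[OF s B A(1)] pulls_Tm0[OF s p(1)] A B p sig(3)[OF ctx_cod A B]
        carriers(1)[of A] carriers(1)[of B] carriers(2)[OF p(1)] f
  have "snd (tms (pr1 G A B p) s) = CN Pr1C (fst z) (snd z # [snd (pb A s), snd (pb B (pq A s)), snd (tms p s)])"
    by (rule con_stable_eq[OF s G z _ c(1)]) (use u pulls_Tm0[OF s c(2)] c(3) in \<open>simp_all add: G\<close>)
  then show "tms (pr1 G A B p) s = pr1 z (pb A s) (pb B (pq A s)) (tms p s)" by (simp add: pr1_def prod_eq_iff z)
  have "snd (tms (pr2 G A B p) s) = CN Pr2C (fst z) (snd z # [snd (pb A s), snd (pb B (pq A s)), snd (tms p s)])"
    by (rule con_stable_eq[OF s G z _ d(1)]) (use u pulls_Tm0[OF s d(2)] d(3) c in \<open>simp_all add: G\<close>)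
  then show "tms (pr2 G A B p) s = pr2 z (pb A s) (pb B (pq A s)) (tms p s)" by (simp add: pr2_def prod_eq_iff z)
qed

end


section \<open>Computation and uniqueness rules\<close>

lemma new_axiom:
  assumes "env M xs V" "holds M xs \<phi>"
  shows "(V, \<phi>, \<psi>) \<in> coe1_axioms \<Longrightarrow> holds M xs \<psi>" "(V, \<phi>, \<psi>) \<in> path_axioms \<Longrightarrow> holds M xs \<psi>"
    "(V, \<phi>, \<psi>) \<in> Sigma_axioms \<Longrightarrow> holds M xs \<psi>"
  using axiom[of V \<phi> \<psi> xs] assms by (simp_all add: T0_def)

lemma coeT_left:
  assumes G: "ctx G" and D: "ltyp D" "bs D = intT G" and d: "trm d" "tty d = pb D (sec (leftT G))"
  shows "coeT G D d (leftT G) = d"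
proof -
  let ?n = "fst G" and ?xs = "[snd G, snd D, snd d]"
  have f: "fst D = Suc (Suc ?n)" "fst d = ?n"
    using fst2_of_bs[OF D] fst_of_tty[OF d(2)] G D by simp_all
  have v: "ev M ?xs (Tvar 0) = Some (snd G)" "ev M ?xs (Tvar 1) = Some (snd D)"
    "ev M ?xs (Tvar 2) = Some (snd d)" by simp_all
  note l = ev_intv[OF G v(1) refl]
  have "ev M ?xs (ft (Suc ?n) (Tvar 1)) = Some (snd (bs D))"
    by (rule ev_ft_bs[OF D(1) v(2)]) (use D f in simp)
  moreover have "ev M ?xs (ty ?n (Tvar 2)) = Some (snd (tty d))" "ev M ?xs (ty ?n (lft ?n (Tvar 0))) = Some (snd (tty (leftT G)))"
    using ev_ty_tty[OF d(1) v(3)] ev_ty_tty[OF leftT(1)[OF G] l(2)] f by (simp_all add: leftT_def del: ev.simps)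
  moreover have "ev M ?xs (inst ?n KTy (Tvar 0) (Tvar 1) (lft ?n (Tvar 0))) = Some (snd (pb D (sec (leftT G))))"
    by (rule ev_inst_KTy[OF v(1,2) l(2)]) (use G D in simp_all)
  ultimately have h: "holds M ?xs (prem Coe1C ?n [Tvar 0, Tvar 1, Tvar 2, lft ?n (Tvar 0)])"
    using l D d G by (simp del: ev.simps)
  have "([Ctx ?n, Ctx (?n + 2), Tm ?n], prem Coe1C ?n [Tvar 0, Tvar 1, Tvar 2, lft ?n (Tvar 0)],
      [Eq (cn Coe1C ?n [Tvar 0, Tvar 1, Tvar 2, lft ?n (Tvar 0)]) (Tvar 2)]) \<in> coe1_axioms"
    unfolding coe1_axioms_def Let_def by (rule UnI2) blast
  then have "holds M ?xs [Eq (cn Coe1C ?n [Tvar 0, Tvar 1, Tvar 2, lft ?n (Tvar 0)]) (Tvar 2)]"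
    by (rule new_axiom(1)[OF _ h, rotated]) (use carriers(1)[OF G] carriers(1)[of D] carriers(2)[OF d(1)] D f in simp)
  moreover have "ev M ?xs (cn Coe1C ?n [Tvar 0, Tvar 1, Tvar 2, lft ?n (Tvar 0)]) = Some (snd (coeT G D d (leftT G)))"
    using coeT(1)[OF G D d leftT[OF G]] v l(2) by simp
  ultimately have "snd (coeT G D d (leftT G)) = snd d"
    using v by (simp del: ev.simps(2))
  then show ?thesis using f by (simp add: prod_eq_iff)
qed

lemma at_plam:
  assumes G: "ctx G" and a: "trm a" "bs (tty a) = intT G" and i: "trm i" "tty i = intT G"
  shows "atT G (tty a) (tms a (sec (leftT G))) (tms a (sec (rightT G))) (plam G a) i = tms a (sec i)"
proof -
  let ?n = "fst G" and ?xs = "[snd G, snd a, snd i]"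
  have f: "fst a = Suc ?n" "fst i = ?n"
    using fst_bs_tty[of a] fst_of_tty[OF i(2)] a G by simp_all
  have v: "ev M ?xs (Tvar 0) = Some (snd G)" "ev M ?xs (Tvar 1) = Some (snd a)" "ev M ?xs (Tvar 2) = Some (snd i)"
    by simp_all
  note l = ev_intv[OF G v(1) refl]
  have ea: "ev M ?xs (ty (Suc ?n) (Tvar 1)) = Some (snd (tty a))"
    by (rule ev_ty_tty[OF a(1) v(2)]) (simp add: f)
  have e1: "ev M ?xs (ft (Suc ?n) (ty (Suc ?n) (Tvar 1))) = Some (snd (bs (tty a)))"
    by (rule ev_ft_bs[OF _ ea]) (use a(1) f in simp_all)
  have e2: "ev M ?xs (ty ?n (Tvar 2)) = Some (snd (tty i))"
    by (rule ev_ty_tty[OF i(1) v(3)]) (simp add: f)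
  have e3: "ev M ?xs (inst ?n KTm (Tvar 0) (Tvar 1) (lft ?n (Tvar 0))) = Some (snd (tms a (sec (leftT G))))"
    by (rule ev_inst_KTm[OF v(1,2) l(2)]) (use G a in simp_all)
  have e4: "ev M ?xs (inst ?n KTm (Tvar 0) (Tvar 1) (rgt ?n (Tvar 0))) = Some (snd (tms a (sec (rightT G))))"
    by (rule ev_inst_KTm[OF v(1,2) l(3)]) (use G a in simp_all)
  have e5: "ev M ?xs (inst ?n KTm (Tvar 0) (Tvar 1) (Tvar 2)) = Some (snd (tms a (sec i)))"
    by (rule ev_inst_KTm[OF v(1,2,3)]) (use G a i in simp_all)
  have h: "holds M ?xs (prem PLamC ?n [Tvar 0, Tvar 1] @ [Eq (ty ?n (Tvar 2)) (intv ?n (Tvar 0))])"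
    using e1 e2 l a i by (simp del: ev.simps)
  let ?ts = "[Tvar 0, ty (Suc ?n) (Tvar 1), inst ?n KTm (Tvar 0) (Tvar 1) (lft ?n (Tvar 0)),
        inst ?n KTm (Tvar 0) (Tvar 1) (rgt ?n (Tvar 0)), cn PLamC ?n [Tvar 0, Tvar 1], Tvar 2]"
  have "([Ctx ?n, Tm (?n + 1), Tm ?n], prem PLamC ?n [Tvar 0, Tvar 1] @ [Eq (ty ?n (Tvar 2)) (intv ?n (Tvar 0))],
      [Eq (cn AtC ?n ?ts) (inst ?n KTm (Tvar 0) (Tvar 1) (Tvar 2))]) \<in> path_axioms"
    unfolding path_axioms_def Let_def by (rule UnI1, rule UnI2) blast
  then have "holds M ?xs [Eq (cn AtC ?n ?ts) (inst ?n KTm (Tvar 0) (Tvar 1) (Tvar 2))]"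
    by (rule new_axiom(2)[OF _ h, rotated]) (use carriers(1)[OF G] carriers(2)[OF a(1)] carriers(2)[OF i(1)] f in simp)
  moreover have "ev M ?xs (cn PLamC ?n [Tvar 0, Tvar 1]) = Some (snd (plam G a))"
    using plam(3)[OF G a] v by simp
  then have mts: "map (ev M ?xs) ?ts = map Some [snd G, snd (tty a), snd (tms a (sec (leftT G))),
      snd (tms a (sec (rightT G))), snd (plam G a), snd i]"
    using v ea e3 e4 by (simp del: ev.simps)
  have "ev M ?xs (cn AtC ?n ?ts) = Some (snd (atT G (tty a) (tms a (sec (leftT G))) (tms a (sec (rightT G))) (plam G a) i))"
    unfolding ev_cn[OF mts] by (intro atT(1)) (use G a i plam[OF G a] in simp_all)
  ultimately have "snd (atT G (tty a) (tms a (sec (leftT G))) (tms a (sec (rightT G))) (plam G a) i) = snd (tms a (sec i))"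
    using e5 by (simp del: ev.simps)
  then show ?thesis using i G by (simp add: prod_eq_iff)
qed

text \<open>The eta rule lives over the context extended by \<open>x : I\<close>, with all data
  weakened along \<open>w\<close>. Most of the work is to show that the weakened data satisfy the
  premises of \<open>at\<close>.\<close>

lemma path_eqs:
  assumes G: "ctx G" and C: "ltyp C" "bs C = intT G" and a: "trm a" "tty a = pb C (sec (leftT G))"
    and b: "trm b" "tty b = pb C (sec (rightT G))" and p: "trm p" "tty p = pathT G C a b"
  defines "w \<equiv> dsp (intT G)"
  shows "plam G (atT (intT G) (pb C (pq (intT G) w)) (tms a w) (tms b w) (tms p w) (v0 (intT G))) = p"
    "atT G C a b p (leftT G) = a" "atT G C a b p (rightT G) = b"
proof -
  let ?n = "fst G" and ?xs = "[snd G, snd C, snd a, snd b, snd p]"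
  have f: "fst C = Suc (Suc ?n)" "fst a = ?n" "fst b = ?n" "fst p = ?n"
    using fst2_of_bs[OF C] fst_of_tty[OF a(2)] fst_of_tty[OF b(2)] fst_of_tty[OF p(2)] 
      pathT(3)[OF G C a b] G C by simp_all
  have v: "ev M ?xs (Tvar 0) = Some (snd G)" "ev M ?xs (Tvar 1) = Some (snd C)"
    "ev M ?xs (Tvar 2) = Some (snd a)" "ev M ?xs (Tvar 3) = Some (snd b)"
    "ev M ?xs (Tvar 4) = Some (snd p)" by simp_all
  note l = ev_intv[OF G v(1) refl]
  have "ev M ?xs (ty ?n (Tvar 4)) = Some (snd (tty p))"
    by (rule ev_ty_tty[OF p(1) v(5)]) (simp add: f)
  then have h: "holds M ?xs [Eq (ty ?n (Tvar 4)) (cn PathC ?n [Tvar 0, Tvar 1, Tvar 2, Tvar 3])]"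
    using ev_cn_pathT[OF G C a b v(1-4) refl] p by (simp del: ev.simps)
  let ?I = "intv ?n (Tvar 0)"
  let ?at = "cn AtC (Suc ?n) [?I, wk ?n (Ctx 2) ?I (Tvar 1), wk ?n (Tm 0) ?I (Tvar 2),
      wk ?n (Tm 0) ?I (Tvar 3), wk ?n (Tm 0) ?I (Tvar 4), vr (Suc ?n) 0 ?I]"
  let ?lhs = "cn AtC ?n [Tvar 0, Tvar 1, Tvar 2, Tvar 3, Tvar 4, lft ?n (Tvar 0)]"
  let ?rhs = "cn AtC ?n [Tvar 0, Tvar 1, Tvar 2, Tvar 3, Tvar 4, rgt ?n (Tvar 0)]"
  have "([Ctx ?n, Ctx (?n + 2), Tm ?n, Tm ?n, Tm ?n], [Eq (ty ?n (Tvar 4)) (cn PathC ?n [Tvar 0, Tvar 1, Tvar 2, Tvar 3])],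
      [Eq (cn PLamC ?n [Tvar 0, ?at]) (Tvar 4), Eq ?lhs (Tvar 2), Eq ?rhs (Tvar 3)]) \<in> path_axioms"
    unfolding path_axioms_def Let_def by (rule UnI2, rule UN_I[OF UNIV_I], rule singletonI)
  then have hh: "holds M ?xs [Eq (cn PLamC ?n [Tvar 0, ?at]) (Tvar 4), Eq ?lhs (Tvar 2), Eq ?rhs (Tvar 3)]"
    by (rule new_axiom(2)[OF _ h, rotated]) (use carriers(1)[OF G] carriers(1)[of C] carriers(2)[OF a(1)] carriers(2)[OF b(1)]
      carriers(2)[OF p(1)] C f in simp)
  have "ev M ?xs ?lhs = Some (snd (atT G C a b p (leftT G)))" "ev M ?xs ?rhs = Some (snd (atT G C a b p (rightT G)))"
    using atT(1)[OF G C a b p leftT[OF G]] atT(1)[OF G C a b p rightT[OF G]] v l by simp_all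
  then have "snd (atT G C a b p (leftT G)) = snd a" "snd (atT G C a b p (rightT G)) = snd b"
    using hh v by (simp_all del: ev.simps)
  then show "atT G C a b p (leftT G) = a" "atT G C a b p (rightT G) = b"
    using f by (simp_all add: prod_eq_iff)
  let ?W = "intT G"
  have W: "ltyp ?W" "bs ?W = G" "fst ?W = Suc ?n" using G by simp_all
  have w: "cmo w" "dm w = ?W" "cd w = G" using W by (simp_all add: w_def)
  note st = intT_stable[OF w(1,3,2)] leftT_stable[OF w(1,3,2)] rightT_stable[OF w(1,3,2)]
  let ?C = "pb C (pq ?W w)"
  have q: "cmo (pq ?W w)" "dm (pq ?W w) = intT ?W" "cd (pq ?W w) = ?W"
    using W w st by simp_all
  have C': "ltyp ?C" "bs ?C = intT ?W" using q C by simp_all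
  \<comment> \<open>The sections given by the two ends of the interval commute with weakening. Hence
    the weakened end points have the types that the weakened \<open>C\<close> takes at the
    ends.\<close>
  have sq: "cc (pq ?W w) (sec x') = cc (sec x) w"
    if x: "trm x" "tty x = ?W" and x': "trm x'" "tty x' = intT ?W" and t: "tms x w = x'" for x x'
  proof (rule ex_ext[of _ _ ?W])
    note s = sec[OF x(1), unfolded x(2) W(2)] and s' = sec[OF x'(1), unfolded x'(2)]
    have s'': "cc (dsp (intT ?W)) (sec x') = cid ?W" "dm (sec x') = ?W" using s' W by simp_all
    have "cc (dsp ?W) (pq ?W w) = cc w (dsp (intT ?W))" using W w st(1) by simp
    from comp_reassoc[OF this, of "sec x'"] have "cc (dsp ?W) (cc (pq ?W w) (sec x')) = w"
      using W w q s'(1,3) s'' by simp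
    moreover from comp_reassoc[OF s(4), of w] have "cc (dsp ?W) (cc (sec x) w) = w"
      using W w s(1-3) by simp
    ultimately show "cc (dsp ?W) (cc (pq ?W w) (sec x')) = cc (dsp ?W) (cc (sec x) w)" by (simp only:)
    have "lst (cc (pq ?W w) (sec x')) = x'"
      using W w q s'(1,3,5) st(1) by simp
    moreover have "lst (cc (sec x) w) = x'"
      using W w s(1,3,5) t by simp
    ultimately show "lst (cc (pq ?W w) (sec x')) = lst (cc (sec x) w)" by (simp only:)
    show "cmo (cc (pq ?W w) (sec x'))" "cmo (cc (sec x) w)" "dm (cc (pq ?W w) (sec x')) = dm (cc (sec x) w)"
      "cd (cc (pq ?W w) (sec x')) = ?W" "cd (cc (sec x) w) = ?W"
      using q s'(1,3) s'' s(1-3) w by simp_all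
  qed (rule W(1))
  note seq = sq[OF leftT[OF G] leftT(1)[of ?W] leftT(2)[of ?W] st(2)] sq[OF rightT[OF G] rightT(1)[of ?W] rightT(2)[of ?W] st(3)]
  have a': "trm (tms a w)" "tty (tms a w) = pb ?C (sec (leftT ?W))"
    and b': "trm (tms b w)" "tty (tms b w) = pb ?C (sec (rightT ?W))"
    using a b C G W w q seq by simp_all
  have p': "trm (tms p w)" "tty (tms p w) = pathT ?W ?C (tms a w) (tms b w)"
    using p w pathT(3)[OF G C a b] pathT_stable[OF w(1,3,2) C a b] by simp_all
  have i': "trm (v0 ?W)" "tty (v0 ?W) = intT ?W" using W st(1) by (simp_all add: w_def)
  note at = atT[OF _ C' a' b' p' i']
  have "ev M ?xs (wk ?n (Ctx 2) ?I (Tvar 1)) = Some (snd ?C)"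
    by (rule ev_wk[OF _ W(1) l(1) v(2) W(3)]) (use pulls_Ctx2[OF w(1) C W(1)] W w in \<open>simp add: w_def\<close>)
  moreover have "ev M ?xs (wk ?n (Tm 0) ?I (Tvar 2)) = Some (snd (tms a w))"
    by (rule ev_wk[OF _ W(1) l(1) v(3) W(3)]) (use pulls_Tm0[OF w(1) a(1)] a C G W w in \<open>simp add: w_def\<close>)
  moreover have "ev M ?xs (wk ?n (Tm 0) ?I (Tvar 3)) = Some (snd (tms b w))"
    by (rule ev_wk[OF _ W(1) l(1) v(4) W(3)]) (use pulls_Tm0[OF w(1) b(1)] b C G W w in \<open>simp add: w_def\<close>)
  moreover have "ev M ?xs (wk ?n (Tm 0) ?I (Tvar 4)) = Some (snd (tms p w))"
    by (rule ev_wk[OF _ W(1) l(1) v(5) W(3)]) (use pulls_Tm0[OF w(1) p(1)] p pathT(3)[OF G C a b] W w in \<open>simp add: w_def\<close>)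
  moreover have "ev M ?xs (vr (Suc ?n) 0 ?I) = Some (snd (v0 ?W))"
    using l(1) carriers(1)[of ?W] W by (simp add: v0_def)
  ultimately have "ev M ?xs ?at = Some (snd (atT ?W ?C (tms a w) (tms b w) (tms p w) (v0 ?W)))"
    using at(1) l(1) W by simp
  moreover note pl = plam[OF G, of "atT ?W ?C (tms a w) (tms b w) (tms p w) (v0 ?W)"]
  ultimately have "ev M ?xs (cn PLamC ?n [Tvar 0, ?at]) = Some (snd (plam G (atT ?W ?C (tms a w) (tms b w) (tms p w) (v0 ?W))))"
    using v(1) at W i' C' by simp
  then have "snd (plam G (atT ?W ?C (tms a w) (tms b w) (tms p w) (v0 ?W))) = snd p"
    using hh v(5) by (simp del: ev.simps)
  then show "plam G (atT ?W ?C (tms a w) (tms b w) (tms p w) (v0 ?W)) = p"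
    using f by (simp add: prod_eq_iff)
qed

lemma pr_pair:
  assumes G: "ctx G" and A: "ltyp A" "bs A = G" and B: "ltyp B" "bs B = A"
    and a: "trm a" "tty a = A" and b: "trm b" "tty b = pb B (sec a)"
  shows "pr1 G A B (pair G A B a b) = a" "pr2 G A B (pair G A B a b) = b"
proof -
  let ?n = "fst G" and ?xs = "[snd G, snd A, snd B, snd a, snd b]"
  have f: "fst B = Suc (Suc ?n)" "fst A = Suc ?n" "fst a = ?n" "fst b = ?n"
    using fst2_of_bs[OF B A] fst_bs[of A] A fst_of_tty[OF a(2)] fst_of_tty[OF b(2)] a B by simp_all
  have v: "ev M ?xs (Tvar 0) = Some (snd G)" "ev M ?xs (Tvar 1) = Some (snd A)"
    "ev M ?xs (Tvar 2) = Some (snd B)" "ev M ?xs (Tvar 3) = Some (snd a)" "ev M ?xs (Tvar 4) = Some (snd b)" by simp_all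
  have e: "ev M ?xs (ft ?n (Tvar 1)) = Some (snd (bs A))" "ev M ?xs (ft (Suc ?n) (Tvar 2)) = Some (snd (bs B))"
    "ev M ?xs (ty ?n (Tvar 3)) = Some (snd (tty a))" "ev M ?xs (ty ?n (Tvar 4)) = Some (snd (tty b))"
    "ev M ?xs (inst ?n KTy (Tvar 0) (Tvar 2) (Tvar 3)) = Some (snd (pb B (sec a)))"
    using ev_ft_bs[OF A(1) v(2)] ev_ft_bs[OF B(1) v(3)] ev_ty_tty[OF a(1) v(4)] ev_ty_tty[OF b(1) v(5)]
      ev_inst_KTy[OF v(1,3,4) a(1)] A B a f by (simp_all del: ev.simps)
  let ?ts = "[Tvar 0, Tvar 1, Tvar 2, Tvar 3, Tvar 4]"
  have h: "holds M ?xs (prem PairC ?n ?ts)"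
    using e v A B a b by (simp del: ev.simps)
  let ?c = "cn PairC ?n ?ts"
  have "([Ctx ?n, Ctx (?n + 1), Ctx (?n + 2), Tm ?n, Tm ?n], prem PairC ?n ?ts,
      [Eq (cn Pr1C ?n [Tvar 0, Tvar 1, Tvar 2, ?c]) (Tvar 3), Eq (cn Pr2C ?n [Tvar 0, Tvar 1, Tvar 2, ?c]) (Tvar 4)]) \<in> Sigma_axioms"
    unfolding Sigma_axioms_def Let_def by (rule UnI1, rule UnI2) blast
  then have "holds M ?xs [Eq (cn Pr1C ?n [Tvar 0, Tvar 1, Tvar 2, ?c]) (Tvar 3), Eq (cn Pr2C ?n [Tvar 0, Tvar 1, Tvar 2, ?c]) (Tvar 4)]"
    by (rule new_axiom(3)[OF _ h, rotated]) (use carriers(1)[OF G] carriers(1)[of A] carriers(1)[of B] carriers(2)[OF a(1)] carriers(2)[OF b(1)] A B f in simp)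
  moreover have "ev M ?xs ?c = Some (snd (pair G A B a b))"
    using pair(1)[OF G A B a b] v by simp
  then have "ev M ?xs (cn Pr1C ?n [Tvar 0, Tvar 1, Tvar 2, ?c]) = Some (snd (pr1 G A B (pair G A B a b)))"
    "ev M ?xs (cn Pr2C ?n [Tvar 0, Tvar 1, Tvar 2, ?c]) = Some (snd (pr2 G A B (pair G A B a b)))"
    using pr1(1)[OF G A B pair(2,3)[OF G A B a b]] pr2(1)[OF G A B pair(2,3)[OF G A B a b]] v by simp_all
  ultimately have "snd (pr1 G A B (pair G A B a b)) = snd a" "snd (pr2 G A B (pair G A B a b)) = snd b"
    using v by (simp_all del: ev.simps(2))
  then show "pr1 G A B (pair G A B a b) = a" "pr2 G A B (pair G A B a b) = b"
    using f by (simp_all add: prod_eq_iff)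
qed

lemma pair_eta:
  assumes G: "ctx G" and A: "ltyp A" "bs A = G" and B: "ltyp B" "bs B = A" and p: "trm p" "tty p = sig G A B"
  shows "pair G A B (pr1 G A B p) (pr2 G A B p) = p"
proof -
  let ?n = "fst G" and ?xs = "[snd G, snd A, snd B, snd p]"
  note v = pr_prem[OF G A B p]
  let ?ts = "[Tvar 0, Tvar 1, Tvar 2, Tvar 3]"
  have h: "holds M ?xs (prem Pr1C ?n ?ts)"
    using v by (simp del: ev.simps)
  let ?t = "cn PairC ?n [Tvar 0, Tvar 1, Tvar 2, cn Pr1C ?n ?ts, cn Pr2C ?n ?ts]"
  have "([Ctx ?n, Ctx (?n + 1), Ctx (?n + 2), Tm ?n], prem Pr1C ?n ?ts, [Eq ?t (Tvar 3)]) \<in> Sigma_axioms"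
    unfolding Sigma_axioms_def Let_def by (rule UnI2) blast
  then have "holds M ?xs [Eq ?t (Tvar 3)]"
    by (rule new_axiom(3)[OF _ h, rotated]) (use v(6) in simp)
  moreover have "ev M ?xs (cn Pr1C ?n ?ts) = Some (snd (pr1 G A B p))" "ev M ?xs (cn Pr2C ?n ?ts) = Some (snd (pr2 G A B p))"
    using pr1(1)[OF G A B p] pr2(1)[OF G A B p] v(1-4) by simp_all
  then have "ev M ?xs ?t = Some (snd (pair G A B (pr1 G A B p) (pr2 G A B p)))"
    using pair(1)[OF G A B pr1(2,3)[OF G A B p] pr2(2,3)[OF G A B p]] v(1-4) by simp
  ultimately have "snd (pair G A B (pr1 G A B p) (pr2 G A B p)) = snd p"
    using v(4) by (simp del: ev.simps(2))
  then show ?thesis using fst_of_tty[OF p(2) sig(3)[OF G A B]] by (simp add: prod_eq_iff)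
qed


text \<open>By stability the interval type over \<open>a\<close> is the pullback of the closed
  interval type along the map to the empty context. So extension by \<open>x : I\<close> is
  literally the cylinder of the locale.\<close>

lemma intT_cyl: "ctx a \<Longrightarrow> intT a = cyl a"
  unfolding cyl_def uI_def[symmetric] using intT_stable[of "bang a" one a] by (simp add: uI_def)

lemma cyl_eqI:
  assumes "cmo f" "cmo g" "cd f = cyl a" "cd g = cyl a" "dm f = dm g" "ctx a"
    "cc (dsp (cyl a)) f = cc (dsp (cyl a)) g" "lst f = lst g"
  shows "f = g"
  by (rule ex_ext[OF assms(1-5) _ assms(7,8)]) (use assms(6) in simp)

lemma lst_pI: "ctx a \<Longrightarrow> lst (pI a) = v0 (cyl a)"
  unfolding pI_def cyl_def by (rule pq(5)) simp_all

lemma lst_pI_comp: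
  assumes "cmo f" "cd f = cyl a" "ctx a"
  shows "lst (cc (pI a) f) = lst f"
  using lst_cc[of "pI a" f] lst_pI[of a] tms_v0[of f "cyl a"] assms by simp

lemma lst_i0: "ctx a \<Longrightarrow> lst (i0 a) = leftT a" and lst_i1: "ctx a \<Longrightarrow> lst (i1 a) = rightT a"
proof -
  assume a: "ctx a"
  have "lst (cc uL (bang a)) = leftT a"
    using a lst_cc[of uL "bang a"] sec(5)[OF leftT(1)[OF one(1)]] leftT_stable[of "bang a" one a]
    by (simp add: uL_def[symmetric])
  then show "lst (i0 a) = leftT a" using lst_pI_comp[of "i0 a" a] a by simp
  have "lst (cc uR (bang a)) = rightT a"
    using a lst_cc[of uR "bang a"] sec(5)[OF rightT(1)[OF one(1)]] rightT_stable[of "bang a" one a]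
    by (simp add: uR_def[symmetric])
  then show "lst (i1 a) = rightT a" using lst_pI_comp[of "i1 a" a] a by simp
qed

lemma tty_leftT: "ctx a \<Longrightarrow> tty (leftT a) = cyl a" "ctx a \<Longrightarrow> tty (rightT a) = cyl a"
  by (simp_all add: intT_cyl)

lemma sec_leftT: "ctx a \<Longrightarrow> sec (leftT a) = i0 a" and sec_rightT: "ctx a \<Longrightarrow> sec (rightT a) = i1 a"
proof -
  assume a: "ctx a"
  note s = sec[OF leftT(1)[OF a], unfolded tty_leftT(1)[OF a]] and t = sec[OF rightT(1)[OF a], unfolded tty_leftT(2)[OF a]]
  show "sec (leftT a) = i0 a"
    by (rule cyl_eqI[of _ _ a]) (use a s lst_i0 in simp_all)
  show "sec (rightT a) = i1 a"
    by (rule cyl_eqI[of _ _ a]) (use a t lst_i1 in simp_all)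
qed

lemma lst_cyf: "cmo f \<Longrightarrow> lst (cyf f) = v0 (cyl (dm f))"
  using lst_pI_comp[of "cyf f" "cd f"] lst_pI[of "dm f"] by simp

lemma pq_cyl: "cmo f \<Longrightarrow> cd f = a \<Longrightarrow> pq (cyl a) f = cyf f"
proof -
  assume f: "cmo f" "cd f = a"
  have p: "pb (cyl a) f = cyl (dm f)"
    using intT_stable[OF f refl] f intT_cyl[of a] intT_cyl[of "dm f"] by auto
  show ?thesis
    by (rule cyl_eqI[of _ _ a]) (use f pq[of "cyl a" f] p lst_cyf in auto)
qed

lemma pb_cyl [simp]: "cmo f \<Longrightarrow> cd f = a \<Longrightarrow> pb (cyl a) f = cyl (dm f)"
  using intT_stable[of f a "dm f"] intT_cyl[of a] intT_cyl[of "dm f"] by auto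

text \<open>The diagonal in the interval coordinate: it substitutes the variable
  \<open>x : I\<close> of the context for a fresh interval variable. \<open>coe\<^sub>1\<close> and
  \<open>at\<close> will be applied to this variable, so their types are instantiated along
  \<open>diag\<close>. Weakening by the old coordinate followed by \<open>diag\<close> is the
  identity, see \<open>cyf_pr_diag\<close>.\<close>

definition diag :: "'x ob \<Rightarrow> 'x ar" where "diag a = sec (v0 (cyl a))"

lemma tty_v0_cyl: "ctx a \<Longrightarrow> tty (v0 (cyl a)) = cyl (cyl a)"
  using v0(2)[of "cyl a"] pb_cyl[of "dsp (cyl a)" a] by simp

lemma diag [simp]:
  assumes "ctx a"
  shows "cmo (diag a)" "dm (diag a) = cyl a" "cd (diag a) = cyl (cyl a)" "cc (dsp (cyl (cyl a))) (diag a) = cid (cyl a)"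
    "lst (diag a) = v0 (cyl a)"
  using sec[of "v0 (cyl a)", unfolded tty_v0_cyl[OF assms]] assms by (simp_all add: diag_def)

lemma lst_cid: "ltyp a \<Longrightarrow> lst (cid a) = v0 a"
  using tms_v0[of "cid a" a] tms_id[of "v0 a" a] v0(2)[of a] by simp

lemma cyf_diag [simp]:
  assumes "cmo f" "dm f = a"
  shows "cc (cyf (cc f (dsp (cyl a)))) (diag a) = cyf f"
proof (rule cyl_eqI[of _ _ "cd f"])
  have a: "ctx a" using assms cmo_ctx by blast
  have "cc (dsp (cyl (cyl a))) (diag a) = cid (cyl a)" using a by simp
  then show "cc (dsp (cyl (cd f))) (cc (cyf (cc f (dsp (cyl a)))) (diag a)) = cc (dsp (cyl (cd f))) (cyf f)"
    using assms a comp_reassoc[OF cyf(4)[of "cc f (dsp (cyl a))" "cd f"], of "diag a"] by simp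
  show "lst (cc (cyf (cc f (dsp (cyl a)))) (diag a)) = lst (cyf f)"
    using assms a lst_cc[of "cyf (cc f (dsp (cyl a)))" "diag a"] lst_cyf[of "cc f (dsp (cyl a))"] lst_cyf[of f] tms_v0[of "diag a" "cyl (cyl a)"]
    by simp
qed (use assms in auto)

lemma cyf_pr_diag [simp]: "ctx a \<Longrightarrow> cc (cyf (dsp (cyl a))) (diag a) = cid (cyl a)"
  using cyf_diag[of "cid a" a] by simp

lemma sec_dm: "trm a \<Longrightarrow> tty a = A \<Longrightarrow> bs A = G \<Longrightarrow> hom (sec a) G A \<and> cc (dsp A) (sec a) = cid G \<and> lst (sec a) = a"
  using sec[of a] by auto

text \<open>The filler is the section given by the term \<open>coe\<^sub>1(d, t, x)\<close> over
  \<open>a, x : I\<close>, with \<open>t\<close> the last term of \<open>k\<close>. Restricted to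
  the left end it is, by stability, the transport of \<open>t\<close> to \<open>left\<close>, which
  is \<open>t\<close>.\<close>

lemma model_fill:
  assumes d: "ltyp d" "bs d = cyl a" and a: "ctx a" and k: "hom k a d" "cc (dsp d) k = i0 a"
  shows "\<exists>K. hom K (cyl a) d \<and> cc (dsp d) K = cid (cyl a) \<and> cc K (i0 a) = k"
proof -
  define t where "t = lst k"
  have t: "trm t" "tty t = pb d (i0 a)" using lst[of k d] d k by (simp_all add: t_def)
  \<comment> \<open>Over the context \<open>a, x : I\<close> the family \<open>?D\<close> is
    \<open>d\<close> with its interval variable renamed to a fresh one:
    \<open>cyf (dsp (cyl a))\<close> keeps the outer coordinate and forgets the inner one.
    \<open>?t\<close> is \<open>t\<close> weakened by \<open>x\<close>.\<close>
  let ?W = "cyl a" and ?D = "pb d (cyf (dsp (cyl a)))" and ?t = "tms t (dsp (cyl a))"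
  have W: "ctx ?W" using a by simp
  have D: "ltyp ?D" "bs ?D = intT ?W" using d a by (simp_all add: intT_cyl)
  have t': "trm ?t" "tty ?t = pb ?D (sec (leftT ?W))"
    using t d a by (simp_all add: sec_leftT)
  have i: "trm (v0 ?W)" "tty (v0 ?W) = intT ?W" using a by (simp_all add: tty_v0_cyl intT_cyl)
  define e where "e = coeT ?W ?D ?t (v0 ?W)"
  note c = coeT[OF W D t' i, folded e_def]
  have e: "trm e" "tty e = d"
    using c(2,3) d a by (simp_all add: diag_def[symmetric])
  note s = sec_dm[OF e d(2)]
  have "tms e (i0 a) = coeT a (pb ?D (cyf (i0 a))) (tms ?t (i0 a)) (tms (v0 ?W) (i0 a))"
    unfolding e_def using coeT_stable[of "i0 a" ?W a, OF _ _ _ D t' i] a pq_cyl[of "i0 a" "cyl a"] by (simp add: intT_cyl)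
  also have "\<dots> = coeT a d t (leftT a)"
    using t d a tms_v0[of "i0 a" ?W] lst_i0 by simp
  also have "\<dots> = t"
    by (rule coeT_left) (use t d a in \<open>simp_all add: intT_cyl sec_leftT\<close>)
  finally have lk: "lst (cc (sec e) (i0 a)) = lst k"
    using s d a by (simp add: t_def)
  have dk: "cc (dsp d) (cc (sec e) (i0 a)) = cc (dsp d) k"
    using comp_reassoc[of "dsp d" "sec e" "cid (cyl a)" "i0 a"] s d a k by simp
  have "cc (sec e) (i0 a) = k"
    by (rule ex_ext[OF _ _ _ _ _ d(1) dk lk]) (use s d a k(1) in simp_all)
  then show ?thesis using s by blast
qed

text \<open>\<open>P\<close> is the path type between the last terms of \<open>u\<close> and
  \<open>v\<close>, and \<open>e\<close> evaluates the path variable of \<open>P\<close> at the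
  interval variable. The boundary equations give the ends of \<open>e\<close>; in the universal
  property existence is the beta rule for path abstraction, and uniqueness is the eta rule.\<close>

lemma model_path:
  assumes c: "ltyp c" "bs c = cyl a" and a: "ctx a" and u: "hom u a c" "cc (dsp c) u = i0 a"
    and v: "hom v a c" "cc (dsp c) v = i1 a"
  shows "\<exists>p e. ltyp p \<and> bs p = a \<and> hom e (cyl p) c \<and> cc (dsp c) e = cyf (dsp p) \<and>
            cc e (i0 p) = cc u (dsp p) \<and> cc e (i1 p) = cc v (dsp p) \<and>
            (\<forall>s h. cmo s \<and> cd s = a \<and> hom h (cyl (dm s)) c \<and> cc (dsp c) h = cyf s \<and>
               cc h (i0 (dm s)) = cc u s \<and> cc h (i1 (dm s)) = cc v s \<longrightarrow>
               (\<exists>!k. hom k (dm s) p \<and> cc (dsp p) k = s \<and> cc e (cyf k) = h))"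
proof -
  define tu where "tu = lst u"
  define tv where "tv = lst v"
  have tu: "trm tu" "tty tu = pb c (i0 a)" and tv: "trm tv" "tty tv = pb c (i1 a)"
    using lst[of u c] lst[of v c] c u v by (simp_all add: tu_def tv_def)
  have C: "ltyp c" "bs c = intT a" using c a by (simp_all add: intT_cyl)
  have tu': "trm tu" "tty tu = pb c (sec (leftT a))" and tv': "trm tv" "tty tv = pb c (sec (rightT a))"
    using tu tv a by (simp_all add: sec_leftT sec_rightT)
  define P where "P = pathT a c tu tv"
  have P: "ltyp P" "bs P = a" using pathT[OF a C tu' tv'] by (simp_all add: P_def)
  have P_stable: "pb P s = pathT (dm s) (pb c (cyf s)) (tms tu s) (tms tv s)" if "cmo s" "cd s = a" for s
    unfolding P_def using pathT_stable[OF that refl C tu' tv'] pq_cyl[OF that] a by (simp add: intT_cyl)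
  have C_s: "ltyp (pb c (cyf s))" "bs (pb c (cyf s)) = intT (dm s)"
    "trm (tms tu s)" "tty (tms tu s) = pb (pb c (cyf s)) (sec (leftT (dm s)))"
    "trm (tms tv s)" "tty (tms tv s) = pb (pb c (cyf s)) (sec (rightT (dm s)))"
    if "cmo s" "cd s = a" for s
    using that c tu tv a by (simp_all add: intT_cyl sec_leftT sec_rightT)
  let ?W = "cyl P"
  have W: "ctx ?W" using P by simp
  define s0 where "s0 = cc (dsp P) (dsp ?W)"
  have s0: "cmo s0" "dm s0 = ?W" "cd s0 = a" using P by (simp_all add: s0_def)
  note C0 = C_s[OF s0(1,3), unfolded s0(2)]
  let ?p = "tms (v0 P) (dsp ?W)"
  have p: "trm ?p" "tty ?p = pathT ?W (pb c (cyf s0)) (tms tu s0) (tms tv s0)"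
    using P P_stable[OF s0(1,3)] s0(2) by (simp_all add: s0_def)
  have i: "trm (v0 ?W)" "tty (v0 ?W) = intT ?W" using P by (simp_all add: tty_v0_cyl intT_cyl)
  define te where "te = atT ?W (pb c (cyf s0)) (tms tu s0) (tms tv s0) ?p (v0 ?W)"
  note at = atT[OF W C0 p i, folded te_def]
  have te: "trm te" "tty te = pb c (cyf (dsp P))"
    using at(2,3) c P by (simp_all add: diag_def[symmetric] s0_def)
  \<comment> \<open>By stability every substitution instance of \<open>te\<close> is
    \<open>at\<close> applied to substituted data. The values of \<open>e\<close> at both ends and
    along \<open>cyf k\<close> are special cases.\<close>
  have te_sub: "tms te t = atT (dm t) (pb c (cyf (cc s0 t))) (tms tu (cc s0 t)) (tms tv (cc s0 t)) (tms (v0 P) (cc (dsp ?W) t)) (lst t)"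
    if t: "cmo t" "cd t = ?W" for t
  proof -
    have "tms te t = atT (dm t) (pb (pb c (cyf s0)) (cyf t)) (tms (tms tu s0) t) (tms (tms tv s0) t) (tms ?p t) (tms (v0 ?W) t)"
      unfolding te_def using atT_stable[OF t refl C0 p i] pq_cyl[OF t] W by (simp add: intT_cyl)
    then show ?thesis
      using t c tu tv P s0 a tms_v0[of t ?W] by simp
  qed
  define e where "e = ex c (cyf (dsp P)) te"
  have e: "cmo e" "dm e = cyl P" "cd e = c" "cc (dsp c) e = cyf (dsp P)" "lst e = te"
    using ex[of c "cyf (dsp P)" te] c P te by (simp_all add: e_def)
  note r = comp_reassoc[OF e(4)] comp_reassoc[OF u(2)] comp_reassoc[OF v(2)]
  note CP = C_s[of "dsp P", unfolded dsp(2)]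
  have vP: "trm (v0 P)" "tty (v0 P) = pathT P (pb c (cyf (dsp P))) (tms tu (dsp P)) (tms tv (dsp P))"
    using P P_stable[of "dsp P"] by simp_all
  have eqs: "atT P (pb c (cyf (dsp P))) (tms tu (dsp P)) (tms tv (dsp P)) (v0 P) (leftT P) = tms tu (dsp P)"
    "atT P (pb c (cyf (dsp P))) (tms tu (dsp P)) (tms tv (dsp P)) (v0 P) (rightT P) = tms tv (dsp P)"
    by (rule path_eqs; use P CP vP in simp)+
  have e0: "cc e (i0 P) = cc u (dsp P)"
  proof (rule ex_ext[of _ _ c])
    have "lst (cc e (i0 P)) = tms te (i0 P)" using lst_cc[of e "i0 P"] e c by simp
    also have "\<dots> = tms tu (dsp P)"
      using te_sub[of "i0 P"] P eqs(1) lst_i0[of P] by (simp add: s0_def)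
    finally show "lst (cc e (i0 P)) = lst (cc u (dsp P))" using lst_cc[of u "dsp P"] u c by (simp add: tu_def)
  qed (use e P u c a r in simp_all)
  have e1: "cc e (i1 P) = cc v (dsp P)"
  proof (rule ex_ext[of _ _ c])
    have "lst (cc e (i1 P)) = tms te (i1 P)" using lst_cc[of e "i1 P"] e c by simp
    also have "\<dots> = tms tv (dsp P)"
      using te_sub[of "i1 P"] P eqs(2) lst_i1[of P] by (simp add: s0_def)
    finally show "lst (cc e (i1 P)) = lst (cc v (dsp P))" using lst_cc[of v "dsp P"] v c by (simp add: tv_def)
  qed (use e P v c a r in simp_all)
  have univ: "\<exists>!k. hom k (dm s) P \<and> cc (dsp P) k = s \<and> cc e (cyf k) = h"
    if s: "cmo s" "cd s = a" and h: "hom h (cyl (dm s)) c" "cc (dsp c) h = cyf s"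
      and hu: "cc h (i0 (dm s)) = cc u s" and hv: "cc h (i1 (dm s)) = cc v s" for s h
  proof -
    let ?z = "dm s"
    have z: "ctx ?z" using s by simp
    note Cs = C_s[OF s]
    define th where "th = lst h"
    have th: "trm th" "tty th = pb c (cyf s)" using lst[of h c] h c by (simp_all add: th_def)
    have th01: "tms th (i0 ?z) = tms tu s" "tms th (i1 ?z) = tms tv s"
      using lst_cc[of h "i0 ?z"] lst_cc[of h "i1 ?z"] lst_cc[of u s] lst_cc[of v s] hu hv h u v c
      by (simp_all add: th_def tu_def tv_def)
    have thb: "bs (tty th) = intT ?z" using th Cs by simp
    define q where "q = plam ?z th"
    have q: "trm q" "tty q = pb P s"
      using plam[OF z th(1) thb] P_stable[OF s] th th01 z by (simp_all add: q_def sec_leftT sec_rightT)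
    define k where "k = ex P s q"
    have k: "cmo k" "dm k = ?z" "cd k = P" "cc (dsp P) k = s" "lst k = q"
      using ex[of P s q] P s q by (simp_all add: k_def)
    have ek: "lst (cc e (cyf k')) = atT (cyl ?z) (pb c (cyf (cc s (dsp (cyl ?z))))) (tms tu (cc s (dsp (cyl ?z))))
        (tms tv (cc s (dsp (cyl ?z)))) (tms (lst k') (dsp (cyl ?z))) (v0 (cyl ?z))"
      if k': "cmo k'" "dm k' = ?z" "cd k' = P" "cc (dsp P) k' = s" for k'
    proof -
      have "cc s0 (cyf k') = cc s (dsp (cyl ?z))"
        using k' P z comp_reassoc[OF k'(4), of "dsp (cyl ?z)"] by (simp add: s0_def)
      moreover have "tms (v0 P) (cc (dsp ?W) (cyf k')) = tms (lst k') (dsp (cyl ?z))"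
        using k' P tms_v0[of "cc k' (dsp (cyl ?z))" P] lst_cc[of k' "dsp (cyl ?z)"] z by simp
      ultimately show ?thesis
        using te_sub[of "cyf k'"] k' P lst_cc[of e "cyf k'"] e c lst_cyf[of k'] by simp
    qed
    show ?thesis
    proof (rule ex1I[of _ k])
      \<comment> \<open>\<open>?t\<close> is \<open>th\<close> weakened by a second interval
        variable. Evaluating its path abstraction at the old variable restores \<open>th\<close>,
        since the diagonal undoes the weakening.\<close>
      let ?t = "tms th (cyf (dsp (cyl ?z)))"
      have t: "trm ?t" "tty ?t = pb c (cyf (cc s (dsp (cyl ?z))))" "bs (tty ?t) = intT (cyl ?z)"
        using th c s z by (simp_all add: intT_cyl)
      have "tms q (dsp (cyl ?z)) = plam (cyl ?z) ?t"
        unfolding q_def using plam_stable[of "dsp (cyl ?z)" ?z "cyl ?z", OF _ _ _ th(1) thb] z pq_cyl[of "dsp (cyl ?z)" ?z]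
        by (simp add: intT_cyl)
      moreover have "tms ?t (sec (leftT (cyl ?z))) = tms tu (cc s (dsp (cyl ?z)))"
        "tms ?t (sec (rightT (cyl ?z))) = tms tv (cc s (dsp (cyl ?z)))"
        using th01 th tu tv c s z a tms_tms[of th "i0 ?z" "dsp (cyl ?z)"] tms_tms[of th "i1 ?z" "dsp (cyl ?z)"]
        by (simp_all add: sec_leftT sec_rightT)
      ultimately have "lst (cc e (cyf k)) = tms ?t (sec (v0 (cyl ?z)))"
        using ek[OF k(1-4)] at_plam[of "cyl ?z" ?t "v0 (cyl ?z)"] t z k(5) tty_v0_cyl[OF z] by (simp add: intT_cyl)
      also have "\<dots> = th" using th c s z by (simp add: diag_def[symmetric])
      finally have lk: "lst (cc e (cyf k)) = lst h" by (simp add: th_def)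
      have "cc (dsp c) (cc e (cyf k)) = cyf s"
        using comp_reassoc[OF e(4), of "cyf k"] e(1-3) k(1-4) c P by simp
      then have dk: "cc (dsp c) (cc e (cyf k)) = cc (dsp c) h" using h(2) by (simp only:)
      have "cc e (cyf k) = h"
        by (rule ex_ext[OF _ _ _ _ _ c(1) dk lk]) (use e(1-3) k(1-3) h(1) P in simp_all)
      then show "hom k ?z P \<and> cc (dsp P) k = s \<and> cc e (cyf k) = h" using k by simp
    next
      fix k' assume "hom k' ?z P \<and> cc (dsp P) k' = s \<and> cc e (cyf k') = h"
      then have k': "cmo k'" "dm k' = ?z" "cd k' = P" "cc (dsp P) k' = s" "cc e (cyf k') = h" by simp_all
      have l: "trm (lst k')" "tty (lst k') = pathT ?z (pb c (cyf s)) (tms tu s) (tms tv s)"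
        using lst[of k' P] k' P P_stable[OF s] by simp_all
      \<comment> \<open>The eta rule recovers the last term of \<open>k'\<close> from the evaluation
        of \<open>k'\<close>, that is, from \<open>h\<close>.\<close>
      have "plam ?z (lst (cc e (cyf k'))) = lst k'"
        unfolding ek[OF k'(1-4)] using path_eqs(1)[OF z Cs l] z s c tu tv a
        by (simp add: intT_cyl pq_cyl)
      then have "lst k' = q" using k'(5) by (simp add: q_def th_def)
      then show "k' = k"
        using ex_ext[of k' k P] k' k P by simp
    qed
  qed
  show ?thesis
    using P e e0 e1 univ by (intro exI[of _ P] exI[of _ e]) simp
qed

text \<open>\<open>v\<close> pairs the two last variables of the context \<open>B\<close>, and
  \<open>u\<close> consists of the two projections of the variable of \<open>S\<close>. Pairing and
  projections are formed over the contexts \<open>B\<close> and \<open>S\<close>, with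
  \<open>A\<close> and \<open>B\<close> pulled back along \<open>w\<close> and \<open>d\<close>.
  Stability compares these data, after which the equations are the beta and eta rules.\<close>

lemma model_sigma:
  assumes B: "ltyp B" "ltyp (bs B)"
  shows "\<exists>s u v. ltyp s \<and> bs s = bs (bs B) \<and> hom u s B \<and> hom v B s \<and>
            cc u v = cid B \<and> cc v u = cid s \<and> cc (dsp (bs B)) (cc (dsp B) u) = dsp s"
proof -
  define A where "A = bs B"
  define G where "G = bs A"
  have A: "ltyp A" "bs A = G" and B': "ltyp B" "bs B = A" and G: "ctx G"
    using B by (simp_all add: A_def G_def)
  define S where "S = sig G A B"
  have S: "ltyp S" "bs S = G" using sig[OF G A B'] by (simp_all add: S_def)
  have S_stable: "pb S s = sig (dm s) (pb A s) (pb B (pq A s))" if "cmo s" "cd s = G" for s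
    unfolding S_def using sig_stable[OF that refl A B'] .
  have AB: "ltyp (pb A s)" "bs (pb A s) = dm s" "ltyp (pb B (pq A s))" "bs (pb B (pq A s)) = pb A s"
    if "cmo s" "cd s = G" for s
    using that A B' by simp_all
  define w where "w = cc (dsp A) (dsp B)"
  have w: "cmo w" "dm w = B" "cd w = G" using A B' by (simp_all add: w_def)
  \<comment> \<open>The canonical arrow over \<open>f\<close>, restricted along the section of a
    term, is the extension of \<open>f\<close> by this term. This identifies the type that the
    second component must have.\<close>
  have sec_pq: "cc (pq A f) (sec t) = ex A f t" if f: "cmo f" "cd f = G" and t: "trm t" "tty t = pb A f" for f t
  proof (rule ex_ext[of _ _ A])
    note s = sec_dm[OF t, of "dm f"] and x = ex[OF A(1) f(1) _ t]
    show "cc (dsp A) (cc (pq A f) (sec t)) = cc (dsp A) (ex A f t)"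
      using s x f A pq(4)[OF A(1) f(1)] comp_reassoc[OF pq(4)[OF A(1) f(1)], of "sec t"] by simp
    show "lst (cc (pq A f) (sec t)) = lst (ex A f t)"
      using s x f A lst_cc[of "pq A f" "sec t"] tms_v0[of "sec t" "pb A f"] by simp
  qed (use sec_dm[OF t, of "dm f"] ex[OF A(1) f(1) _ t] f A in simp_all)
  let ?a = "tms (v0 A) (dsp B)"
  have a: "trm ?a" "tty ?a = pb A w" using A B' by (simp_all add: w_def)
  have exa: "ex A w ?a = dsp B"
    using ex_lst[of "dsp B" A] A B' tms_v0[of "dsp B" A] by (simp add: w_def)
  have b: "trm (v0 B)" "tty (v0 B) = pb (pb B (pq A w)) (sec ?a)"
    using A B' w a sec_pq[OF w(1,3) a] exa sec_dm[OF a, of B] by simp_all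
  define pv where "pv = pair B (pb A w) (pb B (pq A w)) ?a (v0 B)"
  have cB: "ctx B" using B' by simp
  note ABw = AB[OF w(1,3), unfolded w(2)]
  note pa = pair[OF cB ABw a b, folded pv_def]
  have pv: "trm pv" "tty pv = pb S w" using pa S_stable[OF w(1,3)] w(2) by simp_all
  define v where "v = ex S w pv"
  have v: "cmo v" "dm v = B" "cd v = S" "cc (dsp S) v = w" "lst v = pv"
    using ex[of S w pv] S w pv by (simp_all add: v_def)
  define d where "d = dsp S"
  have d: "cmo d" "dm d = S" "cd d = G" using S by (simp_all add: d_def)
  have cS: "ctx S" using S by simp
  note ABd = AB[OF d(1,3), unfolded d(2)]
  have pS: "trm (v0 S)" "tty (v0 S) = sig S (pb A d) (pb B (pq A d))"
    using S S_stable[OF d(1,3)] d(2) by (simp_all add: d_def)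
  define x where "x = pr1 S (pb A d) (pb B (pq A d)) (v0 S)"
  define y where "y = pr2 S (pb A d) (pb B (pq A d)) (v0 S)"
  note px = pr1[OF cS ABd pS, folded x_def] and py = pr2[OF cS ABd pS, folded x_def y_def]
  define u1 where "u1 = ex A d x"
  have u1: "cmo u1" "dm u1 = S" "cd u1 = A" "cc (dsp A) u1 = d" "lst u1 = x"
    using ex[OF A(1) d(1) _ px(2,3)] A d by (simp_all add: u1_def)
  have y: "trm y" "tty y = pb B u1"
    using py(2,3) sec_pq[OF d(1,3) px(2,3)] A B' d px(2,3) sec_dm[OF px(2,3), of S] by (simp_all add: u1_def)
  define u where "u = ex B u1 y"
  have u: "cmo u" "dm u = S" "cd u = B" "cc (dsp B) u = u1" "lst u = y"
    using ex[OF B'(1) u1(1) _ y] B' u1 by (simp_all add: u_def)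
  have wu: "cc w u = d"
    using A B' u u1(4) by (simp add: w_def)
  have dv: "cc d v = w" using v by (simp add: d_def)
  \<comment> \<open>The pullback squares of \<open>A\<close> along \<open>v\<close> and along
    \<open>d\<close> paste strictly to the one along \<open>w\<close>; so the data over
    \<open>S\<close> restrict along \<open>v\<close> to the data over \<open>B\<close>.\<close>
  have st: "pb (pb A d) v = pb A w" "pb (pb B (pq A d)) (pq (pb A d) v) = pb B (pq A w)" "tms (v0 S) v = pv"
  proof -
    show "pb (pb A d) v = pb A w" using A d v dv by simp
    show "tms (v0 S) v = pv" using v S by simp
    have "cc (pq A d) (pq (pb A d) v) = pq A w"
    proof (rule ex_ext[of _ _ A])
      show "cc (dsp A) (cc (pq A d) (pq (pb A d) v)) = cc (dsp A) (pq A w)"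
        using A d v w dv pq(4)[of A d] pq(4)[of "pb A d" v] comp_reassoc[OF pq(4)[of A d], of "pq (pb A d) v"]
          cc_assoc[of "dsp (pb A w)" v d] by simp
      show "lst (cc (pq A d) (pq (pb A d) v)) = lst (pq A w)"
        using A d v w dv lst_cc[of "pq A d" "pq (pb A d) v"] tms_v0[of "pq (pb A d) v" "pb A d"] by simp
    qed (use A d v w dv in simp_all)
    then show "pb (pb B (pq A d)) (pq (pb A d) v) = pb B (pq A w)" using A B' d v by simp
  qed
  have xv: "tms x v = ?a" "tms y v = v0 B"
    using pr_stable[OF v(1) v(3) v(2) ABd pS] st pr_pair[OF cB ABw a b] by (simp_all add: x_def y_def pv_def)
  have u1v: "cc u1 v = dsp B"
  proof (rule ex_ext[of _ _ A])
    show "cc (dsp A) (cc u1 v) = cc (dsp A) (dsp B)"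
      using comp_reassoc[OF u1(4), of v] u1 v A dv by (simp add: w_def)
    show "lst (cc u1 v) = lst (dsp B)"
      using lst_cc[of u1 v] u1 v A B' xv tms_v0[of "dsp B" A] by simp
  qed (use u1 v A B' in simp_all)
  have uv: "cc u v = cid B"
  proof (rule ex_ext[of _ _ B])
    show "cc (dsp B) (cc u v) = cc (dsp B) (cid B)"
      using comp_reassoc[OF u(4), of v] u v B' u1v by simp
    show "lst (cc u v) = lst (cid B)"
      using lst_cc[of u v] u v B' xv lst_cid[of B] by simp
  qed (use u v B' in simp_all)
  have st': "pb (pb A w) u = pb A d" "pb (pb B (pq A w)) (pq (pb A w) u) = pb B (pq A d)" "tms ?a u = x" "tms (v0 B) u = y"
  proof -
    show "pb (pb A w) u = pb A d" using A w u wu by simp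
    show "tms (v0 B) u = y" using u B' by simp
    show "tms ?a u = x" using A B' u u1 lst_cc[of "dsp B" u] by simp
    have "cc (pq A w) (pq (pb A w) u) = pq A d"
    proof (rule ex_ext[of _ _ A])
      show "cc (dsp A) (cc (pq A w) (pq (pb A w) u)) = cc (dsp A) (pq A d)"
        using A d u w wu pq(4)[of A w] pq(4)[of "pb A w" u] comp_reassoc[OF pq(4)[of A w], of "pq (pb A w) u"]
          cc_assoc[of "dsp (pb A d)" u w] by simp
      show "lst (cc (pq A w) (pq (pb A w) u)) = lst (pq A d)"
        using A d u w wu lst_cc[of "pq A w" "pq (pb A w) u"] tms_v0[of "pq (pb A w) u" "pb A w"] by simp
    qed (use A d u w wu in simp_all)
    then show "pb (pb B (pq A w)) (pq (pb A w) u) = pb B (pq A d)" using A B' w u by simp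
  qed
  have "tms pv u = v0 S"
    using pair_stable[OF u(1) u(3) u(2) ABw a b] st' pair_eta[OF cS ABd pS] by (simp add: pv_def x_def y_def)
  then have vu: "cc v u = cid S"
  proof -
    assume t: "tms pv u = v0 S"
    show ?thesis
    proof (rule ex_ext[of _ _ S])
      show "cc (dsp S) (cc v u) = cc (dsp S) (cid S)"
        using comp_reassoc[OF v(4), of u] u v S wu by (simp add: d_def)
      show "lst (cc v u) = lst (cid S)"
        using lst_cc[of v u] u v S t lst_cid[of S] by simp
    qed (use u v S in simp_all)
  qed
  show ?thesis
    using S u v uv vu u1(4) by (intro exI[of _ S] exI[of _ u] exI[of _ v]) (simp add: A_def G_def d_def)
qed

sublocale path_cat ctx fst cmo dm cd cid cc bs dsp pb pq one uI uL uR
  by unfold_locales (rule model_fill model_path model_sigma; assumption)+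

end

section \<open>Equivalences of categories\<close>

locale category =
  fixes C :: "('o, 'm) cat"
  assumes is_cat: "is_cat C"
begin

lemma Idn [simp]: "A \<in> Obj C \<Longrightarrow> Idn C A \<in> Hom C A A"
  using is_cat by (simp add: is_cat_def)

lemma Comp [simp]: "A \<in> Obj C \<Longrightarrow> B \<in> Obj C \<Longrightarrow> D \<in> Obj C \<Longrightarrow> f \<in> Hom C A B \<Longrightarrow> g \<in> Hom C B D
    \<Longrightarrow> Comp C A B D g f \<in> Hom C A D"
  using is_cat unfolding is_cat_def by blast

lemma unit [simp]: "A \<in> Obj C \<Longrightarrow> B \<in> Obj C \<Longrightarrow> f \<in> Hom C A B \<Longrightarrow> Comp C A B B (Idn C B) f = f"
  "A \<in> Obj C \<Longrightarrow> B \<in> Obj C \<Longrightarrow> f \<in> Hom C A B \<Longrightarrow> Comp C A A B f (Idn C A) = f"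
  using is_cat unfolding is_cat_def by blast+

lemma assoc: "A \<in> Obj C \<Longrightarrow> B \<in> Obj C \<Longrightarrow> D \<in> Obj C \<Longrightarrow> E \<in> Obj C \<Longrightarrow> f \<in> Hom C A B
    \<Longrightarrow> g \<in> Hom C B D \<Longrightarrow> h \<in> Hom C D E
    \<Longrightarrow> Comp C A D E h (Comp C A B D g f) = Comp C A B E (Comp C B D E h g) f"
  using is_cat unfolding is_cat_def by blast

lemma iso_cancel_left:
  assumes "A \<in> Obj C" "B \<in> Obj C" "D \<in> Obj C" "is_iso C B D u" "f \<in> Hom C A B" "f' \<in> Hom C A B"
    "Comp C A B D u f = Comp C A B D u f'"
  shows "f = f'"
proof -
  obtain v where v: "u \<in> Hom C B D" "v \<in> Hom C D B" "Comp C B D B v u = Idn C B"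
    using assms(4) by (auto simp: is_iso_def)
  have "f = Comp C A B B (Comp C B D B v u) f" using assms v(3) by simp
  also have "\<dots> = Comp C A D B v (Comp C A B D u f)" using assoc[OF assms(1,2,3,2,5) v(1,2), symmetric] .
  also have "\<dots> = Comp C A D B v (Comp C A B D u f')" by (simp only: assms(7))
  also have "\<dots> = Comp C A B B (Comp C B D B v u) f'" using assoc[OF assms(1,2,3,2,6) v(1,2)] .
  also have "\<dots> = f'" using assms v(3) by simp
  finally show ?thesis .
qed

lemma iso_cancel_right:
  assumes "A \<in> Obj C" "B \<in> Obj C" "D \<in> Obj C" "is_iso C A B u" "f \<in> Hom C B D" "f' \<in> Hom C B D"
    "Comp C A B D f u = Comp C A B D f' u"
  shows "f = f'"
proof -
  obtain v where v: "u \<in> Hom C A B" "v \<in> Hom C B A" "Comp C B A B u v = Idn C B"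
    using assms(4) by (auto simp: is_iso_def)
  have "f = Comp C B B D f (Comp C B A B u v)" using assms v(3) by simp
  also have "\<dots> = Comp C B A D (Comp C A B D f u) v" using assoc[OF assms(2,1,2,3) v(2,1) assms(5)] .
  also have "\<dots> = Comp C B A D (Comp C A B D f' u) v" by (simp only: assms(7))
  also have "\<dots> = Comp C B B D f' (Comp C B A B u v)" using assoc[OF assms(2,1,2,3) v(2,1) assms(6), symmetric] .
  also have "\<dots> = f'" using assms v(3) by simp
  finally show ?thesis .
qed

end

definition fully_faithful :: "('o, 'm) cat \<Rightarrow> ('p, 'n) cat \<Rightarrow> ('o, 'm, 'p, 'n) func \<Rightarrow> bool" where
  "fully_faithful C D F \<longleftrightarrow>
     (\<forall>A \<in> Obj C. \<forall>B \<in> Obj C. bij_betw (mp F A B) (Hom C A B) (Hom D (ob F A) (ob F B)))"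

definition ess_surj :: "('o, 'm) cat \<Rightarrow> ('p, 'n) cat \<Rightarrow> ('o, 'm, 'p, 'n) func \<Rightarrow> bool" where
  "ess_surj C D F \<longleftrightarrow> (\<forall>B \<in> Obj D. \<exists>A \<in> Obj C. \<exists>w. is_iso D (ob F A) B w)"

lemma nat_isomorphic_idE:
  assumes "nat_isomorphic C C (comp_func G F) id_func"
  obtains \<alpha> where "\<And>A. A \<in> Obj C \<Longrightarrow> is_iso C (ob G (ob F A)) A (\<alpha> A)"
    "\<And>A B f. A \<in> Obj C \<Longrightarrow> B \<in> Obj C \<Longrightarrow> f \<in> Hom C A B \<Longrightarrow>
      Comp C (ob G (ob F A)) (ob G (ob F B)) B (\<alpha> B) (mp G (ob F A) (ob F B) (mp F A B f)) =
      Comp C (ob G (ob F A)) A B f (\<alpha> A)"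
proof -
  obtain \<alpha> where "\<forall>A \<in> Obj C. is_iso C (ob G (ob F A)) A (\<alpha> A)"
    "\<forall>A \<in> Obj C. \<forall>B \<in> Obj C. \<forall>f \<in> Hom C A B.
      Comp C (ob G (ob F A)) (ob G (ob F B)) B (\<alpha> B) (mp G (ob F A) (ob F B) (mp F A B f)) =
      Comp C (ob G (ob F A)) A B f (\<alpha> A)"
    using assms unfolding nat_isomorphic_def comp_func_def id_func_def by auto
  then show thesis by (intro that[of \<alpha>]) simp_all
qed

text \<open>By naturality \<open>f\<close> composed with the invertible component at
  \<open>A\<close> is determined by the image of \<open>f\<close> under \<open>F\<close>. The lemma
  is also applied with the roles of \<open>F\<close> and \<open>G\<close> exchanged, where it yields
  fullness of \<open>F\<close>.\<close>

lemma nat_iso_id_faithful: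
  assumes F: "is_functor C D F" and G: "is_functor D C G" and n: "nat_isomorphic C C (comp_func G F) id_func"
    and AB: "A \<in> Obj C" "B \<in> Obj C" and f: "f \<in> Hom C A B" "f' \<in> Hom C A B" and e: "mp F A B f = mp F A B f'"
  shows "f = f'"
proof -
  interpret C: category C using F by (simp add: is_functor_def category_def)
  obtain \<alpha> where i: "\<And>A. A \<in> Obj C \<Longrightarrow> is_iso C (ob G (ob F A)) A (\<alpha> A)"
    and nat: "\<And>A B f. A \<in> Obj C \<Longrightarrow> B \<in> Obj C \<Longrightarrow> f \<in> Hom C A B \<Longrightarrow>
      Comp C (ob G (ob F A)) (ob G (ob F B)) B (\<alpha> B) (mp G (ob F A) (ob F B) (mp F A B f)) =
      Comp C (ob G (ob F A)) A B f (\<alpha> A)"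
    using nat_isomorphic_idE[OF n] by metis
  have o: "ob G (ob F A) \<in> Obj C" using F G AB by (simp add: is_functor_def)
  show ?thesis
    by (rule C.iso_cancel_right[OF o AB i[OF AB(1)] f]) (use nat[OF AB f(1)] nat[OF AB f(2)] e in simp)
qed

lemma equivalence_fully_faithful:
  assumes "is_equivalence C D F"
  shows "fully_faithful C D F" "ess_surj C D F"
proof -
  obtain G where F: "is_functor C D F" and G: "is_functor D C G"
    and n: "nat_isomorphic C C (comp_func G F) id_func" and m: "nat_isomorphic D D (comp_func F G) id_func"
    using assms by (auto simp: is_equivalence_def)
  interpret C: category C using F by (simp add: is_functor_def category_def)
  interpret D: category D using F by (simp add: is_functor_def category_def)
  have Fo: "ob F A \<in> Obj D" "A \<in> Obj C \<Longrightarrow> B \<in> Obj C \<Longrightarrow> f \<in> Hom C A B \<Longrightarrow> mp F A B f \<in> Hom D (ob F A) (ob F B)"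
    if "A \<in> Obj C" for A B f using F that by (simp_all add: is_functor_def)
  have Go: "ob G A \<in> Obj C" "A \<in> Obj D \<Longrightarrow> B \<in> Obj D \<Longrightarrow> f \<in> Hom D A B \<Longrightarrow> mp G A B f \<in> Hom C (ob G A) (ob G B)"
    if "A \<in> Obj D" for A B f using G that by (simp_all add: is_functor_def)
  obtain \<alpha> where i: "\<And>A. A \<in> Obj C \<Longrightarrow> is_iso C (ob G (ob F A)) A (\<alpha> A)"
    and nat: "\<And>A B f. A \<in> Obj C \<Longrightarrow> B \<in> Obj C \<Longrightarrow> f \<in> Hom C A B \<Longrightarrow>
      Comp C (ob G (ob F A)) (ob G (ob F B)) B (\<alpha> B) (mp G (ob F A) (ob F B) (mp F A B f)) =
      Comp C (ob G (ob F A)) A B f (\<alpha> A)"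
    using nat_isomorphic_idE[OF n] by metis
  show "ess_surj C D F"
    unfolding ess_surj_def using nat_isomorphic_idE[OF m] Go(1) by metis
  show "fully_faithful C D F"
    unfolding fully_faithful_def
  proof (intro ballI)
    fix A B assume AB: "A \<in> Obj C" "B \<in> Obj C"
    have FA: "ob F A \<in> Obj D" "ob F B \<in> Obj D" and GA: "ob G (ob F A) \<in> Obj C" "ob G (ob F B) \<in> Obj C"
      using AB Fo Go by simp_all
    show "bij_betw (mp F A B) (Hom C A B) (Hom D (ob F A) (ob F B))"
      unfolding bij_betw_def
    proof (intro conjI equalityI subsetI)
      show "inj_on (mp F A B) (Hom C A B)"
        using nat_iso_id_faithful[OF F G n AB] by (auto simp: inj_on_def)
      show "x \<in> Hom D (ob F A) (ob F B)" if "x \<in> mp F A B ` Hom C A B" for x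
        using that Fo AB by auto
      fix g assume g: "g \<in> Hom D (ob F A) (ob F B)"
      obtain v where v: "\<alpha> A \<in> Hom C (ob G (ob F A)) A" "v \<in> Hom C A (ob G (ob F A))"
        "Comp C (ob G (ob F A)) A (ob G (ob F A)) v (\<alpha> A) = Idn C (ob G (ob F A))"
        using i[OF AB(1)] by (auto simp: is_iso_def)
      have b: "\<alpha> B \<in> Hom C (ob G (ob F B)) B" using i[OF AB(2)] by (simp add: is_iso_def)
      have Gg: "mp G (ob F A) (ob F B) g \<in> Hom C (ob G (ob F A)) (ob G (ob F B))"
        using Go(2) FA g by simp
      \<comment> \<open>The candidate preimage \<open>?f\<close> of \<open>g\<close> is
        \<open>G g\<close> conjugated with the components of the isomorphism. Naturality identifies
        its image under \<open>G \<circ> F\<close> with \<open>G g\<close>, and faithfulness of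
        \<open>G\<close> removes \<open>G\<close>.\<close>
      let ?h = "Comp C (ob G (ob F A)) (ob G (ob F B)) B (\<alpha> B) (mp G (ob F A) (ob F B) g)"
      let ?f = "Comp C A (ob G (ob F A)) B ?h v"
      have h: "?h \<in> Hom C (ob G (ob F A)) B" using b Gg GA AB by simp
      then have f: "?f \<in> Hom C A B" using v GA AB by simp
      have GF: "mp G (ob F A) (ob F B) (mp F A B ?f) \<in> Hom C (ob G (ob F A)) (ob G (ob F B))"
        using Go(2) FA Fo(2) AB f by simp
      have "Comp C (ob G (ob F A)) A B ?f (\<alpha> A) = ?h"
        using C.assoc[OF GA(1) AB(1) GA(1) AB(2) v(1,2) h, symmetric] v(3) h GA AB by simp
      then have "mp G (ob F A) (ob F B) (mp F A B ?f) = mp G (ob F A) (ob F B) g"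
        by (intro C.iso_cancel_left[OF GA AB(2) i[OF AB(2)] GF Gg]) (use nat[OF AB f] in simp)
      then have "mp F A B ?f = g"
        by (intro nat_iso_id_faithful[OF G F m FA]) (use Fo(2) AB f g in simp_all)
      then show "g \<in> mp F A B ` Hom C A B" using f by (metis image_eqI)
    qed
  qed
qed

lemma fully_faithful_equivalence:
  assumes F: "is_functor C D F" and ff: "fully_faithful C D F" and es: "ess_surj C D F"
  shows "is_equivalence C D F"
proof -
  interpret C: category C using F by (simp add: is_functor_def category_def)
  interpret D: category D using F by (simp add: is_functor_def category_def)
  have Fo: "ob F A \<in> Obj D" "mp F A A (Idn C A) = Idn D (ob F A)" if "A \<in> Obj C" for A
    using F that by (simp_all add: is_functor_def)
  have Fm: "mp F A B f \<in> Hom D (ob F A) (ob F B)"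
    if "A \<in> Obj C" "B \<in> Obj C" "f \<in> Hom C A B" for A B f using F that by (simp add: is_functor_def)
  have Fc: "mp F A E (Comp C A B E g f) = Comp D (ob F A) (ob F B) (ob F E) (mp F B E g) (mp F A B f)"
    if "A \<in> Obj C" "B \<in> Obj C" "E \<in> Obj C" "f \<in> Hom C A B" "g \<in> Hom C B E" for A B E f g
    using F that unfolding is_functor_def by blast
  have inj: "f = f'" if "A \<in> Obj C" "B \<in> Obj C" "f \<in> Hom C A B" "f' \<in> Hom C A B" "mp F A B f = mp F A B f'" for A B f f'
    using ff that unfolding fully_faithful_def bij_betw_def inj_on_def by blast
  have surj: "\<exists>f \<in> Hom C A B. mp F A B f = g" if "A \<in> Obj C" "B \<in> Obj C" "g \<in> Hom D (ob F A) (ob F B)" for A B g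
  proof -
    have "g \<in> mp F A B ` Hom C A B" using ff that by (simp add: fully_faithful_def bij_betw_def)
    then show ?thesis by (rule imageE) (metis)
  qed
  have "\<forall>B \<in> Obj D. \<exists>A w v. A \<in> Obj C \<and> w \<in> Hom D (ob F A) B \<and> v \<in> Hom D B (ob F A) \<and>
      Comp D (ob F A) B (ob F A) v w = Idn D (ob F A) \<and> Comp D B (ob F A) B w v = Idn D B"
    using es unfolding ess_surj_def is_iso_def by blast
  then obtain go w v where go: "\<And>B. B \<in> Obj D \<Longrightarrow> go B \<in> Obj C"
    and w: "\<And>B. B \<in> Obj D \<Longrightarrow> w B \<in> Hom D (ob F (go B)) B"
    and v: "\<And>B. B \<in> Obj D \<Longrightarrow> v B \<in> Hom D B (ob F (go B))"
    and vw: "\<And>B. B \<in> Obj D \<Longrightarrow> Comp D (ob F (go B)) B (ob F (go B)) (v B) (w B) = Idn D (ob F (go B))"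
    and wv: "\<And>B. B \<in> Obj D \<Longrightarrow> Comp D B (ob F (go B)) B (w B) (v B) = Idn D B"
    by metis
  define pre where "pre = (\<lambda>A B g. SOME f. f \<in> Hom C A B \<and> mp F A B f = g)"
  have pre: "pre A B g \<in> Hom C A B" "mp F A B (pre A B g) = g"
    if "A \<in> Obj C" "B \<in> Obj C" "g \<in> Hom D (ob F A) (ob F B)" for A B g
    using someI_ex[of "\<lambda>f. f \<in> Hom C A B \<and> mp F A B f = g"] surj[OF that] unfolding pre_def by blast+
  \<comment> \<open>The conjugate of \<open>g\<close> with the chosen isomorphisms \<open>w\<close>,
    an arrow between objects in the image of \<open>F\<close>. The inverse functor sends
    \<open>g\<close> to the unique arrow over it, and \<open>w\<close> becomes one of the two
    natural isomorphisms.\<close>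
  define cj where "cj = (\<lambda>A B g. Comp D (ob F (go A)) B (ob F (go B)) (v B) (Comp D (ob F (go A)) A B g (w A)))"
  have cj: "cj A B g \<in> Hom D (ob F (go A)) (ob F (go B))" if "A \<in> Obj D" "B \<in> Obj D" "g \<in> Hom D A B" for A B g
    using that go w v Fo by (simp add: cj_def)
  have w_cj: "Comp D (ob F (go A)) (ob F (go B)) B (w B) (cj A B g) = Comp D (ob F (go A)) A B g (w A)"
    if "A \<in> Obj D" "B \<in> Obj D" "g \<in> Hom D A B" for A B g
    unfolding cj_def using that go w v Fo wv D.assoc[of "ob F (go A)" B "ob F (go B)" B "Comp D (ob F (go A)) A B g (w A)" "v B" "w B"]
    by simp
  have w_iso: "is_iso D (ob F (go B)) B (w B)" if "B \<in> Obj D" for B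
    using that w v vw wv by (auto simp: is_iso_def intro!: bexI[of _ "v B"])
  define G where "G = \<lparr>ob = go, mp = (\<lambda>A B g. pre (go A) (go B) (cj A B g))\<rparr>"
  have Gm: "mp G A B g \<in> Hom C (go A) (go B)" "mp F (go A) (go B) (mp G A B g) = cj A B g"
    if "A \<in> Obj D" "B \<in> Obj D" "g \<in> Hom D A B" for A B g
    using that go cj pre by (simp_all add: G_def)
  have G: "is_functor D C G"
    unfolding is_functor_def
  proof (intro conjI ballI)
    show "is_cat D" "is_cat C" using F by (simp_all add: is_functor_def)
    fix A assume A: "A \<in> Obj D"
    show "ob G A \<in> Obj C" using A go by (simp add: G_def)
    have "cj A A (Idn D A) = Idn D (ob F (go A))" using A go w v Fo vw by (simp add: cj_def)
    then show "mp G A A (Idn D A) = Idn C (ob G A)"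
      using inj[of "go A" "go A" "mp G A A (Idn D A)" "Idn C (go A)"] A go Fo Gm[of A A "Idn D A"] by (simp add: G_def)
  next
    fix A B f assume "A \<in> Obj D" "B \<in> Obj D" "f \<in> Hom D A B"
    then show "mp G A B f \<in> Hom C (ob G A) (ob G B)" using Gm by (simp add: G_def)
  next
    fix A B E f g assume o: "A \<in> Obj D" "B \<in> Obj D" "E \<in> Obj D" and f: "f \<in> Hom D A B" and g: "g \<in> Hom D B E"
    note oo = o Fo(1)[OF go[OF o(1)]] Fo(1)[OF go[OF o(2)]] Fo(1)[OF go[OF o(3)]]
    note Gf = Gm[OF o(1,2) f] and Gg = Gm[OF o(2,3) g] and Ggf = Gm[OF o(1,3), of "Comp D A B E g f"]
    \<comment> \<open>The two arrows are compared after composition with the invertible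
      \<open>w E\<close>; the rule \<open>w_cj\<close> moves \<open>w\<close> past each
      factor.\<close>
    have "cj A E (Comp D A B E g f) = Comp D (ob F (go A)) (ob F (go B)) (ob F (go E)) (cj B E g) (cj A B f)"
    proof (rule D.iso_cancel_left[OF _ _ _ w_iso])
      have "Comp D (ob F (go A)) (ob F (go E)) E (w E) (Comp D (ob F (go A)) (ob F (go B)) (ob F (go E)) (cj B E g) (cj A B f)) =
        Comp D (ob F (go A)) (ob F (go B)) E (Comp D (ob F (go B)) B E g (w B)) (cj A B f)"
        using D.assoc[OF oo(4,5,6,3) cj[OF o(1,2) f] cj[OF o(2,3) g] w[OF o(3)]] w_cj[OF o(2,3) g] by simp
      also have "\<dots> = Comp D (ob F (go A)) B E g (Comp D (ob F (go A)) A B f (w A))"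
        using D.assoc[OF oo(4,5,2,3) cj[OF o(1,2) f] w[OF o(2)] g] w_cj[OF o(1,2) f] by simp
      also have "\<dots> = Comp D (ob F (go A)) A E (Comp D A B E g f) (w A)"
        using D.assoc[OF oo(4,1,2,3) w[OF o(1)] f g] .
      finally show "Comp D (ob F (go A)) (ob F (go E)) E (w E) (cj A E (Comp D A B E g f)) =
        Comp D (ob F (go A)) (ob F (go E)) E (w E) (Comp D (ob F (go A)) (ob F (go B)) (ob F (go E)) (cj B E g) (cj A B f))"
        using w_cj[OF o(1,3), of "Comp D A B E g f"] o f g by simp
    qed (use oo f g cj in simp_all)
    then show "mp G A E (Comp D A B E g f) = Comp C (ob G A) (ob G B) (ob G E) (mp G B E g) (mp G A B f)"
      using inj[of "go A" "go E" "mp G A E (Comp D A B E g f)" "Comp C (go A) (go B) (go E) (mp G B E g) (mp G A B f)"]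
        Fc[of "go A" "go B" "go E" "mp G A B f" "mp G B E g"] Gf Gg Ggf go o f g by (simp add: G_def)
  qed
  have "nat_isomorphic D D (comp_func F G) id_func"
    unfolding nat_isomorphic_def
    by (rule exI[of _ w]) (use w_iso w_cj Gm in \<open>auto simp: comp_func_def id_func_def G_def\<close>)
  moreover have "nat_isomorphic C C (comp_func G F) id_func"
  proof -
    \<comment> \<open>The other natural isomorphism has no components yet: they are the preimages
      under \<open>F\<close> of the chosen isomorphisms at objects \<open>F A\<close>, and their
      inverses are the preimages of the inverses.\<close>
    define u where "u = (\<lambda>A. pre (go (ob F A)) A (w (ob F A)))"
    define t where "t = (\<lambda>A. pre A (go (ob F A)) (v (ob F A)))"
    have u: "u A \<in> Hom C (go (ob F A)) A" "mp F (go (ob F A)) A (u A) = w (ob F A)"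
      and t: "t A \<in> Hom C A (go (ob F A))" "mp F A (go (ob F A)) (t A) = v (ob F A)" if "A \<in> Obj C" for A
      using that pre go Fo w v by (simp_all add: u_def t_def)
    have "is_iso C (go (ob F A)) A (u A)" if A: "A \<in> Obj C" for A
    proof -
      have "Comp C (go (ob F A)) A (go (ob F A)) (t A) (u A) = Idn C (go (ob F A))"
        by (rule inj[of "go (ob F A)" "go (ob F A)"]) (use A go Fo u[OF A] t[OF A] vw Fc in simp_all)
      moreover have "Comp C A (go (ob F A)) A (u A) (t A) = Idn C A"
        by (rule inj[of A A]) (use A go Fo u[OF A] t[OF A] wv Fc in simp_all)
      ultimately show ?thesis using u[OF A] t[OF A] by (auto simp: is_iso_def intro!: bexI[of _ "t A"])
    qed
    moreover have "Comp C (go (ob F A)) (go (ob F B)) B (u B) (mp G (ob F A) (ob F B) (mp F A B f)) =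
        Comp C (go (ob F A)) A B f (u A)" if A: "A \<in> Obj C" and B: "B \<in> Obj C" and f: "f \<in> Hom C A B" for A B f
      by (rule inj[of "go (ob F A)" B])
        (use A B f go Fo u[OF A] u[OF B] Fm Gm[of "ob F A" "ob F B" "mp F A B f"] w_cj[of "ob F A" "ob F B" "mp F A B f"] Fc in simp_all)
    ultimately show ?thesis
      unfolding nat_isomorphic_def by (intro exI[of _ u]) (simp add: comp_func_def id_func_def G_def)
  qed
  ultimately show ?thesis
    using F G unfolding is_equivalence_def by blast
qed

theorem equivalence_iff:
  "is_functor C D F \<Longrightarrow> is_equivalence C D F \<longleftrightarrow> fully_faithful C D F \<and> ess_surj C D F"
  using equivalence_fully_faithful fully_faithful_equivalence by blast

section \<open>Path types and the homotopy relation on terms\<close>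

context t0_model
begin

lemma ev_wk_dsp:
  assumes "ltyp A" "ltyp B" "bs A = bs B" "ev M xs t = Some (snd A)" "ev M xs u = Some (snd B)" "fst A = Suc n"
  shows "ev M xs (wk n (Ctx (Suc 0)) t u) = Some (snd (pb B (dsp A)))"
  by (rule ev_wk[OF pulls_Ctx1(1)[OF dsp(1)[OF assms(1)] assms(2)] assms(1,4,5,6)]) (simp only: assms(3) dsp)

text \<open>Nonsense unless \<open>a\<close> and \<open>b\<close> have the same type.\<close>

definition path_ty :: "'x ob \<Rightarrow> 'x ob \<Rightarrow> 'x ob" where
  "path_ty a b = pathT (bs (tty a)) (pb (tty a) (dsp (cyl (bs (tty a))))) a b"

context
  fixes a b A G
  assumes a: "trm a" "tty a = A" and b: "trm b" "tty b = A" and G: "bs A = G"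
begin

lemma path_ty_prems:
  "ctx G" "ltyp A" "fst a = fst G" "fst b = fst G" "ltyp (pb A (dsp (cyl G)))" "bs (pb A (dsp (cyl G))) = intT G"
  "tty a = pb (pb A (dsp (cyl G))) (sec (leftT G))" "tty b = pb (pb A (dsp (cyl G))) (sec (rightT G))"
proof -
  show A: "ltyp A" using a tty by blast
  then show z: "ctx G" using G bs by blast
  show "fst a = fst G" "fst b = fst G" using a b G fst_bs_tty by metis+
  show "ltyp (pb A (dsp (cyl G)))" "bs (pb A (dsp (cyl G))) = intT G"
    using A z G by (simp_all add: intT_cyl)
  show "tty a = pb (pb A (dsp (cyl G))) (sec (leftT G))" "tty b = pb (pb A (dsp (cyl G))) (sec (rightT G))"
    using A z G a b by (simp_all add: sec_leftT sec_rightT)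
qed

lemmas path_ty_args = path_ty_prems(1,5,6) a(1) path_ty_prems(7) b(1) path_ty_prems(8)

lemma path_ty: "ltyp (path_ty a b)" "bs (path_ty a b) = G" "fst (path_ty a b) = Suc (fst a)"
    "fn M (New (PathC, fst a)) [snd G, snd (pb A (dsp (cyl G))), snd a, snd b] = Some (snd (path_ty a b))"
  using pathT[OF path_ty_args] path_ty_prems(3) by (simp_all add: path_ty_def a(2) G)

lemma ev_pth:
  assumes "ev M xs \<Gamma> = Some (snd G)" "ev M xs t = Some (snd A)" "ev M xs u = Some (snd a)" "ev M xs v = Some (snd b)" "n = fst a"
  shows "ev M xs (pth n \<Gamma> t u v) = Some (snd (path_ty a b))"
proof -
  note z = path_ty_prems(1)
  have "ev M xs (intv n \<Gamma>) = Some (snd (cyl G))"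
    using ev_intv(1)[OF z assms(1)] assms(5) path_ty_prems(3) z by (simp add: intT_cyl)
  then have "ev M xs (wk n (Ctx (Suc 0)) (intv n \<Gamma>) t) = Some (snd (pb A (dsp (cyl G))))"
    using ev_wk_dsp[of "cyl G" A xs "intv n \<Gamma>" t n] z path_ty_prems(2,3) G assms intT(2)[of G] by (simp add: intT_cyl)
  then show ?thesis
    unfolding pth_def using ev_cn_pathT[OF path_ty_args assms(1) _ assms(3,4)] assms(5) path_ty_prems(3)
    by (simp add: path_ty_def a(2) G)
qed

text \<open>From left to right, a path is weakened and evaluated at the interval variable; from
  right to left, a term over the cylinder is abstracted. The ends are given by the boundary
  equations and by the typing of the abstraction.\<close>

lemma path_term_iff:
  "(\<exists>p. trm p \<and> tty p = path_ty a b) \<longleftrightarrow>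
   (\<exists>t. trm t \<and> tty t = pb A (dsp (cyl G)) \<and> tms t (i0 G) = a \<and> tms t (i1 G) = b)"
  (is "?L \<longleftrightarrow> ?R")
proof
  note z = path_ty_prems(1) and A = path_ty_prems(2)
  let ?W = "pb A (dsp (cyl G))" and ?w = "dsp (cyl G)" and ?C = "cyl G"
  {
    assume ?L
    then obtain p where p: "trm p" "tty p = pathT G ?W a b" by (auto simp: path_ty_def a(2) G)
    have w: "cmo ?w" "dm ?w = ?C" "cd ?w = G" using z by simp_all
    have C: "ctx ?C" using z by simp
    have W': "ltyp (pb ?W (cyf ?w))" "bs (pb ?W (cyf ?w)) = intT ?C"
      and a': "trm (tms a ?w)" "tty (tms a ?w) = pb (pb ?W (cyf ?w)) (sec (leftT ?C))"
      and b': "trm (tms b ?w)" "tty (tms b ?w) = pb (pb ?W (cyf ?w)) (sec (rightT ?C))"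
      using z A a b G by (simp_all add: intT_cyl sec_leftT sec_rightT)
    have p': "trm (tms p ?w)" "tty (tms p ?w) = pathT ?C (pb ?W (cyf ?w)) (tms a ?w) (tms b ?w)"
      using pathT_stable[OF w(1,3,2) path_ty_args(2-7)] pq_cyl[OF w(1,3)] p z pathT(3)[OF path_ty_args]
      by (simp_all add: intT_cyl)
    have i: "trm (v0 ?C)" "tty (v0 ?C) = intT ?C" using z by (simp_all add: tty_v0_cyl intT_cyl)
    define t where "t = atT ?C (pb ?W (cyf ?w)) (tms a ?w) (tms b ?w) (tms p ?w) (v0 ?C)"
    note at = atT[OF C W' a' b' p' i, folded t_def]
    have end_val: "tms t k = atT G ?W a b p (lst k)"
      if k: "cmo k" "dm k = G" "cd k = ?C" "cc ?w k = cid G" for k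
    proof -
      have ck: "cc (cyf ?w) (cyf k) = cid (cyl G)" using k z by simp
      have "tms t k = atT G (pb (pb ?W (cyf ?w)) (cyf k)) (tms (tms a ?w) k) (tms (tms b ?w) k) (tms (tms p ?w) k) (tms (v0 ?C) k)"
        unfolding t_def using atT_stable[OF k(1,3,2) W' a' b' p' i] pq_cyl[OF k(1,3)] z by (simp add: intT_cyl)
      moreover have "pb (pb ?W (cyf ?w)) (cyf k) = ?W"
        using ck k z A G comp_reassoc[OF k(4), of ?w] by simp
      moreover have "tms (tms a ?w) k = a" "tms (tms b ?w) k = b" "tms (tms p ?w) k = p"
        using k z a b G p pathT(3)[OF path_ty_args] by simp_all
      moreover have "tms (v0 ?C) k = lst k" using tms_v0[OF k(1,3)] z by simp
      ultimately show ?thesis by simp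
    qed
    have "tty t = ?W" using at(3) z A G by (simp add: diag_def[symmetric])
    moreover have "tms t (i0 G) = a"
      using end_val[of "i0 G"] path_eqs(2)[OF path_ty_args p] lst_i0 z by simp
    moreover have "tms t (i1 G) = b"
      using end_val[of "i1 G"] path_eqs(3)[OF path_ty_args p] lst_i1 z by simp
    ultimately show ?R using at(2) by blast
  }
  assume ?R
  then obtain t where t: "trm t" "tty t = ?W" "tms t (i0 G) = a" "tms t (i1 G) = b" by blast
  have "bs (tty t) = intT G" using t path_ty_prems(6) by simp
  then show ?L
    using plam[OF z t(1)] t z by (intro exI[of _ "plam G t"]) (simp add: sec_leftT sec_rightT path_ty_def a(2) G)
qed

end

lemma trm_carrier: "trm (n, x) \<longleftrightarrow> x \<in> K (Tm n)"
  by (simp add: trm_def)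

lemma ex_trm: "(\<And>t. P t \<Longrightarrow> fst t = n) \<Longrightarrow> (\<exists>t. trm t \<and> P t) \<longleftrightarrow> (\<exists>x \<in> K (Tm n). P (n, x))"
  unfolding trm_def by (metis fst_conv prod.collapse snd_conv)

lemma tty_snd: "tty a = A \<longleftrightarrow> fst A = Suc (fst a) \<and> TY (fst a) (snd a) = snd A"
  by (auto simp: tty_def prod_eq_iff)

lemma homotopic_iff:
  "(x, y) \<in> homotopic M n \<longleftrightarrow> trm (n, x) \<and> trm (n, y) \<and> tty (n, y) = tty (n, x) \<and>
     (\<exists>p. trm p \<and> tty p = path_ty (n, x) (n, y))"
proof (cases "trm (n, x) \<and> trm (n, y) \<and> tty (n, y) = tty (n, x)")
  case True
  let ?A = "tty (n, x)"
  have a: "trm (n, x)" "trm (n, y)" "tty (n, y) = ?A" using True by simp_all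
  have A: "ltyp ?A" using a by simp
  have h: "holds M [x, y, p] [Eq (ty n (Tvar 0)) (ty n (Tvar 1)), Eq (ty n (Tvar 2)) (pth n (ft n (ty n (Tvar 0))) (ty n (Tvar 0)) (Tvar 0) (Tvar 1))]
      \<longleftrightarrow> tty (n, p) = path_ty (n, x) (n, y)" if p: "p \<in> K (Tm n)" for p
  proof -
    let ?xs = "[x, y, p]"
    have e: "ev M ?xs (ty n (Tvar 0)) = Some (snd ?A)" "ev M ?xs (ty n (Tvar 1)) = Some (snd ?A)"
      "ev M ?xs (ty n (Tvar 2)) = Some (snd (tty (n, p)))"
      using ev_ty_tty[of "(n, x)" ?xs "Tvar 0" n] ev_ty_tty[of "(n, y)" ?xs "Tvar 1" n] ev_ty_tty[of "(n, p)" ?xs "Tvar 2" n]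
        a p trm_carrier by simp_all
    have g: "ev M ?xs (ft n (ty n (Tvar 0))) = Some (snd (bs ?A))"
      using ev_ft_bs[OF A e(1)] by simp
    have "ev M ?xs (pth n (ft n (ty n (Tvar 0))) (ty n (Tvar 0)) (Tvar 0) (Tvar 1)) = Some (snd (path_ty (n, x) (n, y)))"
      by (rule ev_pth[OF a(1) refl a(2,3) refl g e(1)]) simp_all
    then show ?thesis
      using e path_ty(3)[OF a(1) refl a(2,3) refl] by (auto simp: prod_eq_iff simp del: ev.simps)
  qed
  have "(\<exists>p. trm p \<and> tty p = path_ty (n, x) (n, y)) \<longleftrightarrow> (\<exists>p \<in> K (Tm n). tty (n, p) = path_ty (n, x) (n, y))"
    using path_ty(3)[OF a(1) refl a(2,3) refl] by (auto simp: trm_def tty_snd)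
  then show ?thesis
    using True h unfolding homotopic_def Let_def by (auto simp: trm_carrier)
next
  case False
  have "TY n x = TY n y" if "x \<in> K (Tm n)" "y \<in> K (Tm n)" "holds1 M [x, y, p] (Eq (ty n (Tvar 0)) (ty n (Tvar 1)))" for p
    using that by simp
  then have "(x, y) \<notin> homotopic M n"
    using False unfolding homotopic_def Let_def holds_Cons by (fastforce simp: trm_carrier tty_def)
  then show ?thesis using False by blast
qed

text \<open>A fibrewise homotopy is an arrow whose composite with the display map is prescribed, so
  it is determined by its last term. This is a term over the cylinder with prescribed ends, that is,
  a path between the last terms of \<open>f\<close> and \<open>g\<close>.\<close>

lemma fh_iff:
  assumes f: "hom f z A" and g: "hom g z A" and A: "ltyp A" and fg: "cc (dsp A) g = cc (dsp A) f"
  shows "fh A f g \<longleftrightarrow> (\<exists>p. trm p \<and> tty p = path_ty (lst f) (lst g))"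
proof -
  define s where "s = cc (dsp A) f"
  have s: "cmo s" "dm s = z" "cd s = bs A" and z: "ctx z" using f A by (auto simp: s_def)
  have t: "trm (lst f)" "tty (lst f) = pb A s" "trm (lst g)" "tty (lst g) = pb A s"
    using lst[of f A] lst[of g A] f g fg A by (simp_all add: s_def)
  have b: "bs (pb A s) = z" using A s by simp
  have "fh A f g \<longleftrightarrow> (\<exists>t. trm t \<and> tty t = pb (pb A s) (dsp (cyl z)) \<and> tms t (i0 z) = lst f \<and> tms t (i1 z) = lst g)"
  proof
    assume "fh A f g"
    then have "\<exists>H. hom H (cyl z) A \<and> cc (dsp A) H = cc s (dsp (cyl z)) \<and> cc H (i0 z) = f \<and> cc H (i1 z) = g"
      using f by (simp add: fh_def s_def)
    then obtain H where H: "hom H (cyl z) A" "cc (dsp A) H = cc s (dsp (cyl z))" "cc H (i0 z) = f" "cc H (i1 z) = g"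
      by blast
    show "\<exists>t. trm t \<and> tty t = pb (pb A s) (dsp (cyl z)) \<and> tms t (i0 z) = lst f \<and> tms t (i1 z) = lst g"
      using lst[of H A] lst_cc[of H "i0 z"] lst_cc[of H "i1 z"] H A s z by (intro exI[of _ "lst H"]) simp
  next
    assume "\<exists>t. trm t \<and> tty t = pb (pb A s) (dsp (cyl z)) \<and> tms t (i0 z) = lst f \<and> tms t (i1 z) = lst g"
    then obtain t where u: "trm t" "tty t = pb (pb A s) (dsp (cyl z))" "tms t (i0 z) = lst f" "tms t (i1 z) = lst g"
      by blast
    define H where "H = ex A (cc s (dsp (cyl z))) t"
    have H: "cmo H" "dm H = cyl z" "cd H = A" "cc (dsp A) H = cc s (dsp (cyl z))" "lst H = t"
      using ex[of A "cc s (dsp (cyl z))" t] A s z u by (simp_all add: H_def)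
    have d: "cc (dsp A) (cc H (i0 z)) = cc (dsp A) f" "cc (dsp A) (cc H (i1 z)) = cc (dsp A) g"
      using comp_reassoc[OF H(4), of "i0 z"] comp_reassoc[OF H(4), of "i1 z"] H(1-3) A s z fg by (simp_all add: s_def[symmetric])
    have l: "lst (cc H (i0 z)) = lst f" "lst (cc H (i1 z)) = lst g"
      using lst_cc[of H "i0 z"] lst_cc[of H "i1 z"] H A u by simp_all
    have "cc H (i0 z) = f" "cc H (i1 z) = g"
      using ex_ext[OF _ _ _ _ _ A d(1) l(1)] ex_ext[OF _ _ _ _ _ A d(2) l(2)] H(1-3) f g z by simp_all
    then show "fh A f g"
      unfolding fh_def using H(1-4) f g fg by (intro conjI exI[of _ H]) (simp_all add: s_def)
  qed
  then show ?thesis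
    using path_term_iff[OF t b] by simp
qed

lemma homotopic_fh:
  assumes f: "hom f z A" and g: "hom g z A" and A: "ltyp A" and fg: "cc (dsp A) g = cc (dsp A) f"
  shows "(snd (lst f), snd (lst g)) \<in> homotopic M (fst z) \<longleftrightarrow> fh A f g"
proof -
  have "(fst z, snd (lst f)) = lst f" "(fst z, snd (lst g)) = lst g"
    using f g by (simp_all add: prod_eq_iff)
  then show ?thesis
    unfolding homotopic_iff fh_iff[OF assms] using lst[of f A] lst[of g A] f g fg A by auto
qed

text \<open>Turns terms into sections, so that the properties of an equivalence relation carry over
  from \<open>fh\<close> to the relation that defines \<open>Ho\<close>.\<close>

lemma homotopic_sec:
  "(x, y) \<in> homotopic M n \<longleftrightarrow> trm (n, x) \<and> trm (n, y) \<and> fh (tty (n, x)) (sec (n, x)) (sec (n, y))"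
proof -
  have "(x, y) \<in> homotopic M n \<longleftrightarrow> fh (tty (n, x)) (sec (n, x)) (sec (n, y))"
    if "trm (n, x)" "trm (n, y)" "tty (n, y) = tty (n, x)"
    using homotopic_fh[of "sec (n, x)" "bs (tty (n, x))" "tty (n, x)" "sec (n, y)"] sec[of "(n, x)"] sec[of "(n, y)"] that
    by simp
  moreover have "tty (n, y) = tty (n, x)" if "trm (n, y)" "fh (tty (n, x)) (sec (n, x)) (sec (n, y))"
    using fh_arr[OF that(2)] sec[OF that(1)] by simp
  ultimately show ?thesis using homotopic_iff by blast
qed

lemma homotopic_refl: "x \<in> K (Tm n) \<Longrightarrow> (x, x) \<in> homotopic M n"
  using fh_refl[of "tty (n, x)" "sec (n, x)" "bs (tty (n, x))"] sec[of "(n, x)"]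
  by (simp add: homotopic_sec trm_carrier)

lemma homotopic_sym: "(x, y) \<in> homotopic M n \<Longrightarrow> (y, x) \<in> homotopic M n"
  using fh_sym[of "tty (n, x)" "sec (n, x)" "sec (n, y)"] homotopic_iff[of x y n] by (simp add: homotopic_sec)

lemma homotopic_trans: "(x, y) \<in> homotopic M n \<Longrightarrow> (y, z) \<in> homotopic M n \<Longrightarrow> (x, z) \<in> homotopic M n"
  using fh_trans[of "tty (n, x)" "sec (n, x)" "sec (n, y)" "sec (n, z)"] homotopic_iff[of x y n] by (simp add: homotopic_sec)

lemma homotopic_class_eq:
  "x \<in> K (Tm n) \<Longrightarrow> homotopic M n `` {x} = homotopic M n `` {y} \<longleftrightarrow> (x, y) \<in> homotopic M n"
  using homotopic_refl[of x n] homotopic_sym[of _ _ n] homotopic_trans[of _ _ n] by blast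


subsection \<open>The homotopy category\<close>

abbreviation cty :: "'x \<Rightarrow> 'x ob" where "cty A \<equiv> (Suc 0, A)"

lemma cty [simp]: "ctx (cty A) \<longleftrightarrow> A \<in> K (Ty 0)" "A \<in> K (Ty 0) \<Longrightarrow> bs (cty A) = one"
  using ctx_0[of "bs (cty A)"] by (simp_all add: ctx_def bs_def one_def EMP_unique)

lemma closed_cty: "ltyp a \<Longrightarrow> bs a = one \<Longrightarrow> \<exists>A. a = cty A \<and> A \<in> K (Ty 0)"
  using ltyp_Suc[of a] by (auto simp: bs_def one_def)

text \<open>Arrows in \<open>Ho\<close> are sets of terms; this is the class of an arrow between
  closed types. Such an arrow consists of a single term, so its last term is all of it.\<close>

definition cls :: "'x ar \<Rightarrow> 'x set" where "cls f = homotopic M 1 `` {snd (lst f)}"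

text \<open>The classes are formed by fibrewise homotopy over the context \<open>A\<close>, with
  \<open>B\<close> weakened to it. As \<open>B\<close> is closed, this agrees with homotopy of
  arrows.\<close>

lemma cls_eq: "hom f (cty A) (cty B) \<Longrightarrow> hom g (cty A) (cty B) \<Longrightarrow> cls f = cls g \<longleftrightarrow> hm f g"
proof -
  assume h: "hom f (cty A) (cty B)" "hom g (cty A) (cty B)"
  then have B: "ltyp (cty B)" "bs (cty B) = one" using cmo_ctx cty by (metis fst_conv nat.simps(3))+
  have d: "cc (dsp (cty B)) g = cc (dsp (cty B)) f" using h B by simp
  have "snd (lst f) \<in> K (Tm 1)" using lst(1)[of f "cty B"] h B by (simp add: trm_def)
  then have "cls f = cls g \<longleftrightarrow> (snd (lst f), snd (lst g)) \<in> homotopic M 1"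
    unfolding cls_def by (rule homotopic_class_eq)
  also have "\<dots> \<longleftrightarrow> fh (cty B) f g" using homotopic_fh[OF h B(1) d] by simp
  also have "\<dots> \<longleftrightarrow> hm f g" using fh_hm[of "cty B" f g] hm_fh[of "cty B" f g] B h by blast
  finally show ?thesis .
qed

lemma cty_arrow:
  assumes "A \<in> K (Ty 0)" "B \<in> K (Ty 0)" and t: "trm (1, b)" "tty (1, b) = pb (cty B) (dsp (cty A))"
  shows "\<exists>f. hom f (cty A) (cty B) \<and> snd (lst f) = b"
proof -
  have AB: "ltyp (cty A)" "ltyp (cty B)" "bs (cty A) = bs (cty B)" using assms(1,2) by simp_all
  have "cd (dsp (cty A)) = bs (cty B)" using AB(3) by (simp only: dsp(3))
  note e = ex[OF AB(2) dsp(1)[OF AB(1)] this t]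
  have "hom (ex (cty B) (dsp (cty A)) (1, b)) (cty A) (cty B)" using e(1) by (simp only: dm_ex dsp(2))
  moreover have "snd (lst (ex (cty B) (dsp (cty A)) (1, b))) = b" by (simp only: e(3) snd_conv)
  ultimately show ?thesis by blast
qed

lemma maps_hom:
  assumes "A \<in> K (Ty 0)" "B \<in> K (Ty 0)"
  shows "maps M A B = {b. \<exists>f. hom f (cty A) (cty B) \<and> snd (lst f) = b}"
proof -
  have AB: "ltyp (cty A)" "ltyp (cty B)" "bs (cty A) = bs (cty B)" using assms by simp_all
  have h: "b \<in> maps M A B \<longleftrightarrow> trm (1, b) \<and> tty (1, b) = pb (cty B) (dsp (cty A))" for b
  proof -
    have "ev M [A, B, b] (wk 0 (Ctx (Suc 0)) (Tvar 0) (Tvar 1)) = Some (snd (pb (cty B) (dsp (cty A))))"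
      by (rule ev_wk_dsp[OF AB]) simp_all
    moreover have "ev M [A, B, b] (ty (Suc 0) (Tvar 2)) = Some (TY (Suc 0) b)" if "b \<in> K (Tm 1)"
      using that by simp
    ultimately show ?thesis
      unfolding maps_def is_map_def by (auto simp: trm_carrier tty_snd simp del: ev.simps)
  qed
  show ?thesis
  proof (intro equalityI subsetI CollectI)
    fix b assume "b \<in> maps M A B"
    then show "\<exists>f. hom f (cty A) (cty B) \<and> snd (lst f) = b"
      using cty_arrow[OF assms] h by blast
  next
    fix b assume "b \<in> {b. \<exists>f. hom f (cty A) (cty B) \<and> snd (lst f) = b}"
    then obtain f where f: "hom f (cty A) (cty B)" "snd (lst f) = b" by blast
    have l: "lst f = (1, b)" using f by (simp add: prod_eq_iff)
    have c: "cmo f" "cd f = cty B" "ltyp (cd f)" using f AB(2) by simp_all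
    have d: "cc (dsp (cty B)) f = dsp (cty A)" using f assms by simp
    show "b \<in> maps M A B"
      unfolding h using lst(1)[OF c(1,3,2)] lst(2)[OF c(1,3,2)] unfolding l d by (rule conjI)
  qed
qed

lemma Obj_Ho: "Obj (Ho M) = K (Ty 0)"
  by (simp add: Ho_def)

lemma Hom_Ho: "A \<in> K (Ty 0) \<Longrightarrow> B \<in> K (Ty 0) \<Longrightarrow> Hom (Ho M) A B = cls ` {f. hom f (cty A) (cty B)}"
proof -
  assume "A \<in> K (Ty 0)" "B \<in> K (Ty 0)"
  then have m: "maps M A B = (\<lambda>f. snd (lst f)) ` {f. hom f (cty A) (cty B)}" by (simp add: maps_hom image_def) blast
  have "Hom (Ho M) A B = (\<Union>x \<in> maps M A B. {homotopic M 1 `` {x}})" by (simp add: Ho_def quotient_def)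
  then show ?thesis unfolding m cls_def by blast
qed

lemma Idn_Ho: "A \<in> K (Ty 0) \<Longrightarrow> Idn (Ho M) A = cls (cid (cty A))"
  using lst_cid[of "cty A"] by (simp add: Ho_def cls_def v0_def)

lemma cls_mem:
  assumes f: "hom f (cty A) (cty B)"
  shows "b \<in> cls f \<longleftrightarrow> (\<exists>g. hom g (cty A) (cty B) \<and> hm f g \<and> snd (lst g) = b)"
proof -
  have B: "ltyp (cty B)" "bs (cty B) = one" "A \<in> K (Ty 0)" "B \<in> K (Ty 0)"
    using f cmo_ctx cty by (metis fst_conv nat.simps(3))+
  have l: "lst f = (1, snd (lst f))" using f by (simp add: prod_eq_iff)
  have l': "trm (lst f)" "tty (lst f) = pb (cty B) (dsp (cty A))"
    using f lst[of f "cty B"] B by simp_all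
  note l = l l'
  show ?thesis
  proof
    assume b: "b \<in> cls f"
    then have h: "(snd (lst f), b) \<in> homotopic M 1" by (simp add: cls_def)
    then have "trm (1, b)" "tty (1, b) = pb (cty B) (dsp (cty A))" using homotopic_iff[of "snd (lst f)" b 1] l by simp_all
    then obtain g where g: "hom g (cty A) (cty B)" "snd (lst g) = b"
      using cty_arrow[OF B(3,4)] by blast
    have "homotopic M 1 `` {snd (lst f)} = homotopic M 1 `` {b}"
      using h homotopic_class_eq l(1,2) trm_carrier by metis
    then have "cls f = cls g" using g(2) by (simp add: cls_def)
    then show "\<exists>g. hom g (cty A) (cty B) \<and> hm f g \<and> snd (lst g) = b"
      using cls_eq[OF f g(1)] g by blast
  next
    assume "\<exists>g. hom g (cty A) (cty B) \<and> hm f g \<and> snd (lst g) = b"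
    then obtain g where g: "hom g (cty A) (cty B)" "hm f g" "snd (lst g) = b" by blast
    have "cls f = cls g" using cls_eq[OF f g(1)] g(2) by blast
    moreover have "trm (lst g)" using lst(1)[of g "cty B"] g B by simp
    ultimately show "b \<in> cls f"
      using g homotopic_refl[of b 1] by (simp add: cls_def trm_def)
  qed
qed

text \<open>Composition in \<open>Ho\<close> saturates the set of all composites of representatives.
  These composites lie in one class because \<open>hm\<close> is compatible with composition on both
  sides.\<close>

lemma Comp_Ho:
  assumes f: "hom f (cty A) (cty B)" and g: "hom g (cty B) (cty C)"
  shows "Comp (Ho M) A B C (cls g) (cls f) = cls (cc g f)"
proof -
  have o: "A \<in> K (Ty 0)" "B \<in> K (Ty 0)" "C \<in> K (Ty 0)"
    using f g cmo_ctx cty by metis+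
  have ev: "ev M [A, snd (lst g'), snd (lst f')] (cmp 0 (Tvar 0) (Tvar 1) (Tvar 2)) = Some (snd (lst (cc g' f')))"
    if f': "hom f' (cty A) (cty B)" and g': "hom g' (cty B) (cty C)" for f' g'
  proof -
    have "ls f' = [snd (lst f')]"
    proof -
      have "length (ls f') = Suc 0" using f' mor_carrier unfolding cmo_def by fastforce
      then show ?thesis by (cases "ls f'") (simp_all add: lst_def)
    qed
    moreover have "trm (lst g')" "bs (tty (lst g')) = cty B"
      using lst[of g' "cty C"] g' o by simp_all
    ultimately have "ev M [A, snd (lst g'), snd (lst f')] (sb KTm (fst (dm f')) (fst (cd f')) (Tvar 0) (Tvar 1) [Tvar 2]) = Some (snd (tms (lst g') f'))"
      by (intro ev_sb(2)) (use f' g' in simp_all)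
    then show ?thesis
      using f' g' lst_cc[of g' f'] by (simp add: cmp_def vars_def del: ev.simps)
  qed
  have "Comp (Ho M) A B C (cls g) (cls f) = homotopic M 1 ``
      {d. \<exists>g' f'. hom f' (cty A) (cty B) \<and> hom g' (cty B) (cty C) \<and> hm f f' \<and> hm g g' \<and> d = snd (lst (cc g' f'))}"
    (is "_ = _ `` ?D")
  proof -
    have "{d. \<exists>c \<in> cls g. \<exists>b \<in> cls f. ev M [A, c, b] (cmp 0 (Tvar 0) (Tvar 1) (Tvar 2)) = Some d} = ?D"
      using ev cls_mem[OF f] cls_mem[OF g] by fastforce
    then show ?thesis by (simp add: Ho_def)
  qed
  also have "\<dots> = (\<Union>d \<in> ?D. homotopic M 1 `` {d})" by blast
  also have "\<dots> = cls (cc g f)"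
  proof -
    have "homotopic M 1 `` {d} = cls (cc g f)" if d: "d \<in> ?D" for d
    proof -
      obtain g' f' where h: "hom f' (cty A) (cty B)" "hom g' (cty B) (cty C)" "hm f f'" "hm g g'" "d = snd (lst (cc g' f'))"
        using d by blast
      have "hm (cc g f) (cc g' f')"
        by (rule hm_trans[OF hm_post[OF h(3)] hm_pre[OF h(4)]]) (use f g h in simp_all)
      then have "cls (cc g f) = cls (cc g' f')"
        using cls_eq[of "cc g f" A C "cc g' f'"] f g h(1,2) by simp
      then show ?thesis using h(5) by (simp add: cls_def)
    qed
    moreover have "snd (lst (cc g f)) \<in> ?D" using f g hm_refl by blast
    ultimately show ?thesis by blast
  qed
  finally show ?thesis .
qed

lemma is_cat_Ho: "is_cat (Ho M)"
  unfolding is_cat_def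
proof (intro conjI ballI)
  fix A assume A: "A \<in> Obj (Ho M)"
  then show "Idn (Ho M) A \<in> Hom (Ho M) A A" by (auto simp: Obj_Ho Hom_Ho Idn_Ho)
  fix B assume B: "B \<in> Obj (Ho M)"
  note AB = A[unfolded Obj_Ho] B[unfolded Obj_Ho]
  fix \<beta> assume "\<beta> \<in> Hom (Ho M) A B"
  then obtain b where b: "hom b (cty A) (cty B)" "\<beta> = cls b" using AB by (auto simp: Hom_Ho)
  show "Comp (Ho M) A B B (Idn (Ho M) B) \<beta> = \<beta>" "Comp (Ho M) A A B \<beta> (Idn (Ho M) A) = \<beta>"
    using Comp_Ho[of b A B "cid (cty B)" B] Comp_Ho[of "cid (cty A)" A A b B] b AB by (simp_all add: Idn_Ho)
next
  fix A B C \<beta> \<gamma>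
  assume o: "A \<in> Obj (Ho M)" "B \<in> Obj (Ho M)" "C \<in> Obj (Ho M)" and h: "\<beta> \<in> Hom (Ho M) A B" "\<gamma> \<in> Hom (Ho M) B C"
  obtain b c where bc: "hom b (cty A) (cty B)" "\<beta> = cls b" "hom c (cty B) (cty C)" "\<gamma> = cls c"
    using o h by (auto simp: Hom_Ho Obj_Ho)
  then have "hom (cc c b) (cty A) (cty C)" by simp
  then show "Comp (Ho M) A B C \<gamma> \<beta> \<in> Hom (Ho M) A C"
    using Comp_Ho[OF bc(1,3)] bc(2,4) o by (auto simp: Hom_Ho Obj_Ho)
next
  fix A B C D \<beta> \<gamma> \<delta>
  assume o: "A \<in> Obj (Ho M)" "B \<in> Obj (Ho M)" "C \<in> Obj (Ho M)" "D \<in> Obj (Ho M)"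
    and h: "\<beta> \<in> Hom (Ho M) A B" "\<gamma> \<in> Hom (Ho M) B C" "\<delta> \<in> Hom (Ho M) C D"
  obtain b c d where bcd: "hom b (cty A) (cty B)" "\<beta> = cls b" "hom c (cty B) (cty C)" "\<gamma> = cls c"
    "hom d (cty C) (cty D)" "\<delta> = cls d"
    using o h by (auto simp: Hom_Ho Obj_Ho)
  then have "hom (cc c b) (cty A) (cty C)" "hom (cc d c) (cty B) (cty D)" by simp_all
  then show "Comp (Ho M) A C D \<delta> (Comp (Ho M) A B C \<gamma> \<beta>) = Comp (Ho M) A B D (Comp (Ho M) B C D \<delta> \<gamma>) \<beta>"
    using Comp_Ho bcd by simp
qed


subsection \<open>The conditions on weak equivalences\<close>

text \<open>The formula in (tm,n) speaks of a term over \<open>z : I\<close> with prescribed ends,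
  the definition of \<open>Ho\<close> of a term of a path type; \<open>path_term_iff\<close>
  identifies them.\<close>

lemma holds_homotopy:
  assumes a: "trm (n, x)" "tty (n, x) = A" and b: "trm (n, y)" "tty (n, y) = A"
  shows "(\<exists>t \<in> K (Tm (Suc n)). holds M [snd A, x, y, t]
      (let A = Tvar 0; a' = Tvar 1; a = Tvar 2; h = Tvar 3; \<Gamma> = ft n A
       in [is_map n (intv n \<Gamma>) A h, Eq (inst n KTm \<Gamma> h (lft n \<Gamma>)) a', Eq (inst n KTm \<Gamma> h (rgt n \<Gamma>)) a])) \<longleftrightarrow>
    (x, y) \<in> homotopic M n"
proof -
  define G where "G = bs A"
  note P = path_ty_prems[OF a b G_def[symmetric]]
  have n: "n = fst G" using P(3) by simp
  have iff: "holds M [snd A, x, y, t]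
      (let A = Tvar 0; a' = Tvar 1; a = Tvar 2; h = Tvar 3; \<Gamma> = ft n A
       in [is_map n (intv n \<Gamma>) A h, Eq (inst n KTm \<Gamma> h (lft n \<Gamma>)) a', Eq (inst n KTm \<Gamma> h (rgt n \<Gamma>)) a]) \<longleftrightarrow>
     tty (Suc n, t) = pb A (dsp (cyl G)) \<and> tms (Suc n, t) (i0 G) = (n, x) \<and> tms (Suc n, t) (i1 G) = (n, y)"
    if t: "trm (Suc n, t)" for t
  proof -
    let ?xs = "[snd A, x, y, t]" and ?\<Gamma> = "ft n (Tvar 0) :: t0 trm"
    have g: "ev M ?xs ?\<Gamma> = Some (snd G)"
      using ev_ft_bs[OF P(2), of ?xs "Tvar 0"] n by (simp add: G_def)
    note l = ev_intv[OF P(1) g n]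
    have w: "ev M ?xs (wk n (Ctx (Suc 0)) (intv n ?\<Gamma>) (Tvar 0)) = Some (snd (pb A (dsp (cyl G))))"
      by (rule ev_wk_dsp) (use P(1,2) l intT(2)[of G] n in \<open>simp_all add: intT_cyl G_def\<close>)
    have ty: "ev M ?xs (ty (Suc n) (Tvar 3)) = Some (snd (tty (Suc n, t)))"
      by (rule ev_ty_tty[OF t]) simp_all
    have f: "fst (pb A (dsp (cyl G))) = Suc (Suc n)" using intT(2)[of G] P(1) n by (simp add: intT_cyl)
    have m: "holds1 M ?xs (is_map n (intv n ?\<Gamma>) (Tvar 0) (Tvar 3)) \<longleftrightarrow> tty (Suc n, t) = pb A (dsp (cyl G))"
      using w ty f by (simp add: is_map_def prod_eq_iff del: ev.simps)
    have e: "ev M ?xs (inst n KTm ?\<Gamma> (Tvar 3) (lft n ?\<Gamma>)) = Some (snd (tms (Suc n, t) (i0 G)))"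
      "ev M ?xs (inst n KTm ?\<Gamma> (Tvar 3) (rgt n ?\<Gamma>)) = Some (snd (tms (Suc n, t) (i1 G)))"
      if "tty (Suc n, t) = pb A (dsp (cyl G))"
    proof -
      have v: "ev M ?xs (Tvar 3) = Some (snd (Suc n, t))" by simp
      have b: "bs (tty (Suc n, t)) = tty (leftT G)" "bs (tty (Suc n, t)) = tty (rightT G)"
        "bs (tty (leftT G)) = G" "bs (tty (rightT G)) = G"
        unfolding that P(6) using P(1) by simp_all
      show "ev M ?xs (inst n KTm ?\<Gamma> (Tvar 3) (lft n ?\<Gamma>)) = Some (snd (tms (Suc n, t) (i0 G)))"
        using ev_inst_KTm[OF g v l(2) leftT(1)[OF P(1)] b(3) t b(1) n[symmetric]] unfolding sec_leftT[OF P(1)] .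
      show "ev M ?xs (inst n KTm ?\<Gamma> (Tvar 3) (rgt n ?\<Gamma>)) = Some (snd (tms (Suc n, t) (i1 G)))"
        using ev_inst_KTm[OF g v l(3) rightT(1)[OF P(1)] b(4) t b(2) n[symmetric]] unfolding sec_rightT[OF P(1)] .
    qed
    show ?thesis
      unfolding Let_def holds_Cons holds_Nil m using e n P(1) by (auto simp: prod_eq_iff)
  qed
  have "(x, y) \<in> homotopic M n \<longleftrightarrow>
    (\<exists>t. trm t \<and> tty t = pb A (dsp (cyl G)) \<and> tms t (i0 G) = (n, x) \<and> tms t (i1 G) = (n, y))"
    unfolding homotopic_iff path_term_iff[OF a b G_def[symmetric]] using a b by simp
  also have "\<dots> \<longleftrightarrow> (\<exists>t \<in> K (Tm (Suc n)). tty (Suc n, t) = pb A (dsp (cyl G)) \<and>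
      tms (Suc n, t) (i0 G) = (n, x) \<and> tms (Suc n, t) (i1 G) = (n, y))"
  proof -
    have "fst t = Suc n" if "tty t = pb A (dsp (cyl G))" for t
      using arg_cong[OF that, of fst] intT(2)[of G] P(1) n by (simp add: intT_cyl tty_def)
    then show ?thesis
      using ex_trm[of "\<lambda>t. tty t = pb A (dsp (cyl G)) \<and> tms t (i0 G) = (n, x) \<and> tms t (i1 G) = (n, y)" "Suc n"] by blast
  qed
  finally show ?thesis
    using iff by (auto simp: trm_carrier)
qed

text \<open>Reads the formula of (ty,n) in the category: \<open>b\<close>, \<open>a\<^sub>1\<close>
  and \<open>a\<^sub>2\<close> are the last terms of arrows over \<open>G\<close> between the total
  spaces, and \<open>p\<close> and \<open>q\<close> witness fibrewise homotopies.\<close>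

lemma holds_fibrewise_equiv:
  assumes A: "ltyp A" "bs A = G" and B: "ltyp B" "bs B = G" and n: "n = fst G"
  shows "(\<exists>b \<in> K (Tm (Suc n)). \<exists>a\<^sub>1 \<in> K (Tm (Suc n)). \<exists>p \<in> K (Tm (Suc n)).
         \<exists>a\<^sub>2 \<in> K (Tm (Suc n)). \<exists>q \<in> K (Tm (Suc n)).
           holds M [snd A, snd B, b, a\<^sub>1, p, a\<^sub>2, q]
             (let A = Tvar 0; B = Tvar 1; b = Tvar 2; a\<^sub>1 = Tvar 3; p = Tvar 4; a\<^sub>2 = Tvar 5; q = Tvar 6
              in [is_map n A B b,
                  is_map n B A a\<^sub>1, is_retr n A a\<^sub>1 b p,
                  is_map n B A a\<^sub>2, is_retr n B b a\<^sub>2 q])) \<longleftrightarrow>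
    (\<exists>f g g'. hom f A B \<and> cc (dsp B) f = dsp A \<and> hom g B A \<and> cc (dsp A) g = dsp B \<and>
       hom g' B A \<and> cc (dsp A) g' = dsp B \<and> fh A (cc g f) (cid A) \<and> fh B (cc f g') (cid B))"
proof -
  have map: "holds1 M xs (is_map n u v w) \<longleftrightarrow> tty t = pb D (dsp C)"
    if "ltyp C" "bs C = G" "ltyp D" "bs D = G" "trm t" "fst t = Suc n"
      "ev M xs u = Some (snd C)" "ev M xs v = Some (snd D)" "ev M xs w = Some (snd t)" for C D t xs u v w
  proof -
    have "ev M xs (wk n (Ctx (Suc 0)) u v) = Some (snd (pb D (dsp C)))"
      by (rule ev_wk_dsp) (use that n fst_bs[of C] in simp_all)
    moreover have "ev M xs (ty (Suc n) w) = Some (snd (tty t))"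
      by (rule ev_ty_tty[OF that(5,9)]) (use that(6) in simp)
    ultimately show ?thesis
      using that n fst_bs[of C] by (simp add: is_map_def prod_eq_iff del: ev.simps)
  qed
  \<comment> \<open>The term \<open>g[y := f]\<close> evaluates to the last term of the composite
    arrow, and the variable to the last term of the identity; so the type of \<open>p\<close> is the
    path type that \<open>fh_iff\<close> associates with these two arrows.\<close>
  have retr: "holds1 M xs (is_retr n u v w r) \<longleftrightarrow> tty p = path_ty (lst (cc k f)) (lst (cid C))"
    if C: "ltyp C" "bs C = G" and D: "ltyp D" "bs D = G" and p: "trm p" "fst p = Suc n"
      and f: "hom f C D" "cc (dsp D) f = dsp C" and k: "hom k D C" "cc (dsp C) k = dsp D"
      and e: "ev M xs u = Some (snd C)" "ev M xs v = Some (snd (lst k))" "ev M xs w = Some (snd (lst f))"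
        "ev M xs r = Some (snd p)" for C D p f k xs u v w r
  proof -
    have n': "fst C = Suc n" "fst D = Suc n" using C D n fst_bs[OF C(1)] fst_bs[OF D(1)] by simp_all
    have wk: "ev M xs (wk n (Ctx (Suc 0)) u u) = Some (snd (pb C (dsp C)))"
      by (rule ev_wk_dsp) (use C e n' in simp_all)
    have l: "trm (lst k)" "bs (tty (lst k)) = D" using lst[of k C] k C D by simp_all
    have "ls f = butlast (ls f) @ [last (ls f)]" using ltyp_ls[of f] f D by blast
    moreover have "map (ev M xs) (vars (Suc n) (Suc 0) u @ [w]) = map Some (butlast (ls f) @ [last (ls f)])"
      using ev_vars[OF e(1), of "Suc n" "Suc 0"] C n' e(3) cc_dsp[of f] f D
      by (simp add: ctx_def lst_def dsp_def)
    ultimately have "map (ev M xs) (vars (Suc n) (Suc 0) u @ [w]) = map Some (ls f)" by argo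
    then have "ev M xs (cmp n u v w) = Some (snd (tms (lst k) f))"
      using ev_sb(2)[OF _ _ _ l(1) _ e(2), of f u "vars (Suc n) (Suc 0) u @ [w]"] f l e(1) n' by (simp add: cmp_def)
    then have cm: "ev M xs (cmp n u v w) = Some (snd (lst (cc k f)))" using k C lst_cc[of k f] by simp
    have vv: "ev M xs (vr (Suc n) 0 u) = Some (snd (lst (cid C)))"
      using e(1) C n' lst_cid[of C] by (simp add: v0_def ctx_def)
    have t: "trm (lst (cc k f))" "tty (lst (cc k f)) = pb C (dsp C)" "trm (lst (cid C))" "tty (lst (cid C)) = pb C (dsp C)"
      using lst[of "cc k f" C] lst[of "cid C" C] f k C comp_reassoc[OF k(2), of f] D by simp_all
    have pt: "ev M xs (pth (Suc n) u (wk n (Ctx (Suc 0)) u u) (cmp n u v w) (vr (Suc n) 0 u)) = Some (snd (path_ty (lst (cc k f)) (lst (cid C))))"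
      by (rule ev_pth[OF t _ e(1) wk cm vv]) (use C f n' in simp_all)
    have "ev M xs (ty (Suc n) r) = Some (snd (tty p))" using ev_ty_tty[OF p(1) e(4)] p by simp
    moreover have "fst (path_ty (lst (cc k f)) (lst (cid C))) = fst (tty p)"
      using path_ty(3)[OF t refl] f n' p by simp
    ultimately show ?thesis
      using pt by (simp add: is_retr_def prod_eq_iff del: ev.simps)
  qed
  have path: "fh C (cc k f) (cid C) \<longleftrightarrow> (\<exists>p \<in> K (Tm (Suc n)). tty (Suc n, p) = path_ty (lst (cc k f)) (lst (cid C)))"
    if C: "ltyp C" "bs C = G" and D: "ltyp D" "bs D = G"
      and f: "hom f C D" "cc (dsp D) f = dsp C" and k: "hom k D C" "cc (dsp C) k = dsp D" for C D f k
  proof -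
    have n': "fst C = Suc n" using C n fst_bs[OF C(1)] by simp
    have kf: "cc (dsp C) (cc k f) = dsp C" using comp_reassoc[OF k(2), of f] f k C D by simp
    have t: "trm (lst (cc k f))" "tty (lst (cc k f)) = pb C (dsp C)" "trm (lst (cid C))" "tty (lst (cid C)) = pb C (dsp C)"
      using lst[of "cc k f" C] lst[of "cid C" C] f k C kf by simp_all
    have "fst p = Suc n" if "tty p = path_ty (lst (cc k f)) (lst (cid C))" for p
      using arg_cong[OF that, of fst] path_ty(3)[OF t refl] f n' by (simp add: tty_def)
    then have "(\<exists>p. trm p \<and> tty p = path_ty (lst (cc k f)) (lst (cid C))) \<longleftrightarrow>
        (\<exists>p \<in> K (Tm (Suc n)). tty (Suc n, p) = path_ty (lst (cc k f)) (lst (cid C)))"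
      using ex_trm[of "\<lambda>p. tty p = path_ty (lst (cc k f)) (lst (cid C))" "Suc n"] by blast
    then show ?thesis
      using fh_iff[of "cc k f" C C "cid C"] f k C kf by simp
  qed
  have arrow: "(Suc n, t) = lst (ex D (dsp C) (Suc n, t)) \<and> hom (ex D (dsp C) (Suc n, t)) C D \<and> cc (dsp D) (ex D (dsp C) (Suc n, t)) = dsp C"
    if "ltyp C" "bs C = G" "ltyp D" "bs D = G" "trm (Suc n, t)" "tty (Suc n, t) = pb D (dsp C)" for C D t
    using ex[of D "dsp C" "(Suc n, t)"] that by simp
  have lsts: "trm (lst f)" "tty (lst f) = pb D (dsp C)" "lst f = (Suc n, snd (lst f))"
    if "ltyp C" "bs C = G" "ltyp D" "bs D = G" "hom f C D" "cc (dsp D) f = dsp C" for C D f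
  proof -
    show "trm (lst f)" "tty (lst f) = pb D (dsp C)" using lst[of f D] that by simp_all
    show "lst f = (Suc n, snd (lst f))" using that fst_bs[of C] n by (simp add: prod_eq_iff[of "lst f"])
  qed
  show ?thesis (is "?L \<longleftrightarrow> ?R")
  proof
    assume ?L
    then obtain b a1 p a2 q where c: "trm (Suc n, b)" "trm (Suc n, a1)" "trm (Suc n, p)" "trm (Suc n, a2)" "trm (Suc n, q)"
      and h: "holds1 M [snd A, snd B, b, a1, p, a2, q] (is_map n (Tvar 0) (Tvar 1) (Tvar 2))"
        "holds1 M [snd A, snd B, b, a1, p, a2, q] (is_map n (Tvar 1) (Tvar 0) (Tvar 3))"
        "holds1 M [snd A, snd B, b, a1, p, a2, q] (is_retr n (Tvar 0) (Tvar 3) (Tvar 2) (Tvar 4))"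
        "holds1 M [snd A, snd B, b, a1, p, a2, q] (is_map n (Tvar 1) (Tvar 0) (Tvar 5))"
        "holds1 M [snd A, snd B, b, a1, p, a2, q] (is_retr n (Tvar 1) (Tvar 2) (Tvar 5) (Tvar 6))"
      unfolding Let_def holds_Cons trm_carrier by blast
    let ?xs = "[snd A, snd B, b, a1, p, a2, q]"
    have m: "tty (Suc n, b) = pb B (dsp A)" "tty (Suc n, a1) = pb A (dsp B)" "tty (Suc n, a2) = pb A (dsp B)"
      using h(1) map[OF A B c(1), of ?xs "Tvar 0" "Tvar 1" "Tvar 2"] h(2) map[OF B A c(2), of ?xs "Tvar 1" "Tvar 0" "Tvar 3"]
        h(4) map[OF B A c(4), of ?xs "Tvar 1" "Tvar 0" "Tvar 5"] by simp_all
    define f where "f = ex B (dsp A) (Suc n, b)"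
    define g where "g = ex A (dsp B) (Suc n, a1)"
    define g' where "g' = ex A (dsp B) (Suc n, a2)"
    note f = arrow[OF A B c(1) m(1), folded f_def] and g = arrow[OF B A c(2) m(2), folded g_def]
      and g' = arrow[OF B A c(4) m(3), folded g'_def]
    have l: "snd (lst f) = b" "snd (lst g) = a1" "snd (lst g') = a2" using f g g' by (metis snd_conv)+
    have "tty (Suc n, p) = path_ty (lst (cc g f)) (lst (cid A))"
      using h(3) retr[OF A B c(3) _ _ _ _ _, of f g ?xs "Tvar 0" "Tvar 3" "Tvar 2" "Tvar 4"] f g l by simp
    moreover have "tty (Suc n, q) = path_ty (lst (cc f g')) (lst (cid B))"
      using h(5) retr[OF B A c(5) _ _ _ _ _, of g' f ?xs "Tvar 1" "Tvar 2" "Tvar 5" "Tvar 6"] f g' l by simp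
    ultimately show ?R
      using f g g' path[OF A B, of f g] path[OF B A, of g' f] c(3,5) unfolding trm_carrier by blast
  next
    assume ?R
    then obtain f g g' where f: "hom f A B" "cc (dsp B) f = dsp A" and g: "hom g B A" "cc (dsp A) g = dsp B"
      and g': "hom g' B A" "cc (dsp A) g' = dsp B" and h: "fh A (cc g f) (cid A)" "fh B (cc f g') (cid B)"
      by blast
    obtain p q where p: "trm (Suc n, p)" "tty (Suc n, p) = path_ty (lst (cc g f)) (lst (cid A))"
      and q: "trm (Suc n, q)" "tty (Suc n, q) = path_ty (lst (cc f g')) (lst (cid B))"
      using path[OF A B f g] path[OF B A g' f] h unfolding trm_carrier by blast
    let ?b = "snd (lst f)" and ?a1 = "snd (lst g)" and ?a2 = "snd (lst g')"
    note lf = lsts[OF A B f] and lg = lsts[OF B A g] and lg' = lsts[OF B A g']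
    let ?xs = "[snd A, snd B, ?b, ?a1, p, ?a2, q]"
    have "holds1 M ?xs (is_map n (Tvar 0) (Tvar 1) (Tvar 2))" "holds1 M ?xs (is_map n (Tvar 1) (Tvar 0) (Tvar 3))"
      "holds1 M ?xs (is_map n (Tvar 1) (Tvar 0) (Tvar 5))"
    proof -
      have e: "fst (lst f) = Suc n" "fst (lst g) = Suc n" "fst (lst g') = Suc n"
        using lf(3) lg(3) lg'(3) by (metis fst_conv)+
      show "holds1 M ?xs (is_map n (Tvar 0) (Tvar 1) (Tvar 2))"
        using map[OF A B lf(1) e(1), of ?xs "Tvar 0" "Tvar 1" "Tvar 2"] lf(2) by simp
      show "holds1 M ?xs (is_map n (Tvar 1) (Tvar 0) (Tvar 3))"
        using map[OF B A lg(1) e(2), of ?xs "Tvar 1" "Tvar 0" "Tvar 3"] lg(2) by simp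
      show "holds1 M ?xs (is_map n (Tvar 1) (Tvar 0) (Tvar 5))"
        using map[OF B A lg'(1) e(3), of ?xs "Tvar 1" "Tvar 0" "Tvar 5"] lg'(2) by simp
    qed
    moreover have "holds1 M ?xs (is_retr n (Tvar 0) (Tvar 3) (Tvar 2) (Tvar 4))"
      using retr[OF A B p(1) _ f g, of ?xs "Tvar 0" "Tvar 3" "Tvar 2" "Tvar 4"] p by simp
    moreover have "holds1 M ?xs (is_retr n (Tvar 1) (Tvar 2) (Tvar 5) (Tvar 6))"
      using retr[OF B A q(1) _ g' f, of ?xs "Tvar 1" "Tvar 2" "Tvar 5" "Tvar 6"] q by simp
    moreover have "?b \<in> K (Tm (Suc n))" "?a1 \<in> K (Tm (Suc n))" "?a2 \<in> K (Tm (Suc n))" "p \<in> K (Tm (Suc n))" "q \<in> K (Tm (Suc n))"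
      using lf(1,3) lg(1,3) lg'(1,3) p(1) q(1) trm_carrier by metis+
    ultimately show ?L
      unfolding Let_def holds_Cons
      by (intro bexI[of _ ?b] bexI[of _ ?a1] bexI[of _ p] bexI[of _ ?a2] bexI[of _ q] conjI holds_Nil) assumption+
  qed
qed

end

section \<open>Morphisms of models\<close>

lemma map2_replicate: "length as = k \<Longrightarrow> map2 h (replicate k s) as = map (h s) as"
  by (induction as arbitrary: k) auto

locale t0_morphism = X: t0_model M + Y: t0_model N
  for M :: "'x t0_struct" and N :: "'y t0_struct" +
  fixes h :: "sort \<Rightarrow> 'x \<Rightarrow> 'y"
  assumes morphism: "is_morphism T0 M N h"
begin

lemma h_car [simp]: "x \<in> car M s \<Longrightarrow> h s x \<in> car N s"
  using morphism by (simp add: is_morphism_def)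

lemma h_fn: "f \<in> funs T0 \<Longrightarrow> fn M f xs = Some y \<Longrightarrow> fn N f (map2 h (fdom T0 f) xs) = Some (h (fcod T0 f) y)"
  using morphism by (simp add: is_morphism_def)

lemma h_EMP: "h (Ctx 0) X.EMP = Y.EMP"
  using h_fn[OF _ X.fn_EMP] by simp

lemma h_FT [simp]: "A \<in> car M (Ty n) \<Longrightarrow> Y.FT n (h (Ty n) A) = h (Ctx n) (X.FT n A)"
  using h_fn[OF _ X.fn_FT[of A n]] by simp

lemma h_TY [simp]: "a \<in> car M (Tm n) \<Longrightarrow> Y.TY n (h (Tm n) a) = h (Ty n) (X.TY n a)"
  using h_fn[OF _ X.fn_TY[of a n]] by simp

lemma h_VR [simp]: "G \<in> car M (Ctx n) \<Longrightarrow> i < n \<Longrightarrow> Y.VR n i (h (Ctx n) G) = h (Tm n) (X.VR n i G)"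
  using h_fn[OF _ X.fn_VR[of G n i]] by simp

lemma h_VARS: "G \<in> car M (Ctx n) \<Longrightarrow> map (h (Tm n)) (X.VARS n j G) = Y.VARS n j (h (Ctx n) G)"
  by (auto simp: X.VARS_def Y.VARS_def)

lemma h_FTN: "A \<in> car M (Ctx (n + j)) \<Longrightarrow> Y.FTN n j (h (Ctx (n + j)) A) = h (Ctx n) (X.FTN n j A)"
  by (induction j arbitrary: A) simp_all

lemma h_fn_SB:
  assumes "fn M (Bas (SubS p n k)) (G # t # as) = Some y"
  shows "fn N (Bas (SubS p n k)) (h (Ctx n) G # h (ksort p k) t # map (h (Tm n)) as) = Some (h (ksort p n) y)"
proof -
  have "length as = k" using X.mor_carrier[of n k G] X.fn_SB_defined[OF assms] by blast
  then show ?thesis using h_fn[OF _ assms] by (simp add: map2_replicate)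
qed

lemma h_mor: "X.mor n k G D as \<Longrightarrow> Y.mor n k (h (Ctx n) G) (h (Ctx k) D) (map (h (Tm n)) as)"
proof -
  assume m: "X.mor n k G D as"
  note c = X.mor_carrier[OF m]
  have "fn N (Bas (SubS KTy n i)) (h (Ctx n) G # Y.FTN (Suc i) (k - Suc i) (h (Ctx k) D) # take i (map (h (Tm n)) as)) =
      Some (Y.TY n (map (h (Tm n)) as ! i))" if i: "i < k" for i
  proof -
    have e: "fn M (Bas (SubS KTy n i)) (G # X.FTN (Suc i) (k - Suc i) D # take i as) = Some (X.TY n (as ! i))"
      using m i by (simp add: X.mor_def)
    have "Y.FTN (Suc i) (k - Suc i) (h (Ctx k) D) = h (Ty i) (X.FTN (Suc i) (k - Suc i) D)"
      using h_FTN[of D "Suc i" "k - Suc i"] c i by simp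
    moreover have "as ! i \<in> car M (Tm n)" using c i by simp
    ultimately show ?thesis using h_fn_SB[OF e] c i by (simp add: take_map)
  qed
  then show ?thesis using c by (simp add: Y.mor_def)
qed

lemma h_SB:
  assumes "t \<in> car M (ksort p k)" "X.mor n k G (X.KC p k t) as"
  shows "Y.SB p n k (h (Ctx n) G) (h (ksort p k) t) (map (h (Tm n)) as) = h (ksort p n) (X.SB p n k G t as)"
  using Y.fn_SB_defined[OF h_fn_SB[OF X.fn_SB[OF assms]]] by simp

text \<open>Objects and terms are stored alike, as a length with an element, but \<open>h\<close>
  acts on them at different sorts; hence the separate maps \<open>fo\<close> and
  \<open>ftm\<close>.\<close>

definition fo :: "'x ob \<Rightarrow> 'y ob" where "fo a = (fst a, h (Ctx (fst a)) (snd a))"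
definition ftm :: "'x ob \<Rightarrow> 'y ob" where "ftm a = (fst a, h (Tm (fst a)) (snd a))"
definition fm :: "'x ar \<Rightarrow> 'y ar" where
  "fm f = (fo (X.dm f), fo (X.cd f), map (h (Tm (fst (X.dm f)))) (X.ls f))"

lemma fst_fo [simp]: "fst (fo a) = fst a" "fst (ftm a) = fst a"
  by (simp_all add: fo_def ftm_def)

lemma fo [simp]: "X.ctx a \<Longrightarrow> Y.ctx (fo a)" "X.ltyp a \<Longrightarrow> Y.bs (fo a) = fo (X.bs a)"
proof -
  show "X.ctx a \<Longrightarrow> Y.ctx (fo a)" by (simp add: X.ctx_def Y.ctx_def fo_def)
  show "X.ltyp a \<Longrightarrow> Y.bs (fo a) = fo (X.bs a)"
    using X.ltyp_Suc[of a] by (auto simp: X.bs_def Y.bs_def fo_def)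
qed

lemma ftm [simp]: "X.trm a \<Longrightarrow> Y.trm (ftm a)" "X.trm a \<Longrightarrow> Y.tty (ftm a) = fo (X.tty a)"
  by (simp_all add: X.trm_def Y.trm_def ftm_def fo_def X.tty_def Y.tty_def)

lemma fm [simp]: "X.cmo f \<Longrightarrow> Y.cmo (fm f)" "Y.dm (fm f) = fo (X.dm f)" "Y.cd (fm f) = fo (X.cd f)"
  using h_mor by (simp_all add: X.cmo_def Y.cmo_def fm_def fo_def)

lemma fo_pb: "X.ltyp A \<Longrightarrow> X.cmo f \<Longrightarrow> X.cd f = X.bs A \<Longrightarrow> fo (X.pb A f) = Y.pb (fo A) (fm f)"
  using X.ltyp_Suc[of A] h_SB[of "snd A" KTy "fst (X.bs A)"]
  by (auto simp: X.pb_def Y.pb_def fo_def fm_def X.cmo_def X.bs_def)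

lemma ftm_tms: "X.trm a \<Longrightarrow> X.cmo f \<Longrightarrow> X.cd f = X.bs (X.tty a) \<Longrightarrow> ftm (X.tms a f) = Y.tms (ftm a) (fm f)"
  using h_SB[of "snd a" KTm "fst a"]
  by (simp add: X.tms_def Y.tms_def ftm_def fm_def fo_def X.cmo_def X.bs_def X.tty_def X.trm_def)

lemma fm_cc:
  assumes "X.cmo f" "X.cmo g" "X.cd f = X.dm g"
  shows "fm (X.cc g f) = Y.cc (fm g) (fm f)"
proof -
  have "h (Tm (fst (X.dm f))) (X.SB KTm (fst (X.dm f)) (fst (X.cd f)) (snd (X.dm f)) a (X.ls f)) =
      Y.SB KTm (fst (X.dm f)) (fst (X.cd f)) (h (Ctx (fst (X.dm f))) (snd (X.dm f))) (h (Tm (fst (X.dm g))) a) (map (h (Tm (fst (X.dm f)))) (X.ls f))"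
    if a: "a \<in> set (X.ls g)" for a
    using ftm_tms[of "(fst (X.dm g), a)" f] X.cmo_trm[OF assms(2) a] assms
    by (simp add: X.tms_def Y.tms_def ftm_def fm_def fo_def)
  then show ?thesis
    by (simp add: X.cc_def Y.cc_def fm_def fo_def)
qed

lemma fm_cid: "X.ctx a \<Longrightarrow> fm (X.cid a) = Y.cid (fo a)"
  using h_VARS[of "snd a" "fst a" 0] by (simp add: X.cid_def Y.cid_def fm_def fo_def X.ctx_def)

lemma fm_dsp: "X.ltyp a \<Longrightarrow> fm (X.dsp a) = Y.dsp (fo a)"
  using h_VARS[of "snd a" "fst a" 1] fo(2)[of a] by (simp add: X.dsp_def Y.dsp_def fm_def fo_def[of a] X.ctx_def)

lemma lst_fm: "X.cmo f \<Longrightarrow> fst (X.cd f) \<noteq> 0 \<Longrightarrow> Y.lst (fm f) = ftm (X.lst f)"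
  using X.ls_ne[of f] by (simp add: X.lst_def Y.lst_def ftm_def fm_def last_map)

lemma fm_ex: "fst a = fst (X.dm s) \<Longrightarrow> fm (X.ex A s a) = Y.ex (fo A) (fm s) (ftm a)"
  by (simp add: X.ex_def Y.ex_def fm_def ftm_def)

lemma fm_sec: "X.trm a \<Longrightarrow> fm (X.sec a) = Y.sec (ftm a)"
  using fm_ex[of a "X.cid (X.bs (X.tty a))" "X.tty a"] fm_cid[of "X.bs (X.tty a)"]
  by (simp add: X.sec_def Y.sec_def)

lemma fo_one: "fo X.one = Y.one"
  by (simp add: fo_def X.one_def Y.one_def h_EMP)

lemma fo_intT: "X.ctx a \<Longrightarrow> fo (X.intT a) = Y.intT (fo a)"
  and ftm_leftT: "X.ctx a \<Longrightarrow> ftm (X.leftT a) = Y.leftT (fo a)"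
  and ftm_rightT: "X.ctx a \<Longrightarrow> ftm (X.rightT a) = Y.rightT (fo a)"
proof -
  assume a: "X.ctx a"
  note x = X.fn_intT[OF a] and y = Y.fn_intT[OF fo(1)[OF a]]
  show "fo (X.intT a) = Y.intT (fo a)"
    using h_fn[OF _ x(1)] y(1) by (simp add: prod_eq_iff) (simp add: fo_def)
  show "ftm (X.leftT a) = Y.leftT (fo a)"
    using h_fn[OF _ x(2)] y(2) by (simp add: prod_eq_iff X.leftT_def Y.leftT_def) (simp add: fo_def ftm_def)
  show "ftm (X.rightT a) = Y.rightT (fo a)"
    using h_fn[OF _ x(3)] y(3) by (simp add: prod_eq_iff X.rightT_def Y.rightT_def) (simp add: fo_def ftm_def)
qed

lemma fo_cyl: "X.ctx a \<Longrightarrow> fo (X.cyl a) = Y.cyl (fo a)"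
  using fo_intT[of a] by (simp add: X.intT_cyl Y.intT_cyl)

lemma fm_i0: "X.ctx a \<Longrightarrow> fm (X.i0 a) = Y.i0 (fo a)"
  and fm_i1: "X.ctx a \<Longrightarrow> fm (X.i1 a) = Y.i1 (fo a)"
  using fm_sec[of "X.leftT a"] fm_sec[of "X.rightT a"]
  by (simp_all add: ftm_leftT ftm_rightT X.sec_leftT Y.sec_leftT X.sec_rightT Y.sec_rightT)

sublocale F: path_functor X.ctx fst X.cmo X.dm X.cd X.cid X.cc X.bs X.dsp X.pb X.pq X.one X.uI X.uL X.uR
    Y.ctx fst Y.cmo Y.dm Y.cd Y.cid Y.cc Y.bs Y.dsp Y.pb Y.pq Y.one Y.uI Y.uL Y.uR fo fm
  by unfold_locales (simp_all add: fo_one fo_cyl fm_cc fm_cid fm_dsp fm_i0 fm_i1)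

text \<open>Needed for faithfulness: a path between images in \<open>N\<close> is then a term of the
  image of a type of \<open>M\<close>, to which (tm,n) applies.\<close>

lemma fo_path_ty:
  assumes a: "X.trm a" "X.tty a = A" and b: "X.trm b" "X.tty b = A"
  shows "fo (X.path_ty a b) = Y.path_ty (ftm a) (ftm b)"
proof -
  define G where "G = X.bs A"
  note P = X.path_ty_prems[OF a b G_def[symmetric]]
  have d: "fo (X.pb A (X.dsp (X.cyl G))) = Y.pb (fo A) (Y.dsp (Y.cyl (fo G)))"
    using fo_pb[of A "X.dsp (X.cyl G)"] P(1,2) fm_dsp[of "X.cyl G"] by (simp add: G_def fo_cyl)
  have G': "Y.bs (fo A) = fo G" using P(2) by (simp add: G_def)
  note x = X.path_ty(3,4)[OF a b G_def[symmetric]]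
  have ta: "Y.trm (ftm a)" "Y.tty (ftm a) = fo A" "Y.trm (ftm b)" "Y.tty (ftm b) = fo A" using a b by simp_all
  note y = Y.path_ty(3,4)[OF ta G']
  have f: "fst (X.pb A (X.dsp (X.cyl G))) = Suc (Suc (fst G))" using P(1) X.intT(2)[of G] by (simp add: X.intT_cyl)
  have "snd (fo (X.path_ty a b)) = snd (Y.path_ty (ftm a) (ftm b))"
    using h_fn[OF _ x(2)] y(2) x(1) P(3,4) f unfolding d[symmetric]
    by (simp add: fo_def ftm_def numeral_2_eq_2)
  then show ?thesis using x(1) y(1) by (simp add: prod_eq_iff)
qed

lemma weak_equiv_tm_iff:
  "weak_equiv_tm M N h n \<longleftrightarrow> (\<forall>A \<in> car M (Ty n). \<forall>a \<in> car N (Tm n). Y.TY n a = h (Ty n) A \<longrightarrow>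
     (\<exists>a' \<in> car M (Tm n). X.TY n a' = A \<and> (h (Tm n) a', a) \<in> homotopic N n))"
proof -
  have "holds N [h (Ty n) A, a] [Eq (ty n (Tvar 1)) (Tvar 0)] \<longleftrightarrow> Y.TY n a = h (Ty n) A" if "a \<in> car N (Tm n)" for A a
    using that by simp
  moreover have "(\<exists>t \<in> car N (Tm (Suc n)). holds M [A, a'] [Eq (ty n (Tvar 1)) (Tvar 0)] \<and>
        holds N [h (Ty n) A, h (Tm n) a', a, t]
             (let A = Tvar 0; a' = Tvar 1; a = Tvar 2; h = Tvar 3; \<Gamma> = ft n A
              in [is_map n (intv n \<Gamma>) A h,
                  Eq (inst n KTm \<Gamma> h (lft n \<Gamma>)) a',
                  Eq (inst n KTm \<Gamma> h (rgt n \<Gamma>)) a])) \<longleftrightarrow>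
      X.TY n a' = A \<and> (h (Tm n) a', a) \<in> homotopic N n"
    if A: "A \<in> car M (Ty n)" and a: "a \<in> car N (Tm n)" "Y.TY n a = h (Ty n) A" and a': "a' \<in> car M (Tm n)" for A a a'
  proof (cases "X.TY n a' = A")
    case True
    have "Y.trm (n, h (Tm n) a')" "Y.tty (n, h (Tm n) a') = (Suc n, h (Ty n) A)" "Y.trm (n, a)" "Y.tty (n, a) = (Suc n, h (Ty n) A)"
      using a a' True by (simp_all add: Y.trm_def Y.tty_def)
    note H = Y.holds_homotopy[OF this, unfolded snd_conv]
    have "holds M [A, a'] [Eq (ty n (Tvar 1)) (Tvar 0)]" using a' True by simp
    then show ?thesis using H True by blast
  next
    case False
    then have "\<not> holds M [A, a'] [Eq (ty n (Tvar 1)) (Tvar 0)]" using a' by simp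
    then show ?thesis using False by blast
  qed
  ultimately show ?thesis
    unfolding weak_equiv_tm_def by (simp only: cong: ball_cong bex_cong imp_cong)
qed

lemma weak_equiv_ty_iff:
  "weak_equiv_ty M N h n \<longleftrightarrow> (\<forall>G B. X.ctx G \<and> fst G = n \<and> Y.ltyp B \<and> Y.bs B = fo G \<longrightarrow>
     (\<exists>A. X.ltyp A \<and> X.bs A = G \<and> (\<exists>f g g'. Y.hom f (fo A) B \<and> Y.cc (Y.dsp B) f = Y.dsp (fo A) \<and>
       Y.hom g B (fo A) \<and> Y.cc (Y.dsp (fo A)) g = Y.dsp B \<and> Y.hom g' B (fo A) \<and> Y.cc (Y.dsp (fo A)) g' = Y.dsp B \<and>
       Y.fh (fo A) (Y.cc g f) (Y.cid (fo A)) \<and> Y.fh B (Y.cc f g') (Y.cid B))))"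
  (is "_ \<longleftrightarrow> (\<forall>G B. _ \<longrightarrow> (\<exists>A. _ \<and> _ \<and> ?E A B))")
proof -
  let ?\<Phi> = "\<lambda>A B. \<exists>b \<in> car N (Tm (Suc n)). \<exists>a\<^sub>1 \<in> car N (Tm (Suc n)). \<exists>p \<in> car N (Tm (Suc n)).
         \<exists>a\<^sub>2 \<in> car N (Tm (Suc n)). \<exists>q \<in> car N (Tm (Suc n)).
           holds N [h (Ty n) A, B, b, a\<^sub>1, p, a\<^sub>2, q]
             (let A = Tvar 0; B = Tvar 1; b = Tvar 2; a\<^sub>1 = Tvar 3; p = Tvar 4; a\<^sub>2 = Tvar 5; q = Tvar 6
              in [is_map n A B b,
                  is_map n B A a\<^sub>1, is_retr n A a\<^sub>1 b p,
                  is_map n B A a\<^sub>2, is_retr n B b a\<^sub>2 q])"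
  have e: "?\<Phi> A B \<longleftrightarrow> ?E (Suc n, A) (Suc n, B)"
    if "A \<in> car M (Ty n)" "X.FT n A = G" "B \<in> car N (Ty n)" "Y.FT n B = h (Ctx n) G" for A B G
  proof -
    have "Y.ltyp (fo (Suc n, A))" "Y.bs (fo (Suc n, A)) = fo (n, G)" "Y.ltyp (Suc n, B)" "Y.bs (Suc n, B) = fo (n, G)"
      "n = fst (fo (n, G))"
      using that by (auto simp: Y.ctx_def Y.bs_def fo_def)
    from Y.holds_fibrewise_equiv[OF this] show ?thesis by (simp only: fo_def fst_conv snd_conv)
  qed
  have "weak_equiv_ty M N h n \<longleftrightarrow> (\<forall>G \<in> car M (Ctx n). \<forall>B \<in> car N (Ty n). Y.FT n B = h (Ctx n) G \<longrightarrow>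
      (\<exists>A \<in> car M (Ty n). X.FT n A = G \<and> ?\<Phi> A B))"
  proof -
    have "holds N [h (Ctx n) G, B] [Eq (ft n (Tvar 1)) (Tvar 0)] \<longleftrightarrow> Y.FT n B = h (Ctx n) G" if "B \<in> car N (Ty n)" for G B
      using that by simp
    moreover have "holds M [G, A] [Eq (ft n (Tvar 1)) (Tvar 0)] \<longleftrightarrow> X.FT n A = G" if "A \<in> car M (Ty n)" for G A
      using that by simp
    ultimately show ?thesis
      unfolding weak_equiv_ty_def by (simp only: cong: ball_cong bex_cong) blast
  qed
  also have "\<dots> \<longleftrightarrow> (\<forall>G \<in> car M (Ctx n). \<forall>B \<in> car N (Ty n). Y.FT n B = h (Ctx n) G \<longrightarrow>
      (\<exists>A \<in> car M (Ty n). X.FT n A = G \<and> ?E (Suc n, A) (Suc n, B)))"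
    by (intro ball_cong imp_cong bex_cong conj_cong refl) (rule e)
  also have "\<dots> \<longleftrightarrow> (\<forall>G B. X.ctx G \<and> fst G = n \<and> Y.ltyp B \<and> Y.bs B = fo G \<longrightarrow>
     (\<exists>A. X.ltyp A \<and> X.bs A = G \<and> ?E A B))"
  proof (intro iffI allI impI ballI)
    fix G B assume L: "\<forall>G \<in> car M (Ctx n). \<forall>B \<in> car N (Ty n). Y.FT n B = h (Ctx n) G \<longrightarrow>
      (\<exists>A \<in> car M (Ty n). X.FT n A = G \<and> ?E (Suc n, A) (Suc n, B))"
      and GB: "X.ctx G \<and> fst G = n \<and> Y.ltyp B \<and> Y.bs B = fo G"
    obtain m B' where B: "B = (Suc m, B')" "B' \<in> car N (Ty m)" using GB Y.ltyp_Suc by blast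
    have m: "m = n" "snd G \<in> car M (Ctx n)" "Y.FT n B' = h (Ctx n) (snd G)"
      using GB B by (auto simp: Y.bs_def fo_def X.ctx_def)
    then obtain A where A: "A \<in> car M (Ty n)" "X.FT n A = snd G" "?E (Suc n, A) (Suc n, B')"
      using L B by blast
    have "X.ltyp (Suc n, A)" "X.bs (Suc n, A) = G"
      using A(1,2) GB by (auto simp: X.ctx_def X.bs_def)
    then show "\<exists>A. X.ltyp A \<and> X.bs A = G \<and> ?E A B" using A(3) B(1) m(1) by blast
  next
    fix G B assume R: "\<forall>G B. X.ctx G \<and> fst G = n \<and> Y.ltyp B \<and> Y.bs B = fo G \<longrightarrow> (\<exists>A. X.ltyp A \<and> X.bs A = G \<and> ?E A B)"
      and GB: "G \<in> car M (Ctx n)" "B \<in> car N (Ty n)" "Y.FT n B = h (Ctx n) G"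
    have "X.ctx (n, G) \<and> fst (n, G) = n \<and> Y.ltyp (Suc n, B) \<and> Y.bs (Suc n, B) = fo (n, G)"
      using GB by (simp add: X.ctx_def Y.ctx_def Y.bs_def fo_def)
    then obtain A where A: "X.ltyp A" "X.bs A = (n, G)" "?E A (Suc n, B)" using R by blast
    obtain m A' where A': "A = (Suc m, A')" "A' \<in> car M (Ty m)" using A X.ltyp_Suc by blast
    have "m = n" "X.FT n A' = G" using A(2) A'(1) by (auto simp: X.bs_def)
    then show "\<exists>A \<in> car M (Ty n). X.FT n A = G \<and> ?E (Suc n, A) (Suc n, B)" using A A' by blast
  qed
  finally show ?thesis .
qed


subsection \<open>The functor on homotopy categories\<close>

lemma fo_cty: "fo (X.cty A) = Y.cty (h (Ty 0) A)"
  by (simp add: fo_def)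

lemma fm_hom: "X.hom f (X.cty A) (X.cty B) \<Longrightarrow> Y.hom (fm f) (Y.cty (h (Ty 0) A)) (Y.cty (h (Ty 0) B))"
  by (simp add: fo_cty)

lemma mp_Ho_map:
  assumes f: "X.hom f (X.cty A) (X.cty B)"
  shows "mp (Ho_map N h) A B (X.cls f) = Y.cls (fm f)"
proof -
  have l: "snd (Y.lst (fm g)) = h (Tm 1) (snd (X.lst g))" if "X.hom g (X.cty A) (X.cty B)" for g
    using lst_fm[of g] that by (simp add: ftm_def)
  have "homotopic N 1 `` {h (Tm 1) b} = Y.cls (fm f)" if b: "b \<in> X.cls f" for b
  proof -
    obtain g where g: "X.hom g (X.cty A) (X.cty B)" "X.hm f g" "snd (X.lst g) = b"
      using X.cls_mem[OF f] b by blast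
    have "Y.cls (fm f) = Y.cls (fm g)"
      using Y.cls_eq[OF fm_hom[OF f] fm_hom[OF g(1)]] F.fm_hm[OF g(2)] by blast
    then show ?thesis using l[OF g(1)] g(3) by (simp add: Y.cls_def)
  qed
  moreover have "snd (X.lst f) \<in> X.cls f" using X.cls_mem[OF f] X.hm_refl f by blast
  ultimately have "homotopic N 1 `` (h (Tm 1) ` X.cls f) = Y.cls (fm f)" by blast
  then show ?thesis by (simp add: Ho_map_def)
qed

lemma ob_Ho_map: "ob (Ho_map N h) A = h (Ty 0) A"
  by (simp add: Ho_map_def)

lemma is_functor_Ho_map: "is_functor (Ho M) (Ho N) (Ho_map N h)"
  unfolding is_functor_def
proof (intro conjI ballI)
  fix A assume "A \<in> Obj (Ho M)"
  then have A: "A \<in> car M (Ty 0)" by (simp add: X.Obj_Ho)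
  then show "ob (Ho_map N h) A \<in> Obj (Ho N)" by (simp add: Y.Obj_Ho ob_Ho_map)
  show "mp (Ho_map N h) A A (Idn (Ho M) A) = Idn (Ho N) (ob (Ho_map N h) A)"
    using A mp_Ho_map[of "X.cid (X.cty A)" A A] fm_cid[of "X.cty A"]
    by (simp add: X.Idn_Ho Y.Idn_Ho ob_Ho_map fo_cty)
next
  fix A B \<beta> assume "A \<in> Obj (Ho M)" "B \<in> Obj (Ho M)" "\<beta> \<in> Hom (Ho M) A B"
  then obtain f where "A \<in> car M (Ty 0)" "B \<in> car M (Ty 0)" "X.hom f (X.cty A) (X.cty B)" "\<beta> = X.cls f"
    by (auto simp: X.Obj_Ho X.Hom_Ho)
  then show "mp (Ho_map N h) A B \<beta> \<in> Hom (Ho N) (ob (Ho_map N h) A) (ob (Ho_map N h) B)"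
    using mp_Ho_map fm_hom by (auto simp: Y.Hom_Ho ob_Ho_map)
next
  fix A B C \<beta> \<gamma> assume "A \<in> Obj (Ho M)" "B \<in> Obj (Ho M)" "C \<in> Obj (Ho M)" "\<beta> \<in> Hom (Ho M) A B" "\<gamma> \<in> Hom (Ho M) B C"
  then obtain f g where fg: "X.hom f (X.cty A) (X.cty B)" "\<beta> = X.cls f" "X.hom g (X.cty B) (X.cty C)" "\<gamma> = X.cls g"
    by (auto simp: X.Obj_Ho X.Hom_Ho)
  then have "X.hom (X.cc g f) (X.cty A) (X.cty C)" by simp
  then show "mp (Ho_map N h) A C (Comp (Ho M) A B C \<gamma> \<beta>) =
      Comp (Ho N) (ob (Ho_map N h) A) (ob (Ho_map N h) B) (ob (Ho_map N h) C) (mp (Ho_map N h) B C \<gamma>) (mp (Ho_map N h) A B \<beta>)"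
    using fg mp_Ho_map Y.Comp_Ho[OF fm_hom[OF fg(1)] fm_hom[OF fg(3)]] X.Comp_Ho[OF fg(1,3)] fm_cc[of f g]
    by (simp add: ob_Ho_map)
qed (rule X.is_cat_Ho Y.is_cat_Ho)+

section \<open>Fullness, faithfulness and essential surjectivity up to homotopy\<close>

definition full :: bool where
  "full \<longleftrightarrow> (\<forall>A \<in> car M (Ty 0). \<forall>B \<in> car M (Ty 0). \<forall>f. Y.hom f (fo (X.cty A)) (fo (X.cty B)) \<longrightarrow>
     (\<exists>g. X.hom g (X.cty A) (X.cty B) \<and> Y.hm (fm g) f))"

definition faithful :: bool where
  "faithful \<longleftrightarrow> (\<forall>A B g g'. X.hom g (X.cty A) (X.cty B) \<and> X.hom g' (X.cty A) (X.cty B) \<and> Y.hm (fm g) (fm g') \<longrightarrow>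
     X.hm g g')"

definition esurj :: bool where
  "esurj \<longleftrightarrow> (\<forall>B \<in> car N (Ty 0). \<exists>A \<in> car M (Ty 0). \<exists>w w'. Y.hom w (fo (X.cty A)) (Y.cty B) \<and>
     Y.hom w' (Y.cty B) (fo (X.cty A)) \<and> Y.hm (Y.cc w w') (Y.cid (Y.cty B)) \<and> Y.hm (Y.cc w' w) (Y.cid (fo (X.cty A))))"

lemma fully_faithful_iff: "fully_faithful (Ho M) (Ho N) (Ho_map N h) \<longleftrightarrow> full \<and> faithful"
proof
  assume ff: "fully_faithful (Ho M) (Ho N) (Ho_map N h)"
  then have ff: "inj_on (mp (Ho_map N h) A B) (X.cls ` {f. X.hom f (X.cty A) (X.cty B)})"
    "mp (Ho_map N h) A B ` X.cls ` {f. X.hom f (X.cty A) (X.cty B)} = Y.cls ` {f. Y.hom f (fo (X.cty A)) (fo (X.cty B))}"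
    if "A \<in> car M (Ty 0)" "B \<in> car M (Ty 0)" for A B
    using that by (simp_all add: fully_faithful_def bij_betw_def X.Obj_Ho X.Hom_Ho Y.Hom_Ho ob_Ho_map fo_cty)
  show "full \<and> faithful"
  proof (rule conjI)
    show full
      unfolding full_def
    proof (intro ballI allI impI)
      fix A B f assume AB: "A \<in> car M (Ty 0)" "B \<in> car M (Ty 0)" and f: "Y.hom f (fo (X.cty A)) (fo (X.cty B))"
      have "Y.cls f \<in> mp (Ho_map N h) A B ` X.cls ` {f. X.hom f (X.cty A) (X.cty B)}"
        unfolding ff(2)[OF AB] using f by blast
      then obtain g where g: "X.hom g (X.cty A) (X.cty B)" "Y.cls f = mp (Ho_map N h) A B (X.cls g)"
        by (elim imageE CollectE) blast
      have "Y.cls (fm g) = Y.cls f" using mp_Ho_map[OF g(1)] g(2) by (simp only:)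
      then show "\<exists>g. X.hom g (X.cty A) (X.cty B) \<and> Y.hm (fm g) f"
        using Y.cls_eq[OF fm_hom[OF g(1)] f[unfolded fo_cty]] g(1) by blast
    qed
    show faithful
      unfolding faithful_def
    proof (intro allI impI)
      fix A B g g' assume g: "X.hom g (X.cty A) (X.cty B) \<and> X.hom g' (X.cty A) (X.cty B) \<and> Y.hm (fm g) (fm g')"
      then have hg: "X.hom g (X.cty A) (X.cty B)" "X.hom g' (X.cty A) (X.cty B)" and hm: "Y.hm (fm g) (fm g')" by blast+
      have AB: "A \<in> car M (Ty 0)" "B \<in> car M (Ty 0)" using hg(1) X.cmo_ctx X.cty(1) by metis+
      have "Y.cls (fm g) = Y.cls (fm g')" using Y.cls_eq[OF fm_hom[OF hg(1)] fm_hom[OF hg(2)]] hm by blast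
      then have "mp (Ho_map N h) A B (X.cls g) = mp (Ho_map N h) A B (X.cls g')"
        unfolding mp_Ho_map[OF hg(1)] mp_Ho_map[OF hg(2)] .
      then have "X.cls g = X.cls g'" using ff(1)[OF AB] hg by (intro inj_onD[OF ff(1)[OF AB]]) blast+
      then show "X.hm g g'" using X.cls_eq[OF hg] by blast
    qed
  qed
next
  assume ff: "full \<and> faithful"
  show "fully_faithful (Ho M) (Ho N) (Ho_map N h)"
    unfolding fully_faithful_def X.Obj_Ho
  proof (intro ballI)
    fix A B assume AB: "A \<in> car M (Ty 0)" "B \<in> car M (Ty 0)"
    have "inj_on (mp (Ho_map N h) A B) (X.cls ` {f. X.hom f (X.cty A) (X.cty B)})"
    proof (rule inj_onI)
      fix \<beta> \<beta>' assume b: "\<beta> \<in> X.cls ` {f. X.hom f (X.cty A) (X.cty B)}" "\<beta>' \<in> X.cls ` {f. X.hom f (X.cty A) (X.cty B)}"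
        and e: "mp (Ho_map N h) A B \<beta> = mp (Ho_map N h) A B \<beta>'"
      obtain f f' where f: "X.hom f (X.cty A) (X.cty B)" "\<beta> = X.cls f" and f': "X.hom f' (X.cty A) (X.cty B)" "\<beta>' = X.cls f'"
        using b by blast
      have "Y.cls (fm f) = Y.cls (fm f')" using e unfolding f(2) f'(2) mp_Ho_map[OF f(1)] mp_Ho_map[OF f'(1)] .
      then have "Y.hm (fm f) (fm f')" using Y.cls_eq[OF fm_hom[OF f(1)] fm_hom[OF f'(1)]] by blast
      then have "X.hm f f'" using ff f(1) f'(1) unfolding faithful_def by blast
      then show "\<beta> = \<beta>'" unfolding f(2) f'(2) using X.cls_eq[OF f(1) f'(1)] by blast
    qed
    moreover have "mp (Ho_map N h) A B ` X.cls ` {f. X.hom f (X.cty A) (X.cty B)} = Y.cls ` {f. Y.hom f (fo (X.cty A)) (fo (X.cty B))}"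
    proof (intro equalityI subsetI)
      fix \<beta> assume "\<beta> \<in> mp (Ho_map N h) A B ` X.cls ` {f. X.hom f (X.cty A) (X.cty B)}"
      then obtain g where g: "X.hom g (X.cty A) (X.cty B)" "\<beta> = mp (Ho_map N h) A B (X.cls g)"
        by (elim imageE CollectE) blast
      then show "\<beta> \<in> Y.cls ` {f. Y.hom f (fo (X.cty A)) (fo (X.cty B))}"
        using mp_Ho_map[OF g(1)] fm_hom[OF g(1)] unfolding fo_cty by blast
    next
      fix \<beta> assume "\<beta> \<in> Y.cls ` {f. Y.hom f (fo (X.cty A)) (fo (X.cty B))}"
      then obtain f where f: "Y.hom f (fo (X.cty A)) (fo (X.cty B))" "\<beta> = Y.cls f" by blast
      obtain g where g: "X.hom g (X.cty A) (X.cty B)" "Y.hm (fm g) f" using ff AB f(1) unfolding full_def by blast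
      have "\<beta> = mp (Ho_map N h) A B (X.cls g)"
        using Y.cls_eq[OF fm_hom[OF g(1)] f(1)[unfolded fo_cty]] g(2) f(2) mp_Ho_map[OF g(1)] by metis
      then show "\<beta> \<in> mp (Ho_map N h) A B ` X.cls ` {f. X.hom f (X.cty A) (X.cty B)}" using g(1) by blast
    qed
    ultimately show "bij_betw (mp (Ho_map N h) A B) (Hom (Ho M) A B) (Hom (Ho N) (ob (Ho_map N h) A) (ob (Ho_map N h) B))"
      using AB by (simp add: bij_betw_def X.Hom_Ho Y.Hom_Ho ob_Ho_map fo_cty)
  qed
qed

lemma is_iso_Ho:
  assumes A: "A \<in> car N (Ty 0)" and B: "B \<in> car N (Ty 0)"
  shows "(\<exists>w. is_iso (Ho N) A B w) \<longleftrightarrow> (\<exists>w w'. Y.hom w (Y.cty A) (Y.cty B) \<and> Y.hom w' (Y.cty B) (Y.cty A) \<and>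
     Y.hm (Y.cc w w') (Y.cid (Y.cty B)) \<and> Y.hm (Y.cc w' w) (Y.cid (Y.cty A)))"
proof -
  have e: "Comp (Ho N) A B A (Y.cls w') (Y.cls w) = Idn (Ho N) A \<longleftrightarrow> Y.hm (Y.cc w' w) (Y.cid (Y.cty A))"
    "Comp (Ho N) B A B (Y.cls w) (Y.cls w') = Idn (Ho N) B \<longleftrightarrow> Y.hm (Y.cc w w') (Y.cid (Y.cty B))"
    if w: "Y.hom w (Y.cty A) (Y.cty B)" "Y.hom w' (Y.cty B) (Y.cty A)" for w w'
  proof -
    have h: "Y.hom (Y.cc w' w) (Y.cty A) (Y.cty A)" "Y.hom (Y.cid (Y.cty A)) (Y.cty A) (Y.cty A)"
      "Y.hom (Y.cc w w') (Y.cty B) (Y.cty B)" "Y.hom (Y.cid (Y.cty B)) (Y.cty B) (Y.cty B)"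
      using w A B by simp_all
    show "Comp (Ho N) A B A (Y.cls w') (Y.cls w) = Idn (Ho N) A \<longleftrightarrow> Y.hm (Y.cc w' w) (Y.cid (Y.cty A))"
      unfolding Y.Comp_Ho[OF w] Y.Idn_Ho[OF A] by (rule Y.cls_eq[OF h(1,2)])
    show "Comp (Ho N) B A B (Y.cls w) (Y.cls w') = Idn (Ho N) B \<longleftrightarrow> Y.hm (Y.cc w w') (Y.cid (Y.cty B))"
      unfolding Y.Comp_Ho[OF w(2,1)] Y.Idn_Ho[OF B] by (rule Y.cls_eq[OF h(3,4)])
  qed
  have "(\<exists>w. is_iso (Ho N) A B w) \<longleftrightarrow> (\<exists>w w'. Y.hom w (Y.cty A) (Y.cty B) \<and> Y.hom w' (Y.cty B) (Y.cty A) \<and>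
      Comp (Ho N) A B A (Y.cls w') (Y.cls w) = Idn (Ho N) A \<and> Comp (Ho N) B A B (Y.cls w) (Y.cls w') = Idn (Ho N) B)"
    unfolding is_iso_def Y.Hom_Ho[OF A B] Y.Hom_Ho[OF B A] by blast
  then show ?thesis using e by blast
qed

lemma ess_surj_iff: "ess_surj (Ho M) (Ho N) (Ho_map N h) \<longleftrightarrow> esurj"
  unfolding ess_surj_def esurj_def X.Obj_Ho Y.Obj_Ho ob_Ho_map fo_cty
  by (intro ball_cong bex_cong refl is_iso_Ho h_car)

text \<open>The last term of \<open>f\<close> has the type \<open>B\<close> weakened to the context
  \<open>A\<close>, which is the image of the type \<open>D\<close> of \<open>M\<close>; so (tm,1)
  provides a homotopic term in the image.\<close>

theorem weak_equivalence_full: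
  assumes w: "weak_equivalence M N h"
  shows full
  unfolding full_def
proof (intro ballI allI impI)
  fix A B f assume AB: "A \<in> car M (Ty 0)" "B \<in> car M (Ty 0)" and f: "Y.hom f (fo (X.cty A)) (fo (X.cty B))"
  have B: "X.ltyp (X.cty B)" "Y.ltyp (fo (X.cty B))" "Y.bs (fo (X.cty B)) = Y.one" using AB by (simp_all add: fo_one)
  define D where "D = X.pb (X.cty B) (X.dsp (X.cty A))"
  have D: "X.ctx D" "fst D = Suc 1" using AB by (simp_all add: D_def)
  have fD: "fo D = Y.pb (fo (X.cty B)) (Y.dsp (fo (X.cty A)))"
    unfolding D_def using fo_pb[of "X.cty B" "X.dsp (X.cty A)"] fm_dsp[of "X.cty A"] AB by simp
  have cf: "Y.cmo f" "Y.cd f = fo (X.cty B)" "Y.ltyp (Y.cd f)" using f B by simp_all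
  have df: "Y.cc (Y.dsp (fo (X.cty B))) f = Y.dsp (fo (X.cty A))" using f B AB by simp
  have l: "Y.trm (Y.lst f)" "Y.tty (Y.lst f) = fo D"
    using Y.lst(1)[OF cf(1,3,2)] Y.lst(2)[OF cf(1,3,2)] unfolding fD df by blast+
  have fl: "fst (Y.lst f) = 1" using f by simp
  have "weak_equiv_tm M N h 1" using w by (simp add: weak_equivalence_def)
  moreover have "snd D \<in> car M (Ty 1)" using D by (simp add: X.ctx_def)
  moreover have "snd (Y.lst f) \<in> car N (Tm 1)" using l(1) fl unfolding Y.trm_def by metis
  moreover have "Y.TY 1 (snd (Y.lst f)) = h (Ty 1) (snd D)"
    using l(2) fl D(2) unfolding Y.tty_def fo_def by (metis snd_conv One_nat_def)
  ultimately obtain b where b: "b \<in> car M (Tm 1)" "X.TY 1 b = snd D" "(h (Tm 1) b, snd (Y.lst f)) \<in> homotopic N 1"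
    unfolding weak_equiv_tm_iff by blast
  have "X.trm (1, b)" "X.tty (1, b) = X.pb (X.cty B) (X.dsp (X.cty A))"
    using b D by (simp_all add: X.trm_def X.tty_def D_def prod_eq_iff)
  then obtain g where g: "X.hom g (X.cty A) (X.cty B)" "snd (X.lst g) = b" using X.cty_arrow[OF AB] by blast
  have "snd (Y.lst (fm g)) = h (Tm 1) b" using lst_fm[of g] g by (simp add: ftm_def)
  then have "Y.cls (fm g) = Y.cls f"
    unfolding Y.cls_def using Y.homotopic_class_eq[OF h_car[OF b(1)]] b(3) by simp
  then have "Y.hm (fm g) f" using Y.cls_eq[OF fm_hom[OF g(1)] f[unfolded fo_cty]] by blast
  then show "\<exists>g. X.hom g (X.cty A) (X.cty B) \<and> Y.hm (fm g) f" using g(1) by blast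
qed

text \<open>A homotopy between the images is a term of the image of the path type \<open>?P\<close>.
  Condition (tm,1) for \<open>?P\<close> yields a term of \<open>?P\<close> in \<open>M\<close>, and
  its mere existence is a homotopy between \<open>g\<close> and \<open>g'\<close>.\<close>

theorem weak_equivalence_faithful:
  assumes w: "weak_equivalence M N h"
  shows faithful
  unfolding faithful_def
proof (intro allI impI)
  fix A B g g' assume "X.hom g (X.cty A) (X.cty B) \<and> X.hom g' (X.cty A) (X.cty B) \<and> Y.hm (fm g) (fm g')"
  then have g: "X.hom g (X.cty A) (X.cty B)" and g': "X.hom g' (X.cty A) (X.cty B)" and hm: "Y.hm (fm g) (fm g')" by blast+
  have AB: "A \<in> car M (Ty 0)" "B \<in> car M (Ty 0)" using g X.cmo_ctx X.cty(1) by metis+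
  have l: "X.trm (X.lst k)" "X.tty (X.lst k) = X.pb (X.cty B) (X.dsp (X.cty A))" "X.lst k = (1, snd (X.lst k))"
      "ftm (X.lst k) = (1, snd (Y.lst (fm k)))"
    if k: "X.hom k (X.cty A) (X.cty B)" for k
  proof -
    have c: "X.cmo k" "X.ltyp (X.cd k)" "X.cd k = X.cty B" using k AB by simp_all
    have d: "X.cc (X.dsp (X.cty B)) k = X.dsp (X.cty A)" using k AB by simp
    show "X.trm (X.lst k)" "X.tty (X.lst k) = X.pb (X.cty B) (X.dsp (X.cty A))"
      using X.lst(1)[OF c] X.lst(2)[OF c] unfolding d by blast+
    show "X.lst k = (1, snd (X.lst k))" using k by (simp add: prod_eq_iff[of "X.lst k"])
    show "ftm (X.lst k) = (1, snd (Y.lst (fm k)))" using lst_fm[of k] k by (simp add: ftm_def)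
  qed
  let ?P = "X.path_ty (X.lst g) (X.lst g')"
  note P = X.path_ty[OF l(1,2)[OF g] l(1,2)[OF g'] refl]
  have fP: "fo ?P = Y.path_ty (1, snd (Y.lst (fm g))) (1, snd (Y.lst (fm g')))"
    using fo_path_ty[OF l(1,2)[OF g] l(1,2)[OF g']] unfolding l(4)[OF g] l(4)[OF g'] .
  have f1: "fst ?P = Suc 1" using P(3) g by simp
  have "Y.cls (fm g) = Y.cls (fm g')" using Y.cls_eq[OF fm_hom[OF g] fm_hom[OF g']] hm by blast
  moreover have "snd (Y.lst (fm g)) \<in> car N (Tm 1)"
    using ftm(1)[OF l(1)[OF g]] unfolding l(4)[OF g] by (simp add: Y.trm_def)
  ultimately have "(snd (Y.lst (fm g)), snd (Y.lst (fm g'))) \<in> homotopic N 1"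
    unfolding Y.cls_def using Y.homotopic_class_eq by blast
  then obtain p where p: "Y.trm p" "Y.tty p = fo ?P"
    unfolding fP Y.homotopic_iff by blast
  have fp: "fst p = 1" using arg_cong[OF p(2), of fst] f1 by (simp add: Y.tty_def)
  have "weak_equiv_tm M N h 1" using w by (simp add: weak_equivalence_def)
  moreover have "snd ?P \<in> car M (Ty 1)" using P(1) f1 unfolding X.ctx_def by metis
  moreover have "snd p \<in> car N (Tm 1)" using p(1) fp unfolding Y.trm_def by metis
  moreover have "Y.TY 1 (snd p) = h (Ty 1) (snd ?P)"
    using p(2) fp f1 unfolding Y.tty_def fo_def by (metis snd_conv)
  ultimately obtain q where q: "q \<in> car M (Tm 1)" "X.TY 1 q = snd ?P"
    unfolding weak_equiv_tm_iff by blast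
  have "X.trm (1, q)" "X.tty (1, q) = ?P" using q f1 by (simp_all add: X.trm_def X.tty_def prod_eq_iff)
  then have "(snd (X.lst g), snd (X.lst g')) \<in> homotopic M 1"
    unfolding X.homotopic_iff l(3)[OF g, symmetric] l(3)[OF g', symmetric] using l(1,2)[OF g] l(1,2)[OF g'] by simp blast
  moreover have "snd (X.lst g) \<in> car M (Tm 1)" using l(1,3)[OF g] X.trm_carrier by metis
  ultimately have "X.cls g = X.cls g'" unfolding X.cls_def using X.homotopic_class_eq by blast
  then show "X.hm g g'" using X.cls_eq[OF g g'] by blast
qed

theorem weak_equivalence_esurj:
  assumes w: "weak_equivalence M N h"
  shows esurj
  unfolding esurj_def
proof
  fix B assume B: "B \<in> car N (Ty 0)"
  have "weak_equiv_ty M N h 0" using w by (simp add: weak_equivalence_def)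
  moreover have "X.ctx X.one \<and> fst X.one = 0 \<and> Y.ltyp (Y.cty B) \<and> Y.bs (Y.cty B) = fo X.one"
    using B by (simp add: fo_one)
  ultimately obtain a f g g' where a: "X.ltyp a" "X.bs a = X.one"
    and f: "Y.hom f (fo a) (Y.cty B)" and g: "Y.hom g (Y.cty B) (fo a)" and g': "Y.hom g' (Y.cty B) (fo a)"
    and h: "Y.fh (fo a) (Y.cc g f) (Y.cid (fo a))" "Y.fh (Y.cty B) (Y.cc f g') (Y.cid (Y.cty B))"
    unfolding weak_equiv_ty_iff by blast
  obtain A where A: "a = X.cty A" "A \<in> car M (Ty 0)" using X.closed_cty a by blast
  have h: "Y.hm (Y.cc g f) (Y.cid (fo a))" "Y.hm (Y.cc f g') (Y.cid (Y.cty B))"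
    using h Y.fh_hm[of "fo a"] Y.fh_hm[of "Y.cty B"] a B by simp_all
  \<comment> \<open>Condition (ty,0) gives a left inverse \<open>g\<close> and a right inverse
    \<open>g'\<close> of \<open>f\<close>. Both are homotopic to \<open>g\<close> after
    \<open>f\<close> after \<open>g'\<close>, so \<open>g\<close> is inverse to \<open>f\<close> on
    both sides.\<close>
  have "Y.hm g (Y.cc g (Y.cc f g'))"
    using Y.hm_sym[OF Y.hm_post[OF h(2), of g]] f g g' B by simp
  moreover have "Y.hm (Y.cc g (Y.cc f g')) g'"
    using Y.hm_pre[OF h(1), of g'] f g g' by simp
  ultimately have "Y.hm g g'" by (rule Y.hm_trans)
  then have "Y.hm (Y.cc f g) (Y.cc f g')" by (rule Y.hm_post) (use f g in simp_all)
  then have "Y.hm (Y.cc f g) (Y.cid (Y.cty B))" using h(2) by (rule Y.hm_trans)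
  then show "\<exists>A \<in> car M (Ty 0). \<exists>w w'. Y.hom w (fo (X.cty A)) (Y.cty B) \<and>
     Y.hom w' (Y.cty B) (fo (X.cty A)) \<and> Y.hm (Y.cc w w') (Y.cid (Y.cty B)) \<and> Y.hm (Y.cc w' w) (Y.cid (fo (X.cty A)))"
    using f g h(1) A by (intro bexI[of _ A] exI[of _ f] exI[of _ g]) simp_all
qed

theorem equivalence_weak:
  assumes full faithful esurj
  shows "weak_equivalence M N h"
proof -
  have full: "\<exists>g. X.hom g a b \<and> Y.hm (fm g) f"
    if "X.ltyp a" "X.bs a = X.one" "X.ltyp b" "X.bs b = X.one" "Y.hom f (fo a) (fo b)" for a b f
    using X.closed_cty[OF that(1,2)] X.closed_cty[OF that(3,4)] \<open>full\<close> that(5) unfolding full_def by blast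
  have faithful: "X.hm g g'"
    if "X.ltyp a" "X.bs a = X.one" "X.ltyp b" "X.bs b = X.one" "X.hom g a b" "X.hom g' a b" "Y.hm (fm g) (fm g')" for a b g g'
  proof -
    note ab = X.closed_cty[OF that(1,2)] X.closed_cty[OF that(3,4)]
    obtain A B where "a = X.cty A" "b = X.cty B" using ab by blast
    then have "X.hom g (X.cty A) (X.cty B)" "X.hom g' (X.cty A) (X.cty B)" using that(5,6) by simp_all
    then show ?thesis using \<open>faithful\<close> that(7) unfolding faithful_def by blast
  qed
  have esurj: "\<exists>a w w'. X.ltyp a \<and> X.bs a = X.one \<and> Y.hom w (fo a) b \<and> Y.hom w' b (fo a) \<and>
      Y.hm (Y.cc w w') (Y.cid b) \<and> Y.hm (Y.cc w' w) (Y.cid (fo a))"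
    if b: "Y.ltyp b" "Y.bs b = Y.one" for b
  proof -
    obtain B where B: "b = Y.cty B" "B \<in> car N (Ty 0)" using Y.closed_cty[OF b] by blast
    then obtain A w w' where A: "A \<in> car M (Ty 0)" "Y.hom w (fo (X.cty A)) b" "Y.hom w' b (fo (X.cty A))"
      "Y.hm (Y.cc w w') (Y.cid b)" "Y.hm (Y.cc w' w) (Y.cid (fo (X.cty A)))"
      using \<open>esurj\<close> unfolding esurj_def by blast
    have "X.ltyp (X.cty A)" "X.bs (X.cty A) = X.one" using A(1) by simp_all
    then show ?thesis using A(2-) by blast
  qed
  have "weak_equiv_tm M N h n" for n
    unfolding weak_equiv_tm_iff
  proof (intro ballI impI)
    fix A a assume A: "A \<in> car M (Ty n)" and a: "a \<in> car N (Tm n)" "Y.TY n a = h (Ty n) A"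
    let ?A = "(Suc n, A)" and ?a = "(n, a)"
    have A': "X.ltyp ?A" "Y.ltyp (fo ?A)" using A by (simp_all add: X.ctx_def Y.ctx_def fo_def)
    have t: "Y.trm ?a" "Y.tty ?a = fo ?A" using a by (simp_all add: Y.trm_def Y.tty_def fo_def)
    have G: "Y.bs (fo ?A) = fo (X.bs ?A)" using A' by simp
    note s = Y.sec_dm[OF t G]
    have "\<exists>t'. X.hom t' (X.bs ?A) ?A \<and> X.cc (X.dsp ?A) t' = X.cid (X.bs ?A) \<and> Y.fh (fo ?A) (fm t') (Y.sec ?a)"
    proof (rule F.lift_section)
      show "X.ltyp ?A" by (rule A'(1))
      show "Y.hom (Y.sec ?a) (fo (X.bs ?A)) (fo ?A)" "Y.cc (Y.dsp (fo ?A)) (Y.sec ?a) = Y.cid (fo (X.bs ?A))"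
        using s by blast+
    qed (rule full faithful esurj; assumption)+
    then obtain t' where t': "X.hom t' (X.bs ?A) ?A" "X.cc (X.dsp ?A) t' = X.cid (X.bs ?A)" "Y.fh (fo ?A) (fm t') (Y.sec ?a)"
      by blast
    have ct: "X.cmo t'" "X.ltyp (X.cd t')" "X.cd t' = ?A" using t'(1) A' by simp_all
    have l: "X.trm (X.lst t')" "X.tty (X.lst t') = ?A"
      using X.lst(1)[OF ct] X.lst(2)[OF ct] unfolding t'(2) using A' by simp_all
    have fl: "fst (X.lst t') = n" using arg_cong[OF l(2), of fst] by (simp add: X.tty_def)
    have "Y.cc (Y.dsp (fo ?A)) (Y.sec ?a) = Y.cc (Y.dsp (fo ?A)) (fm t')"
      using Y.fh_arr[OF t'(3)] by blast
    then have "(snd (Y.lst (fm t')), snd (Y.lst (Y.sec ?a))) \<in> homotopic N (fst (fo (X.bs ?A)))"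
      using Y.homotopic_fh[of "fm t'" "fo (X.bs ?A)" "fo ?A" "Y.sec ?a"] t' s A'(2) fm[of t'] by metis
    moreover have "Y.lst (fm t') = ftm (X.lst t')" using lst_fm[of t'] ct by simp
    moreover have "fst (X.bs ?A) = n" by (simp add: X.bs_def)
    ultimately have "(h (Tm n) (snd (X.lst t')), a) \<in> homotopic N n"
      using s fl by (simp add: ftm_def)
    moreover have "snd (X.lst t') \<in> car M (Tm n)" using l(1) fl unfolding X.trm_def by metis
    moreover have "X.TY n (snd (X.lst t')) = A" using arg_cong[OF l(2), of snd] fl by (simp add: X.tty_def)
    ultimately show "\<exists>a' \<in> car M (Tm n). X.TY n a' = A \<and> (h (Tm n) a', a) \<in> homotopic N n" by blast
  qed
  moreover have "weak_equiv_ty M N h n" for n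
    unfolding weak_equiv_ty_iff
  proof (intro allI impI)
    fix G B assume "X.ctx G \<and> fst G = n \<and> Y.ltyp B \<and> Y.bs B = fo G"
    then have GB: "X.ctx G" "Y.ltyp B" "Y.bs B = fo G" by blast+
    have "\<exists>A f g g'. X.ltyp A \<and> X.bs A = G \<and> Y.hom f (fo A) B \<and> Y.cc (Y.dsp B) f = Y.dsp (fo A) \<and>
       Y.hom g B (fo A) \<and> Y.cc (Y.dsp (fo A)) g = Y.dsp B \<and> Y.hom g' B (fo A) \<and> Y.cc (Y.dsp (fo A)) g' = Y.dsp B \<and>
       Y.fh (fo A) (Y.cc g f) (Y.cid (fo A)) \<and> Y.fh B (Y.cc f g') (Y.cid B)"
      by (rule F.lift_type; (rule full faithful esurj GB; assumption?)?)
    then show "\<exists>A. X.ltyp A \<and> X.bs A = G \<and> (\<exists>f g g'. Y.hom f (fo A) B \<and> Y.cc (Y.dsp B) f = Y.dsp (fo A) \<and>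
       Y.hom g B (fo A) \<and> Y.cc (Y.dsp (fo A)) g = Y.dsp B \<and> Y.hom g' B (fo A) \<and> Y.cc (Y.dsp (fo A)) g' = Y.dsp B \<and>
       Y.fh (fo A) (Y.cc g f) (Y.cid (fo A)) \<and> Y.fh B (Y.cc f g') (Y.cid B))"
      by blast
  qed
  ultimately show ?thesis by (simp add: weak_equivalence_def)
qed

theorem weak_equivalence_iff: "weak_equivalence M N h \<longleftrightarrow> is_equivalence (Ho M) (Ho N) (Ho_map N h)"
  unfolding equivalence_iff[OF is_functor_Ho_map] fully_faithful_iff ess_surj_iff
  using weak_equivalence_full weak_equivalence_faithful weak_equivalence_esurj equivalence_weak by blast

end

text \<open>Weak equivalences and homotopy categories are formed in the underlying models of
  \<open>T0\<close>, and morphisms of models of \<open>T\<close> are morphisms of these; this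
  reduces the statement to \<open>T0\<close>.\<close>

theorem proposition3p11:
  fixes T :: "(sort, 'f sym, 'r) horn"
    and ver :: "nat \<Rightarrow> ('f sym, 'r, 'f sym, 'r) interp"
    and \<iota> :: "(t0, unit, 'f sym, 'r) interp"
    and X :: "(sort, 'f sym, 'r, 'x) struct"
    and Y :: "(sort, 'f sym, 'r, 'y) struct"
    and f :: "sort \<Rightarrow> 'x \<Rightarrow> 'y"
  assumes "regular T ver"
    and "under_T0 T ver \<iota>"
    and "is_model T X" and "is_model T Y"
    and "is_morphism T X Y f"
  shows "weak_equivalence (reduct T0 \<iota> X) (reduct T0 \<iota> Y) f \<longleftrightarrow>
    is_equivalence (Ho (reduct T0 \<iota> X)) (Ho (reduct T0 \<iota> Y)) (Ho_map (reduct T0 \<iota> Y) f)"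
proof -
  have \<iota>: "is_interp T0 T \<iota>" using assms(2) by (simp add: under_T0_def)
  have T: "wf_theory T" using assms(1) by (simp add: regular_def extends_subst_def)
  interpret t0_morphism "reduct T0 \<iota> X" "reduct T0 \<iota> Y" f
    by unfold_locales
      (intro reduct_model[OF \<iota> wf_T0 T] reduct_morphism[OF \<iota>] assms)+
  show ?thesis by (rule weak_equivalence_iff)
qed

end
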